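(* Let $(A,\phi_0)$ be a Jacobi algebroid over a manifold $M$, let $\pi\in\Gamma(\Lambda^2A)$ be a Jacobi structure on $(A,\phi_0)$, and let $g^*$ be a pseudo-Riemannian metric on the dual bundle $A^*$. Let $\tilde A:=A\times\mathbb{R}$, a vector bundle over $M\times\mathbb{R}$, let $\tilde\pi:=e^{-t}\pi\in\Gamma(\Lambda^2\tilde A)$ be the Poissonization of $\pi$, and let $\tilde g^*:=e^{-t}g^*$, a pseudo-Riemannian metric on $\tilde A^*$. Then the pair $(\pi,g^* )$ is compatible on the Jacobi algebroid $(A,\phi_0)$ if and only if the pair $(\tilde\pi,\tilde g^* )$ is compatible on the Lie algebroid $\tilde A^{-}_{\phi_0}$ over $M\times\mathbb{R}$.
   Context: **Skew and Lie algebroids.** A skew algebroid over $M$ is a vector bundle $A\to M$ with a skew-symmetric $\mathbb{R}$-bilinear bracket $[\cdot,\cdot]_A$ on $\Gamma(A)$ and a bundle map $\rho_A:A\to TM$ (anchor) such that $[X,fY]_A=f[X,Y]_A+(\rho_A(X)f)Y$ for all $X,Y\in\Gamma(A)$, $f\in C^\infty(M)$. It is a Lie algebroid if $[\cdot,\cdot]_A$ satisfies the Jacobi identity. The differential $d_A:\Gamma(\Lambda^kA^* )\to\Gamma(\Lambda^{k+1}A^* )$ is given by the usual formula $(d_A\omega)(X_0,\dots,X_k)=\sum_i(-1)^i\rho_A(X_i)(\omega(X_0,\dots,\hat X_i,\dots,X_k))+\sum_{i<j}(-1)^{i+j}\omega([X_i,X_j]_A,X_0,\dots,\hat X_i,\dots,\hat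 X_j,\dots,X_k)$, and $\mathcal{L}^A_X:=d_A\iota_X+\iota_Xd_A$. Wedge products use the convention $(\alpha\wedge\beta)(X_1,\dots,X_{k+l})=\frac{1}{k!l!}\sum_{\sigma\in S_{k+l}}\mathrm{sgn}(\sigma)\,\alpha(X_{\sigma(1)},\dots,X_{\sigma(k)})\beta(X_{\sigma(k+1)},\dots,X_{\sigma(k+l)})$. The Schouten bracket on $\Gamma(\Lambda^*A)$ is the unique extension of $[\cdot,\cdot]_A$ with $[f,g]_A=0$, $[X,f]_A=\rho_A(X)f$, $[D_1,D_2\wedge D_3]_A=[D_1,D_2]_A\wedge D_3+(-1)^{(a_1+1)a_2}D_2\wedge[D_1,D_3]_A$, $[D_1,D_2]_A=-(-1)^{(a_1-1)(a_2-1)}[D_2,D_1]_A$ for $D_i\in\Gamma(\Lambda^{a_i}A)$. **Jacobi algebroids and Jacobi structures.** A Jacobi algebroid $(A,\phi_0)$ over $M$ is a Lie algebroid $A$ over $M$ together with $\phi_0\in\Gamma(A^* )$ with $d_A\phi_0=0$. Its $\phi_0$-Schouten bracket is $[D_1,D_2]_{A,\phi_0}:=[D_1,D_2]_A+(a_1-1)D_1\wedge\iota_{\phi_0}D_2-(-1)^{a_1+1}(a_2-1)\iota_{\phi_0}D_1\wedge D_2$ for $D_i\in\Gamma(\Lambda^{a_i}A)$. A Jacobi structure on $(A,\phi_0)$ is $\pi\in\Gamma(\Lambda^2A)$ with $[\pi,\pi]_{A,\phi_0}=0$. A Poisson structure on a skew (or Lie) algebroid $A$ is $\pi\in\Gamma(\Lambda^2A)$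 with $[\pi,\pi]_A=0$. Set $d_{A,\phi_0}\omega:=d_A\omega+\phi_0\wedge\omega$ and $\mathcal{L}^{A,\phi_0}_X:=\iota_X\circ d_{A,\phi_0}+d_{A,\phi_0}\circ\iota_X$. For $\pi\in\Gamma(\Lambda^2A)$, $\pi^\sharp:A^*\to A$ is defined by $\langle\pi^\sharp\alpha,\beta\rangle:=\pi(\alpha,\beta)$; put $\rho_\pi:=\rho_A\circ\pi^\sharp$ and $X_0:=-\pi^\sharp\phi_0\in\Gamma(A)$. Define brackets on $\Gamma(A^* )$ by $[\alpha,\beta]_\pi:=\mathcal{L}^A_{\pi^\sharp\alpha}\beta-\mathcal{L}^A_{\pi^\sharp\beta}\alpha-d_A\langle\pi^\sharp\alpha,\beta\rangle$ and $[\alpha,\beta]_{\pi,\phi_0}:=\mathcal{L}^{A,\phi_0}_{\pi^\sharp\alpha}\beta-\mathcal{L}^{A,\phi_0}_{\pi^\sharp\beta}\alpha-d_{A,\phi_0}\langle\pi^\sharp\alpha,\beta\rangle$. Then $A^*_\pi:=(A^*,[\cdot,\cdot]_\pi,\rho_\pi)$ (for any skew algebroid $A$) and $A^*_{\pi,\phi_0}:=(A^*,[\cdot,\cdot]_{\pi,\phi_0},\rho_\pi)$ (for a Jacobi algebroid $(A,\phi_0)$) are skew algebroids. **Levi-Civita connection.** For a skew algebroid $(B,[\cdot,\cdot]_B,\rho_B)$ and a pseudo-Riemannian metric $h$ on $B$, the Levi-Civita connection of $h$ is the unique $\mathbb{R}$-bilinear $\nabla:\Gamma(B)\times\Gamma(B)\to\Gamma(B)$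 with $\nabla_{fX}Y=f\nabla_XY$, $\nabla_X(fY)=f\nabla_XY+(\rho_B(X)f)Y$, $\nabla_XY-\nabla_YX=[X,Y]_B$ and $\rho_B(X)(h(Y,Z))=h(\nabla_XY,Z)+h(Y,\nabla_XZ)$. **Compatibility on a skew (in particular Lie) algebroid.** For $\pi\in\Gamma(\Lambda^2A)$ and a pseudo-Riemannian metric $g^*$ on $A^*$, $(\pi,g^* )$ is compatible on $A$ if $D^\pi\pi=0$, i.e. $\rho_\pi(\alpha)(\pi(\beta,\gamma))=\pi(D^\pi_\alpha\beta,\gamma)+\pi(\beta,D^\pi_\alpha\gamma)$ for all $\alpha,\beta,\gamma\in\Gamma(A^* )$, where $D^\pi$ is the Levi-Civita connection of $g^*$ on $A^*_\pi$. **Compatibility on a Jacobi algebroid.** For $\pi\in\Gamma(\Lambda^2A)$ and a pseudo-Riemannian metric $g^*$ on $A^*$, $(\pi,g^* )$ is compatible on $(A,\phi_0)$ if for all $\alpha,\beta,\gamma\in\Gamma(A^* )$ $$(D^{\pi,\phi_0}_\alpha\pi)(\beta,\gamma)=-\tfrac12\big(\langle X_0,\beta\rangle\pi(\gamma,\alpha)+\langle X_0,\gamma\rangle\pi(\alpha,\beta)+g^*(\alpha,\beta)\,\pi((g^* )^{\flat-1}(X_0),\gamma)-g^*(\alpha,\gamma)\,\pi((g^* )^{\flat-1}(X_0),\beta)\big),$$ where $D^{\pi,\phi_0}$ is the Levi-Civita connection of $g^*$ on $A^*_{\pi,\phi_0}$, $(D^{\pi,\phi_0}_\alpha\pi)(\beta,\gamma):=\rho_\pi(\alpha)(\pi(\beta,\gamma))-\pi(D^{\pi,\phi_0}_\alpha\beta,\gamma)-\pi(\beta,D^{\pi,\phi_0}_\alpha\gamma)$,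 and $(g^* )^{\flat}:A^*\to A$ is the isomorphism $\langle(g^* )^\flat\alpha,\beta\rangle=g^*(\alpha,\beta)$ with inverse $(g^* )^{\flat-1}$. **The Lie algebroid $\tilde A^-_{\phi_0}$.** Let $t$ be the coordinate on $\mathbb{R}$. Sections of $\tilde A=A\times\mathbb{R}\to M\times\mathbb{R}$ (resp. of its dual and exterior powers) are identified with $t$-dependent sections of $A$ (resp. of its dual and exterior powers). $\tilde A^-_{\phi_0}$ is $\tilde A$ with the Lie algebroid structure $[\tilde X,\tilde Y]^{-}:=[\tilde X,\tilde Y]_A+\langle\phi_0,\tilde X\rangle\frac{\partial\tilde Y}{\partial t}-\langle\phi_0,\tilde Y\rangle\frac{\partial\tilde X}{\partial t}$ and anchor $\bar\rho(\tilde X):=\rho_A(\tilde X)+\langle\phi_0,\tilde X\rangle\frac{\partial}{\partial t}$, where $[\tilde X,\tilde Y]_A$ and $\rho_A(\tilde X)$ are computed for each fixed $t$. A 2-section $\pi$ is Jacobi on $(A,\phi_0)$ if and only if $e^{-t}\pi$ is Poisson on $\tilde A^-_{\phi_0}$. *)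

theory Defs
  imports "HOL-Analysis.Analysis" "HOL-Library.Function_Algebras"
begin

text \<open>
  Real-valued and vector-valued functions form a real vector space pointwise. The instance lets
  the fibres of a dual bundle be subspaces of a function type, so that a dual bundle is again
  a vector bundle in the sense below.
\<close>

instantiation "fun" :: (type, real_vector) real_vector
begin
definition scaleR_fun :: "real \<Rightarrow> ('a \<Rightarrow> 'b) \<Rightarrow> 'a \<Rightarrow> 'b"
  where "scaleR_fun c f = (\<lambda>x. c *\<^sub>R f x)"
instance
  by standard (auto simp: scaleR_fun_def fun_eq_iff scaleR_add_right scaleR_add_left)
end


section \<open>Manifolds\<close>

text \<open>
  \<open>Ck_on k S f\<close> is the usual notion of \<open>C\<^sup>k\<close> map when \<open>S\<close> is an open subset of a
  finite-dimensional space; it is only used for such \<open>S\<close>.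
\<close>

primrec Ck_on :: "nat \<Rightarrow> 'e::real_normed_vector set \<Rightarrow> ('e \<Rightarrow> 'f::real_normed_vector) \<Rightarrow> bool" where
  "Ck_on 0 S f \<longleftrightarrow> continuous_on S f"
| "Ck_on (Suc k) S f \<longleftrightarrow>
     f differentiable_on S \<and> (\<forall>w. Ck_on k S (\<lambda>x. frechet_derivative f (at x) w))"

definition Cinf_on :: "'e::real_normed_vector set \<Rightarrow> ('e \<Rightarrow> 'f::real_normed_vector) \<Rightarrow> bool"
  where "Cinf_on S f \<longleftrightarrow> (\<forall>k. Ck_on k S f)"

text \<open>
  A manifold is a Hausdorff second countable type \<open>'m\<close> with a smooth atlas of charts
  \<open>(U, \<phi>)\<close>; the function \<open>\<phi>\<close> is only relevant on \<open>U\<close>. The model space \<open>'e\<close> has sort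
  \<open>{real_inner, heine_borel}\<close>, that is, it is a finite-dimensional inner product space, as
  local compactness forces finite dimension. Unlike
  \<open>euclidean_space\<close> this sort admits the zero space, hence manifolds of dimension 0.
\<close>

type_synonym ('m, 'e) atlas = "('m set \<times> ('m \<Rightarrow> 'e)) set"

definition smooth_manifold ::
    "('m::{t2_space,second_countable_topology}, 'e::{real_inner,heine_borel}) atlas \<Rightarrow> bool"
  where "smooth_manifold C \<longleftrightarrow>
    (\<Union>(U, \<phi>)\<in>C. U) = UNIV \<and>
    (\<forall>(U, \<phi>)\<in>C. open U \<and> open (\<phi> ` U) \<and> homeomorphism U (\<phi> ` U) \<phi> (inv_into U \<phi>)) \<and>
    (\<forall>(U, \<phi>)\<in>C. \<forall>(V, \<psi>)\<in>C. Cinf_on (\<phi> ` (U \<inter> V)) (\<psi> \<circ> inv_into U \<phi>))"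

text \<open>Smoothness of a real function on an open subset \<open>W\<close> of the manifold.\<close>

definition smooth_fun_on ::
    "('m, 'e::{real_inner,heine_borel}) atlas \<Rightarrow> 'm set \<Rightarrow> ('m \<Rightarrow> real) \<Rightarrow> bool"
  where "smooth_fun_on C W f \<longleftrightarrow> (\<forall>(U, \<phi>)\<in>C. Cinf_on (\<phi> ` (U \<inter> W)) (f \<circ> inv_into U \<phi>))"

definition smooth_funs :: "('m, 'e::{real_inner,heine_borel}) atlas \<Rightarrow> ('m \<Rightarrow> real) set"
  where "smooth_funs C = {f. smooth_fun_on C UNIV f}"

text \<open>
  Tangent vectors at \<open>x\<close> are the directional derivatives at \<open>x\<close> taken in a chart. They are
  represented as functionals on all real functions, but only their values on smooth
  functions are meaningful.
\<close>

definition tangent_vectors ::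
    "('m, 'e::{real_inner,heine_borel}) atlas \<Rightarrow> 'm \<Rightarrow> (('m \<Rightarrow> real) \<Rightarrow> real) set"
  where "tangent_vectors C x = {v. \<exists>(U, \<phi>)\<in>C. x \<in> U \<and>
    (\<exists>w. \<forall>f\<in>smooth_funs C. v f = frechet_derivative (f \<circ> inv_into U \<phi>) (at (\<phi> x)) w)}"


section \<open>Vector bundles\<close>

text \<open>
  The fibres of a bundle are subspaces of some real vector space \<open>'v\<close>, which carries no
  topology and only serves as a common universe for the fibres: the smooth structure is given
  by an atlas of local frames \<open>(U, e)\<close> with smooth transition matrices, \<open>e i x\<close> being the
  \<open>i\<close>-th frame vector at \<open>x \<in> U\<close>. Every vector bundle arises in this way (take for \<open>'v\<close> the
  direct sum of all fibres).
\<close>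

record ('m, 'v) vbundle =
  fib :: "'m \<Rightarrow> 'v set"
  rk :: nat
  frames :: "('m set \<times> (nat \<Rightarrow> 'm \<Rightarrow> 'v)) set"

definition vector_bundle ::
    "('m::topological_space, 'e::{real_inner,heine_borel}) atlas \<Rightarrow> ('m, 'v::real_vector) vbundle \<Rightarrow> bool"
  where "vector_bundle C E \<longleftrightarrow>
    (\<Union>(U, e)\<in>frames E. U) = UNIV \<and>
    (\<forall>(U, e)\<in>frames E. open U \<and>
      (\<forall>x\<in>U. inj_on (\<lambda>i. e i x) {..<rk E} \<and> independent ((\<lambda>i. e i x) ` {..<rk E}) \<and>
             span ((\<lambda>i. e i x) ` {..<rk E}) = fib E x)) \<and>
    (\<forall>(U, e)\<in>frames E. \<forall>(V, e')\<in>frames E. \<forall>j<rk E. \<exists>c.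
      (\<forall>i<rk E. smooth_fun_on C (U \<inter> V) (c i)) \<and>
      (\<forall>x\<in>U \<inter> V. e' j x = (\<Sum>i<rk E. c i x *\<^sub>R e i x)))"

definition sections ::
    "('m, 'e::{real_inner,heine_borel}) atlas \<Rightarrow> ('m, 'v::real_vector) vbundle \<Rightarrow> ('m \<Rightarrow> 'v) set"
  where "sections C E = {X. (\<forall>x. X x \<in> fib E x) \<and>
    (\<forall>(U, e)\<in>frames E. \<exists>c. (\<forall>i<rk E. smooth_fun_on C U (c i)) \<and>
      (\<forall>x\<in>U. X x = (\<Sum>i<rk E. c i x *\<^sub>R e i x)))}"

text \<open>
  Covectors are extended by zero outside the fibre, which makes them unique as functions on
  \<open>'v\<close>. The frames of the dual bundle are the dual frames: \<open>representation B v b\<close> is the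
  coefficient of \<open>b\<close> in the expansion of \<open>v\<close> in the basis \<open>B\<close>, and \<open>0\<close> if \<open>v \<notin> span B\<close>.
\<close>

definition dual_space :: "'v::real_vector set \<Rightarrow> ('v \<Rightarrow> real) set"
  where "dual_space V = {\<alpha>. (\<forall>v\<in>V. \<forall>w\<in>V. \<forall>a b. \<alpha> (a *\<^sub>R v + b *\<^sub>R w) = a * \<alpha> v + b * \<alpha> w) \<and>
    (\<forall>v. v \<notin> V \<longrightarrow> \<alpha> v = 0)}"

definition dual_bundle :: "('m, 'v::real_vector) vbundle \<Rightarrow> ('m, 'v \<Rightarrow> real) vbundle"
  where "dual_bundle E = \<lparr>
    fib = (\<lambda>x. dual_space (fib E x)),
    rk = rk E,
    frames = (\<lambda>(U, e). (U, \<lambda>i x v. representation ((\<lambda>j. e j x) ` {..<rk E}) v (e i x))) ` frames E \<rparr>"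

definition pseudo_riemannian_metric ::
    "('m, 'e::{real_inner,heine_borel}) atlas \<Rightarrow> ('m, 'v::real_vector) vbundle \<Rightarrow>
      ('m \<Rightarrow> 'v \<Rightarrow> 'v \<Rightarrow> real) \<Rightarrow> bool"
  where "pseudo_riemannian_metric C E h \<longleftrightarrow>
    (\<forall>x. \<forall>u\<in>fib E x. \<forall>v\<in>fib E x. \<forall>w\<in>fib E x. \<forall>a b.
      h x u v = h x v u \<and> h x (a *\<^sub>R u + b *\<^sub>R v) w = a * h x u w + b * h x v w) \<and>
    (\<forall>x. \<forall>u\<in>fib E x. (\<forall>v\<in>fib E x. h x u v = 0) \<longrightarrow> u = 0) \<and>
    (\<forall>X\<in>sections C E. \<forall>Y\<in>sections C E. (\<lambda>x. h x (X x) (Y x)) \<in> smooth_funs C)"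


section \<open>Exterior algebra\<close>

text \<open>
  Alternating \<open>k\<close>-linear forms on a subspace \<open>V\<close> are functions on lists, extended by zero to
  all lists that are not lists of \<open>k\<close> elements of \<open>V\<close>.
\<close>

definition alt_forms :: "'v::real_vector set \<Rightarrow> nat \<Rightarrow> ('v list \<Rightarrow> real) set"
  where "alt_forms V k = {\<omega>.
    (\<forall>vs. \<not> (length vs = k \<and> set vs \<subseteq> V) \<longrightarrow> \<omega> vs = 0) \<and>
    (\<forall>vs i a b. \<forall>u\<in>V. \<forall>w\<in>V. length vs = k \<and> set vs \<subseteq> V \<and> i < k \<longrightarrow>
      \<omega> (vs[i := a *\<^sub>R u + b *\<^sub>R w]) = a * \<omega> (vs[i := u]) + b * \<omega> (vs[i := w])) \<and>
    (\<forall>vs i j. length vs = k \<and> set vs \<subseteq> V \<and> i < j \<and> j < k \<and> vs ! i = vs ! j \<longrightarrow> \<omega> vs = 0)}"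

abbreviation at_point :: "('m \<Rightarrow> 'v) list \<Rightarrow> 'm \<Rightarrow> 'v list"
  where "at_point Xs x \<equiv> map (\<lambda>X. X x) Xs"

text \<open>\<open>forms C E k\<close> is the space of sections of the \<open>k\<close>-th exterior power of the dual of \<open>E\<close>.\<close>

definition forms ::
    "('m, 'e::{real_inner,heine_borel}) atlas \<Rightarrow> ('m, 'v::real_vector) vbundle \<Rightarrow> nat \<Rightarrow>
      ('m \<Rightarrow> 'v list \<Rightarrow> real) set"
  where "forms C E k = {\<omega>. (\<forall>x. \<omega> x \<in> alt_forms (fib E x) k) \<and>
    (\<forall>Xs. length Xs = k \<and> set Xs \<subseteq> sections C E \<longrightarrow> (\<lambda>x. \<omega> x (at_point Xs x)) \<in> smooth_funs C)}"

text \<open>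
  Sections of the \<open>k\<close>-th exterior power of \<open>E\<close> itself, identified with alternating forms on
  the dual of \<open>E\<close>.
\<close>

abbreviation multivectors ::
    "('m, 'e::{real_inner,heine_borel}) atlas \<Rightarrow> ('m, 'v::real_vector) vbundle \<Rightarrow> nat \<Rightarrow>
      ('m \<Rightarrow> ('v \<Rightarrow> real) list \<Rightarrow> real) set"
  where "multivectors C E k \<equiv> forms C (dual_bundle E) k"

definition form0 :: "('m \<Rightarrow> real) \<Rightarrow> 'm \<Rightarrow> 'v list \<Rightarrow> real"
  where "form0 f = (\<lambda>x vs. if vs = [] then f x else 0)"

definition form1 :: "('m \<Rightarrow> 'v \<Rightarrow> real) \<Rightarrow> 'm \<Rightarrow> 'v list \<Rightarrow> real"
  where "form1 \<alpha> = (\<lambda>x vs. if length vs = 1 then \<alpha> x (hd vs) else 0)"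

text \<open>The inverse of \<open>form1\<close> on 1-forms.\<close>

definition covector :: "('m \<Rightarrow> 'v list \<Rightarrow> real) \<Rightarrow> 'm \<Rightarrow> 'v \<Rightarrow> real"
  where "covector \<omega> = (\<lambda>x v. \<omega> x [v])"

text \<open>A section of \<open>E\<close> as a multivector of degree 1, by evaluation of covectors.\<close>

definition vector1 :: "('m, 'v::real_vector) vbundle \<Rightarrow> ('m \<Rightarrow> 'v) \<Rightarrow> 'm \<Rightarrow> ('v \<Rightarrow> real) list \<Rightarrow> real"
  where "vector1 E X = form1 (\<lambda>x \<alpha>. if \<alpha> \<in> dual_space (fib E x) then \<alpha> (X x) else 0)"

definition wedge ::
    "nat \<Rightarrow> nat \<Rightarrow> ('m \<Rightarrow> 'v list \<Rightarrow> real) \<Rightarrow> ('m \<Rightarrow> 'v list \<Rightarrow> real) \<Rightarrow> 'm \<Rightarrow> 'v list \<Rightarrow> real"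
  where "wedge k l \<omega> \<eta> = (\<lambda>x vs. if length vs = k + l then
    1 / (fact k * fact l) * (\<Sum>\<sigma> | \<sigma> permutes {..<k + l}. of_int (sign \<sigma>) *
      \<omega> x (map (\<lambda>i. vs ! \<sigma> i) [0..<k]) * \<eta> x (map (\<lambda>i. vs ! \<sigma> i) [k..<k + l])) else 0)"

text \<open>
  Contraction with the first argument; used both for vectors into forms and for covectors into
  multivectors. It annihilates forms of degree 0, since these vanish on nonempty lists.
\<close>

definition contract :: "('m \<Rightarrow> 'v) \<Rightarrow> ('m \<Rightarrow> 'v list \<Rightarrow> real) \<Rightarrow> 'm \<Rightarrow> 'v list \<Rightarrow> real"
  where "contract X \<omega> = (\<lambda>x vs. \<omega> x (X x # vs))"


section \<open>Skew, Lie and Jacobi algebroids\<close>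

text \<open>
  The anchor maps a fibre element at \<open>x\<close> to a tangent vector at \<open>x\<close>; the bracket is only
  relevant on sections.
\<close>

record ('m, 'e, 'v) algebroid =
  base :: "('m, 'e) atlas"
  vbun :: "('m, 'v) vbundle"
  bracket :: "('m \<Rightarrow> 'v) \<Rightarrow> ('m \<Rightarrow> 'v) \<Rightarrow> 'm \<Rightarrow> 'v"
  anchor :: "'m \<Rightarrow> 'v \<Rightarrow> ('m \<Rightarrow> real) \<Rightarrow> real"

abbreviation funs :: "('m, 'e::{real_inner,heine_borel}, 'v) algebroid \<Rightarrow> ('m \<Rightarrow> real) set"
  where "funs A \<equiv> smooth_funs (base A)"

abbreviation secs :: "('m, 'e::{real_inner,heine_borel}, 'v::real_vector) algebroid \<Rightarrow> ('m \<Rightarrow> 'v) set"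
  where "secs A \<equiv> sections (base A) (vbun A)"

abbreviation cosecs ::
    "('m, 'e::{real_inner,heine_borel}, 'v::real_vector) algebroid \<Rightarrow> ('m \<Rightarrow> 'v \<Rightarrow> real) set"
  where "cosecs A \<equiv> sections (base A) (dual_bundle (vbun A))"

abbreviation aforms ::
    "('m, 'e::{real_inner,heine_borel}, 'v::real_vector) algebroid \<Rightarrow> nat \<Rightarrow>
      ('m \<Rightarrow> 'v list \<Rightarrow> real) set"
  where "aforms A \<equiv> forms (base A) (vbun A)"

abbreviation mvecs ::
    "('m, 'e::{real_inner,heine_borel}, 'v::real_vector) algebroid \<Rightarrow> nat \<Rightarrow>
      ('m \<Rightarrow> ('v \<Rightarrow> real) list \<Rightarrow> real) set"
  where "mvecs A \<equiv> multivectors (base A) (vbun A)"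

text \<open>The function \<open>\<rho>(X)f\<close>.\<close>

definition anchor_fun :: "('m, 'e, 'v) algebroid \<Rightarrow> ('m \<Rightarrow> 'v) \<Rightarrow> ('m \<Rightarrow> real) \<Rightarrow> 'm \<Rightarrow> real"
  where "anchor_fun A X f = (\<lambda>x. anchor A x (X x) f)"

text \<open>
  That the anchor is a smooth bundle map is expressed by its being fibrewise linear and mapping
  smooth sections to smooth vector fields.
\<close>

definition bundle_map_to_TM :: "('m, 'e::{real_inner,heine_borel}, 'v::real_vector) algebroid \<Rightarrow> bool"
  where "bundle_map_to_TM A \<longleftrightarrow>
    (\<forall>x. \<forall>v\<in>fib (vbun A) x. anchor A x v \<in> tangent_vectors (base A) x) \<and>
    (\<forall>x. \<forall>v\<in>fib (vbun A) x. \<forall>w\<in>fib (vbun A) x. \<forall>a b. \<forall>f\<in>funs A.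
      anchor A x (a *\<^sub>R v + b *\<^sub>R w) f = a * anchor A x v f + b * anchor A x w f) \<and>
    (\<forall>X\<in>secs A. \<forall>f\<in>funs A. anchor_fun A X f \<in> funs A)"

definition skew_algebroid ::
    "('m::{t2_space,second_countable_topology}, 'e::{real_inner,heine_borel}, 'v::real_vector) algebroid \<Rightarrow> bool"
  where "skew_algebroid A \<longleftrightarrow>
    smooth_manifold (base A) \<and> vector_bundle (base A) (vbun A) \<and> bundle_map_to_TM A \<and>
    (\<forall>X\<in>secs A. \<forall>Y\<in>secs A. bracket A X Y \<in> secs A) \<and>
    (\<forall>X\<in>secs A. \<forall>Y\<in>secs A. bracket A X Y = - bracket A Y X) \<and>
    (\<forall>X\<in>secs A. \<forall>Y\<in>secs A. \<forall>Z\<in>secs A. \<forall>a b.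
      bracket A (a *\<^sub>R X + b *\<^sub>R Y) Z = a *\<^sub>R bracket A X Z + b *\<^sub>R bracket A Y Z) \<and>
    (\<forall>X\<in>secs A. \<forall>Y\<in>secs A. \<forall>f\<in>funs A.
      bracket A X (\<lambda>x. f x *\<^sub>R Y x) = (\<lambda>x. f x *\<^sub>R bracket A X Y x + anchor_fun A X f x *\<^sub>R Y x))"

definition lie_algebroid ::
    "('m::{t2_space,second_countable_topology}, 'e::{real_inner,heine_borel}, 'v::real_vector) algebroid \<Rightarrow> bool"
  where "lie_algebroid A \<longleftrightarrow> skew_algebroid A \<and>
    (\<forall>X\<in>secs A. \<forall>Y\<in>secs A. \<forall>Z\<in>secs A.
      bracket A (bracket A X Y) Z + bracket A (bracket A Y Z) X + bracket A (bracket A Z X) Y = 0)"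

text \<open>
  The differential of a \<open>k\<close>-form. Here \<open>nths Xs (- I)\<close> is the list \<open>Xs\<close> without the entries
  whose index lies in \<open>I\<close>.
\<close>

definition ext_d ::
    "('m, 'e::{real_inner,heine_borel}, 'v::real_vector) algebroid \<Rightarrow> nat \<Rightarrow>
      ('m \<Rightarrow> 'v list \<Rightarrow> real) \<Rightarrow> 'm \<Rightarrow> 'v list \<Rightarrow> real"
  where "ext_d A k \<omega> = (THE \<eta>. \<eta> \<in> aforms A (Suc k) \<and>
    (\<forall>Xs. length Xs = Suc k \<and> set Xs \<subseteq> secs A \<longrightarrow> (\<forall>x. \<eta> x (at_point Xs x) =
      (\<Sum>i\<le>k. (-1) ^ i * anchor_fun A (Xs ! i) (\<lambda>y. \<omega> y (at_point (nths Xs (- {i})) y)) x) +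
      (\<Sum>j\<le>k. \<Sum>i<j. (-1) ^ (i + j) *
        \<omega> x (at_point (bracket A (Xs ! i) (Xs ! j) # nths Xs (- {i, j})) x)))))"

text \<open>
  For \<open>k = 0\<close> the first summand of the Lie derivative is \<open>ext_d\<close> of the zero function.
\<close>

definition lie_deriv ::
    "('m, 'e::{real_inner,heine_borel}, 'v::real_vector) algebroid \<Rightarrow> nat \<Rightarrow> ('m \<Rightarrow> 'v) \<Rightarrow>
      ('m \<Rightarrow> 'v list \<Rightarrow> real) \<Rightarrow> 'm \<Rightarrow> 'v list \<Rightarrow> real"
  where "lie_deriv A k X \<omega> = ext_d A (k - 1) (contract X \<omega>) + contract X (ext_d A k \<omega>)"

definition jacobi_algebroid ::
    "('m::{t2_space,second_countable_topology}, 'e::{real_inner,heine_borel}, 'v::real_vector) algebroid \<Rightarrow>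
      ('m \<Rightarrow> 'v \<Rightarrow> real) \<Rightarrow> bool"
  where "jacobi_algebroid A \<phi>\<^sub>0 \<longleftrightarrow>
    lie_algebroid A \<and> \<phi>\<^sub>0 \<in> cosecs A \<and> ext_d A 1 (form1 \<phi>\<^sub>0) = 0"

definition d_phi ::
    "('m, 'e::{real_inner,heine_borel}, 'v::real_vector) algebroid \<Rightarrow> ('m \<Rightarrow> 'v \<Rightarrow> real) \<Rightarrow> nat \<Rightarrow>
      ('m \<Rightarrow> 'v list \<Rightarrow> real) \<Rightarrow> 'm \<Rightarrow> 'v list \<Rightarrow> real"
  where "d_phi A \<phi>\<^sub>0 k \<omega> = ext_d A k \<omega> + wedge 1 k (form1 \<phi>\<^sub>0) \<omega>"

definition lie_deriv_phi ::
    "('m, 'e::{real_inner,heine_borel}, 'v::real_vector) algebroid \<Rightarrow> ('m \<Rightarrow> 'v \<Rightarrow> real) \<Rightarrow> nat \<Rightarrow>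
      ('m \<Rightarrow> 'v) \<Rightarrow> ('m \<Rightarrow> 'v list \<Rightarrow> real) \<Rightarrow> 'm \<Rightarrow> 'v list \<Rightarrow> real"
  where "lie_deriv_phi A \<phi>\<^sub>0 k X \<omega> =
    contract X (d_phi A \<phi>\<^sub>0 k \<omega>) + d_phi A \<phi>\<^sub>0 (k - 1) (contract X \<omega>)"


section \<open>Schouten brackets and Jacobi structures\<close>

text \<open>
  \<open>S a b\<close> is the bracket of multivectors of degrees \<open>a\<close> and \<open>b\<close>. The truncated degree
  \<open>a + b - 1\<close> for \<open>a = b = 0\<close> is harmless, as the bracket of two functions is zero. The
  extensional function space makes \<open>S\<close> unique as a function.
\<close>

definition is_schouten_bracket ::
    "('m, 'e::{real_inner,heine_borel}, 'v::real_vector) algebroid \<Rightarrow>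
      (nat \<Rightarrow> nat \<Rightarrow> ('m \<Rightarrow> ('v \<Rightarrow> real) list \<Rightarrow> real) \<Rightarrow> ('m \<Rightarrow> ('v \<Rightarrow> real) list \<Rightarrow> real) \<Rightarrow>
        'm \<Rightarrow> ('v \<Rightarrow> real) list \<Rightarrow> real) \<Rightarrow> bool"
  where "is_schouten_bracket A S \<longleftrightarrow>
    (\<forall>a b. S a b \<in> mvecs A a \<rightarrow>\<^sub>E mvecs A b \<rightarrow>\<^sub>E mvecs A (a + b - 1)) \<and>
    (\<forall>a b. \<forall>D\<in>mvecs A a. \<forall>D'\<in>mvecs A a. \<forall>F\<in>mvecs A b. \<forall>r s.
      S a b (r *\<^sub>R D + s *\<^sub>R D') F = r *\<^sub>R S a b D F + s *\<^sub>R S a b D' F) \<and>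
    (\<forall>a b. \<forall>D\<in>mvecs A a. \<forall>F\<in>mvecs A b. \<forall>F'\<in>mvecs A b. \<forall>r s.
      S a b D (r *\<^sub>R F + s *\<^sub>R F') = r *\<^sub>R S a b D F + s *\<^sub>R S a b D F') \<and>
    (\<forall>X\<in>secs A. \<forall>Y\<in>secs A.
      S 1 1 (vector1 (vbun A) X) (vector1 (vbun A) Y) = vector1 (vbun A) (bracket A X Y)) \<and>
    (\<forall>f\<in>funs A. \<forall>g\<in>funs A. S 0 0 (form0 f) (form0 g) = 0) \<and>
    (\<forall>X\<in>secs A. \<forall>f\<in>funs A.
      S 1 0 (vector1 (vbun A) X) (form0 f) = form0 (anchor_fun A X f)) \<and>
    (\<forall>a1 a2 a3. \<forall>D1\<in>mvecs A a1. \<forall>D2\<in>mvecs A a2. \<forall>D3\<in>mvecs A a3.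
      S a1 (a2 + a3) D1 (wedge a2 a3 D2 D3) =
        wedge (a1 + a2 - 1) a3 (S a1 a2 D1 D2) D3 +
        (-1) ^ ((a1 + 1) * a2) *\<^sub>R wedge a2 (a1 + a3 - 1) D2 (S a1 a3 D1 D3)) \<and>
    (\<forall>a1 a2. \<forall>D1\<in>mvecs A a1. \<forall>D2\<in>mvecs A a2.
      S a1 a2 D1 D2 = (- ((-1) powi ((int a1 - 1) * (int a2 - 1)))) *\<^sub>R S a2 a1 D2 D1)"

definition schouten ::
    "('m, 'e::{real_inner,heine_borel}, 'v::real_vector) algebroid \<Rightarrow> nat \<Rightarrow> nat \<Rightarrow>
      ('m \<Rightarrow> ('v \<Rightarrow> real) list \<Rightarrow> real) \<Rightarrow> ('m \<Rightarrow> ('v \<Rightarrow> real) list \<Rightarrow> real) \<Rightarrow>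
        'm \<Rightarrow> ('v \<Rightarrow> real) list \<Rightarrow> real"
  where "schouten A = (THE S. is_schouten_bracket A S)"

definition schouten_phi ::
    "('m, 'e::{real_inner,heine_borel}, 'v::real_vector) algebroid \<Rightarrow> ('m \<Rightarrow> 'v \<Rightarrow> real) \<Rightarrow> nat \<Rightarrow> nat \<Rightarrow>
      ('m \<Rightarrow> ('v \<Rightarrow> real) list \<Rightarrow> real) \<Rightarrow> ('m \<Rightarrow> ('v \<Rightarrow> real) list \<Rightarrow> real) \<Rightarrow>
        'm \<Rightarrow> ('v \<Rightarrow> real) list \<Rightarrow> real"
  where "schouten_phi A \<phi>\<^sub>0 a1 a2 D1 D2 =
    schouten A a1 a2 D1 D2 +
    (real a1 - 1) *\<^sub>R wedge a1 (a2 - 1) D1 (contract \<phi>\<^sub>0 D2) -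
    ((-1) ^ (a1 + 1) * (real a2 - 1)) *\<^sub>R wedge (a1 - 1) a2 (contract \<phi>\<^sub>0 D1) D2"

definition jacobi_structure ::
    "('m, 'e::{real_inner,heine_borel}, 'v::real_vector) algebroid \<Rightarrow> ('m \<Rightarrow> 'v \<Rightarrow> real) \<Rightarrow>
      ('m \<Rightarrow> ('v \<Rightarrow> real) list \<Rightarrow> real) \<Rightarrow> bool"
  where "jacobi_structure A \<phi>\<^sub>0 \<pi> \<longleftrightarrow> \<pi> \<in> mvecs A 2 \<and> schouten_phi A \<phi>\<^sub>0 2 2 \<pi> \<pi> = 0"


section \<open>The skew algebroids on the dual bundle\<close>

definition sharp ::
    "('m, 'e, 'v::real_vector) algebroid \<Rightarrow> ('m \<Rightarrow> ('v \<Rightarrow> real) list \<Rightarrow> real) \<Rightarrow> 'm \<Rightarrow> ('v \<Rightarrow> real) \<Rightarrow> 'v"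
  where "sharp A \<pi> x \<alpha> = (THE v. v \<in> fib (vbun A) x \<and>
    (\<forall>\<beta>\<in>fib (dual_bundle (vbun A)) x. \<beta> v = \<pi> x [\<alpha>, \<beta>]))"

abbreviation sharp_sec ::
    "('m, 'e, 'v::real_vector) algebroid \<Rightarrow> ('m \<Rightarrow> ('v \<Rightarrow> real) list \<Rightarrow> real) \<Rightarrow>
      ('m \<Rightarrow> 'v \<Rightarrow> real) \<Rightarrow> 'm \<Rightarrow> 'v"
  where "sharp_sec A \<pi> \<alpha> \<equiv> (\<lambda>x. sharp A \<pi> x (\<alpha> x))"

definition bracket_pi ::
    "('m, 'e::{real_inner,heine_borel}, 'v::real_vector) algebroid \<Rightarrow>
      ('m \<Rightarrow> ('v \<Rightarrow> real) list \<Rightarrow> real) \<Rightarrow> ('m \<Rightarrow> 'v \<Rightarrow> real) \<Rightarrow> ('m \<Rightarrow> 'v \<Rightarrow> real) \<Rightarrow> 'm \<Rightarrow> 'v \<Rightarrow> real"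
  where "bracket_pi A \<pi> \<alpha> \<beta> = covector (
    lie_deriv A 1 (sharp_sec A \<pi> \<alpha>) (form1 \<beta>) - lie_deriv A 1 (sharp_sec A \<pi> \<beta>) (form1 \<alpha>) -
    ext_d A 0 (form0 (\<lambda>x. \<beta> x (sharp_sec A \<pi> \<alpha> x))))"

definition bracket_pi_phi ::
    "('m, 'e::{real_inner,heine_borel}, 'v::real_vector) algebroid \<Rightarrow> ('m \<Rightarrow> 'v \<Rightarrow> real) \<Rightarrow>
      ('m \<Rightarrow> ('v \<Rightarrow> real) list \<Rightarrow> real) \<Rightarrow> ('m \<Rightarrow> 'v \<Rightarrow> real) \<Rightarrow> ('m \<Rightarrow> 'v \<Rightarrow> real) \<Rightarrow> 'm \<Rightarrow> 'v \<Rightarrow> real"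
  where "bracket_pi_phi A \<phi>\<^sub>0 \<pi> \<alpha> \<beta> = covector (
    lie_deriv_phi A \<phi>\<^sub>0 1 (sharp_sec A \<pi> \<alpha>) (form1 \<beta>) -
    lie_deriv_phi A \<phi>\<^sub>0 1 (sharp_sec A \<pi> \<beta>) (form1 \<alpha>) -
    d_phi A \<phi>\<^sub>0 0 (form0 (\<lambda>x. \<beta> x (sharp_sec A \<pi> \<alpha> x))))"

definition dual_algebroid ::
    "('m, 'e::{real_inner,heine_borel}, 'v::real_vector) algebroid \<Rightarrow>
      ('m \<Rightarrow> ('v \<Rightarrow> real) list \<Rightarrow> real) \<Rightarrow> ('m, 'e, 'v \<Rightarrow> real) algebroid"
  where "dual_algebroid A \<pi> = \<lparr>
    base = base A,
    vbun = dual_bundle (vbun A),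
    bracket = bracket_pi A \<pi>,
    anchor = (\<lambda>x \<alpha>. anchor A x (sharp A \<pi> x \<alpha>)) \<rparr>"

definition dual_algebroid_phi ::
    "('m, 'e::{real_inner,heine_borel}, 'v::real_vector) algebroid \<Rightarrow> ('m \<Rightarrow> 'v \<Rightarrow> real) \<Rightarrow>
      ('m \<Rightarrow> ('v \<Rightarrow> real) list \<Rightarrow> real) \<Rightarrow> ('m, 'e, 'v \<Rightarrow> real) algebroid"
  where "dual_algebroid_phi A \<phi>\<^sub>0 \<pi> = \<lparr>
    base = base A,
    vbun = dual_bundle (vbun A),
    bracket = bracket_pi_phi A \<phi>\<^sub>0 \<pi>,
    anchor = (\<lambda>x \<alpha>. anchor A x (sharp A \<pi> x \<alpha>)) \<rparr>"


section \<open>Levi-Civita connections and compatibility\<close>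

text \<open>The extensional function space makes the connection unique as a function.\<close>

definition is_levi_civita ::
    "('m, 'e::{real_inner,heine_borel}, 'v::real_vector) algebroid \<Rightarrow> ('m \<Rightarrow> 'v \<Rightarrow> 'v \<Rightarrow> real) \<Rightarrow>
      (('m \<Rightarrow> 'v) \<Rightarrow> ('m \<Rightarrow> 'v) \<Rightarrow> 'm \<Rightarrow> 'v) \<Rightarrow> bool"
  where "is_levi_civita B h D \<longleftrightarrow>
    D \<in> secs B \<rightarrow>\<^sub>E secs B \<rightarrow>\<^sub>E secs B \<and>
    (\<forall>X\<in>secs B. \<forall>Y\<in>secs B. \<forall>Z\<in>secs B. \<forall>a b.
      D (a *\<^sub>R X + b *\<^sub>R Y) Z = a *\<^sub>R D X Z + b *\<^sub>R D Y Z \<and>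
      D Z (a *\<^sub>R X + b *\<^sub>R Y) = a *\<^sub>R D Z X + b *\<^sub>R D Z Y) \<and>
    (\<forall>X\<in>secs B. \<forall>Y\<in>secs B. \<forall>f\<in>funs B.
      D (\<lambda>x. f x *\<^sub>R X x) Y = (\<lambda>x. f x *\<^sub>R D X Y x) \<and>
      D X (\<lambda>x. f x *\<^sub>R Y x) = (\<lambda>x. f x *\<^sub>R D X Y x + anchor_fun B X f x *\<^sub>R Y x)) \<and>
    (\<forall>X\<in>secs B. \<forall>Y\<in>secs B. D X Y - D Y X = bracket B X Y) \<and>
    (\<forall>X\<in>secs B. \<forall>Y\<in>secs B. \<forall>Z\<in>secs B. \<forall>x.
      anchor_fun B X (\<lambda>y. h y (Y y) (Z y)) x = h x (D X Y x) (Z x) + h x (Y x) (D X Z x))"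

definition levi_civita ::
    "('m, 'e::{real_inner,heine_borel}, 'v::real_vector) algebroid \<Rightarrow> ('m \<Rightarrow> 'v \<Rightarrow> 'v \<Rightarrow> real) \<Rightarrow>
      ('m \<Rightarrow> 'v) \<Rightarrow> ('m \<Rightarrow> 'v) \<Rightarrow> 'm \<Rightarrow> 'v"
  where "levi_civita B h = (THE D. is_levi_civita B h D)"

text \<open>
  \<open>cov_deriv_bivector B D \<pi> \<alpha> \<beta> \<gamma>\<close> is \<open>(D\<^sub>\<alpha>\<pi>)(\<beta>, \<gamma>)\<close> for a connection \<open>D\<close> on an algebroid \<open>B\<close>
  whose underlying bundle is the dual bundle of the bundle of which \<open>\<pi>\<close> is a 2-section.
\<close>

definition cov_deriv_bivector ::
    "('m, 'e, 'w) algebroid \<Rightarrow> (('m \<Rightarrow> 'w) \<Rightarrow> ('m \<Rightarrow> 'w) \<Rightarrow> 'm \<Rightarrow> 'w) \<Rightarrow>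
      ('m \<Rightarrow> 'w list \<Rightarrow> real) \<Rightarrow> ('m \<Rightarrow> 'w) \<Rightarrow> ('m \<Rightarrow> 'w) \<Rightarrow> ('m \<Rightarrow> 'w) \<Rightarrow> 'm \<Rightarrow> real"
  where "cov_deriv_bivector B D \<pi> \<alpha> \<beta> \<gamma> = (\<lambda>x.
    anchor_fun B \<alpha> (\<lambda>y. \<pi> y [\<beta> y, \<gamma> y]) x - \<pi> x [D \<alpha> \<beta> x, \<gamma> x] - \<pi> x [\<beta> x, D \<alpha> \<gamma> x])"

definition compatible ::
    "('m, 'e::{real_inner,heine_borel}, 'v::real_vector) algebroid \<Rightarrow>
      ('m \<Rightarrow> ('v \<Rightarrow> real) list \<Rightarrow> real) \<Rightarrow> ('m \<Rightarrow> ('v \<Rightarrow> real) \<Rightarrow> ('v \<Rightarrow> real) \<Rightarrow> real) \<Rightarrow> bool"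
  where "compatible A \<pi> g \<longleftrightarrow>
    (let B = dual_algebroid A \<pi>; D = levi_civita B g in
      \<forall>\<alpha>\<in>cosecs A. \<forall>\<beta>\<in>cosecs A. \<forall>\<gamma>\<in>cosecs A. \<forall>x. cov_deriv_bivector B D \<pi> \<alpha> \<beta> \<gamma> x = 0)"

definition flat_inv ::
    "('m, 'e, 'v::real_vector) algebroid \<Rightarrow> ('m \<Rightarrow> ('v \<Rightarrow> real) \<Rightarrow> ('v \<Rightarrow> real) \<Rightarrow> real) \<Rightarrow>
      'm \<Rightarrow> 'v \<Rightarrow> 'v \<Rightarrow> real"
  where "flat_inv A g x v = (THE \<alpha>. \<alpha> \<in> fib (dual_bundle (vbun A)) x \<and>
    (\<forall>\<beta>\<in>fib (dual_bundle (vbun A)) x. \<beta> v = g x \<alpha> \<beta>))"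

definition jacobi_compatible ::
    "('m, 'e::{real_inner,heine_borel}, 'v::real_vector) algebroid \<Rightarrow> ('m \<Rightarrow> 'v \<Rightarrow> real) \<Rightarrow>
      ('m \<Rightarrow> ('v \<Rightarrow> real) list \<Rightarrow> real) \<Rightarrow> ('m \<Rightarrow> ('v \<Rightarrow> real) \<Rightarrow> ('v \<Rightarrow> real) \<Rightarrow> real) \<Rightarrow> bool"
  where "jacobi_compatible A \<phi>\<^sub>0 \<pi> g \<longleftrightarrow>
    (let B = dual_algebroid_phi A \<phi>\<^sub>0 \<pi>; D = levi_civita B g;
         X\<^sub>0 = (\<lambda>x. - sharp A \<pi> x (\<phi>\<^sub>0 x)); \<xi> = (\<lambda>x. flat_inv A g x (X\<^sub>0 x)) in
      \<forall>\<alpha>\<in>cosecs A. \<forall>\<beta>\<in>cosecs A. \<forall>\<gamma>\<in>cosecs A. \<forall>x.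
        cov_deriv_bivector B D \<pi> \<alpha> \<beta> \<gamma> x =
          - (1 / 2) * (\<beta> x (X\<^sub>0 x) * \<pi> x [\<gamma> x, \<alpha> x] + \<gamma> x (X\<^sub>0 x) * \<pi> x [\<alpha> x, \<beta> x] +
            g x (\<alpha> x) (\<beta> x) * \<pi> x [\<xi> x, \<gamma> x] - g x (\<alpha> x) (\<gamma> x) * \<pi> x [\<xi> x, \<beta> x]))"


section \<open>The Lie algebroid over the product with the real line\<close>

definition tilde_atlas :: "('m, 'e) atlas \<Rightarrow> ('m \<times> real, 'e \<times> real) atlas"
  where "tilde_atlas C = (\<lambda>(U, \<phi>). (U \<times> UNIV, \<lambda>(x, t). (\<phi> x, t))) ` C"

definition tilde_bundle :: "('m, 'v) vbundle \<Rightarrow> ('m \<times> real, 'v) vbundle"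
  where "tilde_bundle E = \<lparr>
    fib = (\<lambda>(x, t). fib E x),
    rk = rk E,
    frames = (\<lambda>(U, e). (U \<times> UNIV, \<lambda>i (x, t). e i x)) ` frames E \<rparr>"

text \<open>
  The derivative with respect to \<open>t\<close> of the curve \<open>t \<mapsto> X (x, t)\<close> in the finite-dimensional space
  \<open>fib E x\<close>, as the vector whose pairing with each covector is the derivative of the pairing.
\<close>

definition time_deriv :: "('m, 'v::real_vector) vbundle \<Rightarrow> ('m \<times> real \<Rightarrow> 'v) \<Rightarrow> 'm \<times> real \<Rightarrow> 'v"
  where "time_deriv E X = (\<lambda>(x, t). THE v. v \<in> fib E x \<and>
    (\<forall>\<xi>\<in>fib (dual_bundle E) x. ((\<lambda>s. \<xi> (X (x, s))) has_real_derivative \<xi> v) (at t)))"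

definition tilde_minus ::
    "('m, 'e, 'v::real_vector) algebroid \<Rightarrow> ('m \<Rightarrow> 'v \<Rightarrow> real) \<Rightarrow> ('m \<times> real, 'e \<times> real, 'v) algebroid"
  where "tilde_minus A \<phi>\<^sub>0 = \<lparr>
    base = tilde_atlas (base A),
    vbun = tilde_bundle (vbun A),
    bracket = (\<lambda>X Y (x, t).
      bracket A (\<lambda>y. X (y, t)) (\<lambda>y. Y (y, t)) x +
      \<phi>\<^sub>0 x (X (x, t)) *\<^sub>R time_deriv (vbun A) Y (x, t) -
      \<phi>\<^sub>0 x (Y (x, t)) *\<^sub>R time_deriv (vbun A) X (x, t)),
    anchor = (\<lambda>(x, t) v f.
      anchor A x v (\<lambda>y. f (y, t)) + \<phi>\<^sub>0 x v * deriv (\<lambda>s. f (x, s)) t) \<rparr>"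

definition poissonization ::
    "('m \<Rightarrow> ('v \<Rightarrow> real) list \<Rightarrow> real) \<Rightarrow> 'm \<times> real \<Rightarrow> ('v \<Rightarrow> real) list \<Rightarrow> real"
  where "poissonization \<pi> = (\<lambda>(x, t) \<alpha>s. exp (- t) * \<pi> x \<alpha>s)"

definition tilde_metric ::
    "('m \<Rightarrow> ('v \<Rightarrow> real) \<Rightarrow> ('v \<Rightarrow> real) \<Rightarrow> real) \<Rightarrow> 'm \<times> real \<Rightarrow> ('v \<Rightarrow> real) \<Rightarrow> ('v \<Rightarrow> real) \<Rightarrow> real"
  where "tilde_metric g = (\<lambda>(x, t) \<alpha> \<beta>. exp (- t) * g x \<alpha> \<beta>)"

end

theory Submission
  imports Defs
begin

text \<open>
  Bump functions extend local frames to global sections, so expressions that are linear over the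
  smooth functions are determined pointwise. Hence the exterior derivative of functions and of
  1-forms, the skew algebroids on the dual bundles and, through the Koszul formula, the Levi-Civita
  connections exist, also on \<open>M \<times> \<real>\<close>, where the expression \<open>D\<pi>\<close> only has to be evaluated on
  time-independent covectors. There one computes, with \<open>\<langle>\<beta>, X\<^sub>0\<rangle> = g(\<xi>, \<beta>)\<close> and the tilde marking the
  objects on \<open>M \<times> \<real>\<close>,
  \<open>D\<^sup>~\<^sub>\<alpha>\<beta> = exp (- t) (D\<^sub>\<alpha>\<beta> - 1/2 \<langle>\<alpha>, X\<^sub>0\<rangle> \<beta> + 1/2 \<langle>\<beta>, X\<^sub>0\<rangle> \<alpha> - 1/2 g(\<alpha>, \<beta>) \<xi>)\<close>,
  so that \<open>D\<^sup>~\<pi>\<^sup>~\<close> is \<open>exp (- 2 t)\<close> times the difference of the two sides of the compatibility condition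
  on \<open>(A, \<phi>\<^sub>0)\<close>.
\<close>

section \<open>Calculus on finite-dimensional inner product spaces\<close>

text \<open>The notions involved are definite descriptions (\<open>ext_d\<close>,
  \<open>sharp\<close>, \<open>flat_inv\<close>, \<open>time_deriv\<close>,
  \<open>levi_civita\<close>). No formula for any of them is available before existence and
  uniqueness are known, and existence includes smoothness; most of the development serves this. To
  do it once, both sides are read as instances of one construction. The bracket
  \<open>bracket_pi\<close> is \<open>bracket_pi_phi\<close> for the zero covector, so
  \<open>compatible\<close> on the product concerns the data
  (\<open>tilde_minus A \<phi>\<^sub>0\<close>, 0, \<open>poissonization \<pi>\<close>,
  \<open>tilde_metric g\<close>) just as \<open>jacobi_compatible\<close> concerns
  (\<open>A\<close>, \<open>\<phi>\<^sub>0\<close>, \<pi>, g), and the locale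
  \<open>bivector_metric\<close> holds for both. All correction terms have one origin: the anchor
  over the product differentiates the weight, \<rho>(X) exp(-t) = - \<open>\<phi>\<^sub>0\<close>(X)
  exp(-t). The weight sits in \<pi> and in g, so this enters the Koszul formula through its brackets
  and through its derivatives of the metric; the coefficients 1/2 are those of that formula.\<close>

lemma exists_finite_orthonormal_expansion:
  "\<exists>B::'e::{real_inner,heine_borel} set. finite B \<and> (\<forall>x. x = (\<Sum>b\<in>B. (x \<bullet> b) *\<^sub>R b))"
proof -
  \<comment> \<open>The sort provides no distinguished basis, so an orthonormal set of maximal size
    is taken. Sizes are bounded because the unit sphere is compact: finitely many balls of radius
    1/2 cover it, and orthonormal vectors, being sqrt 2 apart, have different centres assigned. In
    dimension 0 the empty set results.\<close>
  define ON where "ON B \<longleftrightarrow> finite B \<and> (\<forall>b\<in>B. \<forall>c\<in>B. b \<bullet> c = (if b = c then 1 else 0))" for B :: "'e set"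
  have "compact (sphere (0::'e) 1)"
    unfolding compact_eq_bounded_closed
    by (auto simp: sphere_def bounded_iff intro!: closed_Collect_eq continuous_intros)
  then obtain K :: "'e set" where K: "finite K" "sphere 0 1 \<subseteq> (\<Union>k\<in>K. ball k (1/2))"
    unfolding compact_eq_totally_bounded by (metis half_gt_zero_iff zero_less_one)
  have bound: "card B \<le> card K" if B: "ON B" for B
  proof -
    have "\<exists>k\<in>K. dist k b < 1/2" if "b \<in> B" for b
    proof -
      have "norm b = 1" using B that by (simp add: ON_def norm_eq_sqrt_inner)
      then have "b \<in> sphere 0 1" by simp
      then show ?thesis using K(2) by fastforce
    qed
    then obtain f where f: "\<And>b. b \<in> B \<Longrightarrow> f b \<in> K \<and> dist (f b) b < 1/2" by metis
    have "inj_on f B"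
    proof (rule inj_onI, rule ccontr)
      fix b c assume bc: "b \<in> B" "c \<in> B" "f b = f c" "b \<noteq> c"
      have "dist b c < 1" using f[OF bc(1)] f[OF bc(2)] bc(3)
        by (smt (verit) dist_triangle2 dist_commute field_sum_of_halves)
      then have "(norm (b - c))\<^sup>2 < 1"
        by (metis dist_norm norm_ge_zero one_power2 power_strict_mono zero_less_numeral pos2)
      moreover have "(norm (b - c))\<^sup>2 = 2"
        using B bc by (simp add: ON_def power2_norm_eq_inner inner_diff_left inner_diff_right)
      ultimately show False by simp
    qed
    then show ?thesis using f K(1) by (meson card_inj_on_le image_subsetI)
  qed
  have "ON {}" by (simp add: ON_def)
  then have "\<exists>B. ON B \<and> (\<forall>B'. ON B' \<longrightarrow> card B' \<le> card B)"
    by (rule ex_has_greatest_nat[where b = "Suc (card K)"]) (simp add: bound less_Suc_eq_le)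
  then obtain B where B: "ON B" and max: "\<And>B'. ON B' \<Longrightarrow> card B' \<le> card B"
    by auto
  have fin: "finite B" using B by (simp add: ON_def)
  have "x = (\<Sum>b\<in>B. (x \<bullet> b) *\<^sub>R b)" for x
  proof (rule ccontr)
    \<comment> \<open>The defect of the expansion is orthogonal to \<open>B\<close>; normalised, it
      would enlarge \<open>B\<close> beyond the maximal size.\<close>
    define y where "y = x - (\<Sum>b\<in>B. (x \<bullet> b) *\<^sub>R b)"
    assume "x \<noteq> (\<Sum>b\<in>B. (x \<bullet> b) *\<^sub>R b)"
    then have y0: "y \<noteq> 0" by (simp add: y_def)
    have yo: "y \<bullet> c = 0" if "c \<in> B" for c
    proof -
      have "(\<Sum>b\<in>B. (x \<bullet> b) * (b \<bullet> c)) = (\<Sum>b\<in>B. if b = c then x \<bullet> b else 0)"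
        using B that by (intro sum.cong) (auto simp: ON_def)
      also have "\<dots> = x \<bullet> c" using that fin by simp
      finally show ?thesis by (simp add: y_def inner_diff_left inner_sum_left)
    qed
    define z where "z = y /\<^sub>R norm y"
    have zz: "z \<bullet> z = 1" using y0 by (simp add: z_def dot_square_norm power2_eq_square field_simps)
    have zo: "z \<bullet> c = 0" "c \<bullet> z = 0" if "c \<in> B" for c
      using yo[OF that] by (simp_all add: z_def inner_commute)
    have "z \<notin> B" using zz zo by force
    moreover have "ON (insert z B)" using B zz zo by (auto simp: ON_def)
    ultimately show False using max[of "insert z B"] fin by simp
  qed
  then show ?thesis using fin by blast
qed

text \<open>\<open>frechet_derivative\<close> is a choice among the derivatives at a point, so
  functions with the same set of derivatives get the same value, whether or not that set is
  empty.\<close>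

lemma frechet_derivative_cong_open:
  assumes "open S" "x \<in> S" "\<And>y. y \<in> S \<Longrightarrow> f y = g y"
  shows "frechet_derivative f (at x) = frechet_derivative g (at x)"
proof -
  have "(f has_derivative D) (at x) \<longleftrightarrow> (g has_derivative D) (at x)" for D
    using assms by (metis has_derivative_transform_within_open)
  then show ?thesis by (simp add: frechet_derivative_def)
qed

lemma Ck_on_cong_imp:
  assumes "open S" "\<And>x. x \<in> S \<Longrightarrow> f x = g x" "Ck_on k S f"
  shows "Ck_on k S g"
  using assms(2,3)
proof (induction k arbitrary: f g)
  case 0
  then show ?case by (metis Ck_on.simps(1) continuous_on_cong)
next
  case (Suc k)
  have "g differentiable_on S"
    using Suc.prems assms(1)
    by (auto simp: differentiable_on_def differentiable_def)
       (metis has_derivative_transform)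
  moreover have "Ck_on k S (\<lambda>x. frechet_derivative g (at x) w)" for w
  proof (rule Suc.IH)
    show "Ck_on k S (\<lambda>x. frechet_derivative f (at x) w)" using Suc.prems by simp
    show "frechet_derivative f (at x) w = frechet_derivative g (at x) w" if "x \<in> S" for x
      using frechet_derivative_cong_open[OF assms(1) that] Suc.prems(1) by metis
  qed
  ultimately show ?case by simp
qed

text \<open>\<open>Ck_on\<close> refers to the chosen \<open>frechet_derivative\<close>; this rule
  accepts any explicitly known derivative instead, and the closure properties below rest on
  it.\<close>

lemma Ck_on_SucI:
  assumes "open S" "\<And>x. x \<in> S \<Longrightarrow> (f has_derivative D x) (at x)" "\<And>w. Ck_on k S (\<lambda>x. D x w)"
  shows "Ck_on (Suc k) S f"
proof -
  have "f differentiable_on S"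
    using assms(2) by (meson differentiable_at_imp_differentiable_on differentiable_def)
  moreover have "Ck_on k S (\<lambda>x. frechet_derivative f (at x) w)" for w
    by (rule Ck_on_cong_imp[OF assms(1) _ assms(3)[of w]])
       (use assms(2) frechet_derivative_at in metis)
  ultimately show ?thesis by simp
qed

lemma Ck_on_has_derivative:
  assumes "Ck_on (Suc k) S f" "open S" "x \<in> S"
  shows "(f has_derivative frechet_derivative f (at x)) (at x)"
  using assms by (metis Ck_on.simps(2) differentiable_on_eq_differentiable_at frechet_derivative_works)

lemma Ck_on_subset: "Ck_on k S f \<Longrightarrow> T \<subseteq> S \<Longrightarrow> Ck_on k T f"
  by (induction k arbitrary: f) (auto intro: continuous_on_subset differentiable_on_subset)

lemma Ck_on_Suc_imp: "open S \<Longrightarrow> Ck_on (Suc k) S f \<Longrightarrow> Ck_on k S f"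
proof (induction k arbitrary: f)
  case 0
  then show ?case by (simp add: differentiable_imp_continuous_on)
next
  case (Suc k)
  then show ?case by (metis Ck_on.simps(2))
qed

text \<open>Both ingredients of \<open>Ck_on\<close> on an open set, continuity and
  differentiability, are tested point by point. This is what later allows smoothness to be handled
  one point at a time.\<close>

lemma Ck_on_local:
  assumes "\<And>x. x \<in> S \<Longrightarrow> \<exists>N. open N \<and> x \<in> N \<and> Ck_on k N f" "open S"
  shows "Ck_on k S f"
  using assms(1)
proof (induction k arbitrary: f)
  case 0
  have "isCont f x" if "x \<in> S" for x
    using 0[OF that] by (auto simp: continuous_on_eq_continuous_at)
  then show ?case by (simp add: continuous_at_imp_continuous_on)
next
  case (Suc k)
  have "f differentiable_on S"
    using Suc.prems assms(2) by (metis Ck_on.simps(2) differentiable_on_eq_differentiable_at)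
  moreover have "Ck_on k S (\<lambda>x. frechet_derivative f (at x) w)" for w
    by (rule Suc.IH) (use Suc.prems in fastforce)
  ultimately show ?case by simp
qed

lemma Ck_on_const: "open S \<Longrightarrow> Ck_on k S (\<lambda>_. c)"
proof (induction k arbitrary: c)
  case (Suc k)
  show ?case
    by (rule Ck_on_SucI[where D = "\<lambda>_ _. 0"]) (use Suc in auto)
qed simp

lemma Ck_on_bounded_linear_comp:
  assumes "bounded_linear L" "open S"
  shows "Ck_on k S f \<Longrightarrow> Ck_on k S (\<lambda>x. L (f x))"
proof (induction k arbitrary: f)
  case 0
  then show ?case using assms by (simp add: bounded_linear.continuous_on)
next
  case (Suc k)
  show ?case
  proof (rule Ck_on_SucI[OF assms(2)])
    show "((\<lambda>x. L (f x)) has_derivative (\<lambda>w. L (frechet_derivative f (at x) w))) (at x)" if "x \<in> S" for x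
      using Ck_on_has_derivative[OF Suc.prems assms(2) that] assms(1)
      by (rule bounded_linear.has_derivative[rotated])
    show "Ck_on k S (\<lambda>x. L (frechet_derivative f (at x) w))" for w
      using Suc by simp
  qed
qed

lemma Ck_on_bounded_linear: "bounded_linear L \<Longrightarrow> open S \<Longrightarrow> Ck_on k S L"
proof (induction k)
  case 0
  then show ?case by (simp add: linear_continuous_on)
next
  case (Suc k)
  show ?case
    by (rule Ck_on_SucI[where D = "\<lambda>_. L"])
       (use Suc in \<open>auto intro: Ck_on_const bounded_linear_imp_has_derivative\<close>)
qed

lemma Ck_on_add:
  assumes "open S"
  shows "Ck_on k S f \<Longrightarrow> Ck_on k S g \<Longrightarrow> Ck_on k S (\<lambda>x. f x + g x)"
proof (induction k arbitrary: f g)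
  case 0
  then show ?case by (simp add: continuous_on_add)
next
  case (Suc k)
  show ?case
  proof (rule Ck_on_SucI[OF assms])
    show "((\<lambda>x. f x + g x) has_derivative
        (\<lambda>w. frechet_derivative f (at x) w + frechet_derivative g (at x) w)) (at x)" if "x \<in> S" for x
      by (intro has_derivative_add Ck_on_has_derivative[OF _ assms that]) fact+
    show "Ck_on k S (\<lambda>x. frechet_derivative f (at x) w + frechet_derivative g (at x) w)" for w
      using Suc by simp
  qed
qed

lemma Ck_on_sum:
  "open S \<Longrightarrow> (\<And>i. i \<in> I \<Longrightarrow> Ck_on k S (f i)) \<Longrightarrow> Ck_on k S (\<lambda>x. \<Sum>i\<in>I. f i x)"
  by (induction I rule: infinite_finite_induct) (auto intro: Ck_on_const Ck_on_add)

lemma Ck_on_scaleR: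
  fixes f :: "'d::real_normed_vector \<Rightarrow> real" and g :: "'d \<Rightarrow> 'f::real_normed_vector"
  assumes "open S"
  shows "Ck_on k S f \<Longrightarrow> Ck_on k S g \<Longrightarrow> Ck_on k S (\<lambda>x. f x *\<^sub>R g x)"
proof (induction k arbitrary: f g)
  case 0
  then show ?case by (simp add: continuous_on_scaleR)
next
  case (Suc k)
  show ?case
  proof (rule Ck_on_SucI[OF assms])
    show "((\<lambda>x. f x *\<^sub>R g x) has_derivative
        (\<lambda>w. f x *\<^sub>R frechet_derivative g (at x) w + frechet_derivative f (at x) w *\<^sub>R g x)) (at x)"
      if "x \<in> S" for x
      by (intro has_derivative_scaleR Ck_on_has_derivative[OF _ assms that]) fact+
    show "Ck_on k S (\<lambda>x. f x *\<^sub>R frechet_derivative g (at x) w + frechet_derivative f (at x) w *\<^sub>R g x)" for w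
    proof -
      have "Ck_on k S f" "Ck_on k S g"
        using Suc.prems Ck_on_Suc_imp[OF assms] by blast+
      then show ?thesis using Suc.prems by (intro Ck_on_add[OF assms] Suc.IH) simp_all
    qed
  qed
qed

lemma Ck_on_mult:
  fixes f g :: "'d::real_normed_vector \<Rightarrow> real"
  shows "open S \<Longrightarrow> Ck_on k S f \<Longrightarrow> Ck_on k S g \<Longrightarrow> Ck_on k S (\<lambda>x. f x * g x)"
  using Ck_on_scaleR[of S k f g] by simp

text \<open>The derivative of 1/f consists of Df and two factors 1/f, and the induction hypothesis
  supplies 1/f itself at the order \<open>k\<close>.\<close>

lemma Ck_on_inverse:
  fixes f :: "'d::real_normed_vector \<Rightarrow> real"
  assumes "open S" "\<And>x. x \<in> S \<Longrightarrow> f x \<noteq> 0"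
  shows "Ck_on k S f \<Longrightarrow> Ck_on k S (\<lambda>x. inverse (f x))"
proof (induction k)
  case 0
  then show ?case using assms by (simp add: continuous_on_inverse)
next
  case (Suc k)
  have inv: "Ck_on k S (\<lambda>x. inverse (f x))" using Suc Ck_on_Suc_imp[OF assms(1)] by blast
  show ?case
  proof (rule Ck_on_SucI[OF assms(1)])
    show "((\<lambda>x. inverse (f x)) has_derivative
        (\<lambda>w. - (inverse (f x) * frechet_derivative f (at x) w * inverse (f x)))) (at x)" if "x \<in> S" for x
      using Deriv.has_derivative_inverse[OF assms(2)[OF that] Ck_on_has_derivative[OF Suc.prems assms(1) that]] .
    show "Ck_on k S (\<lambda>x. - (inverse (f x) * frechet_derivative f (at x) w * inverse (f x)))" for w
    proof -
      have "Ck_on k S (\<lambda>x. inverse (f x) * frechet_derivative f (at x) w * inverse (f x))"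
        using Suc.prems inv by (intro Ck_on_mult[OF assms(1)]) auto
      from Ck_on_mult[OF assms(1) Ck_on_const[OF assms(1), of k "-1"] this] show ?thesis by simp
    qed
  qed
qed

text \<open>Expanding \<open>Dg(x) w\<close> in an orthonormal basis turns the chain rule into a finite sum of products
  to which the induction hypothesis applies; this is where finite dimension is used.\<close>

lemma Ck_on_compose:
  fixes f :: "'e::{real_inner,heine_borel} \<Rightarrow> 'f::real_normed_vector"
    and g :: "'d::real_normed_vector \<Rightarrow> 'e"
  assumes "open S" "open T" "\<And>x. x \<in> S \<Longrightarrow> g x \<in> T"
  shows "Ck_on k T f \<Longrightarrow> Ck_on k S g \<Longrightarrow> Ck_on k S (\<lambda>x. f (g x))"
proof (induction k arbitrary: f)
  case 0
  then show ?case using assms by (auto intro: continuous_on_compose2)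
next
  case (Suc k)
  obtain B :: "'e set" where B: "finite B" "\<And>x. x = (\<Sum>b\<in>B. (x \<bullet> b) *\<^sub>R b)"
    using exists_finite_orthonormal_expansion by blast
  let ?D = "\<lambda>x w. \<Sum>b\<in>B. (frechet_derivative g (at x) w \<bullet> b) *\<^sub>R frechet_derivative f (at (g x)) b"
  show ?case
  proof (rule Ck_on_SucI[OF assms(1), where D = ?D])
    fix x assume x: "x \<in> S"
    have df: "(f has_derivative frechet_derivative f (at (g x))) (at (g x))"
      using Ck_on_has_derivative[OF Suc.prems(1) assms(2) assms(3)[OF x]] .
    have "((\<lambda>x. f (g x)) has_derivative
        (\<lambda>w. frechet_derivative f (at (g x)) (frechet_derivative g (at x) w))) (at x)"
      using has_derivative_compose[OF Ck_on_has_derivative[OF Suc.prems(2) assms(1) x] df] .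
    moreover have "frechet_derivative f (at (g x)) (frechet_derivative g (at x) w) = ?D x w" for w
    proof -
      interpret linear "frechet_derivative f (at (g x))"
        using df by (rule has_derivative_linear)
      show ?thesis by (subst B(2)[of "frechet_derivative g (at x) w"]) (simp add: sum scale)
    qed
    ultimately show "((\<lambda>x. f (g x)) has_derivative ?D x) (at x)" by simp
  next
    fix w
    have g: "Ck_on k S g" "Ck_on k S (\<lambda>x. frechet_derivative g (at x) w)"
      and f: "Ck_on k T (\<lambda>y. frechet_derivative f (at y) b)" for b
      using Suc.prems Ck_on_Suc_imp[OF assms(1)] by simp_all
    show "Ck_on k S (\<lambda>x. ?D x w)"
      by (intro Ck_on_sum[OF assms(1)] Ck_on_scaleR[OF assms(1)] Suc.IH f g
          Ck_on_bounded_linear_comp[OF bounded_linear_inner_left assms(1)])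
  qed
qed

section \<open>Bump functions on the model space\<close>

lemma Ck_on_power_exp_inverse:
  "Ck_on k UNIV (\<lambda>s::real. if s \<le> 0 then 0 else inverse s ^ n * exp (- inverse s))"
proof (induction k arbitrary: n)
  \<comment> \<open>The only analytic input: powers of 1/s lose against exp(-1/s) as s tends to 0
    from the right.\<close>
  have lim: "((\<lambda>s::real. if s \<le> 0 then 0 else inverse s ^ n * exp (- inverse s)) \<longlongrightarrow> 0) (at 0)" for n
  proof (rule filterlim_split_at_real)
    show "((\<lambda>s::real. if s \<le> 0 then 0 else inverse s ^ n * exp (- inverse s)) \<longlongrightarrow> 0) (at_left 0)"
      by (rule tendsto_eventually) (auto simp: eventually_at_left_field intro: exI[of _ "-1"])
    have "((\<lambda>s. inverse s ^ n / exp (inverse s)) \<longlongrightarrow> (0::real)) (at_right 0)"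
      using filterlim_compose[OF tendsto_power_div_exp_0 filterlim_inverse_at_top_right] .
    moreover have "\<forall>\<^sub>F s in at_right (0::real).
        inverse s ^ n / exp (inverse s) = (if s \<le> 0 then 0 else inverse s ^ n * exp (- inverse s))"
      by (auto simp: eventually_at_right_field exp_minus divide_inverse intro: exI[of _ 1])
    ultimately show "((\<lambda>s::real. if s \<le> 0 then 0 else inverse s ^ n * exp (- inverse s)) \<longlongrightarrow> 0) (at_right 0)"
      by (rule Lim_transform_eventually)
  qed
  let ?h = "\<lambda>n s::real. if s \<le> 0 then 0 else inverse s ^ n * exp (- inverse s)"
  \<comment> \<open>Differentiation turns the n-th function into a combination of those with
    exponents n + 2 and n + 1. The powers are in the statement to make the family closed under
    differentiation; the case wanted in the end is n = 0.\<close>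
  have der: "(?h n has_real_derivative (?h (n + 2) s - real n * ?h (n + 1) s)) (at s)" for n s
  proof (cases s "0::real" rule: linorder_cases)
    case less
    have "((\<lambda>s. 0) has_real_derivative 0) (at s)" by simp
    then have "(?h n has_real_derivative 0) (at s)"
      by (rule has_field_derivative_transform_within_open[where S = "{..<0}"]) (use less in auto)
    then show ?thesis using less by simp
  next
    case equal
    \<comment> \<open>The difference quotient of the n-th function at 0 is the function with
      exponent n + 1, so the limit above is needed one exponent higher.\<close>
    have "((\<lambda>t. (?h n t - ?h n 0) / (t - 0)) \<longlongrightarrow> 0) (at 0)"
      using lim[of "Suc n"] by (rule Lim_transform_eventually) (auto simp: divide_inverse intro!: always_eventually)
    then show ?thesis using equal by (simp add: has_field_derivative_iff)
  next
    case greater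
    let ?i = "inverse s"
    have di: "(inverse has_real_derivative - (?i ^ 2)) (at s)"
      using DERIV_inverse[of s] greater by (simp add: numeral_2_eq_2)
    have de: "((\<lambda>s. exp (- inverse s)) has_real_derivative exp (- ?i) * ?i ^ 2) (at s)"
      using DERIV_fun_exp[OF DERIV_minus[OF di]] by simp
    have "real n * (- (?i ^ 2) * ?i ^ (n - Suc 0)) * exp (- ?i) + exp (- ?i) * ?i ^ 2 * ?i ^ n =
        ?i ^ (n + 2) * exp (- ?i) - real n * (?i ^ (n + 1) * exp (- ?i))"
      by (cases n) (simp_all add: algebra_simps power2_eq_square)
    then have "((\<lambda>s. inverse s ^ n * exp (- inverse s)) has_real_derivative
        (?i ^ (n + 2) * exp (- ?i) - real n * (?i ^ (n + 1) * exp (- ?i)))) (at s)"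
      using DERIV_mult[OF DERIV_power[OF di, of n] de] by simp
    then have "(?h n has_real_derivative
        (inverse s ^ (n + 2) * exp (- inverse s) - real n * (inverse s ^ (n + 1) * exp (- inverse s)))) (at s)"
      by (rule has_field_derivative_transform_within_open[where S = "{0<..}"]) (use greater in auto)
    then show ?thesis using greater by simp
  qed
  {
    case 0
    have "isCont (?h n) s" for s using der DERIV_isCont by blast
    then show ?case by (simp add: continuous_at_imp_continuous_on)
  next
    case (Suc k)
    show ?case
    proof (rule Ck_on_SucI[where D = "\<lambda>s w. (?h (n + 2) s + (- real n) * ?h (n + 1) s) * w"])
      show "(?h n has_derivative (\<lambda>w. (?h (n + 2) s + (- real n) * ?h (n + 1) s) * w)) (at s)" for s
        using der[of n s] unfolding has_field_derivative_def by simp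
      show "Ck_on k UNIV (\<lambda>s. (?h (n + 2) s + (- real n) * ?h (n + 1) s) * w)" for w
        by (rule Ck_on_mult[OF open_UNIV Ck_on_add[OF open_UNIV Suc Ck_on_mult[OF open_UNIV Ck_on_const[OF open_UNIV] Suc]] Ck_on_const[OF open_UNIV]])
    qed simp
  }
qed

lemma Cinf_on_exp: "Cinf_on UNIV (exp :: real \<Rightarrow> real)"
proof -
  have "Ck_on k UNIV (exp :: real \<Rightarrow> real)" for k
  proof (induction k)
    case 0
    then show ?case by (simp add: continuous_on_exp)
  next
    case (Suc k)
    show ?case
    proof (rule Ck_on_SucI[where D = "\<lambda>s w. exp s * w"])
      show "(exp has_derivative (\<lambda>w. exp s * w)) (at s)" for s :: real
        using DERIV_exp[of s] unfolding has_field_derivative_def .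
    qed (rule open_UNIV, rule Ck_on_mult[OF open_UNIV Suc Ck_on_const[OF open_UNIV]])
  qed
  then show ?thesis by (simp add: Cinf_on_def)
qed

text \<open>With h(s) = exp(-1/s) for s > 0 and 0 otherwise, and q the squared distance to
  \<open>p\<close>, the bump function is the quotient of h(r^2 - q) by h(r^2 - q) + h(q - r^2/4).
  The second summand of the denominator vanishes on the ball of radius r/2, the numerator outside
  the ball of radius r.\<close>

lemma exists_bump_vector_space:
  fixes p :: "'e::{real_inner,heine_borel}"
  assumes "0 < r"
  obtains \<eta> :: "'e \<Rightarrow> real" where "Cinf_on UNIV \<eta>" "\<And>y. y \<in> ball p (r / 2) \<Longrightarrow> \<eta> y = 1"
    "\<And>y. y \<notin> cball p r \<Longrightarrow> \<eta> y = 0"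
proof -
  define h where "h s = (if s \<le> 0 then 0 else exp (- inverse s))" for s :: real
  have h: "Ck_on k UNIV h" for k
  proof -
    have "h = (\<lambda>s. if s \<le> 0 then 0 else inverse s ^ 0 * exp (- inverse s))"
      by (rule ext) (simp add: h_def)
    then show ?thesis using Ck_on_power_exp_inverse[of k 0] by (simp only:)
  qed
  have hpos: "h s \<ge> 0" "h s > 0 \<longleftrightarrow> s > 0" for s by (auto simp: h_def)
  define q where "q y = (y - p) \<bullet> (y - p)" for y
  obtain B :: "'e set" where B: "finite B" "\<And>x. x = (\<Sum>b\<in>B. (x \<bullet> b) *\<^sub>R b)"
    using exists_finite_orthonormal_expansion by blast
  \<comment> \<open>Written in an orthonormal basis the squared distance is a polynomial in linear
    functions, so the closure rules for sums and products apply.\<close>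
  have q_sum: "q = (\<lambda>y. \<Sum>b\<in>B. (y \<bullet> b + (- (p \<bullet> b))) * (y \<bullet> b + (- (p \<bullet> b))))"
  proof
    fix y
    have "q y = (\<Sum>b\<in>B. ((y - p) \<bullet> b) *\<^sub>R b) \<bullet> (y - p)"
      unfolding q_def by (rule arg_cong[OF B(2), of "\<lambda>z. z \<bullet> (y - p)"])
    also have "\<dots> = (\<Sum>b\<in>B. ((y - p) \<bullet> b) * (b \<bullet> (y - p)))"
      by (simp only: inner_sum_left inner_scaleR_left)
    also have "\<dots> = (\<Sum>b\<in>B. (y \<bullet> b + (- (p \<bullet> b))) * (y \<bullet> b + (- (p \<bullet> b))))"
      by (rule sum.cong) (simp_all add: inner_diff_left inner_diff_right inner_commute)
    finally show "q y = \<dots>" .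
  qed
  have q: "Ck_on k UNIV q" for k
    unfolding q_sum
    by (intro Ck_on_sum Ck_on_mult Ck_on_add Ck_on_const Ck_on_bounded_linear bounded_linear_inner_left open_UNIV)
  define \<eta> where "\<eta> y = h (r\<^sup>2 + (-1) * q y) * inverse (h (r\<^sup>2 + (-1) * q y) + h (q y + (- (r\<^sup>2 / 4))))" for y
  \<comment> \<open>As r^2/4 < r^2, the two arguments of h are never both nonpositive.\<close>
  have den: "h (r\<^sup>2 + (-1) * q y) + h (q y + (- (r\<^sup>2 / 4))) \<noteq> 0" for y
  proof (cases "q y < r\<^sup>2")
    case True
    then show ?thesis using hpos(1)[of "q y + (- (r\<^sup>2 / 4))"] hpos(2)[of "r\<^sup>2 + (-1) * q y"] by simp
  next
    case False
    moreover have "r\<^sup>2 > 0" using assms by simp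
    ultimately have "q y + (- (r\<^sup>2 / 4)) > 0" by linarith
    then show ?thesis using hpos(2)[of "q y + (- (r\<^sup>2 / 4))"] hpos(1)[of "r\<^sup>2 + (-1) * q y"] by linarith
  qed
  have s1: "Ck_on k UNIV (\<lambda>y. h (r\<^sup>2 + (-1) * q y))" for k
    by (rule Ck_on_compose[where T = UNIV, OF open_UNIV open_UNIV UNIV_I h])
       (intro Ck_on_add Ck_on_const Ck_on_mult q open_UNIV)
  have s2: "Ck_on k UNIV (\<lambda>y. h (q y + (- (r\<^sup>2 / 4))))" for k
    by (rule Ck_on_compose[where T = UNIV, OF open_UNIV open_UNIV UNIV_I h])
       (intro Ck_on_add Ck_on_const q open_UNIV)
  show thesis
  proof
    show "Cinf_on UNIV \<eta>"
      unfolding Cinf_on_def \<eta>_def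
      using den s1 s2 by (intro allI Ck_on_mult Ck_on_inverse Ck_on_add open_UNIV) auto
    show "\<eta> y = 1" if "y \<in> ball p (r / 2)" for y
    proof -
      have "norm (y - p) < r / 2" using that by (simp add: dist_norm norm_minus_commute)
      then have "(norm (y - p))\<^sup>2 < (r / 2)\<^sup>2" by (intro power_strict_mono) auto
      then have "q y < r\<^sup>2 / 4" by (simp add: q_def power2_norm_eq_inner power_divide)
      then have "h (q y + (- (r\<^sup>2 / 4))) = 0" by (simp add: h_def)
      then show ?thesis using den[of y] by (simp add: \<eta>_def)
    qed
    show "\<eta> y = 0" if "y \<notin> cball p r" for y
    proof -
      have "norm (y - p) > r" using that by (simp add: dist_norm norm_minus_commute)
      then have "(norm (y - p))\<^sup>2 > r\<^sup>2" using assms by (intro power_strict_mono) auto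
      then show ?thesis by (simp add: \<eta>_def h_def q_def power2_norm_eq_inner)
    qed
  qed
qed

section \<open>Smooth functions on manifolds\<close>

text \<open>Smoothness of the germ at a point. Requiring it on a whole open neighbourhood, not just
  for the derivatives at \<open>x\<close>, makes the notion stable under intersecting neighbourhoods
  and lets global smoothness be checked at each point by a local formula.\<close>

definition smooth_at :: "('m::topological_space, 'e::{real_inner,heine_borel}) atlas \<Rightarrow> ('m \<Rightarrow> real) \<Rightarrow> 'm \<Rightarrow> bool"
  where "smooth_at C f x \<longleftrightarrow> (\<exists>N. open N \<and> x \<in> N \<and> smooth_fun_on C N f)"

lemma Cinf_onD: "Cinf_on S f \<Longrightarrow> Ck_on k S f"
  by (simp add: Cinf_on_def)

lemma smooth_fun_onI:
  "(\<And>U \<phi> k. (U, \<phi>) \<in> C \<Longrightarrow> Ck_on k (\<phi> ` (U \<inter> W)) (\<lambda>p. f (inv_into U \<phi> p))) \<Longrightarrow> smooth_fun_on C W f"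
  by (auto simp: smooth_fun_on_def Cinf_on_def comp_def)

lemma smooth_fun_onD:
  "smooth_fun_on C W f \<Longrightarrow> (U, \<phi>) \<in> C \<Longrightarrow> Ck_on k (\<phi> ` (U \<inter> W)) (\<lambda>p. f (inv_into U \<phi> p))"
  by (auto simp: smooth_fun_on_def Cinf_on_def comp_def)

locale manifold =
  fixes C :: "('m::{t2_space,second_countable_topology}, 'e::{real_inner,heine_borel}) atlas"
  assumes smooth_manifold: "smooth_manifold C"
begin

lemma chart_exists: obtains U \<phi> where "(U, \<phi>) \<in> C" "x \<in> U"
proof -
  have "x \<in> (\<Union>(U, \<phi>)\<in>C. U)" using smooth_manifold by (simp add: smooth_manifold_def)
  then show thesis using that by auto
qed

lemma
  assumes "(U, \<phi>) \<in> C"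
  shows chart_open: "open U" and chart_open_image: "open (\<phi> ` U)"
    and chart_continuous: "continuous_on U \<phi>"
    and chart_inv_continuous: "continuous_on (\<phi> ` U) (inv_into U \<phi>)"
    and chart_inj: "inj_on \<phi> U"
proof -
  have "open U \<and> open (\<phi> ` U) \<and> homeomorphism U (\<phi> ` U) \<phi> (inv_into U \<phi>)"
    using smooth_manifold assms unfolding smooth_manifold_def by (metis (no_types, lifting) case_prodD)
  then show "open U" "open (\<phi> ` U)" "continuous_on U \<phi>" "continuous_on (\<phi> ` U) (inv_into U \<phi>)" "inj_on \<phi> U"
    unfolding homeomorphism_def by (auto intro: inj_on_inverseI)
qed

lemma chart_inv: "(U, \<phi>) \<in> C \<Longrightarrow> x \<in> U \<Longrightarrow> inv_into U \<phi> (\<phi> x) = x"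
  using chart_inj by (rule inv_into_f_f)

lemma chart_open_image_Int:
  assumes c: "(U, \<phi>) \<in> C" and W: "open W"
  shows "open (\<phi> ` (U \<inter> W))"
proof -
  have "\<phi> ` (U \<inter> W) = \<phi> ` U \<inter> inv_into U \<phi> -` W"
    using chart_inv[OF c] by force
  then show ?thesis
    using continuous_open_preimage[OF chart_inv_continuous[OF c] chart_open_image[OF c] W] by simp
qed

lemma smooth_fun_on_subset:
  assumes "smooth_fun_on C W f" "V \<subseteq> W"
  shows "smooth_fun_on C V f"
proof (rule smooth_fun_onI)
  fix U \<phi> k assume "(U, \<phi>) \<in> C"
  from smooth_fun_onD[OF assms(1) this]
  show "Ck_on k (\<phi> ` (U \<inter> V)) (\<lambda>p. f (inv_into U \<phi> p))"
    by (rule Ck_on_subset) (use assms(2) in auto)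
qed

lemma smooth_fun_on_cong:
  assumes "open W" "smooth_fun_on C W f" "\<And>x. x \<in> W \<Longrightarrow> f x = g x"
  shows "smooth_fun_on C W g"
proof (rule smooth_fun_onI)
  fix U \<phi> k assume c: "(U, \<phi>) \<in> C"
  show "Ck_on k (\<phi> ` (U \<inter> W)) (\<lambda>p. g (inv_into U \<phi> p))"
    by (rule Ck_on_cong_imp[OF chart_open_image_Int[OF c assms(1)] _ smooth_fun_onD[OF assms(2) c]])
       (auto simp: chart_inv[OF c] assms(3))
qed

lemma smooth_fun_on_iff_smooth_at:
  assumes "open W"
  shows "smooth_fun_on C W f \<longleftrightarrow> (\<forall>x\<in>W. smooth_at C f x)"
proof
  show "smooth_fun_on C W f \<Longrightarrow> \<forall>x\<in>W. smooth_at C f x"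
    using assms by (auto simp: smooth_at_def)
  assume *: "\<forall>x\<in>W. smooth_at C f x"
  show "smooth_fun_on C W f"
  proof (rule smooth_fun_onI)
    fix U \<phi> k assume c: "(U, \<phi>) \<in> C"
    show "Ck_on k (\<phi> ` (U \<inter> W)) (\<lambda>p. f (inv_into U \<phi> p))"
    proof (rule Ck_on_local[OF _ chart_open_image_Int[OF c assms]])
      fix p assume "p \<in> \<phi> ` (U \<inter> W)"
      then obtain x where x: "x \<in> U" "x \<in> W" "p = \<phi> x" by auto
      then obtain N where N: "open N" "x \<in> N" "smooth_fun_on C N f"
        using * by (auto simp: smooth_at_def)
      show "\<exists>N. open N \<and> p \<in> N \<and> Ck_on k N (\<lambda>p. f (inv_into U \<phi> p))"
        using N x chart_open_image_Int[OF c N(1)] smooth_fun_onD[OF N(3) c]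
        by (intro exI[of _ "\<phi> ` (U \<inter> N)"]) auto
    qed
  qed
qed

lemma smooth_funs_iff: "f \<in> smooth_funs C \<longleftrightarrow> (\<forall>x. smooth_at C f x)"
  by (simp add: smooth_funs_def smooth_fun_on_iff_smooth_at)

lemma smooth_funsD: "f \<in> smooth_funs C \<Longrightarrow> smooth_at C f x"
  by (simp add: smooth_funs_iff)

lemma smooth_at_cong:
  assumes "smooth_at C f x" "open N" "x \<in> N" "\<And>y. y \<in> N \<Longrightarrow> f y = g y"
  shows "smooth_at C g x"
proof -
  obtain V where V: "open V" "x \<in> V" "smooth_fun_on C V f"
    using assms(1) by (auto simp: smooth_at_def)
  have o: "open (V \<inter> N)" using V assms(2) by auto
  have "smooth_fun_on C (V \<inter> N) g"
    by (rule smooth_fun_on_cong[OF o smooth_fun_on_subset[OF V(3) Int_lower1]]) (simp add: assms(4))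
  then show ?thesis using V(2) assms(3) o unfolding smooth_at_def by blast
qed

text \<open>One chart around the point decides: any other chart is reached by composing with a
  transition map, which is smooth by the definition of an atlas.\<close>

lemma smooth_at_chartI:
  assumes c: "(U, \<phi>) \<in> C" and N: "open N" "x \<in> N" "N \<subseteq> U"
    and f: "Cinf_on (\<phi> ` N) (f \<circ> inv_into U \<phi>)"
  shows "smooth_at C f x"
proof -
  have "smooth_fun_on C N f"
  proof (rule smooth_fun_onI)
    fix V \<psi> k assume d: "(V, \<psi>) \<in> C"
    have "\<forall>(U, \<phi>)\<in>C. \<forall>(V, \<psi>)\<in>C. Cinf_on (\<phi> ` (U \<inter> V)) (\<psi> \<circ> inv_into U \<phi>)"
      using smooth_manifold by (simp add: smooth_manifold_def)
    then have "Cinf_on (\<psi> ` (V \<inter> U)) (\<phi> \<circ> inv_into V \<psi>)"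
      using c d by fastforce
    then have t: "Ck_on k (\<psi> ` (V \<inter> N)) (\<lambda>p. \<phi> (inv_into V \<psi> p))"
      using N(3) by (intro Ck_on_subset[OF Cinf_onD[of "\<psi> ` (V \<inter> U)"]]) (auto simp: comp_def)
    have "U \<inter> N = N" using N(3) by auto
    then have o: "open (\<psi> ` (V \<inter> N))" "open (\<phi> ` N)"
      using chart_open_image_Int[OF d N(1)] chart_open_image_Int[OF c N(1)] by simp_all
    have "Ck_on k (\<psi> ` (V \<inter> N)) (\<lambda>p. (f \<circ> inv_into U \<phi>) (\<phi> (inv_into V \<psi> p)))"
      by (rule Ck_on_compose[OF o _ Cinf_onD[OF f] t]) (auto simp: chart_inv[OF d])
    then show "Ck_on k (\<psi> ` (V \<inter> N)) (\<lambda>p. f (inv_into V \<psi> p))"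
      by (rule Ck_on_cong_imp[OF o(1), rotated])
         (use N(3) in \<open>auto simp: chart_inv[OF d] chart_inv[OF c]\<close>)
  qed
  then show ?thesis using N by (auto simp: smooth_at_def)
qed

lemma smooth_at_chart:
  assumes "(U, \<phi>) \<in> C" "x \<in> U" "smooth_at C f x"
  obtains N where "open N" "x \<in> N" "N \<subseteq> U" "Cinf_on (\<phi> ` N) (f \<circ> inv_into U \<phi>)"
proof -
  obtain V where V: "open V" "x \<in> V" "smooth_fun_on C V f"
    using assms(3) by (auto simp: smooth_at_def)
  then show thesis
    using assms chart_open[OF assms(1)]
    by (intro that[of "U \<inter> V"]) (auto simp: smooth_fun_on_def)
qed

text \<open>The outer function \<open>F\<close> only has to preserve \<open>Ck_on\<close> for
  functions with values in the open set \<open>T\<close>, as inversion does away from 0. The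
  neighbourhood is shrunk to the preimage of \<open>T\<close>, which is open by continuity.\<close>

lemma smooth_at_unop:
  assumes "smooth_at C f x" "open T" "f x \<in> T"
    and "\<And>k S f. open S \<Longrightarrow> (\<And>p. p \<in> S \<Longrightarrow> f p \<in> T) \<Longrightarrow> Ck_on k S f \<Longrightarrow> Ck_on k S (\<lambda>p::'e. F (f p :: real) :: real)"
  shows "smooth_at C (\<lambda>x. F (f x)) x"
proof -
  obtain U \<phi> where c: "(U, \<phi>) \<in> C" "x \<in> U" by (rule chart_exists)
  then obtain N where N: "open N" "x \<in> N" "N \<subseteq> U" "Cinf_on (\<phi> ` N) (f \<circ> inv_into U \<phi>)"
    using smooth_at_chart assms(1) by blast
  have o: "open (\<phi> ` N)" using chart_open_image_Int[OF c(1) N(1)] N(3) by (simp add: inf_absorb2)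
  have cf: "continuous_on (\<phi> ` N) (f \<circ> inv_into U \<phi>)"
    using Cinf_onD[OF N(4), of 0] by simp
  define P where "P = \<phi> ` N \<inter> (f \<circ> inv_into U \<phi>) -` T"
  have P: "open P" unfolding P_def by (rule continuous_open_preimage[OF cf o assms(2)])
  define N' where "N' = N \<inter> \<phi> -` P"
  have N': "open N'"
    unfolding N'_def using continuous_open_preimage[OF _ N(1) P] chart_continuous[OF c(1)] N(3)
    by (meson continuous_on_subset)
  have x: "x \<in> N'" using N assms(3) chart_inv[OF c] by (auto simp: N'_def P_def)
  have im: "\<phi> ` N' = P" by (auto simp: N'_def P_def)
  show ?thesis
  proof (rule smooth_at_chartI[OF c(1) N' x])
    show "N' \<subseteq> U" using N(3) by (auto simp: N'_def)
    show "Cinf_on (\<phi> ` N') ((\<lambda>x. F (f x)) \<circ> inv_into U \<phi>)"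
      unfolding im Cinf_on_def comp_def
    proof
      fix k
      have "Ck_on k P (\<lambda>p. f (inv_into U \<phi> p))"
        using Ck_on_subset[OF Cinf_onD[OF N(4)], of P] by (simp add: P_def comp_def)
      then show "Ck_on k P (\<lambda>p. F (f (inv_into U \<phi> p)))"
        by (rule assms(4)[OF P, rotated]) (auto simp: P_def)
    qed
  qed
qed

lemma smooth_at_binop:
  assumes "smooth_at C f x" "smooth_at C g x"
    and "\<And>k S f g. open S \<Longrightarrow> Ck_on k S f \<Longrightarrow> Ck_on k S g \<Longrightarrow> Ck_on k S (\<lambda>p::'e. F (f p :: real) (g p :: real) :: real)"
  shows "smooth_at C (\<lambda>x. F (f x) (g x)) x"
proof -
  obtain M N where M: "open M" "x \<in> M" "smooth_fun_on C M f" and N: "open N" "x \<in> N" "smooth_fun_on C N g"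
    using assms(1,2) by (auto simp: smooth_at_def)
  have MN: "open (M \<inter> N)" using M N by auto
  have f: "smooth_fun_on C (M \<inter> N) f" and g: "smooth_fun_on C (M \<inter> N) g"
    using M N by (auto intro: smooth_fun_on_subset)
  have "smooth_fun_on C (M \<inter> N) (\<lambda>x. F (f x) (g x))"
  proof (rule smooth_fun_onI)
    fix U \<phi> k assume c: "(U, \<phi>) \<in> C"
    show "Ck_on k (\<phi> ` (U \<inter> (M \<inter> N))) (\<lambda>p. F (f (inv_into U \<phi> p)) (g (inv_into U \<phi> p)))"
      by (intro assms(3) chart_open_image_Int[OF c MN] smooth_fun_onD[OF f c] smooth_fun_onD[OF g c])
  qed
  then show ?thesis using M N MN unfolding smooth_at_def by (intro exI[of _ "M \<inter> N"]) auto
qed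

lemma smooth_at_const: "smooth_at C (\<lambda>_. c) x"
  unfolding smooth_at_def
  using chart_open_image by (intro exI[of _ UNIV]) (auto intro!: smooth_fun_onI Ck_on_const)

lemma smooth_at_add: "smooth_at C f x \<Longrightarrow> smooth_at C g x \<Longrightarrow> smooth_at C (\<lambda>x. f x + g x) x"
  by (rule smooth_at_binop) (auto intro: Ck_on_add)

lemma smooth_at_mult: "smooth_at C f x \<Longrightarrow> smooth_at C g x \<Longrightarrow> smooth_at C (\<lambda>x. f x * g x) x"
  by (rule smooth_at_binop) (auto intro: Ck_on_mult)

lemma smooth_at_minus: "smooth_at C f x \<Longrightarrow> smooth_at C (\<lambda>x. - f x) x"
  using smooth_at_mult[OF smooth_at_const[of "-1"]] by force

lemma smooth_at_diff: "smooth_at C f x \<Longrightarrow> smooth_at C g x \<Longrightarrow> smooth_at C (\<lambda>x. f x - g x) x"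
  using smooth_at_add[OF _ smooth_at_minus] by force

lemma smooth_at_sum: "(\<And>i. i \<in> I \<Longrightarrow> smooth_at C (f i) x) \<Longrightarrow> smooth_at C (\<lambda>x. \<Sum>i\<in>I. f i x) x"
  by (induction I rule: infinite_finite_induct) (auto intro: smooth_at_const smooth_at_add)

lemma smooth_at_inverse:
  assumes "smooth_at C f x" "f x \<noteq> 0"
  shows "smooth_at C (\<lambda>x. inverse (f x)) x"
  by (rule smooth_at_unop[OF assms(1), where T = "- {0}"]) (use assms(2) in \<open>auto intro: Ck_on_inverse\<close>)

lemma smooth_at_isCont:
  assumes "smooth_at C f x"
  shows "isCont f x"
proof -
  obtain U \<phi> where c: "(U, \<phi>) \<in> C" "x \<in> U" by (rule chart_exists)
  then obtain N where N: "open N" "x \<in> N" "N \<subseteq> U" "Cinf_on (\<phi> ` N) (f \<circ> inv_into U \<phi>)"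
    using smooth_at_chart assms(1) by blast
  have cf: "continuous_on (\<phi> ` N) (f \<circ> inv_into U \<phi>)"
    using Cinf_onD[OF N(4), of 0] by simp
  have "continuous_on N ((f \<circ> inv_into U \<phi>) \<circ> \<phi>)"
    by (rule continuous_on_compose[OF _ cf]) (use chart_continuous[OF c(1)] N(3) continuous_on_subset in blast)
  then have "continuous_on N f"
    by (rule continuous_on_eq) (use N(3) chart_inv[OF c(1)] in auto)
  then show ?thesis using N continuous_on_eq_continuous_at by blast
qed

lemmas smooth_at_intros = smooth_at_const smooth_at_add smooth_at_mult smooth_at_minus smooth_at_diff smooth_at_sum

lemma smooth_funs_const: "(\<lambda>_. c) \<in> smooth_funs C"
  and smooth_funs_add: "f \<in> smooth_funs C \<Longrightarrow> g \<in> smooth_funs C \<Longrightarrow> (\<lambda>x. f x + g x) \<in> smooth_funs C"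
  and smooth_funs_mult: "f \<in> smooth_funs C \<Longrightarrow> g \<in> smooth_funs C \<Longrightarrow> (\<lambda>x. f x * g x) \<in> smooth_funs C"
  and smooth_funs_minus: "f \<in> smooth_funs C \<Longrightarrow> (\<lambda>x. - f x) \<in> smooth_funs C"
  and smooth_funs_diff: "f \<in> smooth_funs C \<Longrightarrow> g \<in> smooth_funs C \<Longrightarrow> (\<lambda>x. f x - g x) \<in> smooth_funs C"
  and smooth_funs_sum: "(\<And>i. i \<in> I \<Longrightarrow> F i \<in> smooth_funs C) \<Longrightarrow> (\<lambda>x. \<Sum>i\<in>I. F i x) \<in> smooth_funs C"
  by (auto simp: smooth_funs_iff intro: smooth_at_intros)

lemmas smooth_funs_intros =
  smooth_funs_const smooth_funs_add smooth_funs_mult smooth_funs_minus smooth_funs_diff smooth_funs_sum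

text \<open>Besides being 1 near \<open>x\<close>, the function vanishes outside a closed set
  \<open>K\<close> inside \<open>W\<close>. The closed set is what allows a product with a function
  that is smooth only on \<open>W\<close> to be extended smoothly by 0: the open complement of
  \<open>K\<close> reaches across the boundary of \<open>W\<close>.\<close>

lemma bump_exists:
  assumes W: "open W" "x \<in> W"
  obtains \<eta> N K where "\<eta> \<in> smooth_funs C" "open N" "x \<in> N" "N \<subseteq> W" "\<forall>y\<in>N. \<eta> y = 1"
    "closed K" "K \<subseteq> W" "\<forall>y. y \<notin> K \<longrightarrow> \<eta> y = 0"
proof -
  obtain U \<phi> where c: "(U, \<phi>) \<in> C" "x \<in> U" by (rule chart_exists)
  have "open (\<phi> ` (U \<inter> W))" "\<phi> x \<in> \<phi> ` (U \<inter> W)"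
    using chart_open_image_Int[OF c(1) W(1)] c W by auto
  then obtain r where r: "r > 0" "cball (\<phi> x) r \<subseteq> \<phi> ` (U \<inter> W)"
    using open_contains_cball by blast
  obtain \<beta> :: "'e \<Rightarrow> real" where \<beta>: "Cinf_on UNIV \<beta>" "\<And>y. y \<in> ball (\<phi> x) (r / 2) \<Longrightarrow> \<beta> y = 1"
    "\<And>y. y \<notin> cball (\<phi> x) r \<Longrightarrow> \<beta> y = 0"
    using exists_bump_vector_space[OF r(1)] by metis
  define \<eta> where "\<eta> y = (if y \<in> U then \<beta> (\<phi> y) else 0)" for y
  define N where "N = U \<inter> \<phi> -` ball (\<phi> x) (r / 2)"
  define K where "K = inv_into U \<phi> ` cball (\<phi> x) r"
  \<comment> \<open>A closed ball of the model space is compact, hence so is its image under the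
    inverse chart; in a Hausdorff space the image is closed in the whole manifold, not merely in the
    chart domain.\<close>
  have "compact K"
    unfolding K_def using r(2)
    by (intro compact_continuous_image continuous_on_subset[OF chart_inv_continuous[OF c(1)]]) auto
  then have K: "closed K" by (rule compact_imp_closed)
  have K_iff: "y \<in> K \<longleftrightarrow> y \<in> U \<and> \<phi> y \<in> cball (\<phi> x) r" for y
  proof
    assume "y \<in> K"
    then obtain p where p: "p \<in> cball (\<phi> x) r" "y = inv_into U \<phi> p" by (auto simp: K_def)
    then have "p \<in> \<phi> ` U" using r(2) by auto
    then show "y \<in> U \<and> \<phi> y \<in> cball (\<phi> x) r" using p by (metis f_inv_into_f inv_into_into)
  next
    assume *: "y \<in> U \<and> \<phi> y \<in> cball (\<phi> x) r"
    then have "y = inv_into U \<phi> (\<phi> y)" using chart_inv[OF c(1)] by simp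
    then show "y \<in> K" unfolding K_def using * by blast
  qed
  have KW: "K \<subseteq> W"
  proof
    fix y assume "y \<in> K"
    then have "y \<in> U" "\<phi> y \<in> \<phi> ` (U \<inter> W)" using K_iff r(2) by auto
    then show "y \<in> W" using inj_onD[OF chart_inj[OF c(1)]] by auto
  qed
  have \<eta>0: "\<eta> y = 0" if "y \<notin> K" for y using that \<beta>(3) by (auto simp: \<eta>_def K_iff)
  have "smooth_at C \<eta> y" for y
  proof (cases "y \<in> U")
    case True
    show ?thesis
    proof (rule smooth_at_chartI[OF c(1) chart_open[OF c(1)] True subset_refl])
      have "Ck_on k (\<phi> ` U) \<beta>" for k
        by (rule Ck_on_subset[OF Cinf_onD[OF \<beta>(1)] subset_UNIV])
      then show "Cinf_on (\<phi> ` U) (\<eta> \<circ> inv_into U \<phi>)"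
        unfolding Cinf_on_def
        by (auto intro: Ck_on_cong_imp[OF chart_open_image[OF c(1)], of \<beta>] simp: \<eta>_def chart_inv[OF c(1)])
    qed
  next
    case False
    then have "y \<in> - K" by (simp add: K_iff)
    then show ?thesis
      by (rule smooth_at_cong[OF smooth_at_const[of 0] open_Compl[OF K]]) (simp add: \<eta>0)
  qed
  then have "\<eta> \<in> smooth_funs C" by (simp add: smooth_funs_iff)
  moreover have "open N" unfolding N_def
    by (rule continuous_open_preimage[OF chart_continuous[OF c(1)] chart_open[OF c(1)] open_ball])
  moreover have "x \<in> N" using c r(1) by (simp add: N_def)
  moreover have "N \<subseteq> K" using r(1) by (auto simp: N_def K_iff)
  moreover have "\<eta> y = 1" if "y \<in> N" for y using that \<beta>(2) by (auto simp: N_def \<eta>_def)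
  ultimately show thesis using that[of \<eta> N K] K KW \<eta>0 by blast
qed

text \<open>\<open>W\<close> and the complement of \<open>K\<close> are used as a cover: on
  \<open>W\<close> both factors are smooth, and on the open complement of \<open>K\<close> the
  product is 0, whatever the values of \<open>f\<close> there.\<close>

lemma smooth_funs_bump_mult:
  assumes "\<eta> \<in> smooth_funs C" "closed K" "K \<subseteq> W" "\<forall>y. y \<notin> K \<longrightarrow> \<eta> y = 0"
    and "\<And>y. y \<in> W \<Longrightarrow> smooth_at C f y"
  shows "(\<lambda>x. \<eta> x * f x) \<in> smooth_funs C"
  unfolding smooth_funs_iff
proof
  fix x
  show "smooth_at C (\<lambda>x. \<eta> x * f x) x"
  proof (cases "x \<in> W")
    case True
    then show ?thesis using assms by (intro smooth_at_mult) (auto simp: smooth_funs_iff)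
  next
    case False
    then have "x \<in> - K" using assms(3) by auto
    then show ?thesis
      by (rule smooth_at_cong[OF smooth_at_const[of 0] open_Compl[OF assms(2)]]) (simp add: assms(4))
  qed
qed

text \<open>The induction on \<open>J\<close> is Gaussian elimination: a pivot that does not vanish at \<open>x\<close> does not vanish nearby.\<close>

lemma smooth_solution_of_linear_system:
  fixes M :: "'i \<Rightarrow> 'j \<Rightarrow> 'm \<Rightarrow> real"
  assumes "finite J" "finite I" "card I = card J"
    and "\<And>i j. i \<in> I \<Longrightarrow> j \<in> J \<Longrightarrow> smooth_at C (M i j) x" "\<And>i. i \<in> I \<Longrightarrow> smooth_at C (b i) x"
    and "\<And>c. (\<forall>i\<in>I. (\<Sum>j\<in>J. M i j x * c j) = 0) \<Longrightarrow> \<forall>j\<in>J. c j = 0"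
  shows "\<exists>c. (\<forall>j\<in>J. smooth_at C (c j) x) \<and>
    (\<forall>\<^sub>F y in nhds x. \<forall>i\<in>I. (\<Sum>j\<in>J. M i j y * c j y) = b i y)"
  using assms
proof (induction J arbitrary: I M b rule: finite_induct)
  case empty
  then show ?case by simp
next
  case (insert k J)
  \<comment> \<open>Without a pivot in column \<open>k\<close>, the \<open>k\<close>-th unit vector
    would lie in the kernel at \<open>x\<close>.\<close>
  have "\<exists>i\<in>I. M i k x \<noteq> 0"
  proof (rule ccontr)
    assume "\<not> ?thesis"
    then have "\<forall>i\<in>I. (\<Sum>j\<in>insert k J. M i j x * (if j = k then 1 else 0)) = 0"
      using insert.hyps by (auto intro!: sum.neutral)
    from insert.prems(5)[OF this] show False by simp
  qed
  then obtain l where l: "l \<in> I" "M l k x \<noteq> 0" by auto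
  define q where "q y = inverse (M l k y)" for y
  have q: "smooth_at C q x"
    unfolding q_def using insert.prems l by (intro smooth_at_inverse) auto
  have cardI: "card (I - {l}) = card J" using insert l by simp
  have evq: "\<forall>\<^sub>F y in nhds x. M l k y * q y = 1"
  proof -
    have "isCont (M l k) x" using smooth_at_isCont insert.prems l by auto
    then have "\<forall>\<^sub>F y in nhds x. M l k y \<noteq> 0"
      using l(2) by (metis isCont_def tendsto_imp_eventually_ne tendsto_at_iff_tendsto_nhds)
    then show ?thesis by eventually_elim (simp add: q_def)
  qed
  define M' where "M' i j y = M i j y - M i k y * q y * M l j y" for i j y
  define b' where "b' i y = b i y - M i k y * q y * b l y" for i y
  have "\<exists>c. (\<forall>j\<in>J. smooth_at C (c j) x) \<and>
      (\<forall>\<^sub>F y in nhds x. \<forall>i\<in>I - {l}. (\<Sum>j\<in>J. M' i j y * c j y) = b' i y)"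
  proof (rule insert.IH[OF _ cardI])
    show "finite (I - {l})" using insert by simp
    show "smooth_at C (M' i j) x" if "i \<in> I - {l}" "j \<in> J" for i j
      unfolding M'_def using that insert.prems l q by (intro smooth_at_diff smooth_at_mult) auto
    show "smooth_at C (b' i) x" if "i \<in> I - {l}" for i
      unfolding b'_def using that insert.prems l q by (intro smooth_at_diff smooth_at_mult) auto
    fix c assume c: "\<forall>i\<in>I - {l}. (\<Sum>j\<in>J. M' i j x * c j) = 0"
    \<comment> \<open>A kernel vector of the reduced system extends to one of the full system by
      solving row \<open>l\<close> for the \<open>k\<close>-th unknown, so the reduced system again
      has trivial kernel at \<open>x\<close>.\<close>
    define d where "d = c(k := - q x * (\<Sum>j\<in>J. M l j x * c j))"
    have d: "d j = c j" if "j \<in> J" for j using that insert.hyps by (auto simp: d_def)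
    have "(\<Sum>j\<in>insert k J. M i j x * d j) = 0" if i: "i \<in> I" for i
    proof -
      have "(\<Sum>j\<in>insert k J. M i j x * d j) = M i k x * d k + (\<Sum>j\<in>J. M i j x * c j)"
        using insert.hyps d by simp
      also have "\<dots> = (\<Sum>j\<in>J. M' i j x * c j)"
        by (simp add: d_def M'_def algebra_simps sum_subtractf sum_negf sum_distrib_left)
      also have "\<dots> = 0"
      proof (cases "i = l")
        case True
        then have "M' i j x = 0" for j using l(2) by (simp add: M'_def q_def)
        then show ?thesis by simp
      qed (use c i in simp)
      finally show ?thesis .
    qed
    then have "\<forall>j\<in>insert k J. d j = 0" using insert.prems(5) by blast
    then show "\<forall>j\<in>J. c j = 0" using d by simp
  qed
  then obtain c where c: "\<And>j. j \<in> J \<Longrightarrow> smooth_at C (c j) x"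
    and ev: "\<forall>\<^sub>F y in nhds x. \<forall>i\<in>I - {l}. (\<Sum>j\<in>J. M' i j y * c j y) = b' i y" by auto
  \<comment> \<open>Back substitution for the \<open>k\<close>-th unknown, now with functions. Row
    \<open>l\<close> of the reduced system is zero wherever the pivot times \<open>q\<close> is 1,
    so the equation of row \<open>l\<close> itself holds there as well.\<close>
  define d where "d = c(k := \<lambda>y. q y * (b l y - (\<Sum>j\<in>J. M l j y * c j y)))"
  have d: "d j = c j" if "j \<in> J" for j using that insert.hyps by (auto simp: d_def)
  have "smooth_at C (d j) x" if "j \<in> insert k J" for j
  proof (cases "j = k")
    case True
    then show ?thesis unfolding d_def using insert.prems l q c
      by (auto intro!: smooth_at_intros)
  qed (use that d c in auto)
  moreover have "\<forall>\<^sub>F y in nhds x. \<forall>i\<in>I. (\<Sum>j\<in>insert k J. M i j y * d j y) = b i y"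
    using ev evq
  proof eventually_elim
    case (elim y)
    have "(\<Sum>j\<in>insert k J. M i j y * d j y) = b i y" if i: "i \<in> I" for i
    proof -
      have "(\<Sum>j\<in>insert k J. M i j y * d j y) = M i k y * d k y + (\<Sum>j\<in>J. M i j y * c j y)"
        using insert.hyps d by simp
      also have "\<dots> = (\<Sum>j\<in>J. M' i j y * c j y) + M i k y * q y * b l y"
        by (simp add: d_def M'_def algebra_simps sum_subtractf sum_negf sum_distrib_left)
      also have "\<dots> = b i y"
      proof (cases "i = l")
        case True
        then have "M' i j y = 0" for j using elim(2) by (simp add: M'_def)
        then show ?thesis using True elim(2) by simp
      qed (use elim(1) i in \<open>simp add: b'_def\<close>)
      finally show ?thesis .
    qed
    then show ?case by blast
  qed
  ultimately show ?case by blast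
qed

end

section \<open>Vector bundles\<close>

lemma sum_fun_apply: "(\<Sum>i\<in>I. F i) x = (\<Sum>i\<in>I. F i x)" for F :: "'i \<Rightarrow> 'a \<Rightarrow> 'b::comm_monoid_add"
  by (induction I rule: infinite_finite_induct) (auto simp: zero_fun_def plus_fun_def)

text \<open>\<open>vector_bundle\<close> speaks of a frame as a set together with injectivity of its
  indexing; the familiar criterion on vanishing combinations of an indexed family yields
  both.\<close>

lemma independent_familyI:
  fixes f :: "'i \<Rightarrow> 'v::real_vector"
  assumes "finite I" "\<And>c. (\<Sum>i\<in>I. c i *\<^sub>R f i) = 0 \<Longrightarrow> \<forall>i\<in>I. c i = 0"
  shows "inj_on f I" "independent (f ` I)"
proof -
  show inj: "inj_on f I"
  proof (rule inj_onI, rule ccontr)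
    fix i j assume ij: "i \<in> I" "j \<in> I" "f i = f j" "i \<noteq> j"
    \<comment> \<open>The combination f i - f j: were the two vectors equal, it would be a
      nontrivial relation.\<close>
    let ?c = "\<lambda>k. (if k = i then 1 else 0) - (if k = j then 1 else (0::real))"
    have "(\<Sum>k\<in>I. ?c k *\<^sub>R f k) = (\<Sum>k\<in>I. if k = i then f k else 0) - (\<Sum>k\<in>I. if k = j then f k else 0)"
      unfolding sum_subtractf[symmetric] by (rule sum.cong) auto
    also have "\<dots> = 0" using ij assms(1) by simp
    finally have "\<forall>i\<in>I. ?c i = 0" by (rule assms(2))
    then show False using ij by auto
  qed
  show "independent (f ` I)"
  proof
    assume "dependent (f ` I)"
    then obtain u v where u: "v \<in> f ` I" "u v \<noteq> 0" "(\<Sum>v\<in>f ` I. u v *\<^sub>R v) = 0"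
      using assms(1) by (auto simp: dependent_finite)
    then have "(\<Sum>i\<in>I. u (f i) *\<^sub>R f i) = 0"
      by (simp add: sum.reindex[OF inj])
    then show False using assms(2)[of "u \<circ> f"] u by auto
  qed
qed

lemma dual_space_combo:
  assumes "\<alpha> \<in> dual_space V" "v \<in> V" "w \<in> V"
  shows "\<alpha> (a *\<^sub>R v + b *\<^sub>R w) = a * \<alpha> v + b * \<alpha> w"
  using assms by (simp add: dual_space_def)

lemma
  assumes "subspace V" "\<alpha> \<in> dual_space V"
  shows dual_space_add: "v \<in> V \<Longrightarrow> w \<in> V \<Longrightarrow> \<alpha> (v + w) = \<alpha> v + \<alpha> w"
    and dual_space_scale: "v \<in> V \<Longrightarrow> \<alpha> (a *\<^sub>R v) = a * \<alpha> v"
    and dual_space_diff: "v \<in> V \<Longrightarrow> w \<in> V \<Longrightarrow> \<alpha> (v - w) = \<alpha> v - \<alpha> w"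
    and dual_space_minus: "v \<in> V \<Longrightarrow> \<alpha> (- v) = - \<alpha> v"
    and dual_space_zero: "\<alpha> 0 = 0"
    and dual_space_sum: "(\<And>i. i \<in> I \<Longrightarrow> f i \<in> V) \<Longrightarrow> \<alpha> (\<Sum>i\<in>I. c i *\<^sub>R f i) = (\<Sum>i\<in>I. c i * \<alpha> (f i))"
proof -
  note l = dual_space_combo[OF assms(2)]
  show add: "\<alpha> (v + w) = \<alpha> v + \<alpha> w" if "v \<in> V" "w \<in> V" for v w using l[OF that, of 1 1] by simp
  show scale: "\<alpha> (a *\<^sub>R v) = a * \<alpha> v" if "v \<in> V" for a v using l[OF that that, of a 0] by simp
  show "\<alpha> (v - w) = \<alpha> v - \<alpha> w" if "v \<in> V" "w \<in> V" using l[OF that, of 1 "-1"] by simp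
  show "\<alpha> (- v) = - \<alpha> v" if "v \<in> V" using scale[OF that, of "-1"] by simp
  show z: "\<alpha> 0 = 0" using scale[OF subspace_0[OF assms(1)], of 0] by simp
  show "(\<And>i. i \<in> I \<Longrightarrow> f i \<in> V) \<Longrightarrow> \<alpha> (\<Sum>i\<in>I. c i *\<^sub>R f i) = (\<Sum>i\<in>I. c i * \<alpha> (f i))"
    by (induction I rule: infinite_finite_induct)
       (auto simp: z add scale assms(1) subspace_scale subspace_sum)
qed

lemma subspace_dual_space: "subspace (dual_space V)"
  by (auto simp: subspace_def dual_space_def zero_fun_def plus_fun_def scaleR_fun_def algebra_simps)

text \<open>The coordinate functions of a local frame. As \<open>representation\<close> is 0 off the
  span, the same expression, read as a function of \<open>v\<close>, is the \<open>i\<close>-th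
  covector of the dual frame in \<open>dual_bundle\<close>, so that facts about coordinates are at
  the same time facts about dual frames.\<close>

definition frame_coef :: "('m, 'v::real_vector) vbundle \<Rightarrow> (nat \<Rightarrow> 'm \<Rightarrow> 'v) \<Rightarrow> nat \<Rightarrow> 'm \<Rightarrow> 'v \<Rightarrow> real"
  where "frame_coef E e i x v = representation ((\<lambda>j. e j x) ` {..<rk E}) v (e i x)"

lemma dual_bundle_simps [simp]:
  "fib (dual_bundle E) x = dual_space (fib E x)" "rk (dual_bundle E) = rk E"
  by (simp_all add: dual_bundle_def)

lemma frames_dual_bundle: "frames (dual_bundle E) = (\<lambda>(U, e). (U, frame_coef E e)) ` frames E"
  by (simp add: dual_bundle_def frame_coef_def[abs_def])

locale bundle_over = manifold C
  for C :: "('m::{t2_space,second_countable_topology}, 'e::{real_inner,heine_borel}) atlas" +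
  fixes E :: "('m, 'v::real_vector) vbundle"
  assumes vector_bundle: "vector_bundle C E"
begin

abbreviation "Sec \<equiv> sections C E"
abbreviation "Cos \<equiv> sections C (dual_bundle E)"
abbreviation "Fun \<equiv> smooth_funs C"

lemma frame_exists: obtains U e where "(U, e) \<in> frames E" "x \<in> U"
proof -
  have "x \<in> (\<Union>(U, e)\<in>frames E. U)" using vector_bundle by (simp add: vector_bundle_def)
  then show thesis using that by auto
qed

lemma
  assumes "(U, e) \<in> frames E"
  shows frame_open: "open U"
    and frame_inj: "x \<in> U \<Longrightarrow> inj_on (\<lambda>i. e i x) {..<rk E}"
    and frame_independent: "x \<in> U \<Longrightarrow> independent ((\<lambda>i. e i x) ` {..<rk E})"
    and frame_span: "x \<in> U \<Longrightarrow> span ((\<lambda>i. e i x) ` {..<rk E}) = fib E x"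
proof -
  have "\<forall>(U, e)\<in>frames E. open U \<and>
      (\<forall>x\<in>U. inj_on (\<lambda>i. e i x) {..<rk E} \<and> independent ((\<lambda>i. e i x) ` {..<rk E}) \<and>
             span ((\<lambda>i. e i x) ` {..<rk E}) = fib E x)"
    using vector_bundle by (simp add: vector_bundle_def)
  from bspec[OF this assms]
  show "open U" "x \<in> U \<Longrightarrow> inj_on (\<lambda>i. e i x) {..<rk E}"
    "x \<in> U \<Longrightarrow> independent ((\<lambda>i. e i x) ` {..<rk E})"
    "x \<in> U \<Longrightarrow> span ((\<lambda>i. e i x) ` {..<rk E}) = fib E x"
    by auto
qed

lemma subspace_fib: "subspace (fib E x)"
proof -
  obtain U e where "(U, e) \<in> frames E" "x \<in> U" by (rule frame_exists)
  then show ?thesis using frame_span subspace_span by metis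
qed

lemmas fib_zero = subspace_0[OF subspace_fib]
  and fib_add = subspace_add[OF subspace_fib]
  and fib_scale = subspace_scale[OF subspace_fib]
  and fib_diff = subspace_diff[OF subspace_fib]
  and fib_sum = subspace_sum[OF subspace_fib]

lemma frame_mem: "(U, e) \<in> frames E \<Longrightarrow> x \<in> U \<Longrightarrow> i < rk E \<Longrightarrow> e i x \<in> fib E x"
  using frame_span by (metis imageI lessThan_iff span_base)

lemma frame_coef_expand:
  assumes "(U, e) \<in> frames E" "x \<in> U" "v \<in> fib E x"
  shows "(\<Sum>i<rk E. frame_coef E e i x v *\<^sub>R e i x) = v"
proof -
  have "(\<Sum>b\<in>(\<lambda>i. e i x) ` {..<rk E}. representation ((\<lambda>i. e i x) ` {..<rk E}) v b *\<^sub>R b) = v"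
    using assms frame_independent frame_span by (intro real_vector.sum_representation_eq) auto
  then show ?thesis
    by (simp add: sum.reindex[OF frame_inj[OF assms(1,2)]] frame_coef_def)
qed

lemma frame_coef_in_dual:
  assumes "(U, e) \<in> frames E" "x \<in> U"
  shows "frame_coef E e i x \<in> dual_space (fib E x)"
proof -
  let ?B = "(\<lambda>j. e j x) ` {..<rk E}"
  have out: "frame_coef E e i x v = 0" if "v \<notin> span ?B" for v
    using that by (simp add: frame_coef_def real_vector.representation_def)
  have "frame_coef E e i x (a *\<^sub>R v + b *\<^sub>R w) = a * frame_coef E e i x v + b * frame_coef E e i x w"
    if "v \<in> span ?B" "w \<in> span ?B" for v w a b
    using that frame_independent[OF assms]
    by (simp add: frame_coef_def real_vector.representation_add real_vector.representation_scale span_scale)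
  with out show ?thesis
    unfolding frame_span[OF assms, symmetric] dual_space_def by simp
qed

lemma frame_coef_frame:
  assumes "(U, e) \<in> frames E" "x \<in> U" "i < rk E" "j < rk E"
  shows "frame_coef E e i x (e j x) = (if i = j then 1 else 0)"
  using assms frame_independent[OF assms(1,2)] inj_onD[OF frame_inj[OF assms(1,2)], of i j]
  by (auto simp: frame_coef_def real_vector.representation_basis)

lemma frame_coef_combo:
  assumes "(U, e) \<in> frames E" "x \<in> U" "i < rk E"
  shows "frame_coef E e i x (\<Sum>j<rk E. c j *\<^sub>R e j x) = c i"
proof -
  have "frame_coef E e i x (\<Sum>j<rk E. c j *\<^sub>R e j x) = (\<Sum>j<rk E. c j * frame_coef E e i x (e j x))"
    using assms by (intro dual_space_sum[OF subspace_fib frame_coef_in_dual]) (auto intro: frame_mem)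
  also have "\<dots> = (\<Sum>j<rk E. if j = i then c j else 0)"
    using assms by (intro sum.cong) (auto simp: frame_coef_frame)
  finally show ?thesis using assms by simp
qed

lemma frame_coef_transition:
  assumes "(U, e) \<in> frames E" "(V, e') \<in> frames E" "i < rk E" "j < rk E" "x \<in> U" "x \<in> V"
  shows "smooth_at C (\<lambda>x. frame_coef E e i x (e' j x)) x"
proof -
  have "\<forall>(U, e)\<in>frames E. \<forall>(V, e')\<in>frames E. \<forall>j<rk E. \<exists>c.
      (\<forall>i<rk E. smooth_fun_on C (U \<inter> V) (c i)) \<and>
      (\<forall>x\<in>U \<inter> V. e' j x = (\<Sum>i<rk E. c i x *\<^sub>R e i x))"
    using vector_bundle by (simp add: vector_bundle_def)
  from bspec[OF this assms(1)]
  have "\<forall>(V, e')\<in>frames E. \<forall>j<rk E. \<exists>c.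
      (\<forall>i<rk E. smooth_fun_on C (U \<inter> V) (c i)) \<and>
      (\<forall>x\<in>U \<inter> V. e' j x = (\<Sum>i<rk E. c i x *\<^sub>R e i x))"
    by simp
  from bspec[OF this assms(2)] assms(4)
  obtain c where c: "\<forall>i<rk E. smooth_fun_on C (U \<inter> V) (c i)"
      "\<forall>x\<in>U \<inter> V. e' j x = (\<Sum>i<rk E. c i x *\<^sub>R e i x)"
    by auto
  have o: "open (U \<inter> V)" using frame_open assms(1,2) by auto
  have "smooth_at C (c i) x" using c(1) o assms by (auto simp: smooth_fun_on_iff_smooth_at)
  then show ?thesis
    by (rule smooth_at_cong[OF _ o]) (use c(2) assms in \<open>auto simp: frame_coef_combo[OF assms(1)]\<close>)
qed

lemma sections_fib: "X \<in> Sec \<Longrightarrow> X x \<in> fib E x"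
  by (simp add: sections_def)

lemma sections_smooth_coef:
  assumes "X \<in> Sec" "(U, e) \<in> frames E" "x \<in> U" "i < rk E"
  shows "smooth_at C (\<lambda>x. frame_coef E e i x (X x)) x"
proof -
  have "\<forall>(U, e)\<in>frames E. \<exists>c. (\<forall>i<rk E. smooth_fun_on C U (c i)) \<and>
      (\<forall>x\<in>U. X x = (\<Sum>i<rk E. c i x *\<^sub>R e i x))"
    using assms(1) by (simp add: sections_def)
  from bspec[OF this assms(2)]
  obtain c where c: "\<forall>i<rk E. smooth_fun_on C U (c i)" "\<forall>x\<in>U. X x = (\<Sum>i<rk E. c i x *\<^sub>R e i x)"
    by auto
  have "smooth_at C (c i) x"
    using c(1) frame_open[OF assms(2)] assms by (auto simp: smooth_fun_on_iff_smooth_at)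
  then show ?thesis
    by (rule smooth_at_cong[OF _ frame_open[OF assms(2)] assms(3)])
       (use c(2) assms in \<open>auto simp: frame_coef_combo[OF assms(2)]\<close>)
qed

text \<open>\<open>sections\<close> demands smooth coefficients in every frame. One frame around
  each point suffices, since the coefficients in another frame arise by the transition matrix, whose
  entries are smooth.\<close>

lemma sectionsI:
  assumes "\<And>x. X x \<in> fib E x"
    and "\<And>x. \<exists>U e. (U, e) \<in> frames E \<and> x \<in> U \<and> (\<forall>i<rk E. smooth_at C (\<lambda>x. frame_coef E e i x (X x)) x)"
  shows "X \<in> Sec"
proof -
  have "\<exists>c. (\<forall>i<rk E. smooth_fun_on C V (c i)) \<and> (\<forall>x\<in>V. X x = (\<Sum>i<rk E. c i x *\<^sub>R e' i x))"
    if V: "(V, e') \<in> frames E" for V e'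
  proof (intro exI conjI allI impI ballI)
    show "X x = (\<Sum>i<rk E. frame_coef E e' i x (X x) *\<^sub>R e' i x)" if "x \<in> V" for x
      using frame_coef_expand[OF V that assms(1)] by simp
    fix i assume i: "i < rk E"
    show "smooth_fun_on C V (\<lambda>x. frame_coef E e' i x (X x))"
      unfolding smooth_fun_on_iff_smooth_at[OF frame_open[OF V]]
    proof
      fix x assume x: "x \<in> V"
      obtain U e where U: "(U, e) \<in> frames E" "x \<in> U"
        and sm: "\<And>i. i < rk E \<Longrightarrow> smooth_at C (\<lambda>x. frame_coef E e i x (X x)) x"
        using assms(2)[of x] by auto
      have "smooth_at C (\<lambda>x. \<Sum>j<rk E. frame_coef E e j x (X x) * frame_coef E e' i x (e j x)) x"
        using x by (intro smooth_at_sum smooth_at_mult sm frame_coef_transition[OF V U(1) i _ _ U(2)]) auto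
      then show "smooth_at C (\<lambda>x. frame_coef E e' i x (X x)) x"
      proof (rule smooth_at_cong)
        show "open (U \<inter> V)" "x \<in> U \<inter> V" using U V x frame_open by auto
        fix y assume y: "y \<in> U \<inter> V"
        then have "frame_coef E e' i y (\<Sum>j<rk E. frame_coef E e j y (X y) *\<^sub>R e j y) =
            (\<Sum>j<rk E. frame_coef E e j y (X y) * frame_coef E e' i y (e j y))"
          using U V by (intro dual_space_sum[OF subspace_fib frame_coef_in_dual]) (auto intro: frame_mem)
        then show "(\<Sum>j<rk E. frame_coef E e j y (X y) * frame_coef E e' i y (e j y)) = frame_coef E e' i y (X y)"
          using frame_coef_expand[OF U(1) _ assms(1), of y] y by simp
      qed
    qed
  qed
  then show ?thesis using assms(1) by (auto simp: sections_def)
qed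

text \<open>The index set, the coefficients and the sections may vary with the point; a fibrewise
  map is thus shown to be a section by local formulas that need not fit together in any visible
  way.\<close>

lemma sections_local_combo:
  fixes X :: "'m \<Rightarrow> 'v"
  assumes "\<And>x. X x \<in> fib E x"
    and "\<And>x. \<exists>N I (c :: 'i \<Rightarrow> 'm \<Rightarrow> real) Y. open N \<and> x \<in> N \<and> (\<forall>i\<in>I. smooth_at C (c i) x \<and> Y i \<in> Sec) \<and>
      (\<forall>y\<in>N. X y = (\<Sum>i\<in>I. c i y *\<^sub>R Y i y))"
  shows "X \<in> Sec"
proof (rule sectionsI[OF assms(1)])
  fix x
  obtain N I and c :: "'i \<Rightarrow> 'm \<Rightarrow> real" and Y where N: "open N" "x \<in> N"
    and c: "\<forall>i\<in>I. smooth_at C (c i) x \<and> Y i \<in> Sec"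
    and X: "\<forall>y\<in>N. X y = (\<Sum>i\<in>I. c i y *\<^sub>R Y i y)"
    using assms(2)[of x] by blast
  obtain U e where U: "(U, e) \<in> frames E" "x \<in> U" by (rule frame_exists)
  have "smooth_at C (\<lambda>x. frame_coef E e i x (X x)) x" if i: "i < rk E" for i
  proof (rule smooth_at_cong)
    show "smooth_at C (\<lambda>x. \<Sum>j\<in>I. c j x * frame_coef E e i x (Y j x)) x"
      using c U i by (intro smooth_at_sum smooth_at_mult sections_smooth_coef) auto
    show "open (U \<inter> N)" "x \<in> U \<inter> N" using U N frame_open by auto
    show "(\<Sum>j\<in>I. c j y * frame_coef E e i y (Y j y)) = frame_coef E e i y (X y)" if "y \<in> U \<inter> N" for y
      using that X U c sections_fib
      by (simp add: dual_space_sum[OF subspace_fib frame_coef_in_dual[OF U(1)]])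
  qed
  then show "\<exists>U e. (U, e) \<in> frames E \<and> x \<in> U \<and> (\<forall>i<rk E. smooth_at C (\<lambda>x. frame_coef E e i x (X x)) x)"
    using U by blast
qed

lemma sections_combo:
  fixes I :: "'i set"
  assumes "\<And>i. i \<in> I \<Longrightarrow> c i \<in> Fun" "\<And>i. i \<in> I \<Longrightarrow> Y i \<in> Sec"
  shows "(\<lambda>x. \<Sum>i\<in>I. c i x *\<^sub>R Y i x) \<in> Sec"
proof (rule sections_local_combo)
  show "(\<Sum>i\<in>I. c i x *\<^sub>R Y i x) \<in> fib E x" for x
    using assms by (intro fib_sum fib_scale sections_fib) auto
  show "\<exists>N (I' :: 'i set) c' Y'. open N \<and> x \<in> N \<and> (\<forall>i\<in>I'. smooth_at C (c' i) x \<and> Y' i \<in> Sec) \<and>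
      (\<forall>y\<in>N. (\<Sum>i\<in>I. c i y *\<^sub>R Y i y) = (\<Sum>i\<in>I'. c' i y *\<^sub>R Y' i y))" for x
    by (rule exI[of _ UNIV], rule exI[of _ I], rule exI[of _ c], rule exI[of _ Y])
       (use assms in \<open>auto intro: smooth_funsD\<close>)
qed

lemma sections_scale: "f \<in> Fun \<Longrightarrow> X \<in> Sec \<Longrightarrow> (\<lambda>x. f x *\<^sub>R X x) \<in> Sec"
  using sections_combo[of "{()}" "\<lambda>_. f" "\<lambda>_. X"] by simp

lemma sections_sum:
  assumes "\<And>i. i \<in> I \<Longrightarrow> Y i \<in> Sec"
  shows "(\<lambda>x. \<Sum>i\<in>I. Y i x) \<in> Sec"
  using sections_combo[of I "\<lambda>_ _. 1" Y, OF smooth_funs_const assms] by simp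

lemma sections_add: "X \<in> Sec \<Longrightarrow> Y \<in> Sec \<Longrightarrow> (\<lambda>x. X x + Y x) \<in> Sec"
  using sections_sum[of "UNIV :: bool set" "\<lambda>b. if b then X else Y"] by (simp add: UNIV_bool add.commute)

lemma sections_cscale: "X \<in> Sec \<Longrightarrow> (\<lambda>x. a *\<^sub>R X x) \<in> Sec"
  by (rule sections_scale[OF smooth_funs_const])

lemma sections_minus: "X \<in> Sec \<Longrightarrow> (\<lambda>x. - X x) \<in> Sec"
  using sections_cscale[of X "-1"] by simp

lemma sections_diff: "X \<in> Sec \<Longrightarrow> Y \<in> Sec \<Longrightarrow> (\<lambda>x. X x - Y x) \<in> Sec"
  using sections_add[OF _ sections_minus] by force

lemmas sections_intros = sections_scale sections_sum sections_add sections_cscale sections_minus sections_diff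

text \<open>A local frame becomes global after multiplication by a bump function \<eta>. The
  coordinates of a section, which exist only on \<open>U\<close>, need a factor \<eta> of their own,
  so the expansion valid on all of M is one of \<eta>^2 X. Near \<open>x\<close>, where \<eta> = 1,
  it is the ordinary expansion.\<close>

lemma local_frame:
  assumes U: "(U, e) \<in> frames E" "x \<in> U"
  obtains \<eta> N Es where "\<eta> \<in> Fun" "open N" "x \<in> N" "N \<subseteq> U" "\<forall>y\<in>N. \<eta> y = 1"
    "\<forall>i<rk E. Es i \<in> Sec" "\<forall>i<rk E. \<forall>y\<in>N. Es i y = e i y"
    "\<forall>X\<in>Sec. \<forall>i<rk E. (\<lambda>y. \<eta> y * frame_coef E e i y (X y)) \<in> Fun"
    "\<forall>X\<in>Sec. \<forall>y. (\<eta> y * \<eta> y) *\<^sub>R X y = (\<Sum>i<rk E. (\<eta> y * frame_coef E e i y (X y)) *\<^sub>R Es i y)"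
proof -
  obtain \<eta> N K where \<eta>: "\<eta> \<in> Fun" "open N" "x \<in> N" "N \<subseteq> U" "\<forall>y\<in>N. \<eta> y = 1"
    "closed K" "K \<subseteq> U" "\<forall>y. y \<notin> K \<longrightarrow> \<eta> y = 0"
    by (rule bump_exists[OF frame_open[OF U(1)] U(2)])
  define Es where "Es i y = \<eta> y *\<^sub>R e i y" for i y
  \<comment> \<open>The frame \<open>e\<close> carries no information outside \<open>U\<close>;
    there the zero of \<eta> is what puts \<open>Es i y\<close> into the fibre.\<close>
  have \<eta>0: "\<eta> y = 0" if "y \<notin> U" for y using that \<eta> by blast
  have Es_sec: "Es i \<in> Sec" if i: "i < rk E" for i
  proof (rule sectionsI)
    show "Es i y \<in> fib E y" for y
      by (cases "y \<in> U") (auto simp: Es_def \<eta>0 intro!: fib_zero fib_scale frame_mem[OF U(1) _ i])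
    show "\<exists>V e. (V, e) \<in> frames E \<and> y \<in> V \<and> (\<forall>j<rk E. smooth_at C (\<lambda>y. frame_coef E e j y (Es i y)) y)" for y
    proof (cases "y \<in> U")
      case True
      have "smooth_at C (\<lambda>y. frame_coef E e j y (Es i y)) y" if j: "j < rk E" for j
      proof (rule smooth_at_cong[OF _ frame_open[OF U(1)] True])
        show "smooth_at C (\<lambda>y. \<eta> y * (if j = i then 1 else 0)) y"
          by (intro smooth_at_mult smooth_at_const smooth_funsD \<eta>)
        show "\<eta> z * (if j = i then 1 else 0) = frame_coef E e j z (Es i z)" if "z \<in> U" for z
          using dual_space_scale[OF subspace_fib frame_coef_in_dual[OF U(1) that] frame_mem[OF U(1) that i], of j "\<eta> z"]
          by (simp add: Es_def frame_coef_frame[OF U(1) that j i])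
      qed
      then show ?thesis using U(1) True by blast
    next
      case False
      obtain V e' where V: "(V, e') \<in> frames E" "y \<in> V" by (rule frame_exists)
      have "smooth_at C (\<lambda>y. frame_coef E e' j y (Es i y)) y" for j
      proof (rule smooth_at_cong[OF smooth_at_const[of 0]])
        show "open (V \<inter> - K)" "y \<in> V \<inter> - K" using V \<eta> False frame_open by auto
        show "0 = frame_coef E e' j z (Es i z)" if "z \<in> V \<inter> - K" for z
          using that \<eta>(8) dual_space_zero[OF subspace_fib frame_coef_in_dual[OF V(1)]] by (simp add: Es_def)
      qed
      then show ?thesis using V by blast
    qed
  qed
  show thesis
  proof (rule that[of \<eta> N Es])
    show "\<forall>i<rk E. \<forall>y\<in>N. Es i y = e i y" using \<eta>(5) by (simp add: Es_def)
    show "\<forall>X\<in>Sec. \<forall>i<rk E. (\<lambda>y. \<eta> y * frame_coef E e i y (X y)) \<in> Fun"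
      using sections_smooth_coef[OF _ U(1)] by (auto intro!: smooth_funs_bump_mult[OF \<eta>(1,6-8)])
    show "\<forall>X\<in>Sec. \<forall>y. (\<eta> y * \<eta> y) *\<^sub>R X y = (\<Sum>i<rk E. (\<eta> y * frame_coef E e i y (X y)) *\<^sub>R Es i y)"
    proof (intro ballI allI)
      fix X y assume X: "X \<in> Sec"
      show "(\<eta> y * \<eta> y) *\<^sub>R X y = (\<Sum>i<rk E. (\<eta> y * frame_coef E e i y (X y)) *\<^sub>R Es i y)"
      proof (cases "y \<in> U")
        case True
        have "(\<eta> y * \<eta> y) *\<^sub>R (\<Sum>i<rk E. frame_coef E e i y (X y) *\<^sub>R e i y) =
            (\<Sum>i<rk E. (\<eta> y * frame_coef E e i y (X y)) *\<^sub>R Es i y)"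
          by (simp add: Es_def scaleR_sum_right mult_ac)
        then show ?thesis by (simp add: frame_coef_expand[OF U(1) True sections_fib[OF X]])
      qed (simp add: \<eta>0)
    qed
  qed (use \<eta> Es_sec in auto)
qed

lemma local_frame_sections:
  assumes "(U, e) \<in> frames E" "x \<in> U"
  obtains N Es where "open N" "x \<in> N" "N \<subseteq> U" "\<forall>i<rk E. Es i \<in> Sec" "\<forall>i<rk E. \<forall>y\<in>N. Es i y = e i y"
  by (rule local_frame[OF assms])

lemma section_through:
  assumes "v \<in> fib E x"
  obtains X where "X \<in> Sec" "X x = v"
proof -
  obtain U e where U: "(U, e) \<in> frames E" "x \<in> U" by (rule frame_exists)
  obtain N Es where *: "open N" "x \<in> N" "N \<subseteq> U" "\<forall>i<rk E. Es i \<in> Sec" "\<forall>i<rk E. \<forall>y\<in>N. Es i y = e i y"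
      by (rule local_frame_sections[OF U])
  show thesis
  proof
    show "(\<lambda>y. \<Sum>i<rk E. frame_coef E e i x v *\<^sub>R Es i y) \<in> Sec"
      using * by (intro sections_intros) auto
    show "(\<Sum>i<rk E. frame_coef E e i x v *\<^sub>R Es i x) = v"
      using frame_coef_expand[OF U assms] * by simp
  qed
qed

lemma sections_zero: "(\<lambda>x. 0) \<in> Sec"
  using sections_combo[of "{}"] by simp

lemma tensorial_sum:
  fixes F :: "('m \<Rightarrow> 'v) \<Rightarrow> real" and n :: nat
  assumes add: "\<And>X Y. X \<in> Sec \<Longrightarrow> Y \<in> Sec \<Longrightarrow> F (\<lambda>y. X y + Y y) = F X + F Y"
    and scale: "\<And>f X. f \<in> Fun \<Longrightarrow> X \<in> Sec \<Longrightarrow> F (\<lambda>y. f y *\<^sub>R X y) = f x * F X"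
    and "\<And>i. i < n \<Longrightarrow> c i \<in> Fun" "\<And>i. i < n \<Longrightarrow> Y i \<in> Sec"
  shows "F (\<lambda>y. \<Sum>i<n. c i y *\<^sub>R Y i y) = (\<Sum>i<n. c i x * F (Y i))"
  using assms(3,4)
proof (induction n)
  case 0
  have "F (\<lambda>y. 0 *\<^sub>R 0) = 0 * F (\<lambda>y. 0)" by (rule scale[OF smooth_funs_const sections_zero])
  then show ?case by simp
next
  case (Suc n)
  have "F (\<lambda>y. (\<Sum>i<n. c i y *\<^sub>R Y i y) + c n y *\<^sub>R Y n y) =
      F (\<lambda>y. \<Sum>i<n. c i y *\<^sub>R Y i y) + F (\<lambda>y. c n y *\<^sub>R Y n y)"
    using Suc.prems by (intro add sections_combo sections_scale) auto
  also have "F (\<lambda>y. c n y *\<^sub>R Y n y) = c n x * F (Y n)"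
    using Suc.prems by (intro scale) auto
  finally show ?case using Suc by (simp only: sum.lessThan_Suc less_SucI)
qed

text \<open>With \<open>\<eta>\<close> a bump function at \<open>x\<close> and \<open>e\<^sub>i\<close> a local frame, a section \<open>Z\<close> vanishing at \<open>x\<close> is
  \<open>\<Sum> (\<eta> Z\<^sub>i) (\<eta> e\<^sub>i) + (1 - \<eta>\<^sup>2) Z\<close>, where all coefficient functions vanish at \<open>x\<close>.\<close>

lemma tensorial_zero:
  fixes F :: "('m \<Rightarrow> 'v) \<Rightarrow> real"
  assumes add: "\<And>X Y. X \<in> Sec \<Longrightarrow> Y \<in> Sec \<Longrightarrow> F (\<lambda>y. X y + Y y) = F X + F Y"
    and scale: "\<And>f X. f \<in> Fun \<Longrightarrow> X \<in> Sec \<Longrightarrow> F (\<lambda>y. f y *\<^sub>R X y) = f x * F X"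
    and Z: "Z \<in> Sec" "Z x = 0"
  shows "F Z = 0"
proof -
  obtain U e where U: "(U, e) \<in> frames E" "x \<in> U" by (rule frame_exists)
  obtain \<eta> N Es where *: "\<eta> \<in> Fun" "open N" "x \<in> N" "N \<subseteq> U" "\<forall>y\<in>N. \<eta> y = 1"
    "\<forall>i<rk E. Es i \<in> Sec" "\<forall>i<rk E. \<forall>y\<in>N. Es i y = e i y"
    "\<forall>X\<in>Sec. \<forall>i<rk E. (\<lambda>y. \<eta> y * frame_coef E e i y (X y)) \<in> Fun"
    "\<forall>X\<in>Sec. \<forall>y. (\<eta> y * \<eta> y) *\<^sub>R X y = (\<Sum>i<rk E. (\<eta> y * frame_coef E e i y (X y)) *\<^sub>R Es i y)"
    by (rule local_frame[OF U])
  note l = frame_coef_in_dual[OF U]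
  let ?W = "\<lambda>y. \<Sum>i<rk E. (\<eta> y * frame_coef E e i y (Z y)) *\<^sub>R Es i y"
  have W: "?W \<in> Sec" using * Z by (intro sections_combo) auto
  have "F ?W = (\<Sum>i<rk E. (\<eta> x * frame_coef E e i x (Z x)) * F (Es i))"
    by (rule tensorial_sum[OF add scale]) (use * Z in auto)
  then have FW: "F ?W = 0" using Z dual_space_zero[OF subspace_fib l] by simp
  have f: "(\<lambda>y. 1 - \<eta> y * \<eta> y) \<in> Fun" using * by (intro smooth_funs_intros) auto
  have "Z y = ?W y + (1 - \<eta> y * \<eta> y) *\<^sub>R Z y" for y
  proof -
    have "?W y = (\<eta> y * \<eta> y) *\<^sub>R Z y" using *(9) Z(1) by simp
    then show ?thesis by (simp add: scaleR_diff_left)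
  qed
  then have "Z = (\<lambda>y. ?W y + (1 - \<eta> y * \<eta> y) *\<^sub>R Z y)" by (rule ext)
  then have "F Z = F (\<lambda>y. ?W y + (1 - \<eta> y * \<eta> y) *\<^sub>R Z y)" by (rule arg_cong)
  also have "\<dots> = F ?W + F (\<lambda>y. (1 - \<eta> y * \<eta> y) *\<^sub>R Z y)"
    using W f Z by (intro add sections_scale)
  also have "F (\<lambda>y. (1 - \<eta> y * \<eta> y) *\<^sub>R Z y) = (1 - \<eta> x * \<eta> x) * F Z"
    by (rule scale[OF f Z(1)])
  also have "F ?W + (1 - \<eta> x * \<eta> x) * F Z = 0"
    using FW * by simp
  finally show ?thesis .
qed

text \<open>The difference of the two sections vanishes at \<open>x\<close>. The minus sign is
  multiplication by the constant function -1, so no further property of \<open>F\<close> is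
  involved.\<close>

lemma tensorial:
  fixes F :: "('m \<Rightarrow> 'v) \<Rightarrow> real"
  assumes add: "\<And>X Y. X \<in> Sec \<Longrightarrow> Y \<in> Sec \<Longrightarrow> F (\<lambda>y. X y + Y y) = F X + F Y"
    and scale: "\<And>f X. f \<in> Fun \<Longrightarrow> X \<in> Sec \<Longrightarrow> F (\<lambda>y. f y *\<^sub>R X y) = f x * F X"
    and "X \<in> Sec" "Y \<in> Sec" "X x = Y x"
  shows "F X = F Y"
proof -
  have "F (\<lambda>y. X y + (-1) *\<^sub>R Y y) = F X + F (\<lambda>y. (-1) *\<^sub>R Y y)"
    using assms(3,4) by (intro add sections_cscale)
  also have "F (\<lambda>y. (-1) *\<^sub>R Y y) = (-1) * F Y" using assms(4) by (intro scale smooth_funs_const)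
  finally have "F (\<lambda>y. X y + (-1) *\<^sub>R Y y) = F X - F Y" by simp
  moreover have "F (\<lambda>y. X y + (-1) *\<^sub>R Y y) = 0"
    by (rule tensorial_zero[OF add scale]) (use assms(3-5) in \<open>auto intro!: sections_diff\<close>)
  ultimately show ?thesis by simp
qed

section \<open>The dual bundle and its sections\<close>

lemma dual_frame_expand:
  assumes "(U, e) \<in> frames E" "x \<in> U" "\<alpha> \<in> dual_space (fib E x)"
  shows "\<alpha> = (\<Sum>i<rk E. \<alpha> (e i x) *\<^sub>R frame_coef E e i x)"
proof
  fix v
  have "(\<Sum>i<rk E. \<alpha> (e i x) *\<^sub>R frame_coef E e i x) v = (\<Sum>i<rk E. frame_coef E e i x v * \<alpha> (e i x))"
    by (simp add: sum_fun_apply scaleR_fun_def mult.commute)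
  also have "\<dots> = \<alpha> v"
  \<comment> \<open>The equation is one between functions on the whole universe of vectors; off the
    fibre both sides are 0 by the convention in \<open>dual_space\<close>.\<close>
  proof (cases "v \<in> fib E x")
    case True
    have "\<alpha> (\<Sum>i<rk E. frame_coef E e i x v *\<^sub>R e i x) = (\<Sum>i<rk E. frame_coef E e i x v * \<alpha> (e i x))"
      using assms by (intro dual_space_sum[OF subspace_fib]) (auto intro: frame_mem)
    then show ?thesis by (simp add: frame_coef_expand[OF assms(1,2) True])
  next
    case False
    then show ?thesis using frame_coef_in_dual[OF assms(1,2)] assms(3) by (simp add: dual_space_def)
  qed
  finally show "\<alpha> v = (\<Sum>i<rk E. \<alpha> (e i x) *\<^sub>R frame_coef E e i x) v" by simp
qed

text \<open>Expanding a covector of one dual frame in another has as coefficients its values on the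
  frame vectors, that is, entries of a transition matrix of the original bundle. Hence the dual
  transition matrices are smooth.\<close>

lemma vector_bundle_dual: "vector_bundle C (dual_bundle E)"
  unfolding vector_bundle_def
proof (intro conjI)
  show "(\<Union>(U, e)\<in>frames (dual_bundle E). U) = UNIV"
  proof -
    have "x \<in> (\<Union>(U, e)\<in>frames (dual_bundle E). U)" for x
    proof -
      obtain U e where "(U, e) \<in> frames E" "x \<in> U" by (rule frame_exists)
      then show ?thesis by (force simp: frames_dual_bundle)
    qed
    then show ?thesis by blast
  qed
  have ind: "inj_on (\<lambda>i. frame_coef E e i x) {..<rk E}" "independent ((\<lambda>i. frame_coef E e i x) ` {..<rk E})"
    "span ((\<lambda>i. frame_coef E e i x) ` {..<rk E}) = dual_space (fib E x)"
    if U: "(U, e) \<in> frames E" "x \<in> U" for U e x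
  proof -
    have z: "\<forall>i\<in>{..<rk E}. c i = 0" if c: "(\<Sum>i<rk E. c i *\<^sub>R frame_coef E e i x) = 0" for c
    proof
      fix j assume "j \<in> {..<rk E}"
      then have j: "j < rk E" by simp
      have "0 = (\<Sum>i<rk E. c i *\<^sub>R frame_coef E e i x) (e j x)" using c by (simp add: zero_fun_def)
      also have "\<dots> = (\<Sum>i<rk E. if i = j then c i else 0)"
        unfolding sum_fun_apply using U j by (intro sum.cong) (auto simp: scaleR_fun_def frame_coef_frame)
      finally show "c j = 0" using j by simp
    qed
    show "inj_on (\<lambda>i. frame_coef E e i x) {..<rk E}"
      by (rule independent_familyI(1)[OF finite_lessThan]) (rule z)
    show "independent ((\<lambda>i. frame_coef E e i x) ` {..<rk E})"
      by (rule independent_familyI(2)[OF finite_lessThan]) (rule z)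
    show "span ((\<lambda>i. frame_coef E e i x) ` {..<rk E}) = dual_space (fib E x)"
    proof
      show "span ((\<lambda>i. frame_coef E e i x) ` {..<rk E}) \<subseteq> dual_space (fib E x)"
        using U frame_coef_in_dual by (intro span_minimal subspace_dual_space) auto
      show "dual_space (fib E x) \<subseteq> span ((\<lambda>i. frame_coef E e i x) ` {..<rk E})"
      proof
        fix \<alpha> assume "\<alpha> \<in> dual_space (fib E x)"
        from dual_frame_expand[OF U this]
        show "\<alpha> \<in> span ((\<lambda>i. frame_coef E e i x) ` {..<rk E})"
          by (metis (no_types, lifting) imageI span_base span_scale span_sum)
      qed
    qed
  qed
  show "\<forall>(U, e)\<in>frames (dual_bundle E). open U \<and>
      (\<forall>x\<in>U. inj_on (\<lambda>i. e i x) {..<rk (dual_bundle E)} \<and> independent ((\<lambda>i. e i x) ` {..<rk (dual_bundle E)}) \<and>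
             span ((\<lambda>i. e i x) ` {..<rk (dual_bundle E)}) = fib (dual_bundle E) x)"
    using ind frame_open by (auto simp: frames_dual_bundle)
  have "\<exists>c. (\<forall>i<rk E. smooth_fun_on C (U \<inter> V) (c i)) \<and>
      (\<forall>x\<in>U \<inter> V. frame_coef E e' j x = (\<Sum>i<rk E. c i x *\<^sub>R frame_coef E e i x))"
    if U: "(U, e) \<in> frames E" and V: "(V, e') \<in> frames E" and j: "j < rk E" for U e V e' j
  proof (intro exI conjI allI impI ballI)
    have "open (U \<inter> V)" using U V frame_open by auto
    then show "smooth_fun_on C (U \<inter> V) (\<lambda>x. frame_coef E e' j x (e i x))" if "i < rk E" for i
      using that U V j by (auto simp: smooth_fun_on_iff_smooth_at intro: frame_coef_transition)
    show "frame_coef E e' j x = (\<Sum>i<rk E. frame_coef E e' j x (e i x) *\<^sub>R frame_coef E e i x)"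
      if "x \<in> U \<inter> V" for x
      using that U V by (intro dual_frame_expand frame_coef_in_dual) auto
  qed
  then show "\<forall>(U, e)\<in>frames (dual_bundle E). \<forall>(V, e')\<in>frames (dual_bundle E). \<forall>j<rk (dual_bundle E). \<exists>c.
      (\<forall>i<rk (dual_bundle E). smooth_fun_on C (U \<inter> V) (c i)) \<and>
      (\<forall>x\<in>U \<inter> V. e' j x = (\<Sum>i<rk (dual_bundle E). c i x *\<^sub>R e i x))"
    unfolding frames_dual_bundle dual_bundle_simps by fastforce
qed

lemma bundle_over_dual: "bundle_over C (dual_bundle E)"
  by unfold_locales (rule vector_bundle_dual)

lemma frame_dual: "(U, e) \<in> frames E \<Longrightarrow> (U, frame_coef E e) \<in> frames (dual_bundle E)"
  by (force simp: frames_dual_bundle)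

lemma frame_coef_dual:
  assumes "(U, e) \<in> frames E" "x \<in> U" "\<alpha> \<in> dual_space (fib E x)" "i < rk E"
  shows "frame_coef (dual_bundle E) (frame_coef E e) i x \<alpha> = \<alpha> (e i x)"
proof -
  interpret D: bundle_over C "dual_bundle E" by (rule bundle_over_dual)
  show ?thesis
    using D.frame_coef_combo[OF frame_dual[OF assms(1)] assms(2), of i "\<lambda>i. \<alpha> (e i x)"] assms
    by (simp add: dual_frame_expand[OF assms(1-3), symmetric])
qed

lemma cosections_dual: "\<alpha> \<in> Cos \<Longrightarrow> \<alpha> x \<in> dual_space (fib E x)"
  by (simp add: sections_def)

lemma cosections_pairing:
  assumes "\<alpha> \<in> Cos" "X \<in> Sec"
  shows "(\<lambda>x. \<alpha> x (X x)) \<in> Fun"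
  unfolding smooth_funs_iff
proof
  fix x
  interpret D: bundle_over C "dual_bundle E" by (rule bundle_over_dual)
  obtain U e where U: "(U, e) \<in> frames E" "x \<in> U" by (rule frame_exists)
  have "smooth_at C (\<lambda>x. \<Sum>i<rk E. frame_coef E e i x (X x) * \<alpha> x (e i x)) x"
  proof (intro smooth_at_sum smooth_at_mult sections_smooth_coef[OF assms(2) U])
    fix i assume "i \<in> {..<rk E}"
    then have i: "i < rk E" by simp
    have "smooth_at C (\<lambda>x. frame_coef (dual_bundle E) (frame_coef E e) i x (\<alpha> x)) x"
      using D.sections_smooth_coef[OF assms(1) frame_dual[OF U(1)] U(2)] i by simp
    then show "smooth_at C (\<lambda>x. \<alpha> x (e i x)) x"
      by (rule smooth_at_cong[OF _ frame_open[OF U(1)] U(2)])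
         (simp add: frame_coef_dual[OF U(1) _ cosections_dual[OF assms(1)] i])
    show "i < rk E" by (rule i)
  qed
  then show "smooth_at C (\<lambda>x. \<alpha> x (X x)) x"
  proof (rule smooth_at_cong[OF _ frame_open[OF U(1)] U(2)])
    fix y assume y: "y \<in> U"
    have "\<alpha> y (\<Sum>i<rk E. frame_coef E e i y (X y) *\<^sub>R e i y) = (\<Sum>i<rk E. frame_coef E e i y (X y) * \<alpha> y (e i y))"
      using U y by (intro dual_space_sum[OF subspace_fib cosections_dual[OF assms(1)]]) (auto intro: frame_mem)
    then show "(\<Sum>i<rk E. frame_coef E e i y (X y) * \<alpha> y (e i y)) = \<alpha> y (X y)"
      by (simp add: frame_coef_expand[OF U(1) y sections_fib[OF assms(2)]])
  qed
qed

text \<open>The coordinates of a covector in a dual frame are its values on the frame, and near each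
  point the frame is made of global sections. Smooth pairing with all global sections is therefore
  enough.\<close>

lemma cosectionsI:
  assumes "\<And>x. \<alpha> x \<in> dual_space (fib E x)" "\<And>X. X \<in> Sec \<Longrightarrow> (\<lambda>x. \<alpha> x (X x)) \<in> Fun"
  shows "\<alpha> \<in> Cos"
proof -
  interpret D: bundle_over C "dual_bundle E" by (rule bundle_over_dual)
  show ?thesis
  proof (rule D.sectionsI)
    show "\<alpha> x \<in> fib (dual_bundle E) x" for x using assms(1) by simp
    fix x
    obtain U e where U: "(U, e) \<in> frames E" "x \<in> U" by (rule frame_exists)
    obtain N Es where *: "open N" "x \<in> N" "N \<subseteq> U" "\<forall>i<rk E. Es i \<in> Sec" "\<forall>i<rk E. \<forall>y\<in>N. Es i y = e i y"
      by (rule local_frame_sections[OF U])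
    have "smooth_at C (\<lambda>x. frame_coef (dual_bundle E) (frame_coef E e) i x (\<alpha> x)) x" if i: "i < rk E" for i
    proof (rule smooth_at_cong[OF _ *(1,2)])
      show "smooth_at C (\<lambda>x. \<alpha> x (Es i x)) x" using assms(2) * i by (auto intro: smooth_funsD)
      show "\<alpha> y (Es i y) = frame_coef (dual_bundle E) (frame_coef E e) i y (\<alpha> y)" if "y \<in> N" for y
        using * i that frame_coef_dual[OF U(1) _ assms(1) i, of y] by auto
    qed
    then show "\<exists>U e. (U, e) \<in> frames (dual_bundle E) \<and> x \<in> U \<and>
        (\<forall>i<rk (dual_bundle E). smooth_at C (\<lambda>x. frame_coef (dual_bundle E) e i x (\<alpha> x)) x)"
      using U(2) frame_dual[OF U(1)] by (intro exI[of _ U] exI[of _ "frame_coef E e"]) simp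
  qed
qed

text \<open>The uniqueness behind the definite descriptions of vectors through their pairings,
  \<open>sharp\<close> and \<open>time_deriv\<close>.\<close>

lemma covectors_separate:
  assumes "v \<in> fib E x" "w \<in> fib E x" "\<And>\<alpha>. \<alpha> \<in> dual_space (fib E x) \<Longrightarrow> \<alpha> v = \<alpha> w"
  shows "v = w"
proof -
  obtain U e where U: "(U, e) \<in> frames E" "x \<in> U" by (rule frame_exists)
  have "frame_coef E e i x v = frame_coef E e i x w" for i
    by (rule assms(3)[OF frame_coef_in_dual[OF U]])
  then have "(\<Sum>i<rk E. frame_coef E e i x v *\<^sub>R e i x) = (\<Sum>i<rk E. frame_coef E e i x w *\<^sub>R e i x)"
    by (simp only:)
  then show ?thesis
    by (simp only: frame_coef_expand[OF U assms(1)] frame_coef_expand[OF U assms(2)])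
qed

lemma dual_space_eqI:
  assumes "\<alpha> \<in> dual_space (fib E x)" "\<beta> \<in> dual_space (fib E x)" "\<And>Z. Z \<in> Sec \<Longrightarrow> \<alpha> (Z x) = \<beta> (Z x)"
  shows "\<alpha> = \<beta>"
proof
  fix v
  show "\<alpha> v = \<beta> v"
  proof (cases "v \<in> fib E x")
    case True
    then obtain Z where "Z \<in> Sec" "Z x = v" by (rule section_through)
    then show ?thesis using assms(3) by blast
  qed (use assms(1,2) in \<open>simp add: dual_space_def\<close>)
qed

lemma covector_through:
  assumes "\<beta> \<in> dual_space (fib E x)"
  obtains \<alpha> where "\<alpha> \<in> Cos" "\<alpha> x = \<beta>"
proof -
  interpret D: bundle_over C "dual_bundle E" by (rule bundle_over_dual)
  show thesis using D.section_through[of \<beta> x] assms that by auto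
qed

text \<open>\<open>R x v\<close> is a condition on a fibre vector with at most one solution.
  Uniqueness makes the pointwise solution well defined and forces it to coincide with every local
  smooth solution, so existence is a local matter and no partition of unity is needed.\<close>

lemma section_of_local_solutions:
  fixes n :: nat
  assumes unique: "\<And>x v w. v \<in> fib E x \<Longrightarrow> w \<in> fib E x \<Longrightarrow> R x v \<Longrightarrow> R x w \<Longrightarrow> v = w"
    and local: "\<And>x. \<exists>N c Es. open N \<and> x \<in> N \<and> (\<forall>i<n. smooth_at C (c i) x \<and> Es i \<in> Sec) \<and>
      (\<forall>y\<in>N. R y (\<Sum>i<n. c i y *\<^sub>R Es i y))"
  obtains X where "X \<in> Sec" "\<forall>x. R x (X x)"
proof -
  define X where "X x = (THE v. v \<in> fib E x \<and> R x v)" for x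
  have X_eq: "X x = v" if "v \<in> fib E x" "R x v" for x v
    unfolding X_def by (rule the_equality) (use that unique in auto)
  have X: "X x \<in> fib E x \<and> R x (X x) \<and> (\<exists>N (I :: nat set) c Es. open N \<and> x \<in> N \<and>
      (\<forall>i\<in>I. smooth_at C (c i) x \<and> Es i \<in> Sec) \<and> (\<forall>y\<in>N. X y = (\<Sum>i\<in>I. c i y *\<^sub>R Es i y)))" for x
  proof -
    obtain N c Es where N: "open N" "x \<in> N" "\<forall>i<n. smooth_at C (c i) x \<and> Es i \<in> Sec"
      and R: "\<forall>y\<in>N. R y (\<Sum>i<n. c i y *\<^sub>R Es i y)"
      using local[of x] by blast
    have fibm: "(\<Sum>i<n. c i y *\<^sub>R Es i y) \<in> fib E y" for y
      using N by (intro fib_sum fib_scale sections_fib) auto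
    have eq: "X y = (\<Sum>i<n. c i y *\<^sub>R Es i y)" if "y \<in> N" for y
      using fibm by (rule X_eq) (use R that in auto)
    show ?thesis
      by (intro conjI exI[of _ N] exI[of _ "{..<n}"] exI[of _ c] exI[of _ Es] N(1,2))
         (use N(2,3) R eq fibm in \<open>simp_all\<close>)
  qed
  have "X \<in> Sec"
    by (rule sections_local_combo) (use X in blast)+
  then show thesis using that X by blast
qed

text \<open>The identification of the double dual with the bundle, on the level of sections: the
  representing section is locally the sum of the L(\<open>Ds i\<close>) \<open>Es i\<close> for a
  frame \<open>Es\<close> and its dual frame \<open>Ds\<close>. Applied to \<beta> \<mapsto>
  \<pi>(\<alpha>, \<beta>) it produces \<pi>-sharp of \<alpha>.\<close>

lemma dual_representation:
  assumes add: "\<And>\<alpha> \<beta>. \<alpha> \<in> Cos \<Longrightarrow> \<beta> \<in> Cos \<Longrightarrow> L (\<lambda>x. \<alpha> x + \<beta> x) = (\<lambda>x. L \<alpha> x + L \<beta> x)"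
    and scale: "\<And>f \<alpha>. f \<in> Fun \<Longrightarrow> \<alpha> \<in> Cos \<Longrightarrow> L (\<lambda>x. f x *\<^sub>R \<alpha> x) = (\<lambda>x. f x * L \<alpha> x)"
    and smooth: "\<And>\<alpha>. \<alpha> \<in> Cos \<Longrightarrow> L \<alpha> \<in> Fun"
  obtains X where "X \<in> Sec" "\<forall>\<alpha>\<in>Cos. \<forall>x. \<alpha> x (X x) = L \<alpha> x"
proof -
  interpret D: bundle_over C "dual_bundle E" by (rule bundle_over_dual)
  have loc: "\<exists>N c Es. open N \<and> x \<in> N \<and> (\<forall>i<rk E. smooth_at C (c i) x \<and> Es i \<in> Sec) \<and>
      (\<forall>y\<in>N. \<forall>\<alpha>\<in>Cos. \<alpha> y (\<Sum>i<rk E. c i y *\<^sub>R Es i y) = L \<alpha> y)" for x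
  proof -
    obtain U e where U: "(U, e) \<in> frames E" "x \<in> U" by (rule frame_exists)
    obtain N Es where 1: "open N" "x \<in> N" "N \<subseteq> U" "\<forall>i<rk E. Es i \<in> Sec" "\<forall>i<rk E. \<forall>y\<in>N. Es i y = e i y"
      by (rule local_frame_sections[OF U])
    obtain N' Ds where 2: "open N'" "x \<in> N'" "N' \<subseteq> U"
      "\<forall>i<rk (dual_bundle E). Ds i \<in> Cos" "\<forall>i<rk (dual_bundle E). \<forall>y\<in>N'. Ds i y = frame_coef E e i y"
      by (rule D.local_frame_sections[OF frame_dual[OF U(1)] U(2)])
    have "\<alpha> y (\<Sum>i<rk E. L (Ds i) y *\<^sub>R Es i y) = L \<alpha> y" if y: "y \<in> N \<inter> N'" and \<alpha>: "\<alpha> \<in> Cos" for y \<alpha>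
    proof -
      have yU: "y \<in> U" using y 1 by auto
      have eqs: "Es i y = e i y" "Ds i y = frame_coef E e i y" "Ds i \<in> Cos" if "i < rk E" for i
        using 1 2 y that by auto
      have m: "e i y \<in> fib E y" if "i < rk E" for i using frame_mem[OF U(1) yU that] .
      have Lsum: "L (\<lambda>z. \<Sum>i<rk E. \<alpha> y (e i y) *\<^sub>R Ds i z) y = (\<Sum>i<rk E. \<alpha> y (e i y) * L (Ds i) y)"
        by (rule D.tensorial_sum[where F = "\<lambda>\<alpha>. L \<alpha> y" and x = y and c = "\<lambda>i _. \<alpha> y (e i y)"])
           (auto simp: add scale smooth_funs_const eqs)
      \<comment> \<open>Only the value of \<alpha> at \<open>y\<close> matters, so \<alpha> may be
        replaced by a combination of the dual frame with constant coefficients.\<close>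
      have "L \<alpha> y = L (\<lambda>z. \<Sum>i<rk E. \<alpha> y (e i y) *\<^sub>R Ds i z) y"
      proof (rule D.tensorial[where F = "\<lambda>\<alpha>. L \<alpha> y" and x = y, OF _ _ \<alpha>])
        show "(\<lambda>z. \<Sum>i<rk E. \<alpha> y (e i y) *\<^sub>R Ds i z) \<in> Cos"
          using eqs(3) by (intro D.sections_sum D.sections_cscale) auto
        show "\<alpha> y = (\<Sum>i<rk E. \<alpha> y (e i y) *\<^sub>R Ds i y)"
          using dual_frame_expand[OF U(1) yU cosections_dual[OF \<alpha>]] eqs by simp
      qed (simp_all add: add scale)
      also have "\<dots> = (\<Sum>i<rk E. \<alpha> y (e i y) * L (Ds i) y)" by (rule Lsum)
      also have "\<dots> = \<alpha> y (\<Sum>i<rk E. L (Ds i) y *\<^sub>R e i y)"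
        using m by (subst dual_space_sum[OF subspace_fib cosections_dual[OF \<alpha>]]) (auto simp: mult.commute)
      also have "\<dots> = \<alpha> y (\<Sum>i<rk E. L (Ds i) y *\<^sub>R Es i y)" using eqs by simp
      finally show ?thesis by simp
    qed
    then show ?thesis
      using 1 2 smooth by (intro exI[of _ "N \<inter> N'"] exI[of _ "\<lambda>i. L (Ds i)"] exI[of _ Es]) (auto intro: smooth_funsD)
  qed
  show thesis
  proof (rule section_of_local_solutions[OF _ loc])
    show "v = w" if "v \<in> fib E x" "w \<in> fib E x" "\<forall>\<alpha>\<in>Cos. \<alpha> x v = L \<alpha> x" "\<forall>\<alpha>\<in>Cos. \<alpha> x w = L \<alpha> x" for x v w
      using that by (intro covectors_separate[of v x w]) (metis covector_through)+
  qed (rule that, auto)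
qed

end

section \<open>Pseudo-Riemannian metrics\<close>

locale metric_bundle = bundle_over C E
  for C :: "('m::{t2_space,second_countable_topology}, 'e::{real_inner,heine_borel}) atlas"
    and E :: "('m, 'v::real_vector) vbundle" +
  fixes h :: "'m \<Rightarrow> 'v \<Rightarrow> 'v \<Rightarrow> real"
  assumes metric: "pseudo_riemannian_metric C E h"
begin

lemma metric_sym: "u \<in> fib E x \<Longrightarrow> v \<in> fib E x \<Longrightarrow> h x u v = h x v u"
  using metric unfolding pseudo_riemannian_metric_def by meson

lemma metric_combo:
  "u \<in> fib E x \<Longrightarrow> v \<in> fib E x \<Longrightarrow> w \<in> fib E x \<Longrightarrow> h x (a *\<^sub>R u + b *\<^sub>R v) w = a * h x u w + b * h x v w"
  using metric unfolding pseudo_riemannian_metric_def by meson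

lemma metric_nondegenerate: "u \<in> fib E x \<Longrightarrow> (\<And>v. v \<in> fib E x \<Longrightarrow> h x u v = 0) \<Longrightarrow> u = 0"
  using metric unfolding pseudo_riemannian_metric_def by meson

lemma metric_smooth: "X \<in> Sec \<Longrightarrow> Y \<in> Sec \<Longrightarrow> (\<lambda>x. h x (X x) (Y x)) \<in> Fun"
  using metric unfolding pseudo_riemannian_metric_def by meson

lemma metric_add: "u \<in> fib E x \<Longrightarrow> v \<in> fib E x \<Longrightarrow> w \<in> fib E x \<Longrightarrow> h x (u + v) w = h x u w + h x v w"
  using metric_combo[of u x v w 1 1] by simp

lemma metric_scale: "u \<in> fib E x \<Longrightarrow> w \<in> fib E x \<Longrightarrow> h x (a *\<^sub>R u) w = a * h x u w"
  using metric_combo[of u x u w a 0] by simp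

lemma metric_diff: "u \<in> fib E x \<Longrightarrow> v \<in> fib E x \<Longrightarrow> w \<in> fib E x \<Longrightarrow> h x (u - v) w = h x u w - h x v w"
  using metric_combo[of u x v w 1 "-1"] by simp

lemma metric_add_right: "u \<in> fib E x \<Longrightarrow> v \<in> fib E x \<Longrightarrow> w \<in> fib E x \<Longrightarrow> h x w (u + v) = h x w u + h x w v"
  by (simp add: metric_sym[of w] metric_add fib_add)

lemma metric_scale_right: "u \<in> fib E x \<Longrightarrow> w \<in> fib E x \<Longrightarrow> h x w (a *\<^sub>R u) = a * h x w u"
  by (simp add: metric_sym[of w] metric_scale fib_scale)

lemma metric_zero: "w \<in> fib E x \<Longrightarrow> h x 0 w = 0"
  using metric_scale[OF fib_zero, of w x 0] by simp

lemma metric_sum: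
  "w \<in> fib E x \<Longrightarrow> (\<And>i. i \<in> I \<Longrightarrow> f i \<in> fib E x) \<Longrightarrow> h x (\<Sum>i\<in>I. c i *\<^sub>R f i) w = (\<Sum>i\<in>I. c i * h x (f i) w)"
  by (induction I rule: infinite_finite_induct)
     (auto simp: metric_zero metric_add metric_scale fib_scale fib_sum)

lemma metric_eqI:
  assumes "u \<in> fib E x" "v \<in> fib E x" "\<And>Z. Z \<in> Sec \<Longrightarrow> h x u (Z x) = h x v (Z x)"
  shows "u = v"
proof -
  have "u - v = 0"
  proof (rule metric_nondegenerate)
    show "u - v \<in> fib E x" using assms by (intro fib_diff)
    fix w assume w: "w \<in> fib E x"
    then obtain Z where Z: "Z \<in> Sec" "Z x = w" by (rule section_through)
    have "h x u w = h x v w" using assms(3)[OF Z(1)] Z(2) by simp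
    then show "h x (u - v) w = 0" using assms(1,2) w by (simp add: metric_diff)
  qed
  then show ?thesis by simp
qed

text \<open>The musical isomorphism on sections. In a local frame the unknown coefficients solve a
  linear system whose matrix is the Gram matrix of the metric, invertible by nondegeneracy; its
  solution is smooth. Used twice: for the Koszul expression, which gives the connection, and for the
  inverse of the flat map.\<close>

lemma metric_representation:
  assumes add: "\<And>X Y. X \<in> Sec \<Longrightarrow> Y \<in> Sec \<Longrightarrow> K (\<lambda>x. X x + Y x) = (\<lambda>x. K X x + K Y x)"
    and scale: "\<And>f X. f \<in> Fun \<Longrightarrow> X \<in> Sec \<Longrightarrow> K (\<lambda>x. f x *\<^sub>R X x) = (\<lambda>x. f x * K X x)"
    and smooth: "\<And>X. X \<in> Sec \<Longrightarrow> K X \<in> Fun"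
  obtains X where "X \<in> Sec" "\<forall>Z\<in>Sec. \<forall>x. h x (X x) (Z x) = K Z x"
proof -
  have loc: "\<exists>N c Es. open N \<and> x \<in> N \<and> (\<forall>i<rk E. smooth_at C (c i) x \<and> Es i \<in> Sec) \<and>
      (\<forall>y\<in>N. \<forall>Z\<in>Sec. h y (\<Sum>i<rk E. c i y *\<^sub>R Es i y) (Z y) = K Z y)" for x
  proof -
    obtain U e where U: "(U, e) \<in> frames E" "x \<in> U" by (rule frame_exists)
    obtain N Es where 1: "open N" "x \<in> N" "N \<subseteq> U" "\<forall>i<rk E. Es i \<in> Sec" "\<forall>i<rk E. \<forall>y\<in>N. Es i y = e i y"
      by (rule local_frame_sections[OF U])
    define M where "M i j y = h y (Es j y) (Es i y)" for i j y
    have "\<exists>c. (\<forall>j\<in>{..<rk E}. smooth_at C (c j) x) \<and>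
        (\<forall>\<^sub>F y in nhds x. \<forall>i\<in>{..<rk E}. (\<Sum>j\<in>{..<rk E}. M i j y * c j y) = K (Es i) y)"
    proof (rule smooth_solution_of_linear_system)
      show "smooth_at C (M i j) x" if "i \<in> {..<rk E}" "j \<in> {..<rk E}" for i j
        unfolding M_def using 1 that by (intro smooth_funsD metric_smooth) auto
      show "smooth_at C (K (Es i)) x" if "i \<in> {..<rk E}" for i
        using smooth 1 that by (auto intro: smooth_funsD)
      fix c assume c: "\<forall>i\<in>{..<rk E}. (\<Sum>j<rk E. M i j x * c j) = 0"
      \<comment> \<open>A kernel vector of the Gram matrix is the coordinate vector of some
        \<open>u\<close> orthogonal to the whole fibre; nondegeneracy gives \<open>u = 0\<close>,
        and independence of the frame kills its coordinates.\<close>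
      define u where "u = (\<Sum>j<rk E. c j *\<^sub>R e j x)"
      have u: "u \<in> fib E x" unfolding u_def using frame_mem[OF U] by (intro fib_sum fib_scale) auto
      have ui: "h x (e i x) u = 0" if i: "i < rk E" for i
      proof -
        have "h x u (e i x) = (\<Sum>j<rk E. c j * h x (e j x) (e i x))"
          unfolding u_def using frame_mem[OF U] i by (intro metric_sum) auto
        also have "\<dots> = (\<Sum>j<rk E. M i j x * c j)" using 1 i by (intro sum.cong) (auto simp: M_def)
        also have "\<dots> = 0" using c i by simp
        finally show ?thesis using metric_sym[OF u frame_mem[OF U i]] by simp
      qed
      have "u = 0"
      proof (rule metric_nondegenerate[OF u])
        fix v assume v: "v \<in> fib E x"
        have "h x (\<Sum>i<rk E. frame_coef E e i x v *\<^sub>R e i x) u = (\<Sum>i<rk E. frame_coef E e i x v * h x (e i x) u)"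
          using frame_mem[OF U] by (intro metric_sum u) auto
        then show "h x u v = 0"
          using ui by (simp add: frame_coef_expand[OF U v] metric_sym[OF u v])
      qed
      show "\<forall>j\<in>{..<rk E}. c j = 0"
      proof
        fix j assume "j \<in> {..<rk E}"
        then show "c j = 0"
          using frame_coef_combo[OF U, of j c] \<open>u = 0\<close> dual_space_zero[OF subspace_fib frame_coef_in_dual[OF U]]
          by (simp add: u_def)
      qed
    qed auto
    then obtain c V where c: "\<forall>j\<in>{..<rk E}. smooth_at C (c j) x" and V: "open V" "x \<in> V"
      "\<forall>y\<in>V. \<forall>i\<in>{..<rk E}. (\<Sum>j<rk E. M i j y * c j y) = K (Es i) y"
      unfolding eventually_nhds by blast
    have "h y (\<Sum>j<rk E. c j y *\<^sub>R Es j y) (Z y) = K Z y" if y: "y \<in> N \<inter> V" and Z: "Z \<in> Sec" for y Z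
    proof -
      have yU: "y \<in> U" using y 1 by auto
      have eqs: "Es i y = e i y" "Es i \<in> Sec" "e i y \<in> fib E y" if "i < rk E" for i
        using 1 y that frame_mem[OF U(1) yU] by auto
      define z where "z i = frame_coef E e i y (Z y)" for i
      have zZ: "(\<Sum>i<rk E. z i *\<^sub>R e i y) = Z y"
        unfolding z_def by (rule frame_coef_expand[OF U(1) yU sections_fib[OF Z]])
      have Ksum: "K (\<lambda>x. \<Sum>i<rk E. z i *\<^sub>R Es i x) y = (\<Sum>i<rk E. z i * K (Es i) y)"
        by (rule tensorial_sum[where F = "\<lambda>Z. K Z y" and x = y and c = "\<lambda>i _. z i"])
           (auto simp: add scale smooth_funs_const eqs)
      let ?u = "\<Sum>j<rk E. c j y *\<^sub>R e j y"
      have u: "?u \<in> fib E y" using eqs by (intro fib_sum fib_scale) auto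
      have hu: "h y ?u (e i y) = K (Es i) y" if i: "i < rk E" for i
      proof -
        have "h y ?u (e i y) = (\<Sum>j<rk E. c j y * h y (e j y) (e i y))"
          using eqs i by (intro metric_sum) auto
        also have "\<dots> = (\<Sum>j<rk E. M i j y * c j y)" using eqs i by (intro sum.cong) (auto simp: M_def)
        finally show ?thesis using V(3) y i by simp
      qed
      have "K Z y = K (\<lambda>x. \<Sum>i<rk E. z i *\<^sub>R Es i x) y"
      proof (rule tensorial[where F = "\<lambda>Z. K Z y" and x = y, OF _ _ Z])
        show "(\<lambda>x. \<Sum>i<rk E. z i *\<^sub>R Es i x) \<in> Sec"
          using eqs(2) by (intro sections_sum sections_cscale) auto
        show "Z y = (\<Sum>i<rk E. z i *\<^sub>R Es i y)" using zZ eqs by simp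
      qed (simp_all add: add scale)
      also have "\<dots> = (\<Sum>i<rk E. z i * h y ?u (e i y))" using Ksum hu by simp
      also have "\<dots> = h y (\<Sum>i<rk E. z i *\<^sub>R e i y) ?u"
        using eqs u by (subst metric_sum) (auto simp: metric_sym)
      also have "\<dots> = h y ?u (Z y)" unfolding zZ using u sections_fib[OF Z] by (intro metric_sym)
      finally show ?thesis using eqs by simp
    qed
    then show ?thesis
      using 1 V c by (intro exI[of _ "N \<inter> V"] exI[of _ c] exI[of _ Es]) auto
  qed
  show thesis
  proof (rule section_of_local_solutions[OF _ loc])
    show "v = w" if "v \<in> fib E x" "w \<in> fib E x" "\<forall>Z\<in>Sec. h x v (Z x) = K Z x" "\<forall>Z\<in>Sec. h x w (Z x) = K Z x" for x v w
      using that by (intro metric_eqI[of v x w]) auto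
  qed (rule that, auto)
qed

end

section \<open>Skew algebroids\<close>

context manifold
begin

lemma smooth_funs_chart_derivative:
  assumes "f \<in> smooth_funs C" "(U, \<phi>) \<in> C" "x \<in> U"
  shows "((\<lambda>p. f (inv_into U \<phi> p)) has_derivative
    frechet_derivative (\<lambda>p. f (inv_into U \<phi> p)) (at (\<phi> x))) (at (\<phi> x))"
proof (rule Ck_on_has_derivative)
  have "smooth_fun_on C UNIV f" using assms(1) by (simp add: smooth_funs_def)
  from smooth_fun_onD[OF this assms(2)]
  show "Ck_on (Suc 0) (\<phi> ` U) (\<lambda>p. f (inv_into U \<phi> p))" by simp
qed (use assms chart_open_image in auto)

lemma
  assumes v: "v \<in> tangent_vectors C x" and f: "f \<in> smooth_funs C"
  shows tangent_add: "g \<in> smooth_funs C \<Longrightarrow> v (\<lambda>y. f y + g y) = v f + v g"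
    and tangent_mult: "g \<in> smooth_funs C \<Longrightarrow> v (\<lambda>y. f y * g y) = f x * v g + g x * v f"
    and tangent_const: "v (\<lambda>y. c) = 0"
proof -
  obtain U \<phi> w where U: "(U, \<phi>) \<in> C" "x \<in> U"
    and v: "\<forall>f\<in>smooth_funs C. v f = frechet_derivative (\<lambda>p. f (inv_into U \<phi> p)) (at (\<phi> x)) w"
    using v by (auto simp: tangent_vectors_def comp_def)
  note d = smooth_funs_chart_derivative[OF _ U]
  have x: "inv_into U \<phi> (\<phi> x) = x" using chart_inv[OF U] .
  show "v (\<lambda>y. f y + g y) = v f + v g" if g: "g \<in> smooth_funs C"
    using frechet_derivative_at[OF has_derivative_add[OF d[OF f] d[OF g]]] f g
    by (simp add: v smooth_funs_add fun_eq_iff)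
  show "v (\<lambda>y. f y * g y) = f x * v g + g x * v f" if g: "g \<in> smooth_funs C"
    using fun_cong[OF frechet_derivative_at[OF has_derivative_mult[OF d[OF f] d[OF g]]], of w] f g
    by (simp add: v smooth_funs_mult x mult.commute)
  show "v (\<lambda>y. c) = 0"
    by (simp add: v smooth_funs_const)
qed

end

locale skew_alg =
  fixes A :: "('m::{t2_space,second_countable_topology}, 'e::{real_inner,heine_borel}, 'v::real_vector) algebroid"
  assumes skew_algebroid: "skew_algebroid A"

sublocale skew_alg \<subseteq> bundle_over "base A" "vbun A"
  using skew_algebroid by unfold_locales (simp_all add: skew_algebroid_def)

context skew_alg
begin

lemma anchor_tangent: "v \<in> fib (vbun A) x \<Longrightarrow> anchor A x v \<in> tangent_vectors (base A) x"
  using skew_algebroid by (simp add: skew_algebroid_def bundle_map_to_TM_def)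

lemma anchor_combo:
  "v \<in> fib (vbun A) x \<Longrightarrow> w \<in> fib (vbun A) x \<Longrightarrow> f \<in> Fun \<Longrightarrow>
    anchor A x (a *\<^sub>R v + b *\<^sub>R w) f = a * anchor A x v f + b * anchor A x w f"
  using skew_algebroid by (simp add: skew_algebroid_def bundle_map_to_TM_def)

lemma anchor_fun_smooth: "X \<in> Sec \<Longrightarrow> f \<in> Fun \<Longrightarrow> anchor_fun A X f \<in> Fun"
  using skew_algebroid by (simp add: skew_algebroid_def bundle_map_to_TM_def)

lemma anchor_add: "v \<in> fib (vbun A) x \<Longrightarrow> w \<in> fib (vbun A) x \<Longrightarrow> f \<in> Fun \<Longrightarrow>
    anchor A x (v + w) f = anchor A x v f + anchor A x w f"
  using anchor_combo[of v x w f 1 1] by simp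

lemma anchor_scale: "v \<in> fib (vbun A) x \<Longrightarrow> f \<in> Fun \<Longrightarrow> anchor A x (a *\<^sub>R v) f = a * anchor A x v f"
  using anchor_combo[of v x v f a 0] by simp

lemma
  assumes X: "X \<in> Sec" and f: "f \<in> Fun"
  shows anchor_fun_add: "g \<in> Fun \<Longrightarrow> anchor_fun A X (\<lambda>y. f y + g y) x = anchor_fun A X f x + anchor_fun A X g x"
    and anchor_fun_mult: "g \<in> Fun \<Longrightarrow>
      anchor_fun A X (\<lambda>y. f y * g y) x = f x * anchor_fun A X g x + g x * anchor_fun A X f x"
    and anchor_fun_const: "anchor_fun A X (\<lambda>y. c) x = 0"
    and anchor_fun_cmult: "anchor_fun A X (\<lambda>y. c * f y) x = c * anchor_fun A X f x"
    and anchor_fun_minus: "anchor_fun A X (\<lambda>y. - f y) x = - anchor_fun A X f x"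
proof -
  note t = anchor_tangent[OF sections_fib[OF X]]
  show add: "anchor_fun A X (\<lambda>y. f y + g y) x = anchor_fun A X f x + anchor_fun A X g x" if "g \<in> Fun" for g
    using tangent_add[OF t f that] by (simp add: anchor_fun_def)
  show "anchor_fun A X (\<lambda>y. f y * g y) x = f x * anchor_fun A X g x + g x * anchor_fun A X f x" if "g \<in> Fun"
    using tangent_mult[OF t f that] by (simp add: anchor_fun_def)
  have c: "anchor_fun A X (\<lambda>y. c) x = 0" for c
    using tangent_const[OF t f] by (simp add: anchor_fun_def)
  then show "anchor_fun A X (\<lambda>y. c) x = 0" .
  have cm: "anchor_fun A X (\<lambda>y. c * g y) x = c * anchor_fun A X g x" if "g \<in> Fun" for c g
    using tangent_mult[OF t smooth_funs_const[of c] that] c by (simp add: anchor_fun_def)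
  then show "anchor_fun A X (\<lambda>y. c * f y) x = c * anchor_fun A X f x" using f .
  show "anchor_fun A X (\<lambda>y. - f y) x = - anchor_fun A X f x"
    using cm[OF f, of "-1"] by simp
qed

lemma anchor_fun_sec_add:
  "X \<in> Sec \<Longrightarrow> Y \<in> Sec \<Longrightarrow> f \<in> Fun \<Longrightarrow> anchor_fun A (\<lambda>y. X y + Y y) f x = anchor_fun A X f x + anchor_fun A Y f x"
  by (simp add: anchor_fun_def anchor_add sections_fib)

lemma anchor_fun_sec_scale:
  "X \<in> Sec \<Longrightarrow> f \<in> Fun \<Longrightarrow> anchor_fun A (\<lambda>y. c y *\<^sub>R X y) f x = c x * anchor_fun A X f x"
  by (simp add: anchor_fun_def anchor_scale sections_fib)

lemma bracket_sec: "X \<in> Sec \<Longrightarrow> Y \<in> Sec \<Longrightarrow> bracket A X Y \<in> Sec"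
  by (rule skew_algebroid[unfolded skew_algebroid_def, THEN conjunct2, THEN conjunct2, THEN conjunct2, THEN conjunct1, rule_format])

lemma bracket_skew: "X \<in> Sec \<Longrightarrow> Y \<in> Sec \<Longrightarrow> bracket A X Y x = - bracket A Y X x"
  using skew_algebroid[unfolded skew_algebroid_def, THEN conjunct2, THEN conjunct2, THEN conjunct2, THEN conjunct2, THEN conjunct1, rule_format]
  by (metis uminus_apply)

lemma bracket_combo_left: "X \<in> Sec \<Longrightarrow> Y \<in> Sec \<Longrightarrow> Z \<in> Sec \<Longrightarrow>
    bracket A (\<lambda>x. a *\<^sub>R X x + b *\<^sub>R Y x) Z x = a *\<^sub>R bracket A X Z x + b *\<^sub>R bracket A Y Z x"
proof -
  assume "X \<in> Sec" "Y \<in> Sec" "Z \<in> Sec"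
  then have "bracket A (a *\<^sub>R X + b *\<^sub>R Y) Z = a *\<^sub>R bracket A X Z + b *\<^sub>R bracket A Y Z"
    by (rule skew_algebroid[unfolded skew_algebroid_def, THEN conjunct2, THEN conjunct2, THEN conjunct2, THEN conjunct2, THEN conjunct2,
        THEN conjunct1, rule_format])
  moreover have "a *\<^sub>R X + b *\<^sub>R Y = (\<lambda>x. a *\<^sub>R X x + b *\<^sub>R Y x)"
    by (simp add: fun_eq_iff scaleR_fun_def)
  ultimately show ?thesis by (simp add: scaleR_fun_def)
qed

lemma bracket_add_left: "X \<in> Sec \<Longrightarrow> Y \<in> Sec \<Longrightarrow> Z \<in> Sec \<Longrightarrow>
    bracket A (\<lambda>x. X x + Y x) Z x = bracket A X Z x + bracket A Y Z x"
  using bracket_combo_left[of X Y Z 1 1] by simp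

lemma bracket_scale_right: "X \<in> Sec \<Longrightarrow> Y \<in> Sec \<Longrightarrow> f \<in> Fun \<Longrightarrow>
    bracket A X (\<lambda>x. f x *\<^sub>R Y x) x = f x *\<^sub>R bracket A X Y x + anchor_fun A X f x *\<^sub>R Y x"
  by (drule (2) skew_algebroid[unfolded skew_algebroid_def, THEN conjunct2, THEN conjunct2, THEN conjunct2, THEN conjunct2, THEN conjunct2,
      THEN conjunct2, rule_format, THEN fun_cong])

lemma bracket_add_right: "X \<in> Sec \<Longrightarrow> Y \<in> Sec \<Longrightarrow> Z \<in> Sec \<Longrightarrow>
    bracket A Z (\<lambda>x. X x + Y x) x = bracket A Z X x + bracket A Z Y x"
  using bracket_add_left[of X Y Z x] bracket_skew[of Z "\<lambda>x. X x + Y x" x] bracket_skew[of X Z x]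
    bracket_skew[of Y Z x] by (simp add: sections_add)

lemma bracket_scale_left: "X \<in> Sec \<Longrightarrow> Y \<in> Sec \<Longrightarrow> f \<in> Fun \<Longrightarrow>
    bracket A (\<lambda>x. f x *\<^sub>R X x) Y x = f x *\<^sub>R bracket A X Y x - anchor_fun A Y f x *\<^sub>R X x"
  using bracket_scale_right[of Y X f x] bracket_skew[of "\<lambda>x. f x *\<^sub>R X x" Y x] bracket_skew[of X Y x]
  by (simp add: sections_scale)

lemma bracket_fib: "X \<in> Sec \<Longrightarrow> Y \<in> Sec \<Longrightarrow> bracket A X Y x \<in> fib (vbun A) x"
  by (rule sections_fib[OF bracket_sec])

section \<open>The exterior derivative of functions and 1-forms\<close>

lemma alt_forms_eqI:
  assumes "\<omega> \<in> alt_forms (fib (vbun A) x) k" "\<eta> \<in> alt_forms (fib (vbun A) x) k"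
    and "\<And>Xs. length Xs = k \<Longrightarrow> set Xs \<subseteq> Sec \<Longrightarrow> \<omega> (at_point Xs x) = \<eta> (at_point Xs x)"
  shows "\<omega> = \<eta>"
proof
  fix vs
  show "\<omega> vs = \<eta> vs"
  proof (cases "length vs = k \<and> set vs \<subseteq> fib (vbun A) x")
    case True
    have "\<exists>Xs. length Xs = length vs \<and> set Xs \<subseteq> Sec \<and> at_point Xs x = vs" if "set vs \<subseteq> fib (vbun A) x" for vs
      using that
    proof (induction vs)
      case (Cons v vs)
      then obtain Xs where "length Xs = length vs" "set Xs \<subseteq> Sec" "at_point Xs x = vs" by auto
      moreover obtain X where "X \<in> Sec" "X x = v" using section_through[of v x] Cons.prems by auto
      ultimately show ?case by (intro exI[of _ "X # Xs"]) simp
    qed simp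
    then show ?thesis using assms(3) True by metis
  next
    case False
    then show ?thesis using assms(1,2) unfolding alt_forms_def by simp
  qed
qed

text \<open>A form is determined by its values on sections, because every fibre vector extends to a
  section. This settles uniqueness in the definite description once and for all; what remains in
  each degree is to exhibit a form satisfying the formula.\<close>

lemma ext_d_eqI:
  assumes "\<eta> \<in> aforms A (Suc k)"
    and "\<And>Xs x. length Xs = Suc k \<Longrightarrow> set Xs \<subseteq> Sec \<Longrightarrow> \<eta> x (at_point Xs x) =
      (\<Sum>i\<le>k. (-1) ^ i * anchor_fun A (Xs ! i) (\<lambda>y. \<omega> y (at_point (nths Xs (- {i})) y)) x) +
      (\<Sum>j\<le>k. \<Sum>i<j. (-1) ^ (i + j) *
        \<omega> x (at_point (bracket A (Xs ! i) (Xs ! j) # nths Xs (- {i, j})) x))"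
  shows "ext_d A k \<omega> = \<eta>"
  unfolding ext_d_def
proof (rule the_equality)
  show "\<eta> \<in> aforms A (Suc k) \<and>
    (\<forall>Xs. length Xs = Suc k \<and> set Xs \<subseteq> Sec \<longrightarrow> (\<forall>x. \<eta> x (at_point Xs x) =
      (\<Sum>i\<le>k. (-1) ^ i * anchor_fun A (Xs ! i) (\<lambda>y. \<omega> y (at_point (nths Xs (- {i})) y)) x) +
      (\<Sum>j\<le>k. \<Sum>i<j. (-1) ^ (i + j) *
        \<omega> x (at_point (bracket A (Xs ! i) (Xs ! j) # nths Xs (- {i, j})) x))))"
    using assms by blast
  fix \<eta>' assume \<eta>': "\<eta>' \<in> aforms A (Suc k) \<and>
    (\<forall>Xs. length Xs = Suc k \<and> set Xs \<subseteq> Sec \<longrightarrow> (\<forall>x. \<eta>' x (at_point Xs x) =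
      (\<Sum>i\<le>k. (-1) ^ i * anchor_fun A (Xs ! i) (\<lambda>y. \<omega> y (at_point (nths Xs (- {i})) y)) x) +
      (\<Sum>j\<le>k. \<Sum>i<j. (-1) ^ (i + j) *
        \<omega> x (at_point (bracket A (Xs ! i) (Xs ! j) # nths Xs (- {i, j})) x))))"
  show "\<eta>' = \<eta>"
  proof
    fix x
    show "\<eta>' x = \<eta> x"
    proof (rule alt_forms_eqI[of _ x "Suc k"])
      show "\<eta>' x \<in> alt_forms (fib (vbun A) x) (Suc k)" "\<eta> x \<in> alt_forms (fib (vbun A) x) (Suc k)"
        using \<eta>' assms(1) by (simp_all add: forms_def)
      show "\<eta>' x (at_point Xs x) = \<eta> x (at_point Xs x)" if "length Xs = Suc k" "set Xs \<subseteq> Sec" for Xs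
        using \<eta>' assms(2)[OF that] that by simp
    qed
  qed
qed

lemma ext_d_0:
  assumes f: "f \<in> Fun"
  shows "ext_d A 0 (form0 f) = (\<lambda>x vs. if length vs = 1 \<and> set vs \<subseteq> fib (vbun A) x then anchor A x (hd vs) f else 0)"
    (is "_ = ?\<eta>")
    and "ext_d A 0 (form0 f) \<in> aforms A 1"
proof -
  have "?\<eta> x \<in> alt_forms (fib (vbun A) x) 1" for x
    by (auto simp: alt_forms_def length_Suc_conv anchor_combo[OF _ _ f] fib_add fib_scale)
  moreover have "(\<lambda>x. ?\<eta> x (at_point Xs x)) \<in> Fun" if "length Xs = 1" "set Xs \<subseteq> Sec" for Xs
  proof -
    obtain X where X: "Xs = [X]" "X \<in> Sec" using \<open>length Xs = 1\<close> \<open>set Xs \<subseteq> Sec\<close> by (auto simp: length_Suc_conv)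
    then have "(\<lambda>x. ?\<eta> x (at_point Xs x)) = anchor_fun A X f"
      by (simp add: anchor_fun_def sections_fib)
    then show ?thesis using anchor_fun_smooth[OF X(2) f] by simp
  qed
  ultimately have \<eta>: "?\<eta> \<in> aforms A 1" by (simp add: forms_def)
  show e: "ext_d A 0 (form0 f) = ?\<eta>"
  proof (rule ext_d_eqI)
    show "?\<eta> \<in> aforms A (Suc 0)" using \<eta> by simp
    fix Xs x assume "length Xs = Suc 0" "set Xs \<subseteq> Sec"
    then obtain X where X: "Xs = [X]" "X \<in> Sec" by (auto simp: length_Suc_conv)
    then show "?\<eta> x (at_point Xs x) =
      (\<Sum>i\<le>0. (-1) ^ i * anchor_fun A (Xs ! i) (\<lambda>y. form0 f y (at_point (nths Xs (- {i})) y)) x) +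
      (\<Sum>j\<le>0. \<Sum>i<j. (-1) ^ (i + j) *
        form0 f x (at_point (bracket A (Xs ! i) (Xs ! j) # nths Xs (- {i, j})) x))"
      by (simp add: anchor_fun_def sections_fib form0_def nths_Cons)
  qed
  show "ext_d A 0 (form0 f) \<in> aforms A 1" unfolding e by (rule \<eta>)
qed

lemma ext_d_0_apply: "f \<in> Fun \<Longrightarrow> Z \<in> Sec \<Longrightarrow> ext_d A 0 (form0 f) x [Z x] = anchor_fun A Z f x"
  by (simp add: ext_d_0 anchor_fun_def sections_fib)

text \<open>The right-hand side, called \<open>T\<close> below, is a priori an expression in
  sections. It is linear over functions in each argument, since the derivative that the Leibniz rule
  of the anchor produces cancels the one from the Leibniz rule of the bracket, and so it defines a
  2-form.\<close>

lemma
  assumes \<beta>: "\<beta> \<in> Cos"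
  shows ext_d_1_form: "ext_d A 1 (form1 \<beta>) \<in> aforms A 2"
    and ext_d_1_apply: "X \<in> Sec \<Longrightarrow> Y \<in> Sec \<Longrightarrow> ext_d A 1 (form1 \<beta>) x [X x, Y x] =
      anchor_fun A X (\<lambda>y. \<beta> y (Y y)) x - anchor_fun A Y (\<lambda>y. \<beta> y (X y)) x - \<beta> x (bracket A X Y x)"
proof -
  define T where "T X Y x = anchor_fun A X (\<lambda>y. \<beta> y (Y y)) x - anchor_fun A Y (\<lambda>y. \<beta> y (X y)) x - \<beta> x (bracket A X Y x)"
    for X Y x
  note pf = cosections_pairing[OF \<beta>]
  note \<beta>d = cosections_dual[OF \<beta>]
  note lin = dual_space_add[OF subspace_fib \<beta>d] dual_space_diff[OF subspace_fib \<beta>d]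
    dual_space_scale[OF subspace_fib \<beta>d] dual_space_minus[OF subspace_fib \<beta>d]
  have T_add: "T (\<lambda>y. X y + Y y) Z x = T X Z x + T Y Z x" if "X \<in> Sec" "Y \<in> Sec" "Z \<in> Sec" for X Y Z x
    using that
    by (simp add: T_def lin sections_fib bracket_fib bracket_add_left anchor_fun_sec_add pf anchor_fun_add)
  have T_scale: "T (\<lambda>y. f y *\<^sub>R X y) Z x = f x * T X Z x" if "f \<in> Fun" "X \<in> Sec" "Z \<in> Sec" for f X Z x
    using that
    by (simp add: T_def lin sections_fib fib_scale bracket_fib bracket_scale_left anchor_fun_sec_scale pf anchor_fun_mult)
       (simp add: algebra_simps)
  have T_skew: "T X Y x = - T Y X x" if "X \<in> Sec" "Y \<in> Sec" for X Y x
    using bracket_skew[OF that, of x] that by (simp add: T_def lin bracket_fib)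
  \<comment> \<open>Linearity over functions is available in the first argument only; the second is
    treated after exchanging the arguments by skew-symmetry.\<close>
  have T_eq: "T X Y x = T X' Y' x"
    if "X \<in> Sec" "Y \<in> Sec" "X' \<in> Sec" "Y' \<in> Sec" "X x = X' x" "Y x = Y' x" for X Y X' Y' x
  proof -
    have "T X Y x = T X' Y x"
      by (rule tensorial[where F = "\<lambda>X. T X Y x" and x = x]) (use that in \<open>simp_all add: T_add T_scale\<close>)
    moreover have "T Y X' x = T Y' X' x"
      by (rule tensorial[where F = "\<lambda>Y. T Y X' x" and x = x]) (use that in \<open>simp_all add: T_add T_scale\<close>)
    ultimately show ?thesis using T_skew[of X' Y x] T_skew[of X' Y' x] that by simp
  qed
  \<comment> \<open>An arbitrary extension of a fibre vector to a section; by \<open>T_eq\<close>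
    the value of \<open>T\<close> does not depend on the choice.\<close>
  define ext where "ext x v = (SOME X. X \<in> Sec \<and> X x = v)" for x v
  have ext: "ext x v \<in> Sec" "ext x v x = v" if "v \<in> fib (vbun A) x" for x v
  proof -
    have "\<exists>X. X \<in> Sec \<and> X x = v" using section_through[OF that] by metis
    from someI_ex[OF this] show "ext x v \<in> Sec" "ext x v x = v" by (simp_all add: ext_def)
  qed
  define \<eta> where "\<eta> x vs = (if length vs = 2 \<and> set vs \<subseteq> fib (vbun A) x
    then T (ext x (vs ! 0)) (ext x (vs ! 1)) x else 0)" for x vs
  have \<eta>_T: "\<eta> x [X x, Y x] = T X Y x" if "X \<in> Sec" "Y \<in> Sec" for X Y x
    unfolding \<eta>_def using that by (auto simp: sections_fib intro!: T_eq ext)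
  have \<eta>_left: "\<eta> x [a *\<^sub>R u + b *\<^sub>R v, w] = a * \<eta> x [u, w] + b * \<eta> x [v, w]"
    if "u \<in> fib (vbun A) x" "v \<in> fib (vbun A) x" "w \<in> fib (vbun A) x" for x a b u v w
  proof -
    note uvw = that
    obtain X where X: "X \<in> Sec" "X x = u" by (rule section_through[OF uvw(1)])
    obtain Y where Y: "Y \<in> Sec" "Y x = v" by (rule section_through[OF uvw(2)])
    obtain Z where Z: "Z \<in> Sec" "Z x = w" by (rule section_through[OF uvw(3)])
    note XYZ = X Y Z
    have "T (\<lambda>y. a *\<^sub>R X y + b *\<^sub>R Y y) Z x = a * T X Z x + b * T Y Z x"
      using XYZ by (subst T_add) (auto intro: sections_cscale simp: T_scale[OF smooth_funs_const])
    then show ?thesis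
      using \<eta>_T[of "\<lambda>y. a *\<^sub>R X y + b *\<^sub>R Y y" Z x] \<eta>_T[of X Z x] \<eta>_T[of Y Z x] XYZ
      by (simp add: sections_add sections_cscale)
  qed
  have \<eta>_skew: "\<eta> x [u, v] = - \<eta> x [v, u]" if "u \<in> fib (vbun A) x" "v \<in> fib (vbun A) x" for x u v
    using that T_skew[OF ext(1)[OF that(1)] ext(1)[OF that(2)]] by (simp add: \<eta>_def)
  have \<eta>_right: "\<eta> x [w, a *\<^sub>R u + b *\<^sub>R v] = a * \<eta> x [w, u] + b * \<eta> x [w, v]"
    if "u \<in> fib (vbun A) x" "v \<in> fib (vbun A) x" "w \<in> fib (vbun A) x" for x a b u v w
    using that \<eta>_skew[of w x "a *\<^sub>R u + b *\<^sub>R v"] \<eta>_skew[of w x u] \<eta>_skew[of w x v] \<eta>_left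
    by (simp add: fib_add fib_scale)
  have alt: "\<eta> x \<in> alt_forms (fib (vbun A) x) 2" for x
    unfolding alt_forms_def
  proof (intro CollectI conjI allI ballI impI; (elim conjE)?)
    show "\<eta> x vs = 0" if "\<not> (length vs = 2 \<and> set vs \<subseteq> fib (vbun A) x)" for vs
      using that by (auto simp: \<eta>_def)
    show "\<eta> x (vs[i := a *\<^sub>R u + b *\<^sub>R w]) = a * \<eta> x (vs[i := u]) + b * \<eta> x (vs[i := w])"
      if "u \<in> fib (vbun A) x" "w \<in> fib (vbun A) x" "length vs = 2" "set vs \<subseteq> fib (vbun A) x" "i < 2" for vs i a b u w
    proof -
      obtain p q where "vs = [p, q]" using \<open>length vs = 2\<close> by (auto simp: numeral_2_eq_2 length_Suc_conv)
      moreover have "i = 0 \<or> i = 1" using \<open>i < 2\<close> by auto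
      ultimately show ?thesis using that \<eta>_left \<eta>_right by auto
    qed
    show "\<eta> x vs = 0"
      if "length vs = 2" "set vs \<subseteq> fib (vbun A) x" "i < j" "j < 2" "vs ! i = vs ! j" for vs i j
    proof -
      obtain p q where vs: "vs = [p, q]" using \<open>length vs = 2\<close> by (auto simp: numeral_2_eq_2 length_Suc_conv)
      have ij: "i = 0" "j = 1" using that(3,4) by auto
      have "p = q" using that(5) by (simp add: vs ij)
      then show ?thesis using vs that(2) \<eta>_skew[of p x p] by simp
    qed
  qed
  have sm: "(\<lambda>x. \<eta> x (at_point Xs x)) \<in> Fun" if "length Xs = 2" "set Xs \<subseteq> Sec" for Xs
  proof -
    note Xs = that
    obtain X Y where X: "Xs = [X, Y]" "X \<in> Sec" "Y \<in> Sec"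
      using Xs by (auto simp: numeral_2_eq_2 length_Suc_conv)
    have "T X Y \<in> Fun"
      unfolding T_def[abs_def] using X \<beta>
      by (intro smooth_funs_diff anchor_fun_smooth cosections_pairing bracket_sec)
    then show ?thesis using X by (simp add: \<eta>_T)
  qed
  have \<eta>: "\<eta> \<in> aforms A 2" using alt sm by (simp add: forms_def)
  have e: "ext_d A 1 (form1 \<beta>) = \<eta>"
  proof (rule ext_d_eqI)
    show "\<eta> \<in> aforms A (Suc 1)" using \<eta> by (simp add: numeral_2_eq_2)
    fix Xs x assume "length Xs = Suc 1" "set Xs \<subseteq> Sec"
    then obtain X Y where X: "Xs = [X, Y]" "X \<in> Sec" "Y \<in> Sec" by (auto simp: length_Suc_conv)
    then show "\<eta> x (at_point Xs x) =
      (\<Sum>i\<le>1. (-1) ^ i * anchor_fun A (Xs ! i) (\<lambda>y. form1 \<beta> y (at_point (nths Xs (- {i})) y)) x) +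
      (\<Sum>j\<le>1. \<Sum>i<j. (-1) ^ (i + j) *
        form1 \<beta> x (at_point (bracket A (Xs ! i) (Xs ! j) # nths Xs (- {i, j})) x))"
      by (simp add: \<eta>_T T_def form1_def nths_Cons)
  qed
  show "ext_d A 1 (form1 \<beta>) \<in> aforms A 2" unfolding e by (rule \<eta>)
  show "ext_d A 1 (form1 \<beta>) x [X x, Y x] =
      anchor_fun A X (\<lambda>y. \<beta> y (Y y)) x - anchor_fun A Y (\<lambda>y. \<beta> y (X y)) x - \<beta> x (bracket A X Y x)"
    if "X \<in> Sec" "Y \<in> Sec"
    unfolding e \<eta>_T[OF that] T_def ..
qed

end

section \<open>Levi-Civita connections\<close>

locale skew_metric = skew_alg A + metric_bundle "base A" "vbun A" h
  for A :: "('m::{t2_space,second_countable_topology}, 'e::{real_inner,heine_borel}, 'v::real_vector) algebroid"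
    and h :: "'m \<Rightarrow> 'v \<Rightarrow> 'v \<Rightarrow> real"
begin

text \<open>The right-hand side of the Koszul formula, already divided by 2, so that it is to equal
  h(D X Y, Z) itself. Torsion-freeness and metricity use the bracket and the anchor of the skew
  algebroid.\<close>

definition koszul :: "('m \<Rightarrow> 'v) \<Rightarrow> ('m \<Rightarrow> 'v) \<Rightarrow> ('m \<Rightarrow> 'v) \<Rightarrow> 'm \<Rightarrow> real" where
  "koszul X Y Z x = (1 / 2) *
    (anchor_fun A X (\<lambda>y. h y (Y y) (Z y)) x + anchor_fun A Y (\<lambda>y. h y (X y) (Z y)) x -
     anchor_fun A Z (\<lambda>y. h y (X y) (Y y)) x + h x (bracket A X Y x) (Z x) -
     h x (bracket A X Z x) (Y x) - h x (bracket A Y Z x) (X x))"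

lemma
  assumes D: "is_levi_civita A h D"
  shows connection_PiE: "D \<in> Sec \<rightarrow>\<^sub>E Sec \<rightarrow>\<^sub>E Sec"
    and connection_sec: "X \<in> Sec \<Longrightarrow> Y \<in> Sec \<Longrightarrow> D X Y \<in> Sec"
    and connection_add_left: "X \<in> Sec \<Longrightarrow> Y \<in> Sec \<Longrightarrow> Z \<in> Sec \<Longrightarrow> D (\<lambda>x. X x + Y x) Z x = D X Z x + D Y Z x"
    and connection_add_right: "X \<in> Sec \<Longrightarrow> Y \<in> Sec \<Longrightarrow> Z \<in> Sec \<Longrightarrow> D Z (\<lambda>x. X x + Y x) x = D Z X x + D Z Y x"
    and connection_scale_left: "X \<in> Sec \<Longrightarrow> Y \<in> Sec \<Longrightarrow> f \<in> Fun \<Longrightarrow> D (\<lambda>x. f x *\<^sub>R X x) Y x = f x *\<^sub>R D X Y x"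
    and connection_scale_right: "X \<in> Sec \<Longrightarrow> Y \<in> Sec \<Longrightarrow> f \<in> Fun \<Longrightarrow>
      D X (\<lambda>x. f x *\<^sub>R Y x) x = f x *\<^sub>R D X Y x + anchor_fun A X f x *\<^sub>R Y x"
    and connection_torsion: "X \<in> Sec \<Longrightarrow> Y \<in> Sec \<Longrightarrow> bracket A X Y x = D X Y x - D Y X x"
    and connection_metric: "X \<in> Sec \<Longrightarrow> Y \<in> Sec \<Longrightarrow> Z \<in> Sec \<Longrightarrow>
      anchor_fun A X (\<lambda>y. h y (Y y) (Z y)) x = h x (D X Y x) (Z x) + h x (Y x) (D X Z x)"
proof -
  note D' = D[unfolded is_levi_civita_def]
  show pi: "D \<in> Sec \<rightarrow>\<^sub>E Sec \<rightarrow>\<^sub>E Sec" by (rule D'[THEN conjunct1])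
  show "D X Y \<in> Sec" if "X \<in> Sec" "Y \<in> Sec" using PiE_mem[OF PiE_mem[OF pi that(1)] that(2)] .
  note lin = D'[THEN conjunct2, THEN conjunct1, rule_format]
  have e: "1 *\<^sub>R X + 1 *\<^sub>R Y = (\<lambda>x. X x + Y x)" for X Y :: "'m \<Rightarrow> 'v"
    by (simp add: fun_eq_iff)
  show "D (\<lambda>x. X x + Y x) Z x = D X Z x + D Y Z x" if "X \<in> Sec" "Y \<in> Sec" "Z \<in> Sec"
    using conjunct1[OF lin[OF that, of 1 1]] unfolding e by simp
  show "D Z (\<lambda>x. X x + Y x) x = D Z X x + D Z Y x" if "X \<in> Sec" "Y \<in> Sec" "Z \<in> Sec"
    using conjunct2[OF lin[OF that, of 1 1]] unfolding e by simp
  note lb = D'[THEN conjunct2, THEN conjunct2, THEN conjunct1, rule_format]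
  show "D (\<lambda>x. f x *\<^sub>R X x) Y x = f x *\<^sub>R D X Y x" if "X \<in> Sec" "Y \<in> Sec" "f \<in> Fun"
    by (rule fun_cong[OF conjunct1[OF lb[OF that]]])
  show "D X (\<lambda>x. f x *\<^sub>R Y x) x = f x *\<^sub>R D X Y x + anchor_fun A X f x *\<^sub>R Y x" if "X \<in> Sec" "Y \<in> Sec" "f \<in> Fun"
    by (rule fun_cong[OF conjunct2[OF lb[OF that]]])
  show "bracket A X Y x = D X Y x - D Y X x" if "X \<in> Sec" "Y \<in> Sec"
    using fun_cong[OF D'[THEN conjunct2, THEN conjunct2, THEN conjunct2, THEN conjunct1, rule_format, OF that], of x]
    by simp
  show "anchor_fun A X (\<lambda>y. h y (Y y) (Z y)) x = h x (D X Y x) (Z x) + h x (Y x) (D X Z x)"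
    if "X \<in> Sec" "Y \<in> Sec" "Z \<in> Sec"
    by (rule D'[THEN conjunct2, THEN conjunct2, THEN conjunct2, THEN conjunct2, rule_format, OF that])
qed

text \<open>After metricity has replaced the three derivatives and vanishing torsion the three
  brackets, everything cancels except two copies of h(D X Y, Z).\<close>

lemma levi_civita_koszul:
  assumes D: "is_levi_civita A h D" and XYZ: "X \<in> Sec" "Y \<in> Sec" "Z \<in> Sec"
  shows "h x (D X Y x) (Z x) = koszul X Y Z x"
proof -
  have fm: "D X Y x \<in> fib (vbun A) x" if "X \<in> Sec" "Y \<in> Sec" for X Y x
    using sections_fib[OF connection_sec[OF D that]] .
  note tor = connection_torsion[OF D]
  note met = connection_metric[OF D]
  have sym: "h x (Y x) (D X Z x) = h x (D X Z x) (Y x)" if "X \<in> Sec" "Y \<in> Sec" "Z \<in> Sec" for X Y Z x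
    using metric_sym[OF sections_fib[OF that(2)] fm[OF that(1,3)]] .
  show ?thesis
    unfolding koszul_def using XYZ
    by (simp add: met tor metric_diff fm sections_fib sym)
qed

text \<open>For fixed X and Y the Koszul expression satisfies the hypotheses of
  \<open>metric_representation\<close> in Z. Multiplying Z by f creates the derivatives of f along X
  and Y in the first two terms, and the brackets [X, fZ] and [Y, fZ] remove them.\<close>

lemma
  assumes X: "X \<in> Sec" and Y: "Y \<in> Sec"
  shows koszul_smooth: "Z \<in> Sec \<Longrightarrow> koszul X Y Z \<in> Fun"
    and koszul_add: "Z \<in> Sec \<Longrightarrow> W \<in> Sec \<Longrightarrow> koszul X Y (\<lambda>x. Z x + W x) = (\<lambda>x. koszul X Y Z x + koszul X Y W x)"
    and koszul_scale: "f \<in> Fun \<Longrightarrow> Z \<in> Sec \<Longrightarrow> koszul X Y (\<lambda>x. f x *\<^sub>R Z x) = (\<lambda>x. f x * koszul X Y Z x)"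
proof -
  show "koszul X Y Z \<in> Fun" if "Z \<in> Sec"
    unfolding koszul_def[abs_def] using X Y that
    by (intro smooth_funs_intros anchor_fun_smooth metric_smooth bracket_sec)
  show "koszul X Y (\<lambda>x. Z x + W x) = (\<lambda>x. koszul X Y Z x + koszul X Y W x)" if "Z \<in> Sec" "W \<in> Sec"
    using X Y that
    by (simp add: fun_eq_iff koszul_def sections_fib bracket_fib bracket_add_right metric_add metric_add_right
        anchor_fun_sec_add anchor_fun_add metric_smooth algebra_simps)
  show "koszul X Y (\<lambda>x. f x *\<^sub>R Z x) = (\<lambda>x. f x * koszul X Y Z x)" if f: "f \<in> Fun" and Z: "Z \<in> Sec"
  proof
    fix x
    have s: "h x (Z x) (Y x) = h x (Y x) (Z x)" "h x (Z x) (X x) = h x (X x) (Z x)" "h x (Y x) (X x) = h x (X x) (Y x)"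
      using X Y Z by (auto intro!: metric_sym sections_fib)
    show "koszul X Y (\<lambda>x. f x *\<^sub>R Z x) x = f x * koszul X Y Z x"
      using X Y f Z
      by (simp add: koszul_def sections_fib bracket_fib bracket_scale_right metric_add metric_scale metric_scale_right
          fib_scale anchor_fun_sec_scale anchor_fun_mult metric_smooth s)
         (simp add: algebra_simps)
  qed
qed

text \<open>The Koszul expression is represented by a section, which is taken as D X Y. Every
  defining property is then an identity between Koszul expressions, tested against an arbitrary
  section W by nondegeneracy.\<close>

lemma connection_exists:
  obtains D where "is_levi_civita A h D"
proof -
  have "\<exists>V. V \<in> Sec \<and> (\<forall>Z\<in>Sec. \<forall>x. h x (V x) (Z x) = koszul X Y Z x)" if "X \<in> Sec" "Y \<in> Sec" for X Y
  proof -
    note XY = that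
    obtain V where "V \<in> Sec" "\<forall>Z\<in>Sec. \<forall>x. h x (V x) (Z x) = koszul X Y Z x"
      by (rule metric_representation[where K = "koszul X Y",
            OF koszul_add[OF XY] koszul_scale[OF XY] koszul_smooth[OF XY]])
    then show ?thesis by blast
  qed
  note ex = this
  define D0 where "D0 X Y = (SOME V. V \<in> Sec \<and> (\<forall>Z\<in>Sec. \<forall>x. h x (V x) (Z x) = koszul X Y Z x))" for X Y
  have D0: "D0 X Y \<in> Sec" "Z \<in> Sec \<Longrightarrow> h x (D0 X Y x) (Z x) = koszul X Y Z x"
    if "X \<in> Sec" "Y \<in> Sec" for X Y Z x
    using someI_ex[OF ex[OF that]] by (simp_all add: D0_def)
  \<comment> \<open>Restriction to sections makes the chosen map extensional, as
    \<open>is_levi_civita\<close> requires.\<close>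
  define D where "D = (\<lambda>X\<in>Sec. \<lambda>Y\<in>Sec. D0 X Y)"
  have D: "D X Y = D0 X Y" if "X \<in> Sec" "Y \<in> Sec" for X Y using that by (simp add: D_def)
  have mem: "D X Y \<in> Sec" if "X \<in> Sec" "Y \<in> Sec" for X Y using that D0 by (simp add: D)
  have fm: "D X Y x \<in> fib (vbun A) x" if "X \<in> Sec" "Y \<in> Sec" for X Y x
    using sections_fib[OF mem[OF that]] .
  have k: "h x (D X Y x) (Z x) = koszul X Y Z x" if "X \<in> Sec" "Y \<in> Sec" "Z \<in> Sec" for X Y Z x
    using that D0 by (simp add: D)
  note simps = koszul_def sections_fib bracket_fib sections_add sections_scale sections_cscale fib_add fib_scale
    metric_add metric_scale metric_add_right metric_scale_right metric_smooth
    bracket_add_left bracket_add_right bracket_scale_left bracket_scale_right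
    anchor_fun_sec_add anchor_fun_sec_scale anchor_fun_add anchor_fun_mult smooth_funs_const
  have s: "h x (X x) (Y x) = h x (Y x) (X x)" if "X \<in> Sec" "Y \<in> Sec" for X Y x
    using that by (auto intro!: metric_sym sections_fib)
  have add1: "D (\<lambda>x. X x + Y x) Z x = D X Z x + D Y Z x" if "X \<in> Sec" "Y \<in> Sec" "Z \<in> Sec" for X Y Z x
  proof (rule metric_eqI[of _ x])
    fix W assume W: "W \<in> Sec"
    show "h x (D (\<lambda>x. X x + Y x) Z x) (W x) = h x (D X Z x + D Y Z x) (W x)"
      using that W by (simp add: k fm sections_fib metric_add sections_add)
        (simp add: simps algebra_simps)
  qed (use that in \<open>auto intro!: fm fib_add sections_add\<close>)
  have add2: "D Z (\<lambda>x. X x + Y x) x = D Z X x + D Z Y x" if "X \<in> Sec" "Y \<in> Sec" "Z \<in> Sec" for X Y Z x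
  proof (rule metric_eqI[of _ x])
    fix W assume W: "W \<in> Sec"
    show "h x (D Z (\<lambda>x. X x + Y x) x) (W x) = h x (D Z X x + D Z Y x) (W x)"
      using that W by (simp add: k fm sections_fib metric_add sections_add)
        (simp add: simps algebra_simps)
  qed (use that in \<open>auto intro!: fm fib_add sections_add\<close>)
  have scale1: "D (\<lambda>x. f x *\<^sub>R X x) Y x = f x *\<^sub>R D X Y x" if "X \<in> Sec" "Y \<in> Sec" "f \<in> Fun" for X Y f x
  proof (rule metric_eqI[of _ x])
    fix W assume W: "W \<in> Sec"
    have sy: "h x (X x) (Y x) = h x (Y x) (X x)" "h x (W x) (X x) = h x (X x) (W x)" "h x (W x) (Y x) = h x (Y x) (W x)"
      using s that W by auto
    have "koszul (\<lambda>x. f x *\<^sub>R X x) Y W x = f x * koszul X Y W x"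
      using that W by (simp add: simps metric_diff sy) (simp add: algebra_simps)
    then show "h x (D (\<lambda>x. f x *\<^sub>R X x) Y x) (W x) = h x (f x *\<^sub>R D X Y x) (W x)"
      using that W by (simp add: k fm sections_fib metric_scale sections_scale)
  qed (use that in \<open>auto intro!: fm fib_scale sections_scale\<close>)
  have scale2: "D X (\<lambda>x. f x *\<^sub>R Y x) x = f x *\<^sub>R D X Y x + anchor_fun A X f x *\<^sub>R Y x"
    if "X \<in> Sec" "Y \<in> Sec" "f \<in> Fun" for X Y f x
  proof (rule metric_eqI[of _ x])
    fix W assume W: "W \<in> Sec"
    have sy: "h x (Y x) (X x) = h x (X x) (Y x)" "h x (W x) (X x) = h x (X x) (W x)" "h x (W x) (Y x) = h x (Y x) (W x)"
      using s that W by auto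
    have "koszul X (\<lambda>x. f x *\<^sub>R Y x) W x = f x * koszul X Y W x + anchor_fun A X f x * h x (Y x) (W x)"
      using that W by (simp add: simps metric_diff sy) (simp add: algebra_simps)
    then show "h x (D X (\<lambda>x. f x *\<^sub>R Y x) x) (W x) = h x (f x *\<^sub>R D X Y x + anchor_fun A X f x *\<^sub>R Y x) (W x)"
      using that W by (simp add: k fm sections_fib metric_add metric_scale fib_scale sections_scale)
  qed (use that in \<open>auto intro!: fm fib_scale fib_add sections_scale intro: sections_fib\<close>)
  have combo: "D (a *\<^sub>R X + b *\<^sub>R Y) Z = a *\<^sub>R D X Z + b *\<^sub>R D Y Z"
    "D Z (a *\<^sub>R X + b *\<^sub>R Y) = a *\<^sub>R D Z X + b *\<^sub>R D Z Y"
    if "X \<in> Sec" "Y \<in> Sec" "Z \<in> Sec" for X Y Z a b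
  proof -
    have e: "a *\<^sub>R X + b *\<^sub>R Y = (\<lambda>x. (\<lambda>x. a *\<^sub>R X x) x + (\<lambda>x. b *\<^sub>R Y x) x)"
      by (simp add: fun_eq_iff scaleR_fun_def)
    have c: "(\<lambda>x. a *\<^sub>R X x) \<in> Sec" "(\<lambda>x. b *\<^sub>R Y x) \<in> Sec" using that by (auto intro: sections_cscale)
    have d: "D (\<lambda>x. a *\<^sub>R X x) Z x = a *\<^sub>R D X Z x" "D (\<lambda>x. b *\<^sub>R Y x) Z x = b *\<^sub>R D Y Z x"
      "D Z (\<lambda>x. a *\<^sub>R X x) x = a *\<^sub>R D Z X x" "D Z (\<lambda>x. b *\<^sub>R Y x) x = b *\<^sub>R D Z Y x" for x
      using that scale1[OF that(1,3) smooth_funs_const] scale1[OF that(2,3) smooth_funs_const]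
        scale2[OF that(3,1) smooth_funs_const] scale2[OF that(3,2) smooth_funs_const]
      by (simp_all add: anchor_fun_const[OF that(3) smooth_funs_const])
    show "D (a *\<^sub>R X + b *\<^sub>R Y) Z = a *\<^sub>R D X Z + b *\<^sub>R D Y Z"
      unfolding e by (rule ext, subst add1[OF c that(3)]) (simp add: d scaleR_fun_def)
    show "D Z (a *\<^sub>R X + b *\<^sub>R Y) = a *\<^sub>R D Z X + b *\<^sub>R D Z Y"
      unfolding e by (rule ext, subst add2[OF c that(3)]) (simp add: d scaleR_fun_def)
  qed
  have "is_levi_civita A h D"
    unfolding is_levi_civita_def
  proof (intro conjI ballI allI)
    show "D \<in> Sec \<rightarrow>\<^sub>E Sec \<rightarrow>\<^sub>E Sec" using D0 by (auto simp: D_def)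
    fix X Y assume XY: "X \<in> Sec" "Y \<in> Sec"
    show "D X Y - D Y X = bracket A X Y"
    proof
      fix x
      show "(D X Y - D Y X) x = bracket A X Y x"
      proof (rule metric_eqI[of _ x])
        fix W assume W: "W \<in> Sec"
        have b: "bracket A Y X x = - bracket A X Y x" using bracket_skew XY by blast
        have "h x (- bracket A X Y x) (W x) = - h x (bracket A X Y x) (W x)"
          using metric_scale[of "bracket A X Y x" x "W x" "-1"] XY W by (simp add: bracket_fib sections_fib)
        moreover have "(\<lambda>y. h y (X y) (Y y)) = (\<lambda>y. h y (Y y) (X y))"
          using s XY by auto
        \<comment> \<open>Exchanging X and Y leaves the Koszul expression unchanged except for the
          sign of the term with [X, Y].\<close>
        ultimately have "koszul X Y W x - koszul Y X W x = h x (bracket A X Y x) (W x)"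
          by (simp add: koszul_def b algebra_simps)
        then show "h x ((D X Y - D Y X) x) (W x) = h x (bracket A X Y x) (W x)"
          using XY W by (simp add: metric_diff fm sections_fib k)
      qed (use XY in \<open>auto intro!: fm fib_diff bracket_fib\<close>)
    qed
    fix Z assume Z: "Z \<in> Sec"
    show "anchor_fun A X (\<lambda>y. h y (Y y) (Z y)) x = h x (D X Y x) (Z x) + h x (Y x) (D X Z x)" for x
    proof -
      \<comment> \<open>The Koszul expression minus its first term is antisymmetric in Y and Z, so
        the two values add up to the derivative of h(Y, Z) along X.\<close>
      have "h x (Y x) (D X Z x) = koszul X Z Y x"
        using metric_sym[OF sections_fib[OF XY(2)] fm[OF XY(1) Z]] k XY Z by simp
      moreover have sy: "(\<lambda>y. h y (Z y) (Y y)) = (\<lambda>y. h y (Y y) (Z y))" using s XY Z by auto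
      moreover have b: "bracket A Z Y x = - bracket A Y Z x" using bracket_skew XY Z by blast
      moreover have "h x (- bracket A Y Z x) (X x) = - h x (bracket A Y Z x) (X x)"
        using metric_scale[of "bracket A Y Z x" x "X x" "-1"] XY Z by (simp add: bracket_fib sections_fib)
      ultimately show ?thesis
        using XY Z by (simp add: k) (simp add: koszul_def algebra_simps)
    qed
  qed (auto simp: combo scale1 scale2)
  then show thesis by (rule that)
qed

lemma connection_unique:
  assumes "is_levi_civita A h D" "is_levi_civita A h D'"
  shows "D = D'"
proof -
  have pi: "D \<in> Sec \<rightarrow>\<^sub>E Sec \<rightarrow>\<^sub>E Sec" "D' \<in> Sec \<rightarrow>\<^sub>E Sec \<rightarrow>\<^sub>E Sec"
    using assms by (simp_all add: connection_PiE)
  have "D X Y = D' X Y" if "X \<in> Sec" "Y \<in> Sec" for X Y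
  proof
    fix x
    have "D X Y \<in> Sec" "D' X Y \<in> Sec" using assms that by (auto intro: connection_sec)
    then show "D X Y x = D' X Y x"
      using levi_civita_koszul[OF assms(1) that] levi_civita_koszul[OF assms(2) that]
      by (intro metric_eqI[of _ x]) (auto intro: sections_fib)
  qed
  note eq = this
  have "D X = D' X" if "X \<in> Sec" for X
    by (rule PiE_ext[OF PiE_mem[OF pi(1) that] PiE_mem[OF pi(2) that]]) (rule eq[OF that])
  then show ?thesis by (rule PiE_ext[OF pi])
qed

lemma is_levi_civita: "is_levi_civita A h (levi_civita A h)"
proof -
  obtain D where D: "is_levi_civita A h D" by (rule connection_exists)
  show ?thesis unfolding levi_civita_def by (rule theI[where P = "is_levi_civita A h", OF D connection_unique[OF _ D]])
qed

lemma levi_civita_sec: "X \<in> Sec \<Longrightarrow> Y \<in> Sec \<Longrightarrow> levi_civita A h X Y \<in> Sec"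
  by (rule connection_sec[OF is_levi_civita])

end

section \<open>The skew algebroid of a bivector\<close>

lemma scaleR_fun_apply: "(a *\<^sub>R f) x = a *\<^sub>R f x"
  by (simp add: scaleR_fun_def)

text \<open>\<open>alt_forms\<close> prescribes vanishing on repeated entries; skew-symmetry follows
  by polarisation, expanding \<omega>(u + v, u + v) = 0. The unit coefficients in the proof put the
  sum into the shape of the linearity rules.\<close>

lemma
  assumes "\<omega> \<in> alt_forms V 2" "subspace V"
  shows alt_form2_left: "u \<in> V \<Longrightarrow> v \<in> V \<Longrightarrow> w \<in> V \<Longrightarrow> \<omega> [a *\<^sub>R u + b *\<^sub>R v, w] = a * \<omega> [u, w] + b * \<omega> [v, w]"
    and alt_form2_right: "u \<in> V \<Longrightarrow> v \<in> V \<Longrightarrow> w \<in> V \<Longrightarrow> \<omega> [w, a *\<^sub>R u + b *\<^sub>R v] = a * \<omega> [w, u] + b * \<omega> [w, v]"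
    and alt_form2_skew: "u \<in> V \<Longrightarrow> v \<in> V \<Longrightarrow> \<omega> [u, v] = - \<omega> [v, u]"
proof -
  have lin: "\<omega> (vs[i := a *\<^sub>R u + b *\<^sub>R w]) = a * \<omega> (vs[i := u]) + b * \<omega> (vs[i := w])"
    if "u \<in> V" "w \<in> V" "length vs = 2" "set vs \<subseteq> V" "i < 2" for vs i a b u w
    using assms(1) that unfolding alt_forms_def by simp
  show left: "\<omega> [a *\<^sub>R u + b *\<^sub>R v, w] = a * \<omega> [u, w] + b * \<omega> [v, w]" if "u \<in> V" "v \<in> V" "w \<in> V" for a b u v w
    using lin[of u v "[w, w]" 0 a b] that by simp
  show right: "\<omega> [w, a *\<^sub>R u + b *\<^sub>R v] = a * \<omega> [w, u] + b * \<omega> [w, v]" if "u \<in> V" "v \<in> V" "w \<in> V" for a b u v w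
    using lin[of u v "[w, w]" 1 a b] that by simp
  have alt: "\<omega> [u, u] = 0" if "u \<in> V" for u
  proof -
    have "\<forall>vs i j. length vs = 2 \<and> set vs \<subseteq> V \<and> i < j \<and> j < 2 \<and> vs ! i = vs ! j \<longrightarrow> \<omega> vs = 0"
      using assms(1) unfolding alt_forms_def by simp
    from this[rule_format, of "[u, u]" 0 1] show ?thesis using that by simp
  qed
  show "\<omega> [u, v] = - \<omega> [v, u]" if "u \<in> V" "v \<in> V"
    using alt[of "1 *\<^sub>R u + 1 *\<^sub>R v"] alt[OF that(1)] alt[OF that(2)] that
      left[of u v "1 *\<^sub>R u + 1 *\<^sub>R v" 1 1] right[of u v u 1 1] right[of u v v 1 1]
    by (simp add: subspace_add[OF assms(2)])
qed

lemma wedge_1_0: "wedge 1 0 (form1 a) (form0 f) x [v] = a x v * f x"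
proof -
  have "{..<1 + 0} = {0::nat}" by auto
  then show ?thesis by (simp add: wedge_def form1_def form0_def)
qed

text \<open>With the normalisation 1/(k! l!) of \<open>wedge\<close> no factor 1/2 appears
  here.\<close>

lemma wedge_1_1: "wedge 1 1 (form1 a) (form1 b) x [u, v] = a x u * b x v - a x v * b x u"
proof -
  have "{\<sigma>. \<sigma> permutes {..<1 + 1 :: nat}} = {id, Transposition.transpose 0 1}"
  proof -
    have "{..<1 + 1 :: nat} = {0, 1}" by auto
    then show ?thesis by (auto simp: permutes_doubleton_iff)
  qed
  moreover have "id \<noteq> Transposition.transpose (0::nat) 1"
    by (metis id_apply transpose_apply_first zero_neq_one)
  ultimately show ?thesis
    by (simp add: wedge_def form1_def sign_swap_id upt_rec)
qed

lemma wedge_zero_left: "wedge 1 k (form1 (\<lambda>x v. 0)) \<omega> = 0"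
  by (simp add: wedge_def form1_def fun_eq_iff)

lemma contract_form1: "contract X (form1 \<beta>) = form0 (\<lambda>x. \<beta> x (X x))"
  by (simp add: contract_def form1_def form0_def fun_eq_iff)

lemma bracket_pi_eq_bracket_pi_phi: "bracket_pi A \<pi> = bracket_pi_phi A (\<lambda>x v. 0) \<pi>"
proof -
  have "d_phi A (\<lambda>x v. 0) k \<omega> = ext_d A k \<omega>" for k \<omega>
    unfolding d_phi_def wedge_zero_left by simp
  moreover from this have "lie_deriv_phi A (\<lambda>x v. 0) k X \<omega> = lie_deriv A k X \<omega>" for k X \<omega>
    unfolding lie_deriv_phi_def lie_deriv_def by (simp add: add.commute)
  ultimately show ?thesis
    by (intro ext) (simp only: bracket_pi_def bracket_pi_phi_def)
qed

lemma dual_algebroid_eq_dual_algebroid_phi: "dual_algebroid A \<pi> = dual_algebroid_phi A (\<lambda>x v. 0) \<pi>"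
  by (simp add: dual_algebroid_def dual_algebroid_phi_def bracket_pi_eq_bracket_pi_phi)

lemma dual_algebroid_phi_simps [simp]:
  "base (dual_algebroid_phi A \<phi>\<^sub>0 \<pi>) = base A"
  "vbun (dual_algebroid_phi A \<phi>\<^sub>0 \<pi>) = dual_bundle (vbun A)"
  "bracket (dual_algebroid_phi A \<phi>\<^sub>0 \<pi>) = bracket_pi_phi A \<phi>\<^sub>0 \<pi>"
  "anchor (dual_algebroid_phi A \<phi>\<^sub>0 \<pi>) = (\<lambda>x \<alpha>. anchor A x (sharp A \<pi> x \<alpha>))"
  by (simp_all add: dual_algebroid_phi_def)

lemma anchor_fun_dual_algebroid_phi:
  "anchor_fun (dual_algebroid_phi A \<phi>\<^sub>0 \<pi>) \<alpha> f = anchor_fun A (sharp_sec A \<pi> \<alpha>) f"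
  by (simp add: anchor_fun_def)

text \<open>The assumptions are chosen so that the locale has two instances: \<open>A\<close> with
  \<open>\<phi>\<^sub>0\<close> and \<pi>, and \<open>tilde_minus A \<phi>\<^sub>0\<close> with the
  zero covector and \<open>poissonization \<pi>\<close>.\<close>

locale bivector_algebroid = skew_alg A
  for A :: "('m::{t2_space,second_countable_topology}, 'e::{real_inner,heine_borel}, 'v::real_vector) algebroid" +
  fixes \<phi>\<^sub>0 :: "'m \<Rightarrow> 'v \<Rightarrow> real" and \<pi> :: "'m \<Rightarrow> ('v \<Rightarrow> real) list \<Rightarrow> real"
  assumes \<phi>: "\<phi>\<^sub>0 \<in> Cos" and bivector: "\<pi> \<in> mvecs A 2"
begin

abbreviation "Dual x \<equiv> dual_space (fib (vbun A) x)"

lemma bivector_alt: "\<pi> x \<in> alt_forms (Dual x) 2"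
  using bivector by (simp add: forms_def)

lemmas bivector_left = alt_form2_left[OF bivector_alt subspace_dual_space]
  and bivector_right = alt_form2_right[OF bivector_alt subspace_dual_space]
  and bivector_skew = alt_form2_skew[OF bivector_alt subspace_dual_space]

lemma bivector_scale_left: "\<alpha> \<in> Dual x \<Longrightarrow> \<beta> \<in> Dual x \<Longrightarrow> \<pi> x [a *\<^sub>R \<alpha>, \<beta>] = a * \<pi> x [\<alpha>, \<beta>]"
  using bivector_left[of \<alpha> x \<alpha> \<beta> a 0] by simp

lemma bivector_add_left:
  "\<alpha> \<in> Dual x \<Longrightarrow> \<beta> \<in> Dual x \<Longrightarrow> \<gamma> \<in> Dual x \<Longrightarrow> \<pi> x [\<alpha> + \<beta>, \<gamma>] = \<pi> x [\<alpha>, \<gamma>] + \<pi> x [\<beta>, \<gamma>]"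
  using bivector_left[of \<alpha> x \<beta> \<gamma> 1 1] by simp

lemma bivector_scale_right: "\<alpha> \<in> Dual x \<Longrightarrow> \<beta> \<in> Dual x \<Longrightarrow> \<pi> x [\<beta>, a *\<^sub>R \<alpha>] = a * \<pi> x [\<beta>, \<alpha>]"
  using bivector_right[of \<alpha> x \<alpha> \<beta> a 0] by simp

lemma bivector_add_right:
  "\<alpha> \<in> Dual x \<Longrightarrow> \<beta> \<in> Dual x \<Longrightarrow> \<gamma> \<in> Dual x \<Longrightarrow> \<pi> x [\<gamma>, \<alpha> + \<beta>] = \<pi> x [\<gamma>, \<alpha>] + \<pi> x [\<gamma>, \<beta>]"
  using bivector_right[of \<alpha> x \<beta> \<gamma> 1 1] by simp

lemma bivector_smooth: "\<alpha> \<in> Cos \<Longrightarrow> \<beta> \<in> Cos \<Longrightarrow> (\<lambda>x. \<pi> x [\<alpha> x, \<beta> x]) \<in> Fun"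
proof -
  assume "\<alpha> \<in> Cos" "\<beta> \<in> Cos"
  moreover have "\<forall>Xs. length Xs = 2 \<and> set Xs \<subseteq> Cos \<longrightarrow> (\<lambda>x. \<pi> x (at_point Xs x)) \<in> Fun"
    using bivector by (simp add: forms_def)
  from this[rule_format, of "[\<alpha>, \<beta>]"] have "\<alpha> \<in> Cos \<Longrightarrow> \<beta> \<in> Cos \<Longrightarrow> (\<lambda>x. \<pi> x [\<alpha> x, \<beta> x]) \<in> Fun" by simp
  ultimately show ?thesis by blast
qed

lemma sharp_unique:
  assumes "\<alpha> \<in> Dual x" "v \<in> fib (vbun A) x" "\<And>\<beta>. \<beta> \<in> Dual x \<Longrightarrow> \<beta> v = \<pi> x [\<alpha>, \<beta>]"
  shows "sharp A \<pi> x \<alpha> = v"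
  unfolding sharp_def dual_bundle_simps
  by (rule the_equality) (use assms in \<open>auto intro!: covectors_separate\<close>)

text \<open>Pairing \<pi> with \<alpha> in the first slot is linear over functions in the second,
  hence represented by a section; since covectors separate vectors, that section is the one
  described by \<open>sharp\<close>.\<close>

lemma sharp_section:
  assumes \<alpha>: "\<alpha> \<in> Cos"
  shows "sharp_sec A \<pi> \<alpha> \<in> Sec" "\<beta> \<in> Dual x \<Longrightarrow> \<beta> (sharp A \<pi> x (\<alpha> x)) = \<pi> x [\<alpha> x, \<beta>]"
proof -
  obtain X where X: "X \<in> Sec" "\<forall>\<beta>\<in>Cos. \<forall>x. \<beta> x (X x) = \<pi> x [\<alpha> x, \<beta> x]"
    by (rule dual_representation[where L = "\<lambda>\<beta> x. \<pi> x [\<alpha> x, \<beta> x]"])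
       (use \<alpha> in \<open>simp_all add: fun_eq_iff cosections_dual bivector_add_right bivector_scale_right bivector_smooth\<close>)
  have *: "\<beta> (X x) = \<pi> x [\<alpha> x, \<beta>]" if \<beta>: "\<beta> \<in> Dual x" for \<beta> x
  proof -
    obtain b where "b \<in> Cos" "b x = \<beta>" by (rule covector_through[OF \<beta>])
    then show ?thesis using X(2) by blast
  qed
  have e: "sharp A \<pi> x (\<alpha> x) = X x" for x
    by (rule sharp_unique[OF cosections_dual[OF \<alpha>] sections_fib[OF X(1)] *])
  then show "sharp_sec A \<pi> \<alpha> \<in> Sec" using X(1) by simp
  show "\<beta> (sharp A \<pi> x (\<alpha> x)) = \<pi> x [\<alpha> x, \<beta>]" if "\<beta> \<in> Dual x" using * that by (simp add: e)
qed

lemma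
  assumes "\<alpha> \<in> Dual x"
  shows sharp_fib: "sharp A \<pi> x \<alpha> \<in> fib (vbun A) x"
    and sharp_apply: "\<beta> \<in> Dual x \<Longrightarrow> \<beta> (sharp A \<pi> x \<alpha>) = \<pi> x [\<alpha>, \<beta>]"
proof -
  obtain a where a: "a \<in> Cos" "a x = \<alpha>" by (rule covector_through[OF assms])
  show "sharp A \<pi> x \<alpha> \<in> fib (vbun A) x" using sections_fib[OF sharp_section(1)[OF a(1)], of x] a(2) by simp
  show "\<beta> (sharp A \<pi> x \<alpha>) = \<pi> x [\<alpha>, \<beta>]" if "\<beta> \<in> Dual x" using sharp_section(2)[OF a(1) that] a(2) by simp
qed

lemma sharp_combo:
  assumes "\<alpha> \<in> Dual x" "\<beta> \<in> Dual x"
  shows "sharp A \<pi> x (a *\<^sub>R \<alpha> + b *\<^sub>R \<beta>) = a *\<^sub>R sharp A \<pi> x \<alpha> + b *\<^sub>R sharp A \<pi> x \<beta>"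
proof (rule sharp_unique)
  show "a *\<^sub>R \<alpha> + b *\<^sub>R \<beta> \<in> Dual x"
    using assms by (intro subspace_add subspace_scale subspace_dual_space)
  show "a *\<^sub>R sharp A \<pi> x \<alpha> + b *\<^sub>R sharp A \<pi> x \<beta> \<in> fib (vbun A) x"
    using assms by (intro fib_add fib_scale sharp_fib)
  show "\<gamma> (a *\<^sub>R sharp A \<pi> x \<alpha> + b *\<^sub>R sharp A \<pi> x \<beta>) = \<pi> x [a *\<^sub>R \<alpha> + b *\<^sub>R \<beta>, \<gamma>]" if "\<gamma> \<in> Dual x" for \<gamma>
    using assms that by (simp add: dual_space_combo sharp_fib sharp_apply bivector_left)
qed

lemma sharp_scale: "\<alpha> \<in> Dual x \<Longrightarrow> sharp A \<pi> x (a *\<^sub>R \<alpha>) = a *\<^sub>R sharp A \<pi> x \<alpha>"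
  using sharp_combo[of \<alpha> x \<alpha> a 0] by simp

text \<open>The bracket of \<alpha> and \<beta> paired with Z, all Lie derivatives and differentials
  expanded. The last three terms are the whole effect of \<open>\<phi>\<^sub>0\<close>. Having a
  formula in terms of anchor and bracket of \<open>A\<close> reduces every axiom of the dual
  algebroid to a computation.\<close>

definition dual_bracket_at :: "('m \<Rightarrow> 'v \<Rightarrow> real) \<Rightarrow> ('m \<Rightarrow> 'v \<Rightarrow> real) \<Rightarrow> ('m \<Rightarrow> 'v) \<Rightarrow> 'm \<Rightarrow> real" where
  "dual_bracket_at \<alpha> \<beta> Z x =
    anchor_fun A (sharp_sec A \<pi> \<alpha>) (\<lambda>y. \<beta> y (Z y)) x - \<beta> x (bracket A (sharp_sec A \<pi> \<alpha>) Z x) -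
    anchor_fun A (sharp_sec A \<pi> \<beta>) (\<lambda>y. \<alpha> y (Z y)) x + \<alpha> x (bracket A (sharp_sec A \<pi> \<beta>) Z x) -
    anchor_fun A Z (\<lambda>y. \<pi> y [\<alpha> y, \<beta> y]) x +
    \<phi>\<^sub>0 x (sharp A \<pi> x (\<alpha> x)) * \<beta> x (Z x) - \<phi>\<^sub>0 x (sharp A \<pi> x (\<beta> x)) * \<alpha> x (Z x) -
    \<phi>\<^sub>0 x (Z x) * \<pi> x [\<alpha> x, \<beta> x]"

lemma aforms_outside: "\<omega> \<in> aforms A k \<Longrightarrow> \<not> set vs \<subseteq> fib (vbun A) x \<Longrightarrow> \<omega> x vs = 0"
  unfolding forms_def alt_forms_def by simp

text \<open>Two cancellations shape the first formula: the derivative of \<beta>(X) along Z occurs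
  in both halves of the Cartan formula with opposite signs, and so does
  \<open>\<phi>\<^sub>0\<close>(Z) \<beta>(X), leaving \<open>\<phi>\<^sub>0\<close>(X) \<beta>(Z).
  The second claim is needed because a covector must vanish off its fibre.\<close>

lemma lie_deriv_phi_1:
  assumes X: "X \<in> Sec" and \<beta>: "\<beta> \<in> Cos"
  shows "Z \<in> Sec \<Longrightarrow> lie_deriv_phi A \<phi>\<^sub>0 1 X (form1 \<beta>) x [Z x] =
      anchor_fun A X (\<lambda>y. \<beta> y (Z y)) x - \<beta> x (bracket A X Z x) + \<phi>\<^sub>0 x (X x) * \<beta> x (Z x)"
    and "v \<notin> fib (vbun A) x \<Longrightarrow> lie_deriv_phi A \<phi>\<^sub>0 1 X (form1 \<beta>) x [v] = 0"
proof -
  have f: "(\<lambda>x. \<beta> x (X x)) \<in> Fun" by (rule cosections_pairing[OF \<beta> X])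
  have l: "lie_deriv_phi A \<phi>\<^sub>0 1 X (form1 \<beta>) x [v] =
      ext_d A 1 (form1 \<beta>) x [X x, v] + wedge 1 1 (form1 \<phi>\<^sub>0) (form1 \<beta>) x [X x, v] +
      (ext_d A 0 (form0 (\<lambda>x. \<beta> x (X x))) x [v] + wedge 1 0 (form1 \<phi>\<^sub>0) (form0 (\<lambda>x. \<beta> x (X x))) x [v])" for v
    unfolding lie_deriv_phi_def contract_form1 d_phi_def diff_self_eq_0 by (simp add: contract_def)
  show "lie_deriv_phi A \<phi>\<^sub>0 1 X (form1 \<beta>) x [Z x] =
      anchor_fun A X (\<lambda>y. \<beta> y (Z y)) x - \<beta> x (bracket A X Z x) + \<phi>\<^sub>0 x (X x) * \<beta> x (Z x)" if Z: "Z \<in> Sec"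
    unfolding l wedge_1_0 wedge_1_1 ext_d_1_apply[OF \<beta> X Z] ext_d_0_apply[OF f Z] by simp
  show "lie_deriv_phi A \<phi>\<^sub>0 1 X (form1 \<beta>) x [v] = 0" if v: "v \<notin> fib (vbun A) x"
  proof -
    have "\<phi>\<^sub>0 x v = 0" "\<beta> x v = 0"
      using v cosections_dual[OF \<phi>] cosections_dual[OF \<beta>] by (simp_all add: dual_space_def)
    moreover have "ext_d A 1 (form1 \<beta>) x [X x, v] = 0"
      by (rule aforms_outside[OF ext_d_1_form[OF \<beta>]]) (use v in simp)
    moreover have "ext_d A 0 (form0 (\<lambda>x. \<beta> x (X x))) x [v] = 0"
      by (rule aforms_outside[OF ext_d_0(2)[OF f]]) (use v in simp)
    ultimately show ?thesis unfolding l wedge_1_0 wedge_1_1 by simp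
  qed
qed

lemma bracket_pi_phi_apply:
  assumes \<alpha>: "\<alpha> \<in> Cos" and \<beta>: "\<beta> \<in> Cos"
  shows "Z \<in> Sec \<Longrightarrow> bracket_pi_phi A \<phi>\<^sub>0 \<pi> \<alpha> \<beta> x (Z x) = dual_bracket_at \<alpha> \<beta> Z x"
    and "v \<notin> fib (vbun A) x \<Longrightarrow> bracket_pi_phi A \<phi>\<^sub>0 \<pi> \<alpha> \<beta> x v = 0"
proof -
  note sa = sharp_section(1)[OF \<alpha>] and sb = sharp_section(1)[OF \<beta>]
  have p: "(\<lambda>x. \<beta> x (sharp A \<pi> x (\<alpha> x))) = (\<lambda>x. \<pi> x [\<alpha> x, \<beta> x])"
    using sharp_section(2)[OF \<alpha> cosections_dual[OF \<beta>]] by simp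
  have f: "(\<lambda>x. \<pi> x [\<alpha> x, \<beta> x]) \<in> Fun" by (rule bivector_smooth[OF \<alpha> \<beta>])
  have l: "bracket_pi_phi A \<phi>\<^sub>0 \<pi> \<alpha> \<beta> x v = lie_deriv_phi A \<phi>\<^sub>0 1 (sharp_sec A \<pi> \<alpha>) (form1 \<beta>) x [v] -
      lie_deriv_phi A \<phi>\<^sub>0 1 (sharp_sec A \<pi> \<beta>) (form1 \<alpha>) x [v] -
      (ext_d A 0 (form0 (\<lambda>x. \<pi> x [\<alpha> x, \<beta> x])) x [v] +
       wedge 1 0 (form1 \<phi>\<^sub>0) (form0 (\<lambda>x. \<pi> x [\<alpha> x, \<beta> x])) x [v])" for v
    unfolding bracket_pi_phi_def covector_def p by (simp add: d_phi_def)
  show "bracket_pi_phi A \<phi>\<^sub>0 \<pi> \<alpha> \<beta> x (Z x) = dual_bracket_at \<alpha> \<beta> Z x" if Z: "Z \<in> Sec"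
    unfolding l lie_deriv_phi_1(1)[OF sa \<beta> Z] lie_deriv_phi_1(1)[OF sb \<alpha> Z] ext_d_0_apply[OF f Z] wedge_1_0
      dual_bracket_at_def by simp
  show "bracket_pi_phi A \<phi>\<^sub>0 \<pi> \<alpha> \<beta> x v = 0" if v: "v \<notin> fib (vbun A) x"
  proof -
    have "\<phi>\<^sub>0 x v = 0" using v cosections_dual[OF \<phi>] by (simp add: dual_space_def)
    moreover have "ext_d A 0 (form0 (\<lambda>x. \<pi> x [\<alpha> x, \<beta> x])) x [v] = 0"
      by (rule aforms_outside[OF ext_d_0(2)[OF f]]) (use v in simp)
    ultimately show ?thesis
      unfolding l lie_deriv_phi_1(2)[OF sa \<beta> v] lie_deriv_phi_1(2)[OF sb \<alpha> v] wedge_1_0 by simp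
  qed
qed

lemma
  assumes \<alpha>: "\<alpha> \<in> Cos"
  shows cosec_add: "v \<in> fib (vbun A) x \<Longrightarrow> w \<in> fib (vbun A) x \<Longrightarrow> \<alpha> x (v + w) = \<alpha> x v + \<alpha> x w"
    and cosec_scale: "v \<in> fib (vbun A) x \<Longrightarrow> \<alpha> x (a *\<^sub>R v) = a * \<alpha> x v"
    and cosec_diff: "v \<in> fib (vbun A) x \<Longrightarrow> w \<in> fib (vbun A) x \<Longrightarrow> \<alpha> x (v - w) = \<alpha> x v - \<alpha> x w"
  using dual_space_add[OF subspace_fib cosections_dual[OF \<alpha>]] dual_space_scale[OF subspace_fib cosections_dual[OF \<alpha>]]
    dual_space_diff[OF subspace_fib cosections_dual[OF \<alpha>]]
  by blast+

lemma
  assumes \<alpha>: "\<alpha> \<in> Cos" and \<beta>: "\<beta> \<in> Cos"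
  shows dual_bracket_at_add: "Z \<in> Sec \<Longrightarrow> W \<in> Sec \<Longrightarrow>
      dual_bracket_at \<alpha> \<beta> (\<lambda>x. Z x + W x) x = dual_bracket_at \<alpha> \<beta> Z x + dual_bracket_at \<alpha> \<beta> W x"
    and dual_bracket_at_cscale: "Z \<in> Sec \<Longrightarrow> dual_bracket_at \<alpha> \<beta> (\<lambda>x. c *\<^sub>R Z x) x = c * dual_bracket_at \<alpha> \<beta> Z x"
    and dual_bracket_at_smooth: "Z \<in> Sec \<Longrightarrow> dual_bracket_at \<alpha> \<beta> Z \<in> Fun"
    and dual_bracket_at_skew: "Z \<in> Sec \<Longrightarrow> dual_bracket_at \<alpha> \<beta> Z x = - dual_bracket_at \<beta> \<alpha> Z x"
proof -
  note s = sharp_section(1)[OF \<alpha>] sharp_section(1)[OF \<beta>]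
  note lin = cosec_add[OF \<alpha>] cosec_add[OF \<beta>] cosec_add[OF \<phi>] cosec_scale[OF \<alpha>] cosec_scale[OF \<beta>] cosec_scale[OF \<phi>]
  show "dual_bracket_at \<alpha> \<beta> (\<lambda>x. Z x + W x) x = dual_bracket_at \<alpha> \<beta> Z x + dual_bracket_at \<alpha> \<beta> W x"
    if "Z \<in> Sec" "W \<in> Sec"
    using that s \<alpha> \<beta>
    by (simp add: dual_bracket_at_def lin sections_fib bracket_fib bracket_add_right anchor_fun_add cosections_pairing
        anchor_fun_sec_add bivector_smooth algebra_simps)
  show "dual_bracket_at \<alpha> \<beta> (\<lambda>x. c *\<^sub>R Z x) x = c * dual_bracket_at \<alpha> \<beta> Z x" if Z: "Z \<in> Sec"
  proof -
    have "bracket A X (\<lambda>x. c *\<^sub>R Z x) x = c *\<^sub>R bracket A X Z x" if "X \<in> Sec" for X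
      using bracket_scale_right[OF that Z smooth_funs_const[of c]] anchor_fun_const[OF that smooth_funs_const[of 0]]
      by simp
    then show ?thesis
      using Z s \<alpha> \<beta>
      by (simp add: dual_bracket_at_def lin sections_fib bracket_fib anchor_fun_cmult cosections_pairing
          anchor_fun_sec_scale bivector_smooth algebra_simps)
  qed
  show "dual_bracket_at \<alpha> \<beta> Z \<in> Fun" if Z: "Z \<in> Sec"
    unfolding dual_bracket_at_def[abs_def]
    by (intro smooth_funs_diff smooth_funs_add smooth_funs_mult
        anchor_fun_smooth[OF s(1) cosections_pairing[OF \<beta> Z]] anchor_fun_smooth[OF s(2) cosections_pairing[OF \<alpha> Z]]
        cosections_pairing[OF \<beta> bracket_sec[OF s(1) Z]] cosections_pairing[OF \<alpha> bracket_sec[OF s(2) Z]]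
        anchor_fun_smooth[OF Z bivector_smooth[OF \<alpha> \<beta>]] bivector_smooth[OF \<alpha> \<beta>]
        cosections_pairing[OF \<phi> s(1)] cosections_pairing[OF \<phi> s(2)] cosections_pairing[OF \<phi> Z]
        cosections_pairing[OF \<alpha> Z] cosections_pairing[OF \<beta> Z])
  show "dual_bracket_at \<alpha> \<beta> Z x = - dual_bracket_at \<beta> \<alpha> Z x" if "Z \<in> Sec"
  proof -
    have p: "\<pi> y [\<beta> y, \<alpha> y] = - \<pi> y [\<alpha> y, \<beta> y]" for y
      using bivector_skew cosections_dual \<alpha> \<beta> by blast
    show ?thesis
      using anchor_fun_minus[OF that bivector_smooth[OF \<alpha> \<beta>], of x]
      by (simp add: dual_bracket_at_def p)
  qed
qed

lemma bracket_pi_phi_cosec: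
  assumes \<alpha>: "\<alpha> \<in> Cos" and \<beta>: "\<beta> \<in> Cos"
  shows "bracket_pi_phi A \<phi>\<^sub>0 \<pi> \<alpha> \<beta> \<in> Cos"
proof (rule cosectionsI)
  fix x
  note app = bracket_pi_phi_apply[OF \<alpha> \<beta>]
  have "bracket_pi_phi A \<phi>\<^sub>0 \<pi> \<alpha> \<beta> x (a *\<^sub>R v + b *\<^sub>R w) =
      a * bracket_pi_phi A \<phi>\<^sub>0 \<pi> \<alpha> \<beta> x v + b * bracket_pi_phi A \<phi>\<^sub>0 \<pi> \<alpha> \<beta> x w"
    if v: "v \<in> fib (vbun A) x" and w: "w \<in> fib (vbun A) x" for a b v w
  proof -
    obtain Z where Z: "Z \<in> Sec" "Z x = v" by (rule section_through[OF v])
    obtain W where W: "W \<in> Sec" "W x = w" by (rule section_through[OF w])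
    have m: "(\<lambda>y. a *\<^sub>R Z y) \<in> Sec" "(\<lambda>y. b *\<^sub>R W y) \<in> Sec" using Z W by (auto intro: sections_cscale)
    have "bracket_pi_phi A \<phi>\<^sub>0 \<pi> \<alpha> \<beta> x (a *\<^sub>R Z x + b *\<^sub>R W x) = a * dual_bracket_at \<alpha> \<beta> Z x + b * dual_bracket_at \<alpha> \<beta> W x"
      using app(1)[OF sections_add[OF m], of x] dual_bracket_at_add[OF \<alpha> \<beta> m, of x] Z W
      by (simp add: dual_bracket_at_cscale[OF \<alpha> \<beta>])
    then show ?thesis using app(1)[OF Z(1), of x] app(1)[OF W(1), of x] by (simp add: Z W)
  qed
  then show "bracket_pi_phi A \<phi>\<^sub>0 \<pi> \<alpha> \<beta> x \<in> Dual x"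
    using app(2) by (simp add: dual_space_def)
next
  fix Z assume Z: "Z \<in> Sec"
  then show "(\<lambda>x. bracket_pi_phi A \<phi>\<^sub>0 \<pi> \<alpha> \<beta> x (Z x)) \<in> Fun"
    using dual_bracket_at_smooth[OF \<alpha> \<beta> Z] by (simp add: bracket_pi_phi_apply(1)[OF \<alpha> \<beta> Z])
qed

lemma bracket_pi_phi_eqI:
  assumes "\<alpha> \<in> Cos" "\<beta> \<in> Cos" "\<gamma> \<in> Dual x"
    and "\<And>Z. Z \<in> Sec \<Longrightarrow> dual_bracket_at \<alpha> \<beta> Z x = \<gamma> (Z x)"
  shows "bracket_pi_phi A \<phi>\<^sub>0 \<pi> \<alpha> \<beta> x = \<gamma>"
  by (rule dual_space_eqI[OF cosections_dual[OF bracket_pi_phi_cosec[OF assms(1,2)]] assms(3)])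
     (simp add: bracket_pi_phi_apply assms)

text \<open>The axioms for the anchor are inherited through the linearity of \<open>sharp\<close>;
  the identities between brackets are checked after pairing with an arbitrary section Z, where
  \<open>dual_bracket_at\<close> is explicit.\<close>

lemma skew_algebroid_dual: "skew_algebroid (dual_algebroid_phi A \<phi>\<^sub>0 \<pi>)"
  unfolding skew_algebroid_def bundle_map_to_TM_def dual_algebroid_phi_simps anchor_fun_dual_algebroid_phi
proof (intro conjI ballI allI)
  interpret D: bundle_over "base A" "dual_bundle (vbun A)" by (rule bundle_over_dual)
  show "smooth_manifold (base A)" by (rule smooth_manifold)
  show "vector_bundle (base A) (dual_bundle (vbun A))" by (rule vector_bundle_dual)
  show "anchor A x (sharp A \<pi> x \<alpha>) \<in> tangent_vectors (base A) x" if "\<alpha> \<in> fib (dual_bundle (vbun A)) x" for x \<alpha>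
    using that by (simp add: anchor_tangent sharp_fib)
  show "anchor A x (sharp A \<pi> x (a *\<^sub>R \<alpha> + b *\<^sub>R \<beta>)) f =
      a * anchor A x (sharp A \<pi> x \<alpha>) f + b * anchor A x (sharp A \<pi> x \<beta>) f"
    if "\<alpha> \<in> fib (dual_bundle (vbun A)) x" "\<beta> \<in> fib (dual_bundle (vbun A)) x" "f \<in> Fun" for x \<alpha> \<beta> a b f
    using that by (simp add: sharp_combo anchor_combo sharp_fib)
  show "anchor_fun A (sharp_sec A \<pi> \<alpha>) f \<in> Fun" if "\<alpha> \<in> Cos" "f \<in> Fun" for \<alpha> f
    using that by (intro anchor_fun_smooth sharp_section)
  show "bracket_pi_phi A \<phi>\<^sub>0 \<pi> \<alpha> \<beta> \<in> Cos" if "\<alpha> \<in> Cos" "\<beta> \<in> Cos" for \<alpha> \<beta>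
    using that by (rule bracket_pi_phi_cosec)
  have neg: "- \<gamma> \<in> Dual x" if "\<gamma> \<in> Dual x" for x \<gamma>
    using subspace_neg[OF subspace_dual_space that] by simp
  show "bracket_pi_phi A \<phi>\<^sub>0 \<pi> \<alpha> \<beta> = - bracket_pi_phi A \<phi>\<^sub>0 \<pi> \<beta> \<alpha>" if "\<alpha> \<in> Cos" "\<beta> \<in> Cos" for \<alpha> \<beta>
  proof
    fix x
    have "bracket_pi_phi A \<phi>\<^sub>0 \<pi> \<alpha> \<beta> x = - bracket_pi_phi A \<phi>\<^sub>0 \<pi> \<beta> \<alpha> x"
      by (rule bracket_pi_phi_eqI[OF that neg[OF cosections_dual[OF bracket_pi_phi_cosec[OF that(2,1)]]]])
         (simp add: bracket_pi_phi_apply that dual_bracket_at_skew[of \<alpha> \<beta>])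
    then show "bracket_pi_phi A \<phi>\<^sub>0 \<pi> \<alpha> \<beta> x = (- bracket_pi_phi A \<phi>\<^sub>0 \<pi> \<beta> \<alpha>) x" by simp
  qed
  show "bracket_pi_phi A \<phi>\<^sub>0 \<pi> (a *\<^sub>R \<alpha> + b *\<^sub>R \<beta>) \<gamma> =
      a *\<^sub>R bracket_pi_phi A \<phi>\<^sub>0 \<pi> \<alpha> \<gamma> + b *\<^sub>R bracket_pi_phi A \<phi>\<^sub>0 \<pi> \<beta> \<gamma>"
    if \<alpha>: "\<alpha> \<in> Cos" and \<beta>: "\<beta> \<in> Cos" and \<gamma>: "\<gamma> \<in> Cos" for \<alpha> \<beta> \<gamma> a b
  proof
    fix x
    let ?\<delta> = "\<lambda>x. a *\<^sub>R \<alpha> x + b *\<^sub>R \<beta> x"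
    have e: "a *\<^sub>R \<alpha> + b *\<^sub>R \<beta> = ?\<delta>" by (simp add: fun_eq_iff scaleR_fun_apply)
    have \<delta>: "?\<delta> \<in> Cos" using \<alpha> \<beta> by (intro D.sections_add D.sections_cscale)
    have sh: "sharp_sec A \<pi> ?\<delta> = (\<lambda>x. a *\<^sub>R sharp A \<pi> x (\<alpha> x) + b *\<^sub>R sharp A \<pi> x (\<beta> x))"
      using \<alpha> \<beta> by (simp add: sharp_combo cosections_dual)
    have "bracket_pi_phi A \<phi>\<^sub>0 \<pi> ?\<delta> \<gamma> x =
        a *\<^sub>R bracket_pi_phi A \<phi>\<^sub>0 \<pi> \<alpha> \<gamma> x + b *\<^sub>R bracket_pi_phi A \<phi>\<^sub>0 \<pi> \<beta> \<gamma> x"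
    proof (rule bracket_pi_phi_eqI[OF \<delta> \<gamma>])
      show "a *\<^sub>R bracket_pi_phi A \<phi>\<^sub>0 \<pi> \<alpha> \<gamma> x + b *\<^sub>R bracket_pi_phi A \<phi>\<^sub>0 \<pi> \<beta> \<gamma> x \<in> Dual x"
        using \<alpha> \<beta> \<gamma> by (intro subspace_add subspace_scale subspace_dual_space cosections_dual bracket_pi_phi_cosec)
      fix Z assume Z: "Z \<in> Sec"
      note s = sharp_section(1)[OF \<alpha>] sharp_section(1)[OF \<beta>] sharp_section(1)[OF \<gamma>]
      have d: "\<alpha> y \<in> Dual y" "\<beta> y \<in> Dual y" "\<gamma> y \<in> Dual y" for y using \<alpha> \<beta> \<gamma> by (auto intro: cosections_dual)
      have f: "(\<lambda>y. \<alpha> y (Z y)) \<in> Fun" "(\<lambda>y. \<beta> y (Z y)) \<in> Fun" "(\<lambda>y. \<gamma> y (Z y)) \<in> Fun"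
        "(\<lambda>y. \<pi> y [\<alpha> y, \<gamma> y]) \<in> Fun" "(\<lambda>y. \<pi> y [\<beta> y, \<gamma> y]) \<in> Fun"
        using \<alpha> \<beta> \<gamma> Z by (auto intro: cosections_pairing bivector_smooth)
      have c: "anchor_fun A X (\<lambda>y. a * p y + b * q y) x = a * anchor_fun A X p x + b * anchor_fun A X q x"
        if "X \<in> Sec" "p \<in> Fun" "q \<in> Fun" for X p q
        using that by (simp add: anchor_fun_add anchor_fun_cmult smooth_funs_mult smooth_funs_const)
      have r: "anchor_fun A (\<lambda>x. a *\<^sub>R sharp A \<pi> x (\<alpha> x) + b *\<^sub>R sharp A \<pi> x (\<beta> x)) p x =
          a * anchor_fun A (sharp_sec A \<pi> \<alpha>) p x + b * anchor_fun A (sharp_sec A \<pi> \<beta>) p x" if "p \<in> Fun" for p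
        using that d by (simp add: anchor_fun_def anchor_combo sharp_fib)
      have b1: "bracket A (\<lambda>x. a *\<^sub>R sharp A \<pi> x (\<alpha> x) + b *\<^sub>R sharp A \<pi> x (\<beta> x)) Z x =
          a *\<^sub>R bracket A (sharp_sec A \<pi> \<alpha>) Z x + b *\<^sub>R bracket A (sharp_sec A \<pi> \<beta>) Z x"
        by (rule bracket_combo_left[OF s(1,2) Z])
      have g: "\<gamma> x (a *\<^sub>R v + b *\<^sub>R w) = a * \<gamma> x v + b * \<gamma> x w"
          "\<phi>\<^sub>0 x (a *\<^sub>R v + b *\<^sub>R w) = a * \<phi>\<^sub>0 x v + b * \<phi>\<^sub>0 x w"
        if "v \<in> fib (vbun A) x" "w \<in> fib (vbun A) x" for v w
        using that \<gamma> \<phi> by (auto intro!: dual_space_combo cosections_dual)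
      have ev: "(a *\<^sub>R \<xi>) v = a * \<xi> v" for a v and \<xi> :: "'v \<Rightarrow> real"
        by (simp add: scaleR_fun_apply)
      show "dual_bracket_at ?\<delta> \<gamma> Z x =
          (a *\<^sub>R bracket_pi_phi A \<phi>\<^sub>0 \<pi> \<alpha> \<gamma> x + b *\<^sub>R bracket_pi_phi A \<phi>\<^sub>0 \<pi> \<beta> \<gamma> x) (Z x)"
        using Z \<alpha> \<beta> \<gamma>
        by (simp add: scaleR_fun_apply bracket_pi_phi_apply)
           (simp add: dual_bracket_at_def sh[unfolded fun_eq_iff, rule_format] ev r f b1 g c s Z bivector_left d
             bracket_fib sharp_fib algebra_simps)
    qed
    then show "bracket_pi_phi A \<phi>\<^sub>0 \<pi> (a *\<^sub>R \<alpha> + b *\<^sub>R \<beta>) \<gamma> x =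
      (a *\<^sub>R bracket_pi_phi A \<phi>\<^sub>0 \<pi> \<alpha> \<gamma> + b *\<^sub>R bracket_pi_phi A \<phi>\<^sub>0 \<pi> \<beta> \<gamma>) x"
      unfolding e by (simp add: scaleR_fun_apply)
  qed
  show "bracket_pi_phi A \<phi>\<^sub>0 \<pi> \<alpha> (\<lambda>x. f x *\<^sub>R \<beta> x) =
      (\<lambda>x. f x *\<^sub>R bracket_pi_phi A \<phi>\<^sub>0 \<pi> \<alpha> \<beta> x + anchor_fun A (sharp_sec A \<pi> \<alpha>) f x *\<^sub>R \<beta> x)"
    if \<alpha>: "\<alpha> \<in> Cos" and \<beta>: "\<beta> \<in> Cos" and f: "f \<in> Fun" for \<alpha> \<beta> f
  proof
    fix x
    let ?\<delta> = "\<lambda>x. f x *\<^sub>R \<beta> x"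
    have \<delta>: "?\<delta> \<in> Cos" using \<beta> f by (intro D.sections_scale)
    have sh: "sharp A \<pi> x (f x *\<^sub>R \<beta> x) = f x *\<^sub>R sharp A \<pi> x (\<beta> x)" for x
      using \<beta> by (simp add: sharp_scale cosections_dual)
    show "bracket_pi_phi A \<phi>\<^sub>0 \<pi> \<alpha> ?\<delta> x =
        f x *\<^sub>R bracket_pi_phi A \<phi>\<^sub>0 \<pi> \<alpha> \<beta> x + anchor_fun A (sharp_sec A \<pi> \<alpha>) f x *\<^sub>R \<beta> x"
    proof (rule bracket_pi_phi_eqI[OF \<alpha> \<delta>])
      show "f x *\<^sub>R bracket_pi_phi A \<phi>\<^sub>0 \<pi> \<alpha> \<beta> x + anchor_fun A (sharp_sec A \<pi> \<alpha>) f x *\<^sub>R \<beta> x \<in> Dual x"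
        using \<alpha> \<beta> by (intro subspace_add subspace_scale subspace_dual_space cosections_dual bracket_pi_phi_cosec)
      fix Z assume Z: "Z \<in> Sec"
      note s = sharp_section(1)[OF \<alpha>] sharp_section(1)[OF \<beta>]
      have d: "\<alpha> y \<in> Dual y" "\<beta> y \<in> Dual y" for y using \<alpha> \<beta> by (auto intro: cosections_dual)
      have g: "(\<lambda>y. \<alpha> y (Z y)) \<in> Fun" "(\<lambda>y. \<beta> y (Z y)) \<in> Fun" "(\<lambda>y. \<pi> y [\<alpha> y, \<beta> y]) \<in> Fun"
        using \<alpha> \<beta> Z by (auto intro: cosections_pairing bivector_smooth)
      have ev: "(f y *\<^sub>R \<beta> y) v = f y * \<beta> y v" for y v
        by (simp add: scaleR_fun_apply)
      \<comment> \<open>This sign is what makes the Leibniz rule work: the derivative of f along Z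
        appears with factor \<pi>(\<alpha>, \<beta>) once through [f \<pi>-sharp \<beta>, Z] and
        once, negatively, through the derivative of f \<pi>(\<alpha>, \<beta>).\<close>
      have p: "\<alpha> x (sharp A \<pi> x (\<beta> x)) = - \<pi> x [\<alpha> x, \<beta> x]"
        using sharp_apply[of "\<beta> x" x "\<alpha> x"] bivector_skew[of "\<beta> x" x "\<alpha> x"] d by simp
      have pr: "\<pi> y [\<alpha> y, f y *\<^sub>R \<beta> y] = f y * \<pi> y [\<alpha> y, \<beta> y]" for y
        using d by (simp add: bivector_scale_right)
      have b: "bracket A (\<lambda>y. f y *\<^sub>R sharp A \<pi> y (\<beta> y)) Z x =
          f x *\<^sub>R bracket A (sharp_sec A \<pi> \<beta>) Z x - anchor_fun A Z f x *\<^sub>R sharp A \<pi> x (\<beta> x)"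
        by (rule bracket_scale_left[OF s(2) Z f])
      have a: "anchor_fun A (\<lambda>y. f y *\<^sub>R sharp A \<pi> y (\<beta> y)) q x = f x * anchor_fun A (sharp_sec A \<pi> \<beta>) q x"
        if "q \<in> Fun" for q
        by (rule anchor_fun_sec_scale[OF s(2) that])
      have fb: "bracket A (sharp_sec A \<pi> \<beta>) Z x \<in> fib (vbun A) x" by (rule bracket_fib[OF s(2) Z])
      have sf: "sharp A \<pi> x (\<beta> x) \<in> fib (vbun A) x" using d by (simp add: sharp_fib)
      show "dual_bracket_at \<alpha> ?\<delta> Z x =
          (f x *\<^sub>R bracket_pi_phi A \<phi>\<^sub>0 \<pi> \<alpha> \<beta> x + anchor_fun A (sharp_sec A \<pi> \<alpha>) f x *\<^sub>R \<beta> x) (Z x)"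
        using Z \<alpha> \<beta>
        by (simp add: scaleR_fun_apply bracket_pi_phi_apply)
           (simp add: dual_bracket_at_def sh ev pr a b g f s Z fb sf anchor_fun_mult
             cosec_diff[OF \<alpha>] cosec_scale[OF \<alpha>] cosec_scale[OF \<phi>] fib_scale p algebra_simps)
    qed
  qed
qed

end

section \<open>The product with the real line\<close>

lemma Ck_on_fst_compose:
  fixes f :: "'e::{real_inner,heine_borel} \<Rightarrow> 'f::real_normed_vector"
  assumes "open S" "Ck_on k S f"
  shows "Ck_on k (S \<times> (UNIV :: real set)) (\<lambda>q. f (fst q))"
  by (rule Ck_on_compose[OF open_Times[OF assms(1) open_UNIV] assms(1) _ assms(2)])
     (auto intro!: Ck_on_bounded_linear bounded_linear_fst open_Times assms)

lemma Ck_on_Pair_const: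
  assumes "open S"
  shows "Ck_on k S (\<lambda>p::'e::real_normed_vector. (p, t::real))"
proof -
  have "Ck_on k S (\<lambda>p::'e. (p, 0) + (0, t))"
    by (intro Ck_on_add Ck_on_const Ck_on_bounded_linear bounded_linear_Pair bounded_linear_ident
        bounded_linear_zero assms)
  then show ?thesis by simp
qed

section \<open>Charts, smooth functions and tangent vectors on the product\<close>

context manifold
begin

lemma tilde_chart_inv:
  assumes "(U, \<phi>) \<in> C" "p \<in> \<phi> ` U"
  shows "inv_into (U \<times> UNIV) (\<lambda>(x, t). (\<phi> x, t)) (p, s) = (inv_into U \<phi> p, s)"
proof (rule inv_into_f_eq)
  show "inj_on (\<lambda>(x, t). (\<phi> x, t)) (U \<times> UNIV)"
    using inj_onD[OF chart_inj[OF assms(1)]] by (auto simp: inj_on_def)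
  show "(inv_into U \<phi> p, s) \<in> U \<times> UNIV" using assms(2) by (simp add: inv_into_into)
  show "(\<lambda>(x, t). (\<phi> x, t)) (inv_into U \<phi> p, s) = (p, s)" using assms(2) by (simp add: f_inv_into_f)
qed

lemma tilde_chart_image: "(\<lambda>(x, t). (\<phi> x, t)) ` (U \<times> UNIV) = \<phi> ` U \<times> UNIV"
  by force

lemma smooth_manifold_tilde: "smooth_manifold (tilde_atlas C :: ('m \<times> real, 'e \<times> real) atlas)"
  unfolding smooth_manifold_def
proof (intro conjI)
  have "(x, t) \<in> (\<Union>(U, \<phi>)\<in>tilde_atlas C. U)" for x and t :: real
  proof -
    obtain U \<phi> where "(U, \<phi>) \<in> C" "x \<in> U" by (rule chart_exists)
    then show ?thesis by (force simp: tilde_atlas_def)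
  qed
  then show "(\<Union>(U, \<phi>)\<in>(tilde_atlas C :: ('m \<times> real, 'e \<times> real) atlas). U) = UNIV" by fast
  have "open (U \<times> (UNIV :: real set)) \<and> open ((\<lambda>(x, t). (\<phi> x, t)) ` (U \<times> (UNIV :: real set))) \<and>
      homeomorphism (U \<times> (UNIV :: real set)) ((\<lambda>(x, t). (\<phi> x, t)) ` (U \<times> UNIV)) (\<lambda>(x, t). (\<phi> x, t))
        (inv_into (U \<times> UNIV) (\<lambda>(x, t). (\<phi> x, t)))" if c: "(U, \<phi>) \<in> C" for U \<phi>
  proof (intro conjI)
    show "open (U \<times> (UNIV :: real set))" using chart_open[OF c] by (simp add: open_Times)
    show "open ((\<lambda>(x, t). (\<phi> x, t)) ` (U \<times> (UNIV :: real set)))"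
      unfolding tilde_chart_image using chart_open_image[OF c] by (simp add: open_Times)
    show "homeomorphism (U \<times> (UNIV :: real set)) ((\<lambda>(x, t). (\<phi> x, t)) ` (U \<times> UNIV)) (\<lambda>(x, t). (\<phi> x, t))
        (inv_into (U \<times> UNIV) (\<lambda>(x, t). (\<phi> x, t)))"
      unfolding tilde_chart_image
    proof (rule homeomorphismI)
      show "continuous_on (U \<times> (UNIV :: real set)) (\<lambda>(x, t). (\<phi> x, t))"
        unfolding case_prod_beta
        by (intro continuous_on_Pair continuous_on_compose2[OF chart_continuous[OF c]] continuous_intros) auto
      have "continuous_on (\<phi> ` U \<times> (UNIV :: real set)) (\<lambda>q. (inv_into U \<phi> (fst q), snd q))"
        by (intro continuous_on_Pair continuous_on_compose2[OF chart_inv_continuous[OF c]] continuous_intros) auto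
      then show "continuous_on (\<phi> ` U \<times> (UNIV :: real set)) (inv_into (U \<times> UNIV) (\<lambda>(x, t). (\<phi> x, t)))"
        by (rule continuous_on_eq) (auto simp: tilde_chart_inv[OF c])
      show "(\<lambda>(x, t). (\<phi> x, t)) ` (U \<times> (UNIV :: real set)) \<subseteq> \<phi> ` U \<times> UNIV" by auto
      show "inv_into (U \<times> UNIV) (\<lambda>(x, t). (\<phi> x, t)) ` (\<phi> ` U \<times> (UNIV :: real set)) \<subseteq> U \<times> UNIV"
        by (auto simp: tilde_chart_inv[OF c] inv_into_into chart_inv[OF c])
      show "inv_into (U \<times> UNIV) (\<lambda>(x, t). (\<phi> x, t)) ((\<lambda>(x, t). (\<phi> x, t)) q) = q"
        if "q \<in> U \<times> (UNIV :: real set)" for q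
        using that by (auto simp: tilde_chart_inv[OF c] chart_inv[OF c])
      show "(\<lambda>(x, t). (\<phi> x, t)) (inv_into (U \<times> UNIV) (\<lambda>(x, t). (\<phi> x, t)) q) = q"
        if "q \<in> \<phi> ` U \<times> (UNIV :: real set)" for q
        using that by (auto simp: tilde_chart_inv[OF c] chart_inv[OF c])
    qed
  qed
  then show "\<forall>(U, \<phi>)\<in>(tilde_atlas C :: ('m \<times> real, 'e \<times> real) atlas).
      open U \<and> open (\<phi> ` U) \<and> homeomorphism U (\<phi> ` U) \<phi> (inv_into U \<phi>)"
    unfolding tilde_atlas_def by fast
  have "Cinf_on ((\<lambda>(x, t). (\<phi> x, t)) ` ((U \<times> (UNIV :: real set)) \<inter> (V \<times> UNIV)))
      ((\<lambda>(x, t). (\<psi> x, t)) \<circ> inv_into (U \<times> UNIV) (\<lambda>(x, t). (\<phi> x, t)))"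
    if c: "(U, \<phi>) \<in> C" and d: "(V, \<psi>) \<in> C" for U \<phi> V \<psi>
    unfolding Cinf_on_def
  proof
    fix k
    have im: "(\<lambda>(x, t). (\<phi> x, t)) ` ((U \<times> (UNIV :: real set)) \<inter> (V \<times> UNIV)) = \<phi> ` (U \<inter> V) \<times> UNIV"
      by force
    have o: "open (\<phi> ` (U \<inter> V))" by (rule chart_open_image_Int[OF c chart_open[OF d]])
    have o': "open (\<phi> ` (U \<inter> V) \<times> (UNIV :: real set))" using o by (simp add: open_Times)
    have "\<forall>(U, \<phi>)\<in>C. \<forall>(V, \<psi>)\<in>C. Cinf_on (\<phi> ` (U \<inter> V)) (\<psi> \<circ> inv_into U \<phi>)"
      using smooth_manifold by (simp add: smooth_manifold_def)
    then have "Cinf_on (\<phi> ` (U \<inter> V)) (\<psi> \<circ> inv_into U \<phi>)" using c d by fast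
    then have t: "Ck_on k (\<phi> ` (U \<inter> V)) (\<psi> \<circ> inv_into U \<phi>)" by (rule Cinf_onD)
    \<comment> \<open>The transition map (p, s) \<mapsto> (\<tau>(p), s) is split as (\<tau>(p), 0)
      + (0, s), each summand being a linear map applied to a smooth one.\<close>
    have "Ck_on k (\<phi> ` (U \<inter> V) \<times> (UNIV :: real set)) (\<lambda>q. ((\<psi> \<circ> inv_into U \<phi>) (fst q), 0))"
      by (rule Ck_on_bounded_linear_comp[OF _ o' Ck_on_fst_compose[OF o t]])
         (intro bounded_linear_Pair bounded_linear_ident bounded_linear_zero)
    moreover have "Ck_on k (\<phi> ` (U \<inter> V) \<times> (UNIV :: real set)) (\<lambda>q. (0 :: 'e, snd q))"
      by (intro Ck_on_bounded_linear bounded_linear_Pair bounded_linear_snd bounded_linear_zero o')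
    ultimately have "Ck_on k (\<phi> ` (U \<inter> V) \<times> (UNIV :: real set))
        (\<lambda>q. ((\<psi> \<circ> inv_into U \<phi>) (fst q), 0) + (0, snd q))"
      by (rule Ck_on_add[OF o'])
    then show "Ck_on k ((\<lambda>(x, t). (\<phi> x, t)) ` ((U \<times> (UNIV :: real set)) \<inter> (V \<times> UNIV)))
        ((\<lambda>(x, t). (\<psi> x, t)) \<circ> inv_into (U \<times> UNIV) (\<lambda>(x, t). (\<phi> x, t)))"
      unfolding im by (rule Ck_on_cong_imp[OF o', rotated]) (auto simp: tilde_chart_inv[OF c])
  qed
  then show "\<forall>(U, \<phi>)\<in>(tilde_atlas C :: ('m \<times> real, 'e \<times> real) atlas). \<forall>(V, \<psi>)\<in>tilde_atlas C.
      Cinf_on (\<phi> ` (U \<inter> V)) (\<psi> \<circ> inv_into U \<phi>)"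
    unfolding tilde_atlas_def by fast
qed

lemma manifold_tilde: "manifold (tilde_atlas C :: ('m \<times> real, 'e \<times> real) atlas)"
  by unfold_locales (rule smooth_manifold_tilde)

lemma tilde_chart: "(U, \<phi>) \<in> C \<Longrightarrow> (U \<times> UNIV, \<lambda>(x, t). (\<phi> x, t)) \<in> tilde_atlas C"
  by (force simp: tilde_atlas_def)

lemma smooth_at_tildeI:
  fixes f :: "'m \<times> real \<Rightarrow> real"
  assumes c: "(U, \<phi>) \<in> C" and N: "open N" "x \<in> N" "N \<subseteq> U"
    and f: "\<And>k. Ck_on k (\<phi> ` N \<times> UNIV) (\<lambda>q. f (inv_into U \<phi> (fst q), snd q))"
  shows "smooth_at (tilde_atlas C) f (x, t)"
proof -
  interpret T: manifold "tilde_atlas C :: ('m \<times> real, 'e \<times> real) atlas" by (rule manifold_tilde)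
  have "U \<inter> N = N" using N(3) by auto
  then have o: "open (\<phi> ` N \<times> (UNIV :: real set))"
    using chart_open_image_Int[OF c N(1)] by (simp add: open_Times)
  show ?thesis
  proof (rule T.smooth_at_chartI[OF tilde_chart[OF c]])
    show "open (N \<times> (UNIV :: real set))" "(x, t) \<in> N \<times> UNIV" "N \<times> UNIV \<subseteq> U \<times> UNIV"
      using N by (auto simp: open_Times)
    show "Cinf_on ((\<lambda>(x, t). (\<phi> x, t)) ` (N \<times> UNIV)) (f \<circ> inv_into (U \<times> UNIV) (\<lambda>(x, t). (\<phi> x, t)))"
      unfolding tilde_chart_image Cinf_on_def
    proof
      fix k
      show "Ck_on k (\<phi> ` N \<times> UNIV) (f \<circ> inv_into (U \<times> UNIV) (\<lambda>(x, t). (\<phi> x, t)))"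
        by (rule Ck_on_cong_imp[OF o _ f]) (use N(3) in \<open>auto simp: tilde_chart_inv[OF c]\<close>)
    qed
  qed
qed

text \<open>The neighbourhood \<open>N\<close> need not be a product of a set in M and an interval,
  so the openness of its image in the model space is delivered along with it.\<close>

lemma smooth_at_tildeD:
  fixes f :: "'m \<times> real \<Rightarrow> real"
  assumes c: "(U, \<phi>) \<in> C" and x: "x \<in> U" and f: "smooth_at (tilde_atlas C) f (x, t)"
  obtains N where "open N" "(x, t) \<in> N" "N \<subseteq> U \<times> UNIV" "open ((\<lambda>q. (\<phi> (fst q), snd q)) ` N)"
    "\<forall>k. Ck_on k ((\<lambda>q. (\<phi> (fst q), snd q)) ` N) (\<lambda>q. f (inv_into U \<phi> (fst q), snd q))"
proof -
  interpret T: manifold "tilde_atlas C :: ('m \<times> real, 'e \<times> real) atlas" by (rule manifold_tilde)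
  obtain N where N: "open N" "(x, t) \<in> N" "N \<subseteq> U \<times> UNIV"
    "Cinf_on ((\<lambda>(x, t). (\<phi> x, t)) ` N) (f \<circ> inv_into (U \<times> UNIV) (\<lambda>(x, t). (\<phi> x, t)))"
    by (rule T.smooth_at_chart[OF tilde_chart[OF c] _ f]) (use x in auto)
  have "(U \<times> UNIV) \<inter> N = N" using N(3) by auto
  then have o: "open ((\<lambda>(x, t). (\<phi> x, t)) ` N)"
    using T.chart_open_image_Int[OF tilde_chart[OF c] N(1)] by simp
  have "Ck_on k ((\<lambda>(x, t). (\<phi> x, t)) ` N) (\<lambda>q. f (inv_into U \<phi> (fst q), snd q))" for k
    by (rule Ck_on_cong_imp[OF o _ Cinf_onD[OF N(4)]]) (use N(3) in \<open>auto simp: tilde_chart_inv[OF c]\<close>)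
  then show thesis using that N o by (simp add: case_prod_beta)
qed

lemma smooth_at_pullback:
  assumes "smooth_at C f x"
  shows "smooth_at (tilde_atlas C) (\<lambda>q. f (fst q)) (x, t)"
proof -
  obtain U \<phi> where c: "(U, \<phi>) \<in> C" "x \<in> U" by (rule chart_exists)
  obtain N where N: "open N" "x \<in> N" "N \<subseteq> U" "Cinf_on (\<phi> ` N) (f \<circ> inv_into U \<phi>)"
    by (rule smooth_at_chart[OF c assms])
  have "U \<inter> N = N" using N(3) by auto
  then have o: "open (\<phi> ` N)" using chart_open_image_Int[OF c(1) N(1)] by simp
  show ?thesis
    by (rule smooth_at_tildeI[OF c(1) N(1-3)])
       (use Ck_on_fst_compose[OF o Cinf_onD[OF N(4)]] in \<open>simp add: comp_def\<close>)
qed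

text \<open>Freezing the time is composition with p \<mapsto> (p, t) in charts. Together with
  \<open>smooth_at_pullback\<close>, which composes with the projection, it carries functions back
  and forth between M and the product.\<close>

lemma smooth_at_slice:
  assumes "smooth_at (tilde_atlas C) f (x, t)"
  shows "smooth_at C (\<lambda>y. f (y, t)) x"
proof -
  obtain U \<phi> where c: "(U, \<phi>) \<in> C" "x \<in> U" by (rule chart_exists)
  obtain N where N: "open N" "(x, t) \<in> N" "N \<subseteq> U \<times> UNIV" "open ((\<lambda>q. (\<phi> (fst q), snd q)) ` N)"
    "\<forall>k. Ck_on k ((\<lambda>q. (\<phi> (fst q), snd q)) ` N) (\<lambda>q. f (inv_into U \<phi> (fst q), snd q))"
    by (rule smooth_at_tildeD[OF c assms])
  define M where "M = {y. (y, t) \<in> N}"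
  have "M = (\<lambda>y. (y, t)) -` N" by (auto simp: M_def)
  then have M: "open M" using N(1) by (simp add: open_vimage continuous_on_Pair)
  have "x \<in> M" "M \<subseteq> U" using N by (auto simp: M_def)
  then have "U \<inter> M = M" by auto
  then have o: "open (\<phi> ` M)" using chart_open_image_Int[OF c(1) M] by simp
  show ?thesis
  proof (rule smooth_at_chartI[OF c(1) M])
    show "x \<in> M" "M \<subseteq> U" by fact+
    show "Cinf_on (\<phi> ` M) ((\<lambda>y. f (y, t)) \<circ> inv_into U \<phi>)"
      unfolding Cinf_on_def
    proof
      fix k
      have "Ck_on k (\<phi> ` M) (\<lambda>p. (\<lambda>q. f (inv_into U \<phi> (fst q), snd q)) (p, t))"
        by (rule Ck_on_compose[OF o N(4) _ N(5)[rule_format] Ck_on_Pair_const[OF o]])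
           (force simp: M_def)
      then show "Ck_on k (\<phi> ` M) ((\<lambda>y. f (y, t)) \<circ> inv_into U \<phi>)" by (simp add: comp_def)
    qed
  qed
qed

lemma has_derivative_slices:
  assumes "(F has_derivative D) (at (p, t))"
  shows "((\<lambda>p. F (p, t)) has_derivative (\<lambda>w. D (w, 0))) (at p)"
    and "((\<lambda>s. F (p, s)) has_derivative (\<lambda>s. D (0, s))) (at t)"
proof -
  have "((\<lambda>p. (p, t)) has_derivative (\<lambda>w. (w, 0))) (at p)"
    by (auto intro!: derivative_eq_intros)
  from has_derivative_compose[OF this assms]
  show "((\<lambda>p. F (p, t)) has_derivative (\<lambda>w. D (w, 0))) (at p)" .
  have "((\<lambda>s. (p, s)) has_derivative (\<lambda>s. (0, s))) (at t)"
    by (auto intro!: derivative_eq_intros)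
  from has_derivative_compose[OF this assms]
  show "((\<lambda>s. F (p, s)) has_derivative (\<lambda>s. D (0, s))) (at t)" .
qed

text \<open>All four claims come from one computation in a product chart: the time derivative is the
  derivative of the chart expression in the direction (0, 1), and directional derivatives of a
  smooth chart expression are smooth because \<open>Ck_on (Suc k)\<close> hands down
  \<open>Ck_on k\<close> to them.\<close>

lemma
  assumes f: "smooth_at (tilde_atlas C) f (x, t)"
  shows smooth_at_time_derivative:
      "((\<lambda>s. f (x, s)) has_real_derivative deriv (\<lambda>s. f (x, s)) t) (at t)"
    and smooth_at_time_deriv: "smooth_at (tilde_atlas C) (\<lambda>q. deriv (\<lambda>s. f (fst q, s)) (snd q)) (x, t)"
    and tilde_chart_derivative: "(U, \<phi>) \<in> C \<Longrightarrow> x \<in> U \<Longrightarrow>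
      ((\<lambda>q. f (inv_into U \<phi> (fst q), snd q)) has_derivative
        frechet_derivative (\<lambda>q. f (inv_into U \<phi> (fst q), snd q)) (at (\<phi> x, t))) (at (\<phi> x, t))"
    and smooth_at_chart_deriv: "(U, \<phi>) \<in> C \<Longrightarrow> x \<in> U \<Longrightarrow> smooth_at (tilde_atlas C)
      (\<lambda>q. frechet_derivative (\<lambda>q. f (inv_into U \<phi> (fst q), snd q)) (at (\<phi> (fst q), snd q)) w) (x, t)"
proof -
  interpret T: manifold "tilde_atlas C :: ('m \<times> real, 'e \<times> real) atlas" by (rule manifold_tilde)
  have main: "((\<lambda>q. f (inv_into U \<phi> (fst q), snd q)) has_derivative
        frechet_derivative (\<lambda>q. f (inv_into U \<phi> (fst q), snd q)) (at (\<phi> x, t))) (at (\<phi> x, t)) \<and>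
      (\<forall>w. smooth_at (tilde_atlas C)
        (\<lambda>q. frechet_derivative (\<lambda>q. f (inv_into U \<phi> (fst q), snd q)) (at (\<phi> (fst q), snd q)) w) (x, t)) \<and>
      smooth_at (tilde_atlas C) (\<lambda>q. deriv (\<lambda>s. f (fst q, s)) (snd q)) (x, t)"
    if c: "(U, \<phi>) \<in> C" "x \<in> U" for U \<phi>
  proof -
    let ?F = "\<lambda>q. f (inv_into U \<phi> (fst q), snd q)"
    obtain N where N: "open N" "(x, t) \<in> N" "N \<subseteq> U \<times> UNIV" "open ((\<lambda>q. (\<phi> (fst q), snd q)) ` N)"
      "\<forall>k. Ck_on k ((\<lambda>q. (\<phi> (fst q), snd q)) ` N) ?F"
      by (rule smooth_at_tildeD[OF c f])
    have d: "(?F has_derivative frechet_derivative ?F (at (\<phi> (fst q), snd q))) (at (\<phi> (fst q), snd q))"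
      if "q \<in> N" for q
      by (rule Ck_on_has_derivative[OF N(5)[rule_format] N(4)]) (use that in auto)
    have o: "open ((\<lambda>(x, t). (\<phi> x, t)) ` N)" using N(4) by (simp add: case_prod_beta)
    have sm: "smooth_at (tilde_atlas C) (\<lambda>q. frechet_derivative ?F (at (\<phi> (fst q), snd q)) w) (x, t)" for w
    proof (rule T.smooth_at_chartI[OF tilde_chart[OF c(1)] N(1-3)])
      show "Cinf_on ((\<lambda>(x, t). (\<phi> x, t)) ` N)
          ((\<lambda>q. frechet_derivative ?F (at (\<phi> (fst q), snd q)) w) \<circ> inv_into (U \<times> UNIV) (\<lambda>(x, t). (\<phi> x, t)))"
        unfolding Cinf_on_def
      proof
        fix k
        have "Ck_on k ((\<lambda>(x, t). (\<phi> x, t)) ` N) (\<lambda>q. frechet_derivative ?F (at q) w)"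
          using N(5)[rule_format, of "Suc k", unfolded Ck_on.simps, THEN conjunct2, rule_format, of w]
          unfolding case_prod_beta .
        then show "Ck_on k ((\<lambda>(x, t). (\<phi> x, t)) ` N)
          ((\<lambda>q. frechet_derivative ?F (at (\<phi> (fst q), snd q)) w) \<circ> inv_into (U \<times> UNIV) (\<lambda>(x, t). (\<phi> x, t)))"
          by (rule Ck_on_cong_imp[OF o, rotated])
             (auto simp: tilde_chart_inv[OF c(1)] chart_inv[OF c(1)] dest!: subsetD[OF N(3)])
      qed
    qed
    have "smooth_at (tilde_atlas C) (\<lambda>q. deriv (\<lambda>s. f (fst q, s)) (snd q)) (x, t)"
    proof (rule T.smooth_at_cong[OF sm[of "(0, 1)"] N(1,2)])
      fix q assume q: "q \<in> N"
      have dd: "((\<lambda>s. ?F (\<phi> (fst q), s)) has_derivative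
          (\<lambda>s. frechet_derivative ?F (at (\<phi> (fst q), snd q)) (0, s))) (at (snd q))"
        by (rule has_derivative_slices(2)[OF d[OF q]])
      have lin: "linear (frechet_derivative ?F (at (\<phi> (fst q), snd q)))"
        using d[OF q] by (rule has_derivative_linear)
      have e: "(\<lambda>s. frechet_derivative ?F (at (\<phi> (fst q), snd q)) (0, s)) =
          (*) (frechet_derivative ?F (at (\<phi> (fst q), snd q)) (0, 1))"
      proof
        fix s :: real
        have "frechet_derivative ?F (at (\<phi> (fst q), snd q)) (0, s) =
            frechet_derivative ?F (at (\<phi> (fst q), snd q)) (s *\<^sub>R (0, 1))" by simp
        also have "\<dots> = s *\<^sub>R frechet_derivative ?F (at (\<phi> (fst q), snd q)) (0, 1)"
          by (rule linear_scale[OF lin])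
        finally show "frechet_derivative ?F (at (\<phi> (fst q), snd q)) (0, s) =
            frechet_derivative ?F (at (\<phi> (fst q), snd q)) (0, 1) * s"
          by (simp only: real_scaleR_def mult.commute)
      qed
      have fq: "fst q \<in> U" using q N(3) by auto
      have "((\<lambda>s. f (fst q, s)) has_real_derivative
          frechet_derivative ?F (at (\<phi> (fst q), snd q)) (0, 1)) (at (snd q))"
        using dd unfolding e has_field_derivative_def by (simp add: chart_inv[OF c(1) fq])
      then show "frechet_derivative ?F (at (\<phi> (fst q), snd q)) (0, 1) = deriv (\<lambda>s. f (fst q, s)) (snd q)"
        by (simp add: DERIV_imp_deriv)
    qed
    then show ?thesis using sm d[OF N(2)] by simp
  qed
  show "(U, \<phi>) \<in> C \<Longrightarrow> x \<in> U \<Longrightarrow>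
      ((\<lambda>q. f (inv_into U \<phi> (fst q), snd q)) has_derivative
        frechet_derivative (\<lambda>q. f (inv_into U \<phi> (fst q), snd q)) (at (\<phi> x, t))) (at (\<phi> x, t))"
    "(U, \<phi>) \<in> C \<Longrightarrow> x \<in> U \<Longrightarrow> smooth_at (tilde_atlas C)
      (\<lambda>q. frechet_derivative (\<lambda>q. f (inv_into U \<phi> (fst q), snd q)) (at (\<phi> (fst q), snd q)) w) (x, t)"
    using main by blast+
  obtain U \<phi> where c: "(U, \<phi>) \<in> C" "x \<in> U" by (rule chart_exists)
  show "smooth_at (tilde_atlas C) (\<lambda>q. deriv (\<lambda>s. f (fst q, s)) (snd q)) (x, t)"
    using main[OF c] by blast
  have "((\<lambda>s. (\<lambda>q. f (inv_into U \<phi> (fst q), snd q)) (\<phi> x, s)) has_derivative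
      (\<lambda>s. frechet_derivative (\<lambda>q. f (inv_into U \<phi> (fst q), snd q)) (at (\<phi> x, t)) (0, s))) (at t)"
    using main[OF c] by (intro has_derivative_slices(2)) blast
  then have "(\<lambda>s. f (x, s)) differentiable (at t)"
    by (auto simp: differentiable_def chart_inv[OF c])
  then show "((\<lambda>s. f (x, s)) has_real_derivative deriv (\<lambda>s. f (x, s)) t) (at t)"
    by (metis DERIV_imp_deriv real_differentiable_def)
qed

abbreviation "Fun' \<equiv> smooth_funs (tilde_atlas C :: ('m \<times> real, 'e \<times> real) atlas)"

lemma pullback_Fun: "f \<in> smooth_funs C \<Longrightarrow> (\<lambda>q. f (fst q)) \<in> Fun'"
  using smooth_at_pullback by (auto simp: smooth_funs_iff manifold.smooth_funs_iff[OF manifold_tilde])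

lemma slice_Fun: "f \<in> Fun' \<Longrightarrow> (\<lambda>y. f (y, t)) \<in> smooth_funs C"
  using smooth_at_slice by (auto simp: smooth_funs_iff manifold.smooth_funs_iff[OF manifold_tilde])

lemma time_deriv_Fun: "f \<in> Fun' \<Longrightarrow> (\<lambda>q. deriv (\<lambda>s. f (fst q, s)) (snd q)) \<in> Fun'"
  using smooth_at_time_deriv by (auto simp: manifold.smooth_funs_iff[OF manifold_tilde])

lemma exp_Fun: "(\<lambda>q. exp (- snd q)) \<in> Fun'"
proof -
  have "smooth_at (tilde_atlas C) (\<lambda>q. exp (- snd q)) (x, t)" for x t
  proof -
    obtain U \<phi> where c: "(U, \<phi>) \<in> C" "x \<in> U" by (rule chart_exists)
    have o: "open (\<phi> ` U \<times> (UNIV :: real set))" using chart_open_image[OF c(1)] by (simp add: open_Times)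
    show ?thesis
    proof (rule smooth_at_tildeI[OF c(1) chart_open[OF c(1)] c(2) subset_refl])
      fix k
      have "Ck_on k (\<phi> ` U \<times> (UNIV :: real set)) (\<lambda>q. exp (- snd q))"
        by (rule Ck_on_compose[OF o open_UNIV UNIV_I Cinf_onD[OF Cinf_on_exp]])
           (intro Ck_on_bounded_linear bounded_linear_minus bounded_linear_snd o)
      then show "Ck_on k (\<phi> ` U \<times> (UNIV :: real set)) (\<lambda>q. exp (- snd (inv_into U \<phi> (fst q), snd q)))"
        by simp
    qed
  qed
  then show ?thesis by (auto simp: manifold.smooth_funs_iff[OF manifold_tilde])
qed

text \<open>\<open>tangent_vectors\<close> provides some chart, possibly a different one at every
  point. To compare tangent vectors at neighbouring points, they are moved into a prescribed chart
  by the derivative of the transition map.\<close>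

lemma tangent_in_chart:
  assumes v: "v \<in> tangent_vectors C x" and c: "(U, \<phi>) \<in> C" "x \<in> U"
  obtains w where "\<forall>f\<in>smooth_funs C. v f = frechet_derivative (\<lambda>p. f (inv_into U \<phi> p)) (at (\<phi> x)) w"
proof -
  obtain V \<psi> w where V: "(V, \<psi>) \<in> C" "x \<in> V"
    and w: "\<forall>f\<in>smooth_funs C. v f = frechet_derivative (\<lambda>p. f (inv_into V \<psi> p)) (at (\<psi> x)) w"
    using v by (auto simp: tangent_vectors_def comp_def)
  let ?\<tau> = "\<lambda>p. \<phi> (inv_into V \<psi> p)"
  have "\<forall>(U, \<phi>)\<in>C. \<forall>(V, \<psi>)\<in>C. Cinf_on (\<phi> ` (U \<inter> V)) (\<psi> \<circ> inv_into U \<phi>)"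
    using smooth_manifold by (simp add: smooth_manifold_def)
  then have "Cinf_on (\<psi> ` (V \<inter> U)) (\<phi> \<circ> inv_into V \<psi>)" using c V by fast
  then have t: "Ck_on (Suc 0) (\<psi> ` (V \<inter> U)) ?\<tau>" by (simp add: Cinf_onD comp_def del: Ck_on.simps)
  have o: "open (\<psi> ` (V \<inter> U))" by (rule chart_open_image_Int[OF V(1) chart_open[OF c(1)]])
  have m: "\<psi> x \<in> \<psi> ` (V \<inter> U)" using c V by auto
  have d\<tau>: "(?\<tau> has_derivative frechet_derivative ?\<tau> (at (\<psi> x))) (at (\<psi> x))"
    by (rule Ck_on_has_derivative[OF t o m])
  have "v f = frechet_derivative (\<lambda>p. f (inv_into U \<phi> p)) (at (\<phi> x)) (frechet_derivative ?\<tau> (at (\<psi> x)) w)"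
    if f: "f \<in> smooth_funs C" for f
  proof -
    have \<tau>x: "?\<tau> (\<psi> x) = \<phi> x" using chart_inv[OF V] by simp
    have "((\<lambda>p. (\<lambda>p. f (inv_into U \<phi> p)) (?\<tau> p)) has_derivative
        (\<lambda>w. frechet_derivative (\<lambda>p. f (inv_into U \<phi> p)) (at (\<phi> x)) (frechet_derivative ?\<tau> (at (\<psi> x)) w))) (at (\<psi> x))"
      using has_derivative_compose[OF d\<tau>] smooth_funs_chart_derivative[OF f c] unfolding \<tau>x by blast
    from frechet_derivative_at[OF this]
    have "frechet_derivative (\<lambda>p. (\<lambda>p. f (inv_into U \<phi> p)) (?\<tau> p)) (at (\<psi> x)) w =
        frechet_derivative (\<lambda>p. f (inv_into U \<phi> p)) (at (\<phi> x)) (frechet_derivative ?\<tau> (at (\<psi> x)) w)"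
      by (metis (no_types, lifting))
    moreover have "frechet_derivative (\<lambda>p. (\<lambda>p. f (inv_into U \<phi> p)) (?\<tau> p)) (at (\<psi> x)) =
        frechet_derivative (\<lambda>p. f (inv_into V \<psi> p)) (at (\<psi> x))"
      by (rule frechet_derivative_cong_open[OF o m]) (auto simp: chart_inv[OF V(1)] chart_inv[OF c(1)])
    ultimately show ?thesis using w f by simp
  qed
  then show thesis using that by blast
qed

end

section \<open>Bundles over the product and time-dependent sections\<close>

lemma tilde_bundle_simps [simp]:
  "fib (tilde_bundle E) q = fib E (fst q)" "rk (tilde_bundle E) = rk E"
  by (simp_all add: tilde_bundle_def case_prod_beta)

lemma frames_tilde_bundle:
  fixes E :: "('m, 'v) vbundle"
  shows "frames (tilde_bundle E) = (\<lambda>(U, e). (U \<times> UNIV, \<lambda>i q. e i (fst q))) ` frames E"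
proof -
  have "(\<lambda>i (x, t :: real). e i x) = (\<lambda>i q. e i (fst q))" for e :: "nat \<Rightarrow> 'm \<Rightarrow> 'v"
    by (simp add: fun_eq_iff)
  then show ?thesis by (simp add: tilde_bundle_def)
qed

lemma frame_coef_tilde [simp]:
  "frame_coef (tilde_bundle E) (\<lambda>i q. e i (fst q)) i q v = frame_coef E e i (fst q) v"
  by (simp add: frame_coef_def)

text \<open>An equality of records, not only an isomorphism: facts on time-dependent sections,
  proved for an arbitrary bundle over M, thereby apply to time-dependent covectors by taking the
  dual bundle for that bundle.\<close>

lemma dual_bundle_tilde_bundle: "dual_bundle (tilde_bundle E) = tilde_bundle (dual_bundle E)"
proof -
  have "frame_coef (tilde_bundle E) (\<lambda>i q. e i (fst q)) = (\<lambda>i q. frame_coef E e i (fst q))" for e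
    by (simp add: fun_eq_iff)
  then have "frames (dual_bundle (tilde_bundle E)) = frames (tilde_bundle (dual_bundle E))"
    by (simp add: frames_dual_bundle frames_tilde_bundle image_image case_prod_beta)
  then show ?thesis
    by (intro vbundle.equality) (simp_all add: fun_eq_iff)
qed

context bundle_over
begin

lemma sections_near:
  assumes "\<And>x. X x \<in> fib E x"
    and "\<And>x. \<exists>N Y. open N \<and> x \<in> N \<and> Y \<in> Sec \<and> (\<forall>y\<in>N. X y = Y y)"
  shows "X \<in> Sec"
proof (rule sections_local_combo[OF assms(1)])
  fix x
  obtain N Y where "open N" "x \<in> N" "Y \<in> Sec" "\<forall>y\<in>N. X y = Y y" using assms(2)[of x] by blast
  then show "\<exists>N (I :: unit set) c Y. open N \<and> x \<in> N \<and> (\<forall>i\<in>I. smooth_at C (c i) x \<and> Y i \<in> Sec) \<and>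
      (\<forall>y\<in>N. X y = (\<Sum>i\<in>I. c i y *\<^sub>R Y i y))"
    by (intro exI[of _ N] exI[of _ "{()}"] exI[of _ "\<lambda>_ _. 1"] exI[of _ "\<lambda>_. Y"]) (simp add: smooth_at_const)
qed

lemma vector_bundle_tilde: "vector_bundle (tilde_atlas C) (tilde_bundle E)"
  unfolding vector_bundle_def
proof (intro conjI)
  interpret T: manifold "tilde_atlas C" by (rule manifold_tilde)
  have "q \<in> (\<Union>(U, e)\<in>frames (tilde_bundle E). U)" for q
  proof -
    obtain U e where "(U, e) \<in> frames E" "fst q \<in> U" by (rule frame_exists)
    then show ?thesis by (cases q) (force simp: frames_tilde_bundle)
  qed
  then show "(\<Union>(U, e)\<in>frames (tilde_bundle E). U) = UNIV" by blast
  show "\<forall>(U, e)\<in>frames (tilde_bundle E). open U \<and>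
      (\<forall>x\<in>U. inj_on (\<lambda>i. e i x) {..<rk (tilde_bundle E)} \<and> independent ((\<lambda>i. e i x) ` {..<rk (tilde_bundle E)}) \<and>
             span ((\<lambda>i. e i x) ` {..<rk (tilde_bundle E)}) = fib (tilde_bundle E) x)"
    using frame_open frame_inj frame_independent frame_span by (auto simp: frames_tilde_bundle open_Times)
  have "\<exists>c. (\<forall>i<rk E. smooth_fun_on (tilde_atlas C) ((U \<times> UNIV) \<inter> (V \<times> UNIV)) (c i)) \<and>
      (\<forall>q\<in>(U \<times> UNIV) \<inter> (V \<times> UNIV). e' j (fst q) = (\<Sum>i<rk E. c i q *\<^sub>R e i (fst q)))"
    if U: "(U, e) \<in> frames E" and V: "(V, e') \<in> frames E" and j: "j < rk E" for U e V e' j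
  proof (intro exI conjI allI impI ballI)
    have "open ((U \<times> (UNIV :: real set)) \<inter> (V \<times> UNIV))"
      using frame_open[OF U] frame_open[OF V] by (simp add: open_Times open_Int)
    then show "smooth_fun_on (tilde_atlas C) ((U \<times> UNIV) \<inter> (V \<times> UNIV)) (\<lambda>q. frame_coef E e i (fst q) (e' j (fst q)))"
      if "i < rk E" for i
      using that U V j by (auto simp: T.smooth_fun_on_iff_smooth_at intro!: smooth_at_pullback frame_coef_transition)
    show "e' j (fst q) = (\<Sum>i<rk E. frame_coef E e i (fst q) (e' j (fst q)) *\<^sub>R e i (fst q))"
      if "q \<in> (U \<times> UNIV) \<inter> (V \<times> UNIV)" for q
      using that frame_coef_expand[OF U, of "fst q" "e' j (fst q)"] frame_mem[OF V _ j, of "fst q"] by auto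
  qed
  then show "\<forall>(U, e)\<in>frames (tilde_bundle E). \<forall>(V, e')\<in>frames (tilde_bundle E). \<forall>j<rk (tilde_bundle E). \<exists>c.
      (\<forall>i<rk (tilde_bundle E). smooth_fun_on (tilde_atlas C) (U \<inter> V) (c i)) \<and>
      (\<forall>x\<in>U \<inter> V. e' j x = (\<Sum>i<rk (tilde_bundle E). c i x *\<^sub>R e i x))"
    unfolding frames_tilde_bundle tilde_bundle_simps by fastforce
qed

lemma bundle_over_tilde: "bundle_over (tilde_atlas C) (tilde_bundle E)"
  using smooth_manifold_tilde vector_bundle_tilde by unfold_locales

abbreviation "Sec' \<equiv> sections (tilde_atlas C) (tilde_bundle E)"

lemma frame_tilde: "(U, e) \<in> frames E \<Longrightarrow> (U \<times> UNIV, \<lambda>i q. e i (fst q)) \<in> frames (tilde_bundle E)"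
  by (force simp: frames_tilde_bundle)

lemma pullback_sec:
  assumes "X \<in> Sec"
  shows "(\<lambda>q. X (fst q)) \<in> Sec'"
proof -
  interpret T: bundle_over "tilde_atlas C" "tilde_bundle E" by (rule bundle_over_tilde)
  show ?thesis
  proof (rule T.sectionsI)
    show "X (fst q) \<in> fib (tilde_bundle E) q" for q using sections_fib[OF assms] by simp
    show "\<exists>U e. (U, e) \<in> frames (tilde_bundle E) \<and> q \<in> U \<and>
      (\<forall>i<rk (tilde_bundle E). smooth_at (tilde_atlas C) (\<lambda>q. frame_coef (tilde_bundle E) e i q (X (fst q))) q)" for q
    proof -
      obtain x t where q: "q = (x, t)" by (cases q)
      obtain U e where U: "(U, e) \<in> frames E" "x \<in> U" by (rule frame_exists)
      have "smooth_at (tilde_atlas C) (\<lambda>q. frame_coef E e i (fst q) (X (fst q))) q" if "i < rk E" for i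
        unfolding q using smooth_at_pullback[OF sections_smooth_coef[OF assms U that]] .
      then show ?thesis
        using U q by (intro exI[of _ "U \<times> UNIV"] exI[of _ "\<lambda>i q. e i (fst q)"]) (simp add: frame_tilde)
    qed
  qed
qed

lemma tilde_sec_fib: "X \<in> Sec' \<Longrightarrow> X q \<in> fib E (fst q)"
  using bundle_over.sections_fib[OF bundle_over_tilde, of X q] by simp

lemma tilde_sec_coef:
  assumes "X \<in> Sec'" "(U, e) \<in> frames E" "x \<in> U" "i < rk E"
  shows "smooth_at (tilde_atlas C) (\<lambda>q. frame_coef E e i (fst q) (X q)) (x, t)"
proof -
  interpret T: bundle_over "tilde_atlas C" "tilde_bundle E" by (rule bundle_over_tilde)
  show ?thesis
    using T.sections_smooth_coef[OF assms(1) frame_tilde[OF assms(2)], of "(x, t)" i] assms(3,4) by simp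
qed

lemma slice_sec:
  assumes "X \<in> Sec'"
  shows "(\<lambda>x. X (x, t)) \<in> Sec"
proof (rule sectionsI)
  show "X (x, t) \<in> fib E x" for x using tilde_sec_fib[OF assms, of "(x, t)"] by simp
  show "\<exists>U e. (U, e) \<in> frames E \<and> x \<in> U \<and> (\<forall>i<rk E. smooth_at C (\<lambda>x. frame_coef E e i x (X (x, t))) x)" for x
  proof -
    obtain U e where U: "(U, e) \<in> frames E" "x \<in> U" by (rule frame_exists)
    have "smooth_at C (\<lambda>x. frame_coef E e i x (X (x, t))) x" if "i < rk E" for i
      using smooth_at_slice[OF tilde_sec_coef[OF assms U that, of t]] by simp
    then show ?thesis using U by blast
  qed
qed

text \<open>The frame consists of sections over M, independent of time, and the expansion holds on a
  full strip over \<open>N\<close>; all dependence on time is in the coefficients. They are cut off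
  by a bump function on M, which makes them global without touching the time direction.\<close>

lemma tilde_local_frame:
  obtains N Es where "open N" "x \<in> N" "\<forall>i<rk E. Es i \<in> Sec"
    "\<forall>X\<in>Sec'. \<exists>c. (\<forall>i<rk E. c i \<in> Fun') \<and> (\<forall>q. fst q \<in> N \<longrightarrow> X q = (\<Sum>i<rk E. c i q *\<^sub>R Es i (fst q)))"
proof -
  interpret T: bundle_over "tilde_atlas C" "tilde_bundle E" by (rule bundle_over_tilde)
  obtain U e where U: "(U, e) \<in> frames E" "x \<in> U" by (rule frame_exists)
  obtain N Es where 1: "open N" "x \<in> N" "N \<subseteq> U" "\<forall>i<rk E. Es i \<in> Sec" "\<forall>i<rk E. \<forall>y\<in>N. Es i y = e i y"
      by (rule local_frame_sections[OF U])
  obtain \<beta> M K where 2: "\<beta> \<in> Fun" "open M" "x \<in> M" "M \<subseteq> N" "\<forall>y\<in>M. \<beta> y = 1"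
    "closed K" "K \<subseteq> N" "\<forall>y. y \<notin> K \<longrightarrow> \<beta> y = 0"
    by (rule bump_exists[OF 1(1,2)])
  have "\<exists>c. (\<forall>i<rk E. c i \<in> Fun') \<and> (\<forall>q. fst q \<in> M \<longrightarrow> X q = (\<Sum>i<rk E. c i q *\<^sub>R Es i (fst q)))"
    if X: "X \<in> Sec'" for X
  proof (intro exI conjI allI impI)
    show "(\<lambda>q. \<beta> (fst q) * frame_coef E e i (fst q) (X q)) \<in> Fun'" if i: "i < rk E" for i
    proof (rule T.smooth_funs_bump_mult[OF pullback_Fun[OF 2(1)]])
      show "closed (K \<times> (UNIV :: real set))" using 2(6) by (simp add: closed_Times)
      show "K \<times> UNIV \<subseteq> N \<times> UNIV" using 2(7) by auto
      show "\<forall>q. q \<notin> K \<times> UNIV \<longrightarrow> \<beta> (fst q) = 0" using 2(8) by auto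
      show "smooth_at (tilde_atlas C) (\<lambda>q. frame_coef E e i (fst q) (X q)) q" if "q \<in> N \<times> UNIV" for q
        using that tilde_sec_coef[OF X U(1) _ i, of "fst q" "snd q"] 1(3) by auto
    qed
    show "X q = (\<Sum>i<rk E. (\<beta> (fst q) * frame_coef E e i (fst q) (X q)) *\<^sub>R Es i (fst q))" if q: "fst q \<in> M" for q
    proof -
      have "fst q \<in> N" "fst q \<in> U" using q 1 2 by auto
      then have "(\<Sum>i<rk E. (\<beta> (fst q) * frame_coef E e i (fst q) (X q)) *\<^sub>R Es i (fst q)) =
          (\<Sum>i<rk E. frame_coef E e i (fst q) (X q) *\<^sub>R e i (fst q))"
        using q 1 2 by simp
      then show ?thesis using frame_coef_expand[OF U(1) \<open>fst q \<in> U\<close> tilde_sec_fib[OF X]] by simp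
    qed
  qed
  then show thesis using 1 2 by (intro that[of M Es]) auto
qed

text \<open>Expansion in a time-independent frame reduces the smoothness of a fibrewise linear
  expression on time-dependent sections to sections pulled back from M.\<close>

lemma tilde_linear_smooth:
  assumes lin: "\<And>q u v a b. u \<in> fib E (fst q) \<Longrightarrow> v \<in> fib E (fst q) \<Longrightarrow> L q (a *\<^sub>R u + b *\<^sub>R v) = a * L q u + b * L q v"
    and sm: "\<And>X. X \<in> Sec \<Longrightarrow> (\<lambda>q. L q (X (fst q))) \<in> Fun'"
    and X: "X \<in> Sec'"
  shows "(\<lambda>q. L q (X q)) \<in> Fun'"
proof -
  interpret T: bundle_over "tilde_atlas C" "tilde_bundle E" by (rule bundle_over_tilde)
  have "smooth_at (tilde_atlas C) (\<lambda>q. L q (X q)) q" for q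
  proof -
    obtain N Es where N: "open N" "fst q \<in> N" "\<forall>i<rk E. Es i \<in> Sec"
      "\<forall>X\<in>Sec'. \<exists>c. (\<forall>i<rk E. c i \<in> Fun') \<and> (\<forall>q. fst q \<in> N \<longrightarrow> X q = (\<Sum>i<rk E. c i q *\<^sub>R Es i (fst q)))"
      by (rule tilde_local_frame)
    obtain c where c: "\<forall>i<rk E. c i \<in> Fun'" "\<forall>q. fst q \<in> N \<longrightarrow> X q = (\<Sum>i<rk E. c i q *\<^sub>R Es i (fst q))"
      using N(4) X by blast
    have Lsum: "L p (\<Sum>i<n. c i p *\<^sub>R Es i (fst p)) = (\<Sum>i<n. c i p * L p (Es i (fst p)))" if "n \<le> rk E" for n p
      using that
    proof (induction n)
      case 0
      show ?case using lin[OF fib_zero fib_zero, of p 0 0] by simp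
    next
      case (Suc n)
      have "L p (1 *\<^sub>R (\<Sum>i<n. c i p *\<^sub>R Es i (fst p)) + c n p *\<^sub>R Es n (fst p)) =
          1 * L p (\<Sum>i<n. c i p *\<^sub>R Es i (fst p)) + c n p * L p (Es n (fst p))"
        using Suc.prems N(3) by (intro lin fib_sum fib_scale sections_fib) auto
      then show ?case using Suc by simp
    qed
    have "(\<lambda>q. \<Sum>i<rk E. c i q * L q (Es i (fst q))) \<in> Fun'"
      using c N sm by (intro T.smooth_funs_sum T.smooth_funs_mult) auto
    then have "smooth_at (tilde_atlas C) (\<lambda>q. \<Sum>i<rk E. c i q * L q (Es i (fst q))) q" by (rule T.smooth_funsD)
    then show ?thesis
      by (rule T.smooth_at_cong[where N = "N \<times> UNIV"])
         (use N c Lsum in \<open>auto simp: open_Times mem_Times_iff\<close>)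
  qed
  then show ?thesis by (simp add: T.smooth_funs_iff)
qed

lemma time_deriv_eqI:
  assumes "v \<in> fib E x"
    and "\<And>\<xi>. \<xi> \<in> dual_space (fib E x) \<Longrightarrow> ((\<lambda>s. \<xi> (X (x, s))) has_real_derivative \<xi> v) (at t)"
  shows "time_deriv E X (x, t) = v"
  unfolding time_deriv_def prod.case dual_bundle_simps
proof (rule the_equality)
  fix w assume "w \<in> fib E x \<and> (\<forall>\<xi>\<in>dual_space (fib E x). ((\<lambda>s. \<xi> (X (x, s))) has_real_derivative \<xi> w) (at t))"
  then show "w = v" using assms by (intro covectors_separate[of w x v]) (auto intro: DERIV_unique)
qed (use assms in auto)

text \<open>In a time-independent frame the time derivative is obtained by differentiating the
  coefficients. The result is a section of the tilde bundle and has the pairings that the definite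
  description in \<open>time_deriv\<close> asks for.\<close>

lemma
  assumes X: "X \<in> Sec'"
  shows time_deriv_has_derivative: "\<xi> \<in> dual_space (fib E x) \<Longrightarrow>
      ((\<lambda>s. \<xi> (X (x, s))) has_real_derivative \<xi> (time_deriv E X (x, t))) (at t)"
    and time_deriv_sec: "time_deriv E X \<in> Sec'"
proof -
  interpret T: bundle_over "tilde_atlas C" "tilde_bundle E" by (rule bundle_over_tilde)
  have loc: "\<exists>N Y. open N \<and> x \<in> N \<and> Y \<in> Sec' \<and> (\<forall>q. fst q \<in> N \<longrightarrow>
      (\<forall>\<xi>\<in>dual_space (fib E (fst q)). ((\<lambda>s. \<xi> (X (fst q, s))) has_real_derivative \<xi> (Y q)) (at (snd q))))" for x
  proof -
    obtain N Es where N: "open N" "x \<in> N" "\<forall>i<rk E. Es i \<in> Sec"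
      "\<forall>X\<in>Sec'. \<exists>c. (\<forall>i<rk E. c i \<in> Fun') \<and> (\<forall>q. fst q \<in> N \<longrightarrow> X q = (\<Sum>i<rk E. c i q *\<^sub>R Es i (fst q)))"
      by (rule tilde_local_frame)
    obtain c where c: "\<forall>i<rk E. c i \<in> Fun'" "\<forall>q. fst q \<in> N \<longrightarrow> X q = (\<Sum>i<rk E. c i q *\<^sub>R Es i (fst q))"
      using N(4) X by blast
    define Y where "Y q = (\<Sum>i<rk E. deriv (\<lambda>s. c i (fst q, s)) (snd q) *\<^sub>R Es i (fst q))" for q
    have "Y \<in> Sec'"
      unfolding Y_def using c N by (intro T.sections_combo time_deriv_Fun pullback_sec) auto
    moreover have "((\<lambda>s. \<xi> (X (fst q, s))) has_real_derivative \<xi> (Y q)) (at (snd q))"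
      if q: "fst q \<in> N" and \<xi>: "\<xi> \<in> dual_space (fib E (fst q))" for q \<xi>
    proof -
      have m: "Es i (fst q) \<in> fib E (fst q)" if "i < rk E" for i using N(3) that sections_fib by blast
      have e1: "\<xi> (X (fst q, s)) = (\<Sum>i<rk E. c i (fst q, s) * \<xi> (Es i (fst q)))" for s
        using q c(2) dual_space_sum[OF subspace_fib \<xi>, of "{..<rk E}" "\<lambda>i. Es i (fst q)"] m by simp
      have e2: "\<xi> (Y q) = (\<Sum>i<rk E. deriv (\<lambda>s. c i (fst q, s)) (snd q) * \<xi> (Es i (fst q)))"
        unfolding Y_def using m by (intro dual_space_sum[OF subspace_fib \<xi>]) auto
      have "((\<lambda>s. c i (fst q, s)) has_real_derivative deriv (\<lambda>s. c i (fst q, s)) (snd q)) (at (snd q))"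
        if "i < rk E" for i
        using smooth_at_time_derivative[OF T.smooth_funsD, of "c i" "fst q" "snd q"] c that by simp
      then show ?thesis unfolding e1 e2 by (intro DERIV_sum DERIV_cmult_right) auto
    qed
    ultimately show ?thesis using N(1,2) by blast
  qed
  have eq: "time_deriv E X q = Y q"
    if "fst q \<in> N" "Y \<in> Sec'" "\<forall>q. fst q \<in> N \<longrightarrow>
      (\<forall>\<xi>\<in>dual_space (fib E (fst q)). ((\<lambda>s. \<xi> (X (fst q, s))) has_real_derivative \<xi> (Y q)) (at (snd q)))"
    for q :: "'m \<times> real" and N Y
    using time_deriv_eqI[of "Y q" "fst q" X "snd q"] that tilde_sec_fib[OF that(2), of q] by simp
  show "((\<lambda>s. \<xi> (X (x, s))) has_real_derivative \<xi> (time_deriv E X (x, t))) (at t)"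
    if \<xi>: "\<xi> \<in> dual_space (fib E x)"
  proof -
    obtain N Y where NY: "open N" "x \<in> N" "Y \<in> Sec'" "\<forall>q. fst q \<in> N \<longrightarrow>
      (\<forall>\<xi>\<in>dual_space (fib E (fst q)). ((\<lambda>s. \<xi> (X (fst q, s))) has_real_derivative \<xi> (Y q)) (at (snd q)))"
      using loc[of x] by blast
    show ?thesis using NY(4)[rule_format, of "(x, t)" \<xi>] eq[of "(x, t)" N Y] NY \<xi> by simp
  qed
  show "time_deriv E X \<in> Sec'"
  proof (rule T.sections_near)
    fix q :: "'m \<times> real"
    obtain N Y where NY: "open N" "fst q \<in> N" "Y \<in> Sec'" "\<forall>q. fst q \<in> N \<longrightarrow>
      (\<forall>\<xi>\<in>dual_space (fib E (fst q)). ((\<lambda>s. \<xi> (X (fst q, s))) has_real_derivative \<xi> (Y q)) (at (snd q)))"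
      using loc[of "fst q"] by blast
    have e: "time_deriv E X p = Y p" if "fst p \<in> N" for p
      by (rule eq[OF that NY(3,4)])
    show "time_deriv E X q \<in> fib (tilde_bundle E) q"
      using e[OF NY(2)] tilde_sec_fib[OF NY(3), of q] by simp
    show "\<exists>N Y. open N \<and> q \<in> N \<and> Y \<in> Sec' \<and> (\<forall>y\<in>N. time_deriv E X y = Y y)"
      using NY e by (intro exI[of _ "N \<times> UNIV"] exI[of _ Y]) (auto simp: open_Times mem_Times_iff)
  qed
qed

lemma time_deriv_pullback: "X \<in> Sec \<Longrightarrow> time_deriv E (\<lambda>q. X (fst q)) (x, t) = 0"
  by (rule time_deriv_eqI) (auto simp: dual_space_zero[OF subspace_fib] intro: fib_zero)

lemma time_deriv_scale:
  assumes X: "X \<in> Sec'" and f: "f \<in> Fun'"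
  shows "time_deriv E (\<lambda>q. f q *\<^sub>R X q) q = f q *\<^sub>R time_deriv E X q + deriv (\<lambda>s. f (fst q, s)) (snd q) *\<^sub>R X q"
proof -
  interpret T: bundle_over "tilde_atlas C" "tilde_bundle E" by (rule bundle_over_tilde)
  obtain x t where q: "q = (x, t)" by (cases q)
  have m: "X (x, s) \<in> fib E x" "time_deriv E X (x, s) \<in> fib E x" for s
    using tilde_sec_fib[OF X, of "(x, s)"] tilde_sec_fib[OF time_deriv_sec[OF X], of "(x, s)"] by simp_all
  have "time_deriv E (\<lambda>q. f q *\<^sub>R X q) (x, t) = f (x, t) *\<^sub>R time_deriv E X (x, t) + deriv (\<lambda>s. f (x, s)) t *\<^sub>R X (x, t)"
  proof (rule time_deriv_eqI)
    show "f (x, t) *\<^sub>R time_deriv E X (x, t) + deriv (\<lambda>s. f (x, s)) t *\<^sub>R X (x, t) \<in> fib E x"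
      using m by (intro fib_add fib_scale)
    fix \<xi> assume \<xi>: "\<xi> \<in> dual_space (fib E x)"
    have "((\<lambda>s. f (x, s) * \<xi> (X (x, s))) has_real_derivative
        f (x, t) * \<xi> (time_deriv E X (x, t)) + deriv (\<lambda>s. f (x, s)) t * \<xi> (X (x, t))) (at t)"
      using DERIV_mult'[OF smooth_at_time_derivative[OF T.smooth_funsD[OF f]] time_deriv_has_derivative[OF X \<xi>]] .
    then show "((\<lambda>s. \<xi> (f (x, s) *\<^sub>R X (x, s))) has_real_derivative
        \<xi> (f (x, t) *\<^sub>R time_deriv E X (x, t) + deriv (\<lambda>s. f (x, s)) t *\<^sub>R X (x, t))) (at t)"
      using m by (simp add: dual_space_combo[OF \<xi>] dual_space_scale[OF subspace_fib \<xi>])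
  qed
  then show ?thesis by (simp add: q)
qed

lemma time_deriv_combo:
  assumes X: "X \<in> Sec'" and Y: "Y \<in> Sec'"
  shows "time_deriv E (\<lambda>q. a *\<^sub>R X q + b *\<^sub>R Y q) q = a *\<^sub>R time_deriv E X q + b *\<^sub>R time_deriv E Y q"
proof -
  obtain x t where q: "q = (x, t)" by (cases q)
  have m: "Z (x, s) \<in> fib E x" "time_deriv E Z (x, s) \<in> fib E x" if "Z \<in> Sec'" for Z s
    using tilde_sec_fib[OF that, of "(x, s)"] tilde_sec_fib[OF time_deriv_sec[OF that], of "(x, s)"] by simp_all
  have "time_deriv E (\<lambda>q. a *\<^sub>R X q + b *\<^sub>R Y q) (x, t) = a *\<^sub>R time_deriv E X (x, t) + b *\<^sub>R time_deriv E Y (x, t)"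
  proof (rule time_deriv_eqI)
    show "a *\<^sub>R time_deriv E X (x, t) + b *\<^sub>R time_deriv E Y (x, t) \<in> fib E x"
      using m X Y by (intro fib_add fib_scale)
    fix \<xi> assume \<xi>: "\<xi> \<in> dual_space (fib E x)"
    have "((\<lambda>s. a * \<xi> (X (x, s)) + b * \<xi> (Y (x, s))) has_real_derivative
        a * \<xi> (time_deriv E X (x, t)) + b * \<xi> (time_deriv E Y (x, t))) (at t)"
      by (intro DERIV_add DERIV_cmult time_deriv_has_derivative X Y \<xi>)
    then show "((\<lambda>s. \<xi> (a *\<^sub>R X (x, s) + b *\<^sub>R Y (x, s))) has_real_derivative
        \<xi> (a *\<^sub>R time_deriv E X (x, t) + b *\<^sub>R time_deriv E Y (x, t))) (at t)"
      using m X Y by (simp add: dual_space_combo[OF \<xi>])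
  qed
  then show ?thesis by (simp add: q)
qed

end

section \<open>Anchor and bracket on time-dependent sections\<close>

context skew_alg
begin

text \<open>The axioms give smoothness in the point for each fixed time only; joint smoothness needs
  an argument. In a chart the derivative of f along X is the sum of the X(z b) times partial
  derivatives of f, where the \<open>z b\<close> are cut-off coordinates: the first factors are
  smooth on M by the axiom, the second ones on the product.\<close>

lemma anchor_time_smooth_sec:
  assumes X: "X \<in> Sec" and f: "f \<in> Fun'"
  shows "(\<lambda>q. anchor A (fst q) (X (fst q)) (\<lambda>y. f (y, snd q))) \<in> Fun'"
proof -
  interpret T: bundle_over "tilde_atlas (base A)" "tilde_bundle (vbun A)" by (rule bundle_over_tilde)
  obtain B :: "'e set" where B: "finite B" "\<And>x. x = (\<Sum>b\<in>B. (x \<bullet> b) *\<^sub>R b)"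
    using exists_finite_orthonormal_expansion by blast
  have "smooth_at (tilde_atlas (base A)) (\<lambda>q. anchor A (fst q) (X (fst q)) (\<lambda>y. f (y, snd q))) (x, t)" for x t
  proof -
    obtain U \<phi> where c: "(U, \<phi>) \<in> base A" "x \<in> U" by (rule chart_exists)
    obtain \<eta> N K where \<eta>: "\<eta> \<in> Fun" "open N" "x \<in> N" "N \<subseteq> U" "\<forall>y\<in>N. \<eta> y = 1"
      "closed K" "K \<subseteq> U" "\<forall>y. y \<notin> K \<longrightarrow> \<eta> y = 0"
      by (rule bump_exists[OF chart_open[OF c(1)] c(2)])
    \<comment> \<open>Coordinate functions cut off to global smooth functions, because the anchor is
      only controlled on those. They agree with the coordinates on \<open>N\<close>.\<close>
    define z where "z b y = \<eta> y * (\<phi> y \<bullet> b)" for b y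
    have z: "z b \<in> Fun" for b
      unfolding z_def
    proof (rule smooth_funs_bump_mult[OF \<eta>(1,6-8)])
      fix y assume y: "y \<in> U"
      have "Ck_on k (\<phi> ` U) (\<lambda>p. p \<bullet> b)" for k
        by (intro Ck_on_bounded_linear bounded_linear_inner_left chart_open_image[OF c(1)])
      then have "Ck_on k (\<phi> ` U) ((\<lambda>y. \<phi> y \<bullet> b) \<circ> inv_into U \<phi>)" for k
        by (rule Ck_on_cong_imp[OF chart_open_image[OF c(1)], rotated]) (auto simp: chart_inv[OF c(1)])
      then show "smooth_at (base A) (\<lambda>y. \<phi> y \<bullet> b) y"
        by (intro smooth_at_chartI[OF c(1) chart_open[OF c(1)] y]) (auto simp: Cinf_on_def)
    qed
    let ?F = "\<lambda>q. f (inv_into U \<phi> (fst q), snd q)"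
    have fs: "smooth_at (tilde_atlas (base A)) f p" for p by (rule T.smooth_funsD[OF f])
    have sm: "smooth_at (tilde_atlas (base A))
        (\<lambda>q. \<Sum>b\<in>B. anchor_fun A X (z b) (fst q) * frechet_derivative ?F (at (\<phi> (fst q), snd q)) (b, 0)) (x, t)"
      by (intro T.smooth_at_sum T.smooth_at_mult T.smooth_funsD[OF pullback_Fun[OF anchor_fun_smooth[OF X z]]]
          smooth_at_chart_deriv[OF fs c])
    show ?thesis
    proof (rule T.smooth_at_cong[OF sm])
      show "open (N \<times> (UNIV :: real set))" "(x, t) \<in> N \<times> UNIV" using \<eta> by (auto simp: open_Times)
      fix q assume "q \<in> N \<times> (UNIV :: real set)"
      then obtain y s where q: "q = (y, s)" "y \<in> N" by auto
      have yU: "y \<in> U" using q \<eta> by auto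
      obtain w where w: "\<forall>f\<in>Fun. anchor A y (X y) f = frechet_derivative (\<lambda>p. f (inv_into U \<phi> p)) (at (\<phi> y)) w"
        by (rule tangent_in_chart[OF anchor_tangent[OF sections_fib[OF X]] c(1) yU])
      \<comment> \<open>Applied to coordinate functions, the tangent vector returns its own
        components in the chart.\<close>
      have wb: "anchor_fun A X (z b) y = w \<bullet> b" for b
      proof -
        have e1: "frechet_derivative (\<lambda>p. z b (inv_into U \<phi> p)) (at (\<phi> y)) = frechet_derivative (\<lambda>p. p \<bullet> b) (at (\<phi> y))"
          by (rule frechet_derivative_cong_open[OF chart_open_image_Int[OF c(1) \<eta>(2)]])
             (use q yU \<eta>(5) in \<open>auto simp: z_def chart_inv[OF c(1)]\<close>)
        have e2: "(\<lambda>p. p \<bullet> b) = frechet_derivative (\<lambda>p. p \<bullet> b) (at (\<phi> y))"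
          by (intro frechet_derivative_at bounded_linear_imp_has_derivative bounded_linear_inner_left)
        have "anchor_fun A X (z b) y = frechet_derivative (\<lambda>p. z b (inv_into U \<phi> p)) (at (\<phi> y)) w"
          unfolding anchor_fun_def by (rule w[rule_format, OF z])
        then show ?thesis unfolding e1 e2[symmetric] .
      qed
      have d: "(?F has_derivative frechet_derivative ?F (at (\<phi> y, s))) (at (\<phi> y, s))"
        by (rule tilde_chart_derivative[OF fs c(1) yU])
      have e3: "(\<lambda>w. frechet_derivative ?F (at (\<phi> y, s)) (w, 0)) = frechet_derivative (\<lambda>p. f (inv_into U \<phi> p, s)) (at (\<phi> y))"
        using frechet_derivative_at[OF has_derivative_slices(1)[OF d]] by simp
      have "anchor A y (X y) (\<lambda>y. f (y, s)) = frechet_derivative ?F (at (\<phi> y, s)) (w, 0)"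
        using w[rule_format, OF slice_Fun[OF f, of s]] fun_cong[OF e3, of w] by simp
      also have "(w, 0) = (\<Sum>b\<in>B. (w \<bullet> b) *\<^sub>R (b, 0 :: real))"
        using B(2)[of w] by (simp add: prod_eq_iff fst_sum snd_sum)
      also have "frechet_derivative ?F (at (\<phi> y, s)) (\<Sum>b\<in>B. (w \<bullet> b) *\<^sub>R (b, 0 :: real)) =
          (\<Sum>b\<in>B. (w \<bullet> b) * frechet_derivative ?F (at (\<phi> y, s)) (b, 0))"
        using has_derivative_linear[OF d] by (simp add: linear_sum linear_scale del: scaleR_Pair)
      finally show "(\<Sum>b\<in>B. anchor_fun A X (z b) (fst q) * frechet_derivative ?F (at (\<phi> (fst q), snd q)) (b, 0)) =
          anchor A (fst q) (X (fst q)) (\<lambda>y. f (y, snd q))"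
        by (simp add: q wb)
    qed
  qed
  then show ?thesis by (auto simp: T.smooth_funs_iff)
qed

lemma anchor_time_smooth:
  assumes X: "X \<in> Sec'" and f: "f \<in> Fun'"
  shows "(\<lambda>q. anchor A (fst q) (X q) (\<lambda>y. f (y, snd q))) \<in> Fun'"
  by (rule tilde_linear_smooth[OF _ _ X, where L = "\<lambda>q v. anchor A (fst q) v (\<lambda>y. f (y, snd q))"])
     (simp_all add: anchor_combo slice_Fun[OF f] anchor_time_smooth_sec[OF _ f])

text \<open>The difference Z of the two sections vanishes on \<open>N\<close> and is unchanged by
  the factor 1 - \<eta>, as \<eta> is 0 off \<open>N\<close>. The Leibniz rule for (1 - \<eta>) Z
  then yields 0 at \<open>x\<close>, where both 1 - \<eta> and Z vanish.\<close>

lemma bracket_local: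
  assumes X: "X \<in> Sec" "X' \<in> Sec" "Y \<in> Sec" and N: "open N" "x \<in> N" "\<And>y. y \<in> N \<Longrightarrow> X y = X' y"
  shows "bracket A X Y x = bracket A X' Y x"
proof -
  obtain \<eta> M K where \<eta>: "\<eta> \<in> Fun" "open M" "x \<in> M" "M \<subseteq> N" "\<forall>y\<in>M. \<eta> y = 1"
    "closed K" "K \<subseteq> N" "\<forall>y. y \<notin> K \<longrightarrow> \<eta> y = 0"
    by (rule bump_exists[OF N(1,2)])
  define Z where "Z y = X y - X' y" for y
  have Z: "Z \<in> Sec" unfolding Z_def using X by (intro sections_diff)
  have f: "(\<lambda>y. 1 - \<eta> y) \<in> Fun" using \<eta> by (intro smooth_funs_diff smooth_funs_const)
  have "X y = X' y + (1 - \<eta> y) *\<^sub>R Z y" for y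
  proof (cases "y \<in> N")
    case False
    then have "\<eta> y = 0" using \<eta> by blast
    then show ?thesis by (simp add: Z_def)
  qed (use N in \<open>simp add: Z_def\<close>)
  then have "X = (\<lambda>y. X' y + (1 - \<eta> y) *\<^sub>R Z y)" by (rule ext)
  then have "bracket A X Y x = bracket A (\<lambda>y. X' y + (1 - \<eta> y) *\<^sub>R Z y) Y x" by (rule arg_cong)
  also have "\<dots> = bracket A X' Y x + bracket A (\<lambda>y. (1 - \<eta> y) *\<^sub>R Z y) Y x"
    by (intro bracket_add_left X sections_scale f Z)
  also have "bracket A (\<lambda>y. (1 - \<eta> y) *\<^sub>R Z y) Y x = (1 - \<eta> x) *\<^sub>R bracket A Z Y x - anchor_fun A Y (\<lambda>y. 1 - \<eta> y) x *\<^sub>R Z x"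
    by (rule bracket_scale_left[OF Z X(3) f])
  also have "\<dots> = 0" using \<eta> N by (simp add: Z_def)
  finally show ?thesis by simp
qed

lemma bracket_combo:
  fixes n :: nat
  assumes "\<And>i. i < n \<Longrightarrow> c i \<in> Fun" "\<And>i. i < n \<Longrightarrow> X i \<in> Sec" "Y \<in> Sec"
  shows "bracket A (\<lambda>x. \<Sum>i<n. c i x *\<^sub>R X i x) Y x =
    (\<Sum>i<n. c i x *\<^sub>R bracket A (X i) Y x - anchor_fun A Y (c i) x *\<^sub>R X i x)"
  using assms
proof (induction n)
  case 0
  have "bracket A (\<lambda>x. 0 *\<^sub>R Y x) Y x = 0 *\<^sub>R bracket A Y Y x - anchor_fun A Y (\<lambda>x. 0) x *\<^sub>R Y x"
    by (rule bracket_scale_left[OF 0(3,3) smooth_funs_const])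
  then show ?case using anchor_fun_const[OF 0(3) smooth_funs_const] by simp
next
  case (Suc n)
  have "bracket A (\<lambda>x. (\<Sum>i<n. c i x *\<^sub>R X i x) + c n x *\<^sub>R X n x) Y x =
      bracket A (\<lambda>x. \<Sum>i<n. c i x *\<^sub>R X i x) Y x + bracket A (\<lambda>x. c n x *\<^sub>R X n x) Y x"
    using Suc.prems by (intro bracket_add_left sections_combo sections_scale) auto
  then show ?case using Suc by (simp add: bracket_scale_left)
qed

text \<open>Expanding X in a time-independent frame, the slicewise bracket becomes a combination of
  brackets of frame sections and derivatives of the coefficients, both jointly smooth by assumption.
  The second argument is a general family \<open>Y t\<close> so that the lemma can be used twice,
  for a constant family and for the slices of a time-dependent section.\<close>

lemma bracket_time_sec_aux:
  assumes X: "X \<in> Sec'"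
    and Y: "\<And>t. Y t \<in> Sec" "\<And>f. f \<in> Fun' \<Longrightarrow> (\<lambda>q. anchor A (fst q) (Y (snd q) (fst q)) (\<lambda>y. f (y, snd q))) \<in> Fun'"
    and Z: "\<And>Z. Z \<in> Sec \<Longrightarrow> (\<lambda>q. bracket A Z (Y (snd q)) (fst q)) \<in> Sec'"
  shows "(\<lambda>q. bracket A (\<lambda>y. X (y, snd q)) (Y (snd q)) (fst q)) \<in> Sec'"
proof -
  interpret T: bundle_over "tilde_atlas (base A)" "tilde_bundle (vbun A)" by (rule bundle_over_tilde)
  show ?thesis
  proof (rule T.sections_near)
    show "bracket A (\<lambda>y. X (y, snd q)) (Y (snd q)) (fst q) \<in> fib (tilde_bundle (vbun A)) q" for q
      using bracket_fib[OF slice_sec[OF X] Y(1)] by simp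
    fix q :: "'m \<times> real"
    obtain N Es where N: "open N" "fst q \<in> N" "\<forall>i<rk (vbun A). Es i \<in> Sec"
      "\<forall>X\<in>Sec'. \<exists>c. (\<forall>i<rk (vbun A). c i \<in> Fun') \<and> (\<forall>q. fst q \<in> N \<longrightarrow> X q = (\<Sum>i<rk (vbun A). c i q *\<^sub>R Es i (fst q)))"
      by (rule tilde_local_frame)
    obtain c where c: "\<forall>i<rk (vbun A). c i \<in> Fun'" "\<forall>q. fst q \<in> N \<longrightarrow> X q = (\<Sum>i<rk (vbun A). c i q *\<^sub>R Es i (fst q))"
      using N(4) X by blast
    define W where "W q = (\<Sum>i<rk (vbun A). c i q *\<^sub>R bracket A (Es i) (Y (snd q)) (fst q) -
      anchor A (fst q) (Y (snd q) (fst q)) (\<lambda>y. c i (y, snd q)) *\<^sub>R Es i (fst q))" for q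
    have "W \<in> Sec'"
      unfolding W_def using c N Y Z
      by (intro T.sections_sum T.sections_diff T.sections_scale pullback_sec) auto
    moreover have "bracket A (\<lambda>y. X (y, snd p)) (Y (snd p)) (fst p) = W p" if p: "fst p \<in> N" for p
    proof -
      have cs: "(\<lambda>y. c i (y, snd p)) \<in> Fun" if "i < rk (vbun A)" for i using c that slice_Fun by blast
      have "bracket A (\<lambda>y. X (y, snd p)) (Y (snd p)) (fst p) =
          bracket A (\<lambda>y. \<Sum>i<rk (vbun A). c i (y, snd p) *\<^sub>R Es i y) (Y (snd p)) (fst p)"
        using c N p cs by (intro bracket_local[OF slice_sec[OF X] _ Y(1) N(1) p] sections_combo) auto
      also have "\<dots> = (\<Sum>i<rk (vbun A). c i (fst p, snd p) *\<^sub>R bracket A (Es i) (Y (snd p)) (fst p) -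
          anchor_fun A (Y (snd p)) (\<lambda>y. c i (y, snd p)) (fst p) *\<^sub>R Es i (fst p))"
        using N cs by (intro bracket_combo Y) auto
      finally show ?thesis by (simp add: W_def anchor_fun_def)
    qed
    ultimately show "\<exists>N W. open N \<and> q \<in> N \<and> W \<in> Sec' \<and>
        (\<forall>p\<in>N. bracket A (\<lambda>y. X (y, snd p)) (Y (snd p)) (fst p) = W p)"
      using N by (intro exI[of _ "N \<times> UNIV"] exI[of _ W]) (auto simp: open_Times mem_Times_iff)
  qed
qed

lemma bracket_time_sec:
  assumes X: "X \<in> Sec'" and Y: "Y \<in> Sec'"
  shows "(\<lambda>q. bracket A (\<lambda>y. X (y, snd q)) (\<lambda>y. Y (y, snd q)) (fst q)) \<in> Sec'"
proof (rule bracket_time_sec_aux[OF X, where Y = "\<lambda>t y. Y (y, t)"])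
  interpret T: bundle_over "tilde_atlas (base A)" "tilde_bundle (vbun A)" by (rule bundle_over_tilde)
  show "(\<lambda>y. Y (y, t)) \<in> Sec" for t by (rule slice_sec[OF Y])
  show "(\<lambda>q. anchor A (fst q) (Y (fst q, snd q)) (\<lambda>y. f (y, snd q))) \<in> Fun'" if "f \<in> Fun'" for f
    using anchor_time_smooth[OF Y that] by simp
  show "(\<lambda>q. bracket A Z (\<lambda>y. Y (y, snd q)) (fst q)) \<in> Sec'" if Z: "Z \<in> Sec" for Z
  proof -
    \<comment> \<open>The case of one constant argument, with the time-dependent one on the left;
      skew-symmetry then moves it to the right, where the outer application needs it.\<close>
    have "(\<lambda>q. bracket A (\<lambda>y. Y (y, snd q)) Z (fst q)) \<in> Sec'"
    proof (rule bracket_time_sec_aux[OF Y, where Y = "\<lambda>t. Z"])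
      show "Z \<in> Sec" by (rule Z)
      show "(\<lambda>q. anchor A (fst q) (Z (fst q)) (\<lambda>y. f (y, snd q))) \<in> Fun'" if "f \<in> Fun'" for f
        by (rule anchor_time_smooth_sec[OF Z that])
      show "(\<lambda>q. bracket A W Z (fst q)) \<in> Sec'" if "W \<in> Sec" for W
        by (rule pullback_sec[OF bracket_sec[OF that Z]])
    qed
    from T.sections_minus[OF this] show ?thesis
      using bracket_skew[OF Z slice_sec[OF Y]] by simp
  qed
qed

end

section \<open>The skew algebroid over the product with the real line\<close>

lemma tilde_minus_simps [simp]:
  "base (tilde_minus A \<phi>\<^sub>0) = tilde_atlas (base A)"
  "vbun (tilde_minus A \<phi>\<^sub>0) = tilde_bundle (vbun A)"
  by (simp_all add: tilde_minus_def)

lemma bracket_tilde_minus: "bracket (tilde_minus A \<phi>\<^sub>0) X Y q =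
    bracket A (\<lambda>y. X (y, snd q)) (\<lambda>y. Y (y, snd q)) (fst q) +
    \<phi>\<^sub>0 (fst q) (X q) *\<^sub>R time_deriv (vbun A) Y q - \<phi>\<^sub>0 (fst q) (Y q) *\<^sub>R time_deriv (vbun A) X q"
  by (simp add: tilde_minus_def case_prod_beta)

lemma anchor_tilde_minus: "anchor (tilde_minus A \<phi>\<^sub>0) q v f =
    anchor A (fst q) v (\<lambda>y. f (y, snd q)) + \<phi>\<^sub>0 (fst q) v * deriv (\<lambda>s. f (fst q, s)) (snd q)"
  by (simp add: tilde_minus_def case_prod_beta)

lemma anchor_fun_tilde_minus: "anchor_fun (tilde_minus A \<phi>\<^sub>0) X f q =
    anchor A (fst q) (X q) (\<lambda>y. f (y, snd q)) + \<phi>\<^sub>0 (fst q) (X q) * deriv (\<lambda>s. f (fst q, s)) (snd q)"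
  by (simp add: anchor_fun_def anchor_tilde_minus)

context bundle_over
begin

text \<open>\<open>tilde_linear_smooth\<close> in one argument after the other. \<open>F\<close>
  will be the bivector and the metric, whose weighted versions must be smooth over the
  product.\<close>

lemma tilde_bilinear_smooth:
  assumes left: "\<And>x u v w a b. u \<in> fib E x \<Longrightarrow> v \<in> fib E x \<Longrightarrow> w \<in> fib E x \<Longrightarrow>
      F x (a *\<^sub>R u + b *\<^sub>R v) w = a * F x u w + b * F x v w"
    and right: "\<And>x u v w a b. u \<in> fib E x \<Longrightarrow> v \<in> fib E x \<Longrightarrow> w \<in> fib E x \<Longrightarrow>
      F x w (a *\<^sub>R u + b *\<^sub>R v) = a * F x w u + b * F x w v"
    and smooth: "\<And>X Y. X \<in> Sec \<Longrightarrow> Y \<in> Sec \<Longrightarrow> (\<lambda>x. F x (X x) (Y x)) \<in> Fun"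
    and X: "X \<in> Sec'" and Y: "Y \<in> Sec'"
  shows "(\<lambda>q. F (fst q) (X q) (Y q)) \<in> Fun'"
proof (rule tilde_linear_smooth[OF _ _ X, where L = "\<lambda>q u. F (fst q) u (Y q)"])
  show "F (fst q) (a *\<^sub>R u + b *\<^sub>R v) (Y q) = a * F (fst q) u (Y q) + b * F (fst q) v (Y q)"
    if "u \<in> fib E (fst q)" "v \<in> fib E (fst q)" for q u v a b
    by (rule left[OF that tilde_sec_fib[OF Y]])
  show "(\<lambda>q. F (fst q) (Z (fst q)) (Y q)) \<in> Fun'" if Z: "Z \<in> Sec" for Z
  proof (rule tilde_linear_smooth[OF _ _ Y, where L = "\<lambda>q v. F (fst q) (Z (fst q)) v"])
    show "F (fst q) (Z (fst q)) (a *\<^sub>R u + b *\<^sub>R v) = a * F (fst q) (Z (fst q)) u + b * F (fst q) (Z (fst q)) v"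
      if "u \<in> fib E (fst q)" "v \<in> fib E (fst q)" for q u v a b
      by (rule right[OF that sections_fib[OF Z]])
    show "(\<lambda>q. F (fst q) (Z (fst q)) (W (fst q))) \<in> Fun'" if "W \<in> Sec" for W
      by (rule pullback_Fun[OF smooth[OF Z that]])
  qed
qed

end

context skew_alg
begin

text \<open>Each axiom splits into the axiom of \<open>A\<close> on a time slice and a property of
  the time derivative. In the Leibniz rule the product rule of \<open>time_deriv\<close> contributes
  exactly the time component of the anchor.\<close>

lemma skew_algebroid_tilde_minus:
  assumes \<phi>: "\<phi>\<^sub>0 \<in> Cos"
  shows "skew_algebroid (tilde_minus A \<phi>\<^sub>0)"
  unfolding skew_algebroid_def bundle_map_to_TM_def tilde_minus_simps
proof (intro conjI ballI allI)
  interpret T: bundle_over "tilde_atlas (base A)" "tilde_bundle (vbun A)" by (rule bundle_over_tilde)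
  note \<phi>d = cosections_dual[OF \<phi>]
  have \<phi>_smooth: "(\<lambda>q. \<phi>\<^sub>0 (fst q) (X q)) \<in> Fun'" if "X \<in> Sec'" for X
    by (rule tilde_linear_smooth[OF _ _ that, where L = "\<lambda>q. \<phi>\<^sub>0 (fst q)"])
       (auto intro: dual_space_combo[OF \<phi>d] pullback_Fun[OF cosections_pairing[OF \<phi>]])
  show "smooth_manifold (tilde_atlas (base A))" by (rule smooth_manifold_tilde)
  show "vector_bundle (tilde_atlas (base A)) (tilde_bundle (vbun A))" by (rule vector_bundle_tilde)
  show "anchor (tilde_minus A \<phi>\<^sub>0) q v \<in> tangent_vectors (tilde_atlas (base A)) q"
    if v: "v \<in> fib (tilde_bundle (vbun A)) q" for q v
  proof -
    obtain x t where q: "q = (x, t)" by (cases q)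
    have "anchor A x v \<in> tangent_vectors (base A) x" using v q by (simp add: anchor_tangent)
    then obtain U \<phi> w where c: "(U, \<phi>) \<in> base A" "x \<in> U"
      and w: "\<forall>f\<in>Fun. anchor A x v f = frechet_derivative (\<lambda>p. f (inv_into U \<phi> p)) (at (\<phi> x)) w"
      by (auto simp: tangent_vectors_def comp_def)
    \<comment> \<open>If \<open>w\<close> represents the anchor of \<open>v\<close> in a chart of M,
      then (w, \<open>\<phi>\<^sub>0 x v\<close>) represents the new anchor in the product
      chart.\<close>
    have "anchor (tilde_minus A \<phi>\<^sub>0) q v f =
        frechet_derivative (f \<circ> inv_into (U \<times> UNIV) (\<lambda>(x, t). (\<phi> x, t))) (at ((\<lambda>(x, t). (\<phi> x, t)) q)) (w, \<phi>\<^sub>0 x v)"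
      if f: "f \<in> Fun'" for f
    proof -
      let ?F = "\<lambda>q. f (inv_into U \<phi> (fst q), snd q)"
      have d: "(?F has_derivative frechet_derivative ?F (at (\<phi> x, t))) (at (\<phi> x, t))"
        by (rule tilde_chart_derivative[OF T.smooth_funsD[OF f] c])
      interpret L: linear "frechet_derivative ?F (at (\<phi> x, t))" by (rule has_derivative_linear[OF d])
      have "frechet_derivative ?F (at (\<phi> x, t)) (w, \<phi>\<^sub>0 x v) =
          frechet_derivative ?F (at (\<phi> x, t)) ((w, 0) + \<phi>\<^sub>0 x v *\<^sub>R (0, 1))" by simp
      also have "\<dots> = frechet_derivative ?F (at (\<phi> x, t)) (w, 0) + \<phi>\<^sub>0 x v * frechet_derivative ?F (at (\<phi> x, t)) (0, 1)"
        by (simp only: L.add L.scale real_scaleR_def)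
      also have "frechet_derivative ?F (at (\<phi> x, t)) (w, 0) = anchor A x v (\<lambda>y. f (y, t))"
        using w[rule_format, OF slice_Fun[OF f, of t]]
          fun_cong[OF frechet_derivative_at[OF has_derivative_slices(1)[OF d]], of w] by simp
      also have "frechet_derivative ?F (at (\<phi> x, t)) (0, 1) = deriv (\<lambda>s. f (x, s)) t"
      proof -
        have "((\<lambda>s. f (x, s)) has_derivative (\<lambda>s. frechet_derivative ?F (at (\<phi> x, t)) (0, s))) (at t)"
          using has_derivative_slices(2)[OF d] by (simp add: chart_inv[OF c])
        moreover have "((\<lambda>s. f (x, s)) has_derivative (*) (deriv (\<lambda>s. f (x, s)) t)) (at t)"
          using smooth_at_time_derivative[OF T.smooth_funsD[OF f]] unfolding has_field_derivative_def .
        ultimately have "(\<lambda>s. frechet_derivative ?F (at (\<phi> x, t)) (0, s)) = (*) (deriv (\<lambda>s. f (x, s)) t)"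
          by (rule has_derivative_unique)
        from fun_cong[OF this, of 1] show ?thesis by simp
      qed
      finally have "frechet_derivative ?F (at (\<phi> x, t)) (w, \<phi>\<^sub>0 x v) = anchor (tilde_minus A \<phi>\<^sub>0) q v f"
        by (simp add: q anchor_tilde_minus)
      moreover have "frechet_derivative (f \<circ> inv_into (U \<times> UNIV) (\<lambda>(x, t). (\<phi> x, t))) (at (\<phi> x, t)) =
          frechet_derivative ?F (at (\<phi> x, t))"
        by (rule frechet_derivative_cong_open[where S = "\<phi> ` U \<times> UNIV"])
           (use c chart_open_image[OF c(1)] in \<open>auto simp: tilde_chart_inv[OF c(1)] open_Times\<close>)
      ultimately show ?thesis by (simp add: q)
    qed
    then show ?thesis
      unfolding tangent_vectors_def using tilde_chart[OF c(1)] c(2) q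
      by (intro CollectI bexI[of _ "(U \<times> UNIV, \<lambda>(x, t). (\<phi> x, t))"]) auto
  qed
  show "anchor (tilde_minus A \<phi>\<^sub>0) q (a *\<^sub>R v + b *\<^sub>R w) f =
      a * anchor (tilde_minus A \<phi>\<^sub>0) q v f + b * anchor (tilde_minus A \<phi>\<^sub>0) q w f"
    if "v \<in> fib (tilde_bundle (vbun A)) q" "w \<in> fib (tilde_bundle (vbun A)) q" "f \<in> Fun'" for q v w a b f
    using that
    by (simp add: anchor_tilde_minus anchor_combo slice_Fun dual_space_combo[OF \<phi>d] algebra_simps)
  show "anchor_fun (tilde_minus A \<phi>\<^sub>0) X f \<in> Fun'" if "X \<in> Sec'" "f \<in> Fun'" for X f
    unfolding anchor_fun_tilde_minus[abs_def]
    by (intro T.smooth_funs_add T.smooth_funs_mult anchor_time_smooth that \<phi>_smooth time_deriv_Fun)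
  show "bracket (tilde_minus A \<phi>\<^sub>0) X Y \<in> Sec'" if "X \<in> Sec'" "Y \<in> Sec'" for X Y
    unfolding bracket_tilde_minus[abs_def]
    by (intro T.sections_diff T.sections_add T.sections_scale bracket_time_sec that \<phi>_smooth time_deriv_sec)
  show "bracket (tilde_minus A \<phi>\<^sub>0) X Y = - bracket (tilde_minus A \<phi>\<^sub>0) Y X" if "X \<in> Sec'" "Y \<in> Sec'" for X Y
  proof
    fix q
    show "bracket (tilde_minus A \<phi>\<^sub>0) X Y q = (- bracket (tilde_minus A \<phi>\<^sub>0) Y X) q"
      using bracket_skew[OF slice_sec[OF that(1)] slice_sec[OF that(2)], of "snd q" "snd q" "fst q"]
      by (simp add: bracket_tilde_minus)
  qed
  show "bracket (tilde_minus A \<phi>\<^sub>0) (a *\<^sub>R X + b *\<^sub>R Y) Z =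
      a *\<^sub>R bracket (tilde_minus A \<phi>\<^sub>0) X Z + b *\<^sub>R bracket (tilde_minus A \<phi>\<^sub>0) Y Z"
    if X: "X \<in> Sec'" and Y: "Y \<in> Sec'" and Z: "Z \<in> Sec'" for X Y Z a b
  proof
    fix q
    have e: "a *\<^sub>R X + b *\<^sub>R Y = (\<lambda>q. a *\<^sub>R X q + b *\<^sub>R Y q)" by (simp add: fun_eq_iff scaleR_fun_apply)
    have \<phi>l: "\<phi>\<^sub>0 (fst q) (a *\<^sub>R X q + b *\<^sub>R Y q) = a * \<phi>\<^sub>0 (fst q) (X q) + b * \<phi>\<^sub>0 (fst q) (Y q)"
      using X Y by (intro dual_space_combo[OF \<phi>d] tilde_sec_fib)
    show "bracket (tilde_minus A \<phi>\<^sub>0) (a *\<^sub>R X + b *\<^sub>R Y) Z q =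
        (a *\<^sub>R bracket (tilde_minus A \<phi>\<^sub>0) X Z + b *\<^sub>R bracket (tilde_minus A \<phi>\<^sub>0) Y Z) q"
      unfolding e
      using bracket_combo_left[OF slice_sec[OF X] slice_sec[OF Y] slice_sec[OF Z], of a "snd q" b "snd q" "snd q" "fst q"]
      by (simp add: bracket_tilde_minus scaleR_fun_apply \<phi>l time_deriv_combo[OF X Y])
         (simp add: algebra_simps)
  qed
  show "bracket (tilde_minus A \<phi>\<^sub>0) X (\<lambda>q. f q *\<^sub>R Y q) =
      (\<lambda>q. f q *\<^sub>R bracket (tilde_minus A \<phi>\<^sub>0) X Y q + anchor_fun (tilde_minus A \<phi>\<^sub>0) X f q *\<^sub>R Y q)"
    if X: "X \<in> Sec'" and Y: "Y \<in> Sec'" and f: "f \<in> Fun'" for X Y f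
  proof
    fix q
    have \<phi>l: "\<phi>\<^sub>0 (fst q) (f q *\<^sub>R Y q) = f q * \<phi>\<^sub>0 (fst q) (Y q)"
      using Y by (intro dual_space_scale[OF subspace_fib \<phi>d] tilde_sec_fib)
    show "bracket (tilde_minus A \<phi>\<^sub>0) X (\<lambda>q. f q *\<^sub>R Y q) q =
      f q *\<^sub>R bracket (tilde_minus A \<phi>\<^sub>0) X Y q + anchor_fun (tilde_minus A \<phi>\<^sub>0) X f q *\<^sub>R Y q"
      using bracket_scale_right[OF slice_sec[OF X] slice_sec[OF Y] slice_Fun[OF f], of "snd q" "snd q" "snd q" "fst q"]
      by (simp add: bracket_tilde_minus anchor_fun_tilde_minus \<phi>l time_deriv_scale[OF Y f])
         (simp add: anchor_fun_def algebra_simps)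
  qed
qed

end

section \<open>Compatibility\<close>

locale bivector_metric = bivector_algebroid A \<phi>\<^sub>0 \<pi>
  for A :: "('m::{t2_space,second_countable_topology}, 'e::{real_inner,heine_borel}, 'v::real_vector) algebroid"
    and \<phi>\<^sub>0 \<pi> +
  fixes g :: "'m \<Rightarrow> ('v \<Rightarrow> real) \<Rightarrow> ('v \<Rightarrow> real) \<Rightarrow> real"
  assumes g: "pseudo_riemannian_metric (base A) (dual_bundle (vbun A)) g"

text \<open>The connection lives on the dual bundle, so the theory of algebroids with metric is
  instantiated a second time, for the dual algebroid; its facts carry the prefix \<open>M\<close>.
  The rewrites keep base and bundle in the form in which facts about \<open>A\<close> mention
  them.\<close>

sublocale bivector_metric \<subseteq> M: skew_metric "dual_algebroid_phi A \<phi>\<^sub>0 \<pi>" g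
  rewrites "base (dual_algebroid_phi A \<phi>\<^sub>0 \<pi>) = base A"
    and "vbun (dual_algebroid_phi A \<phi>\<^sub>0 \<pi>) = dual_bundle (vbun A)"
proof -
  interpret S: skew_alg "dual_algebroid_phi A \<phi>\<^sub>0 \<pi>" by unfold_locales (rule skew_algebroid_dual)
  show "skew_metric (dual_algebroid_phi A \<phi>\<^sub>0 \<pi>) g"
    by unfold_locales (simp add: g)
qed simp_all

context bivector_metric
begin

abbreviation "D \<equiv> levi_civita (dual_algebroid_phi A \<phi>\<^sub>0 \<pi>) g"

abbreviation "cov \<equiv> cov_deriv_bivector (dual_algebroid_phi A \<phi>\<^sub>0 \<pi>) D \<pi>"

lemma D_fib: "\<alpha> \<in> Cos \<Longrightarrow> \<beta> \<in> Cos \<Longrightarrow> D \<alpha> \<beta> x \<in> Dual x"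
  by (rule cosections_dual[OF M.levi_civita_sec])

lemma cov_apply: "cov \<alpha> \<beta> \<gamma> x =
    anchor_fun A (sharp_sec A \<pi> \<alpha>) (\<lambda>y. \<pi> y [\<beta> y, \<gamma> y]) x - \<pi> x [D \<alpha> \<beta> x, \<gamma> x] - \<pi> x [\<beta> x, D \<alpha> \<gamma> x]"
  by (simp add: cov_deriv_bivector_def anchor_fun_dual_algebroid_phi)

text \<open>Makes tensoriality in the third argument a consequence of tensoriality in the
  second.\<close>

lemma cov_skew:
  assumes "\<alpha> \<in> Cos" "\<beta> \<in> Cos" "\<gamma> \<in> Cos"
  shows "cov \<alpha> \<beta> \<gamma> x = - cov \<alpha> \<gamma> \<beta> x"
proof -
  have d: "\<beta> y \<in> Dual y" "\<gamma> y \<in> Dual y" for y using assms by (auto intro: cosections_dual)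
  have "(\<lambda>y. \<pi> y [\<gamma> y, \<beta> y]) = (\<lambda>y. - \<pi> y [\<beta> y, \<gamma> y])" using bivector_skew d by blast
  moreover have "\<pi> x [D \<alpha> \<gamma> x, \<beta> x] = - \<pi> x [\<beta> x, D \<alpha> \<gamma> x]" "\<pi> x [\<gamma> x, D \<alpha> \<beta> x] = - \<pi> x [D \<alpha> \<beta> x, \<gamma> x]"
    using bivector_skew d D_fib assms by blast+
  ultimately show ?thesis
    using anchor_fun_minus[OF sharp_section(1)[OF assms(1)] bivector_smooth[OF assms(2,3)]]
    by (simp add: cov_apply)
qed

lemma cov_tensorial_first:
  assumes "\<alpha> \<in> Cos" "\<alpha>' \<in> Cos" "\<beta> \<in> Cos" "\<gamma> \<in> Cos" "\<alpha> x = \<alpha>' x"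
  shows "cov \<alpha> \<beta> \<gamma> x = cov \<alpha>' \<beta> \<gamma> x"
proof (rule M.tensorial[where F = "\<lambda>\<alpha>. cov \<alpha> \<beta> \<gamma> x" and x = x, OF _ _ assms(1,2,5)])
  note LC = M.is_levi_civita
  have d: "\<beta> x \<in> Dual x" "\<gamma> x \<in> Dual x" using assms by (auto intro: cosections_dual)
  have f: "(\<lambda>y. \<pi> y [\<beta> y, \<gamma> y]) \<in> Fun" using assms by (intro bivector_smooth)
  have r: "anchor_fun A (sharp_sec A \<pi> \<alpha>) f x = anchor_fun (dual_algebroid_phi A \<phi>\<^sub>0 \<pi>) \<alpha> f x" for \<alpha> f
    by (simp add: anchor_fun_dual_algebroid_phi)
  show "cov (\<lambda>y. X y + Y y) \<beta> \<gamma> x = cov X \<beta> \<gamma> x + cov Y \<beta> \<gamma> x" if "X \<in> Cos" "Y \<in> Cos" for X Y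
    using that assms d D_fib unfolding cov_apply r M.anchor_fun_sec_add[OF that f]
    by (simp add: M.connection_add_left[OF LC] bivector_add_left bivector_add_right)
  show "cov (\<lambda>y. f y *\<^sub>R X y) \<beta> \<gamma> x = f x * cov X \<beta> \<gamma> x" if "f \<in> Fun" "X \<in> Cos" for f X
    using that assms d D_fib unfolding cov_apply r M.anchor_fun_sec_scale[OF that(2) f]
    by (simp add: M.connection_scale_left[OF LC] bivector_scale_left bivector_scale_right algebra_simps)
qed

text \<open>The derivative of f along \<pi>-sharp \<alpha> arises once from the product rule for the
  anchor and once from the connection, with opposite signs.\<close>

lemma cov_tensorial_second:
  assumes "\<alpha> \<in> Cos" "\<beta> \<in> Cos" "\<beta>' \<in> Cos" "\<gamma> \<in> Cos" "\<beta> x = \<beta>' x"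
  shows "cov \<alpha> \<beta> \<gamma> x = cov \<alpha> \<beta>' \<gamma> x"
proof (rule M.tensorial[where F = "\<lambda>\<beta>. cov \<alpha> \<beta> \<gamma> x" and x = x, OF _ _ assms(2,3,5)])
  note LC = M.is_levi_civita
  have d: "\<eta> y \<in> Dual y" if "\<eta> \<in> Cos" for \<eta> y using that by (rule cosections_dual)
  have f: "(\<lambda>y. \<pi> y [\<beta> y, \<gamma> y]) \<in> Fun" if "\<beta> \<in> Cos" for \<beta> using assms that by (intro bivector_smooth)
  note s = sharp_section(1)[OF assms(1)]
  show "cov \<alpha> (\<lambda>y. X y + Y y) \<gamma> x = cov \<alpha> X \<gamma> x + cov \<alpha> Y \<gamma> x" if "X \<in> Cos" "Y \<in> Cos" for X Y
    using that assms d D_fib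
    by (simp add: cov_apply M.connection_add_right[OF LC] bivector_add_left anchor_fun_add[OF s f f])
  show "cov \<alpha> (\<lambda>y. f y *\<^sub>R X y) \<gamma> x = f x * cov \<alpha> X \<gamma> x" if "f \<in> Fun" "X \<in> Cos" for X f
    using that assms d D_fib anchor_fun_mult[OF s that(1) f[OF that(2)]]
    by (simp add: cov_apply M.connection_scale_right[OF LC] bivector_left bivector_scale_left
        anchor_fun_dual_algebroid_phi algebra_simps)
qed

lemma cov_tensorial:
  assumes "\<alpha> \<in> Cos" "\<beta> \<in> Cos" "\<gamma> \<in> Cos" "\<alpha>' \<in> Cos" "\<beta>' \<in> Cos" "\<gamma>' \<in> Cos"
    and "\<alpha> x = \<alpha>' x" "\<beta> x = \<beta>' x" "\<gamma> x = \<gamma>' x"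
  shows "cov \<alpha> \<beta> \<gamma> x = cov \<alpha>' \<beta>' \<gamma>' x"
  using cov_tensorial_first[of \<alpha> \<alpha>' \<beta> \<gamma> x] cov_tensorial_second[of \<alpha>' \<beta> \<beta>' \<gamma> x]
    cov_tensorial_second[of \<alpha>' \<gamma> \<gamma>' \<beta>' x] cov_skew[of \<alpha>' \<beta>' \<gamma> x] cov_skew[of \<alpha>' \<beta>' \<gamma>' x] assms
  by simp

text \<open>The pairing with X is linear over functions on covectors, hence represented through the
  metric by a section; nondegeneracy identifies its values with \<open>flat_inv\<close>.\<close>

lemma flat_inv_section:
  assumes X: "X \<in> Sec"
  shows "flat_inv A g x (X x) \<in> Dual x" "\<beta> \<in> Dual x \<Longrightarrow> g x (flat_inv A g x (X x)) \<beta> = \<beta> (X x)"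
proof -
  obtain \<xi> where \<xi>: "\<xi> \<in> Cos" "\<forall>\<beta>\<in>Cos. \<forall>x. g x (\<xi> x) (\<beta> x) = \<beta> x (X x)"
    by (rule M.metric_representation[where K = "\<lambda>\<beta> x. \<beta> x (X x)"])
       (use cosections_pairing[OF _ X] in \<open>auto simp: scaleR_fun_apply\<close>)
  have *: "g x (\<xi> x) \<beta> = \<beta> (X x)" if \<beta>: "\<beta> \<in> Dual x" for \<beta>
  proof -
    obtain b where "b \<in> Cos" "b x = \<beta>" by (rule covector_through[OF \<beta>])
    then show ?thesis using \<xi>(2) by blast
  qed
  have m: "\<xi> x \<in> Dual x" by (rule cosections_dual[OF \<xi>(1)])
  have "flat_inv A g x (X x) = \<xi> x"
    unfolding flat_inv_def dual_bundle_simps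
  proof (rule the_equality)
    fix \<alpha> assume \<alpha>: "\<alpha> \<in> Dual x \<and> (\<forall>\<beta>\<in>Dual x. \<beta> (X x) = g x \<alpha> \<beta>)"
    show "\<alpha> = \<xi> x"
      by (rule M.metric_eqI[of _ x]) (use \<alpha> m * cosections_dual in auto)
  qed (use m * in auto)
  then show "flat_inv A g x (X x) \<in> Dual x" "\<beta> \<in> Dual x \<Longrightarrow> g x (flat_inv A g x (X x)) \<beta> = \<beta> (X x)"
    using m * by auto
qed

section \<open>The structures over the product, evaluated on time-independent covectors\<close>

abbreviation "Tilde \<equiv> tilde_minus A \<phi>\<^sub>0"

lemma pullback_cosec:
  assumes "\<alpha> \<in> Cos"
  shows "(\<lambda>q. \<alpha> (fst q)) \<in> sections (tilde_atlas (base A)) (dual_bundle (tilde_bundle (vbun A)))"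
  unfolding dual_bundle_tilde_bundle by (rule M.pullback_sec[OF assms])

lemma poissonization_apply: "poissonization \<pi> q \<alpha>s = exp (- snd q) * \<pi> (fst q) \<alpha>s"
  by (simp add: poissonization_def case_prod_beta)

lemma tilde_metric_apply: "tilde_metric g q \<alpha> \<beta> = exp (- snd q) * g (fst q) \<alpha> \<beta>"
  by (simp add: tilde_metric_def case_prod_beta)

text \<open>The second instance of the locale. The covector is zero because
  \<open>compatible\<close> refers to the untwisted bracket; the covector
  \<open>\<phi>\<^sub>0\<close> survives only inside the bracket and anchor of
  \<open>Tilde\<close>.\<close>

lemma bivector_metric_tilde:
  "bivector_metric Tilde (\<lambda>q v. 0) (poissonization \<pi>) (tilde_metric g)"
proof -
  interpret T: skew_alg Tilde
    by unfold_locales (rule skew_algebroid_tilde_minus[OF \<phi>])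
  interpret TM: manifold "tilde_atlas (base A)" by (rule manifold_tilde)
  show ?thesis
  proof unfold_locales
    show "(\<lambda>q v. 0) \<in> T.Cos"
    proof (rule T.cosectionsI)
      show "(\<lambda>v. 0) \<in> dual_space (fib (vbun Tilde) q)" for q by (simp add: dual_space_def)
    qed (rule T.smooth_funs_const)
    have "poissonization \<pi> q \<in> alt_forms (dual_space (fib (vbun A) (fst q))) 2" for q
    proof -
      have e: "poissonization \<pi> q = (\<lambda>\<alpha>s. exp (- snd q) * \<pi> (fst q) \<alpha>s)" by (simp add: fun_eq_iff poissonization_apply)
      show ?thesis using bivector_alt[of "fst q"] unfolding e alt_forms_def by (simp add: algebra_simps)
    qed
    moreover have "(\<lambda>q. poissonization \<pi> q (at_point Xs q)) \<in> Fun'"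
      if Xs: "length Xs = 2" "set Xs \<subseteq> sections (tilde_atlas (base A)) (tilde_bundle (dual_bundle (vbun A)))" for Xs
    proof -
      obtain X Y where X: "Xs = [X, Y]" "X \<in> M.Sec'" "Y \<in> M.Sec'"
        using Xs by (auto simp: numeral_2_eq_2 length_Suc_conv)
      have "(\<lambda>q. \<pi> (fst q) [X q, Y q]) \<in> Fun'"
        by (rule M.tilde_bilinear_smooth[where F = "\<lambda>x u v. \<pi> x [u, v]", OF _ _ _ X(2,3)])
           (simp_all add: bivector_left bivector_right bivector_smooth)
      from TM.smooth_funs_mult[OF exp_Fun this] show ?thesis by (simp add: X poissonization_apply)
    qed
    ultimately show "poissonization \<pi> \<in> mvecs Tilde 2"
      by (simp add: forms_def dual_bundle_tilde_bundle del: split_paired_All)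
    show "pseudo_riemannian_metric (base Tilde) (dual_bundle (vbun Tilde)) (tilde_metric g)"
      unfolding pseudo_riemannian_metric_def
    proof (intro conjI allI ballI impI)
      fix q u v w and a b :: real
      assume m: "u \<in> fib (dual_bundle (vbun Tilde)) q" "v \<in> fib (dual_bundle (vbun Tilde)) q"
        "w \<in> fib (dual_bundle (vbun Tilde)) q"
      show "tilde_metric g q u v = tilde_metric g q v u"
        using m M.metric_sym[of u "fst q" v] by (simp add: tilde_metric_apply)
      show "tilde_metric g q (a *\<^sub>R u + b *\<^sub>R v) w = a * tilde_metric g q u w + b * tilde_metric g q v w"
        using m M.metric_combo[of u "fst q" v w a b] by (simp add: tilde_metric_apply algebra_simps)
    next
      fix q u assume "u \<in> fib (dual_bundle (vbun Tilde)) q" "\<forall>v\<in>fib (dual_bundle (vbun Tilde)) q. tilde_metric g q u v = 0"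
      then show "u = 0" using M.metric_nondegenerate[of u "fst q"] by (simp add: tilde_metric_apply)
    next
      fix X Y assume X: "X \<in> sections (base Tilde) (dual_bundle (vbun Tilde))" "Y \<in> sections (base Tilde) (dual_bundle (vbun Tilde))"
      then have X': "X \<in> M.Sec'" "Y \<in> M.Sec'" by (simp_all add: dual_bundle_tilde_bundle)
      have "(\<lambda>q. g (fst q) (X q) (Y q)) \<in> Fun'"
        by (rule M.tilde_bilinear_smooth[where F = g, OF _ _ M.metric_smooth X'])
           (simp_all add: M.metric_combo M.metric_add_right M.metric_scale_right
             subspace_scale[OF subspace_dual_space])
      from TM.smooth_funs_mult[OF exp_Fun this]
      show "(\<lambda>q. tilde_metric g q (X q) (Y q)) \<in> smooth_funs (base Tilde)" by (simp add: tilde_metric_apply)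
    qed
  qed
qed

text \<open>For time-independent data the product looks like \<open>A\<close>; the weight exp(-t) is
  the one function on which the time component of the anchor acts. Every term with
  \<open>\<phi>\<^sub>0\<close> in the formulas below stems from the second equation.\<close>

lemma tilde_anchor_pullback:
  assumes "X \<in> Sec" "f \<in> Fun"
  shows "anchor_fun Tilde (\<lambda>q. X (fst q)) (\<lambda>q. f (fst q)) q = anchor_fun A X f (fst q)"
    and "anchor_fun Tilde (\<lambda>q. X (fst q)) (\<lambda>q. exp (- snd q)) q = - \<phi>\<^sub>0 (fst q) (X (fst q)) * exp (- snd q)"
proof -
  show "anchor_fun Tilde (\<lambda>q. X (fst q)) (\<lambda>q. f (fst q)) q = anchor_fun A X f (fst q)"
    by (simp add: anchor_fun_tilde_minus) (simp add: anchor_fun_def)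
  have "((\<lambda>s. exp (- s)) has_real_derivative - exp (- snd q)) (at (snd q))"
    by (auto intro!: derivative_eq_intros)
  then have "deriv (\<lambda>s. exp (- s)) (snd q) = - exp (- snd q)" by (rule DERIV_imp_deriv)
  then show "anchor_fun Tilde (\<lambda>q. X (fst q)) (\<lambda>q. exp (- snd q)) q = - \<phi>\<^sub>0 (fst q) (X (fst q)) * exp (- snd q)"
    using anchor_fun_const[OF assms, of "exp (- snd q)" "fst q"]
    by (simp add: anchor_fun_tilde_minus) (simp add: anchor_fun_def)
qed

lemma tilde_anchor_exp:
  assumes X: "X \<in> Sec" and f: "f \<in> Fun"
  shows "anchor_fun Tilde (\<lambda>q. X (fst q)) (\<lambda>q. exp (- snd q) * f (fst q)) q =
    exp (- snd q) * (anchor_fun A X f (fst q) - \<phi>\<^sub>0 (fst q) (X (fst q)) * f (fst q))"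
proof -
  interpret T: bivector_metric Tilde "\<lambda>q v. 0" "poissonization \<pi>" "tilde_metric g"
    rewrites "base Tilde = tilde_atlas (base A)" and "vbun Tilde = tilde_bundle (vbun A)"
    by (rule bivector_metric_tilde) simp_all
  show ?thesis
    using T.anchor_fun_mult[OF pullback_sec[OF X] exp_Fun pullback_Fun[OF f]]
    by (simp add: tilde_anchor_pullback[OF X f] algebra_simps)
qed

lemma tilde_bracket_pullback:
  assumes "X \<in> Sec" "Y \<in> Sec"
  shows "bracket Tilde (\<lambda>q. X (fst q)) (\<lambda>q. Y (fst q)) q = bracket A X Y (fst q)"
  using time_deriv_pullback[OF assms(1), of "fst q" "snd q"] time_deriv_pullback[OF assms(2), of "fst q" "snd q"]
  by (simp add: bracket_tilde_minus)

lemma sharp_tilde: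
  assumes \<xi>: "\<xi> \<in> Dual (fst q)"
  shows "sharp Tilde (poissonization \<pi>) q \<xi> = exp (- snd q) *\<^sub>R sharp A \<pi> (fst q) \<xi>"
proof -
  interpret T: bivector_metric Tilde "\<lambda>q v. 0" "poissonization \<pi>" "tilde_metric g"
    rewrites "base Tilde = tilde_atlas (base A)" and "vbun Tilde = tilde_bundle (vbun A)"
    by (rule bivector_metric_tilde) simp_all
  show ?thesis
    by (rule T.sharp_unique)
       (use \<xi> in \<open>auto simp: sharp_fib sharp_apply poissonization_apply dual_space_scale[OF subspace_fib] intro: fib_scale\<close>)
qed

text \<open>As \<open>\<langle>\<alpha>, X\<^sub>0\<rangle> = \<langle>\<phi>\<^sub>0, \<pi>\<^sup>\<sharp>\<alpha>\<rangle>\<close> for \<open>X\<^sub>0 = - \<pi>\<^sup>\<sharp>\<phi>\<^sub>0\<close>, the correction is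
  \<open>- \<langle>\<alpha>, X\<^sub>0\<rangle> \<beta> + \<langle>\<beta>, X\<^sub>0\<rangle> \<alpha>\<close>.\<close>

lemma bracket_tilde:
  assumes \<alpha>: "\<alpha> \<in> Cos" and \<beta>: "\<beta> \<in> Cos"
  shows "bracket_pi_phi Tilde (\<lambda>q v. 0) (poissonization \<pi>) (\<lambda>q. \<alpha> (fst q)) (\<lambda>q. \<beta> (fst q)) q =
    exp (- snd q) *\<^sub>R (bracket_pi_phi A \<phi>\<^sub>0 \<pi> \<alpha> \<beta> (fst q) -
      \<phi>\<^sub>0 (fst q) (sharp A \<pi> (fst q) (\<alpha> (fst q))) *\<^sub>R \<beta> (fst q) +
      \<phi>\<^sub>0 (fst q) (sharp A \<pi> (fst q) (\<beta> (fst q))) *\<^sub>R \<alpha> (fst q))"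
    (is "?L = ?R")
proof -
  interpret T: bivector_metric Tilde "\<lambda>q v. 0" "poissonization \<pi>" "tilde_metric g"
    rewrites "base Tilde = tilde_atlas (base A)" and "vbun Tilde = tilde_bundle (vbun A)"
    by (rule bivector_metric_tilde) simp_all
  note sa = sharp_section(1)[OF \<alpha>] and sb = sharp_section(1)[OF \<beta>]
  have da: "\<alpha> x \<in> Dual x" and db: "\<beta> x \<in> Dual x" for x using \<alpha> \<beta> by (auto intro: cosections_dual)
  show ?thesis
  proof (rule dual_space_eqI[of _ "fst q"])
    show "?L \<in> Dual (fst q)"
      using T.cosections_dual[OF T.bracket_pi_phi_cosec[OF pullback_cosec[OF \<alpha>] pullback_cosec[OF \<beta>]], of q] by simp
    show "?R \<in> Dual (fst q)"
      by (intro subspace_scale subspace_add subspace_diff subspace_dual_space da db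
          cosections_dual[OF bracket_pi_phi_cosec[OF \<alpha> \<beta>]])
    fix Z assume Z: "Z \<in> Sec"
    have ex: "(\<lambda>q. exp (- snd q)) \<in> Fun'" by (rule exp_Fun)
    have f: "(\<lambda>x. \<alpha> x (Z x)) \<in> Fun" "(\<lambda>x. \<beta> x (Z x)) \<in> Fun"
      using cosections_pairing[OF \<alpha> Z] cosections_pairing[OF \<beta> Z] .
    have sh: "sharp Tilde (poissonization \<pi>) p (\<alpha> (fst p)) = exp (- snd p) *\<^sub>R sharp A \<pi> (fst p) (\<alpha> (fst p))"
      "sharp Tilde (poissonization \<pi>) p (\<beta> (fst p)) = exp (- snd p) *\<^sub>R sharp A \<pi> (fst p) (\<beta> (fst p))" for p
      by (simp_all add: sharp_tilde da db)
    have an: "anchor_fun Tilde (\<lambda>p. exp (- snd p) *\<^sub>R X (fst p)) (\<lambda>p. h (fst p)) q =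
        exp (- snd q) * anchor_fun A X h (fst q)" if "X \<in> Sec" "h \<in> Fun" for X h
      using T.anchor_fun_sec_scale[OF pullback_sec[OF that(1)] pullback_Fun[OF that(2)]]
      by (simp add: tilde_anchor_pullback(1)[OF that])
    \<comment> \<open>The weight that \<open>sharp\<close> acquires stands in the left argument; by
      the Leibniz rule its derivative along Z leaves the extra term \<open>\<phi>\<^sub>0\<close>(Z)
      X.\<close>
    have br: "bracket Tilde (\<lambda>p. exp (- snd p) *\<^sub>R X (fst p)) (\<lambda>p. Z (fst p)) q =
        exp (- snd q) *\<^sub>R (bracket A X Z (fst q) + \<phi>\<^sub>0 (fst q) (Z (fst q)) *\<^sub>R X (fst q))" if "X \<in> Sec" for X
      using T.bracket_scale_left[OF pullback_sec[OF that] pullback_sec[OF Z] ex, of q]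
      by (simp add: tilde_bracket_pullback[OF that Z] tilde_anchor_pullback(2)[OF Z smooth_funs_const] algebra_simps)
    have pa: "\<alpha> x (sharp A \<pi> x (\<beta> x)) = - \<pi> x [\<alpha> x, \<beta> x]" "\<beta> x (sharp A \<pi> x (\<alpha> x)) = \<pi> x [\<alpha> x, \<beta> x]" for x
      using sharp_apply[of "\<beta> x" x "\<alpha> x"] sharp_apply[of "\<alpha> x" x "\<beta> x"] bivector_skew[of "\<beta> x" x "\<alpha> x"] da db by simp_all
    have sf: "sharp A \<pi> x (\<alpha> x) \<in> fib (vbun A) x" "sharp A \<pi> x (\<beta> x) \<in> fib (vbun A) x" for x
      using da db by (simp_all add: sharp_fib)
    have bf: "bracket A (sharp_sec A \<pi> \<alpha>) Z x \<in> fib (vbun A) x" "bracket A (sharp_sec A \<pi> \<beta>) Z x \<in> fib (vbun A) x" for x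
      using bracket_fib sa sb Z by simp_all
    have "?L (Z (fst q)) = T.dual_bracket_at (\<lambda>q. \<alpha> (fst q)) (\<lambda>q. \<beta> (fst q)) (\<lambda>q. Z (fst q)) q"
      by (rule T.bracket_pi_phi_apply(1)[OF pullback_cosec[OF \<alpha>] pullback_cosec[OF \<beta>] pullback_sec[OF Z]])
    \<comment> \<open>The two brackets each contribute - \<open>\<phi>\<^sub>0\<close>(Z)
      \<pi>(\<alpha>, \<beta>) and the derivative of exp(-t) \<pi>(\<alpha>, \<beta>) contributes +
      \<open>\<phi>\<^sub>0\<close>(Z) \<pi>(\<alpha>, \<beta>). What is left is exactly the last
      term of \<open>dual_bracket_at\<close>; its other two terms with \<open>\<phi>\<^sub>0\<close>
      have no counterpart over the product and are subtracted.\<close>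
    also have "\<dots> = exp (- snd q) * (dual_bracket_at \<alpha> \<beta> Z (fst q) -
        \<phi>\<^sub>0 (fst q) (sharp A \<pi> (fst q) (\<alpha> (fst q))) * \<beta> (fst q) (Z (fst q)) +
        \<phi>\<^sub>0 (fst q) (sharp A \<pi> (fst q) (\<beta> (fst q))) * \<alpha> (fst q) (Z (fst q)))"
      unfolding T.dual_bracket_at_def dual_bracket_at_def sh poissonization_apply
        an[OF sa f(2)] an[OF sb f(1)] br[OF sa] br[OF sb] tilde_anchor_exp[OF Z bivector_smooth[OF \<alpha> \<beta>]]
      by (simp add: cosec_add[OF \<alpha>] cosec_add[OF \<beta>] cosec_scale[OF \<alpha>] cosec_scale[OF \<beta>] sf bf fib_scale fib_add pa
          algebra_simps)
    also have "\<dots> = ?R (Z (fst q))"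
      by (simp add: scaleR_fun_apply bracket_pi_phi_apply(1)[OF \<alpha> \<beta> Z])
    finally show "?L (Z (fst q)) = ?R (Z (fst q))" .
  qed
qed

text \<open>One factor exp(-t) comes from \<open>sharp\<close>, the other from the metric. Write a,
  b, c for \<open>\<phi>\<^sub>0\<close> of \<pi>-sharp of \<alpha>, \<beta>, \<gamma>.
  Differentiating the weight of the metric gives - a g(\<beta>, \<gamma>) - b g(\<alpha>, \<gamma>)
  + c g(\<alpha>, \<beta>), and the corrections in the three brackets add up to 2 b g(\<alpha>,
  \<gamma>) - a g(\<beta>, \<gamma>) + a g(\<beta>, \<gamma>) - 2 c g(\<alpha>, \<beta>); half of
  the total is the stated difference.\<close>

lemma koszul_tilde:
  assumes \<alpha>: "\<alpha> \<in> Cos" and \<beta>: "\<beta> \<in> Cos" and \<gamma>: "\<gamma> \<in> Cos"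
  shows "skew_metric.koszul (dual_algebroid_phi Tilde (\<lambda>q v. 0) (poissonization \<pi>)) (tilde_metric g)
      (\<lambda>q. \<alpha> (fst q)) (\<lambda>q. \<beta> (fst q)) (\<lambda>q. \<gamma> (fst q)) q =
    exp (- snd q) * exp (- snd q) * (M.koszul \<alpha> \<beta> \<gamma> (fst q) -
      (1 / 2) * \<phi>\<^sub>0 (fst q) (sharp A \<pi> (fst q) (\<alpha> (fst q))) * g (fst q) (\<beta> (fst q)) (\<gamma> (fst q)) +
      (1 / 2) * \<phi>\<^sub>0 (fst q) (sharp A \<pi> (fst q) (\<beta> (fst q))) * g (fst q) (\<alpha> (fst q)) (\<gamma> (fst q)) -
      (1 / 2) * \<phi>\<^sub>0 (fst q) (sharp A \<pi> (fst q) (\<gamma> (fst q))) * g (fst q) (\<alpha> (fst q)) (\<beta> (fst q)))"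
proof -
  interpret T: bivector_metric Tilde "\<lambda>q v. 0" "poissonization \<pi>" "tilde_metric g"
    rewrites "base Tilde = tilde_atlas (base A)" and "vbun Tilde = tilde_bundle (vbun A)"
    by (rule bivector_metric_tilde) simp_all
  have d: "\<alpha> x \<in> Dual x" "\<beta> x \<in> Dual x" "\<gamma> x \<in> Dual x" for x using \<alpha> \<beta> \<gamma> by (auto intro: cosections_dual)
  have bd: "bracket_pi_phi A \<phi>\<^sub>0 \<pi> \<mu> \<nu> x \<in> Dual x" if "\<mu> \<in> Cos" "\<nu> \<in> Cos" for \<mu> \<nu> x
    using cosections_dual[OF bracket_pi_phi_cosec[OF that]] .
  have an: "anchor_fun (dual_algebroid_phi Tilde (\<lambda>q v. 0) (poissonization \<pi>)) (\<lambda>q. \<mu> (fst q))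
        (\<lambda>q. tilde_metric g q (\<nu> (fst q)) (\<kappa> (fst q))) q =
      exp (- snd q) * exp (- snd q) * (anchor_fun A (sharp_sec A \<pi> \<mu>) (\<lambda>x. g x (\<nu> x) (\<kappa> x)) (fst q) -
        \<phi>\<^sub>0 (fst q) (sharp A \<pi> (fst q) (\<mu> (fst q))) * g (fst q) (\<nu> (fst q)) (\<kappa> (fst q)))"
    if "\<mu> \<in> Cos" "\<nu> \<in> Cos" "\<kappa> \<in> Cos" for \<mu> \<nu> \<kappa>
  proof -
    have s: "sharp_sec A \<pi> \<mu> \<in> Sec" by (rule sharp_section(1)[OF that(1)])
    have f: "(\<lambda>x. g x (\<nu> x) (\<kappa> x)) \<in> Fun" by (rule M.metric_smooth[OF that(2,3)])
    have sh: "sharp Tilde (poissonization \<pi>) p (\<mu> (fst p)) = exp (- snd p) *\<^sub>R sharp A \<pi> (fst p) (\<mu> (fst p))" for p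
      using cosections_dual[OF that(1)] by (simp add: sharp_tilde)
    have ef: "(\<lambda>p. exp (- snd p) * g (fst p) (\<nu> (fst p)) (\<kappa> (fst p))) \<in> Fun'"
      by (rule T.smooth_funs_mult[OF exp_Fun pullback_Fun[OF f]])
    show ?thesis
      unfolding anchor_fun_dual_algebroid_phi sh tilde_metric_apply
      using T.anchor_fun_sec_scale[OF pullback_sec[OF s] ef, of "\<lambda>q. exp (- snd q)" q] tilde_anchor_exp[OF s f, of q]
      by simp
  qed
  have gb: "tilde_metric g q (bracket_pi_phi Tilde (\<lambda>q v. 0) (poissonization \<pi>) (\<lambda>q. \<mu> (fst q)) (\<lambda>q. \<nu> (fst q)) q) (\<kappa> (fst q)) =
      exp (- snd q) * exp (- snd q) * (g (fst q) (bracket_pi_phi A \<phi>\<^sub>0 \<pi> \<mu> \<nu> (fst q)) (\<kappa> (fst q)) -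
        \<phi>\<^sub>0 (fst q) (sharp A \<pi> (fst q) (\<mu> (fst q))) * g (fst q) (\<nu> (fst q)) (\<kappa> (fst q)) +
        \<phi>\<^sub>0 (fst q) (sharp A \<pi> (fst q) (\<nu> (fst q))) * g (fst q) (\<mu> (fst q)) (\<kappa> (fst q)))"
    if "\<mu> \<in> Cos" "\<nu> \<in> Cos" "\<kappa> \<in> Cos" for \<mu> \<nu> \<kappa>
    unfolding bracket_tilde[OF that(1,2)] tilde_metric_apply
    using that cosections_dual bd
    by (simp add: M.metric_scale M.metric_add M.metric_diff subspace_scale[OF subspace_dual_space]
        subspace_add[OF subspace_dual_space] subspace_diff[OF subspace_dual_space])
  have sym: "g x (\<mu> x) (\<nu> x) = g x (\<nu> x) (\<mu> x)" if "\<mu> \<in> Cos" "\<nu> \<in> Cos" for \<mu> \<nu> x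
    using M.metric_sym[of "\<mu> x" x "\<nu> x"] that cosections_dual by simp
  show ?thesis
    unfolding T.M.koszul_def M.koszul_def dual_algebroid_phi_simps an[OF \<alpha> \<beta> \<gamma>] an[OF \<beta> \<alpha> \<gamma>] an[OF \<gamma> \<alpha> \<beta>]
      gb[OF \<alpha> \<beta> \<gamma>] gb[OF \<alpha> \<gamma> \<beta>] gb[OF \<beta> \<gamma> \<alpha>]
    by (simp add: anchor_fun_dual_algebroid_phi sym[OF \<beta> \<alpha>] sym[OF \<gamma> \<alpha>] sym[OF \<gamma> \<beta>]) (simp add: field_simps)
qed

abbreviation "X\<^sub>0 x \<equiv> - sharp A \<pi> x (\<phi>\<^sub>0 x)"
abbreviation "\<xi> x \<equiv> flat_inv A g x (X\<^sub>0 x)"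

lemma X0_apply: "\<alpha> \<in> Dual x \<Longrightarrow> \<alpha> (X\<^sub>0 x) = \<phi>\<^sub>0 x (sharp A \<pi> x \<alpha>)"
  using cosections_dual[OF \<phi>, of x] bivector_skew[of "\<phi>\<^sub>0 x" x \<alpha>]
  by (simp add: dual_space_minus[OF subspace_fib] sharp_fib sharp_apply)

lemma
  shows \<xi>_dual: "\<xi> x \<in> Dual x" and \<xi>_apply: "\<beta> \<in> Dual x \<Longrightarrow> g x (\<xi> x) \<beta> = \<beta> (X\<^sub>0 x)"
  using flat_inv_section[OF sections_minus[OF sharp_section(1)[OF \<phi>]], where x = x] by simp_all

text \<open>Read off from the Koszul expression by nondegeneracy. The term in which \<gamma> is fed
  to \<pi>-sharp is the pairing of \<gamma> with \<open>X\<^sub>0\<close>, that is g(\<xi>,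
  \<gamma>); this is how \<xi> enters. Of the two factors exp(-t) one is absorbed by the metric. The
  sum is nested to the right to match the additivity rules used on it.\<close>

lemma levi_civita_tilde:
  assumes \<alpha>: "\<alpha> \<in> Cos" and \<beta>: "\<beta> \<in> Cos"
  shows "levi_civita (dual_algebroid_phi Tilde (\<lambda>q v. 0) (poissonization \<pi>)) (tilde_metric g)
      (\<lambda>q. \<alpha> (fst q)) (\<lambda>q. \<beta> (fst q)) q =
    exp (- snd q) *\<^sub>R (D \<alpha> \<beta> (fst q) +
      ((- (1 / 2) * \<alpha> (fst q) (X\<^sub>0 (fst q))) *\<^sub>R \<beta> (fst q) +
      (((1 / 2) * \<beta> (fst q) (X\<^sub>0 (fst q))) *\<^sub>R \<alpha> (fst q) +
      (- (1 / 2) * g (fst q) (\<alpha> (fst q)) (\<beta> (fst q))) *\<^sub>R \<xi> (fst q))))"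
    (is "?L = exp _ *\<^sub>R ?R")
proof -
  interpret T: bivector_metric Tilde "\<lambda>q v. 0" "poissonization \<pi>" "tilde_metric g"
    rewrites "base Tilde = tilde_atlas (base A)" and "vbun Tilde = tilde_bundle (vbun A)"
    by (rule bivector_metric_tilde) simp_all
  have d: "\<mu> x \<in> Dual x" if "\<mu> \<in> Cos" for \<mu> x using that by (rule cosections_dual)
  have mem: "a *\<^sub>R \<mu> \<in> Dual x" "\<mu> + \<nu> \<in> Dual x" if "\<mu> \<in> Dual x" "\<nu> \<in> Dual x" for a \<mu> \<nu> x
    using that by (auto intro: subspace_scale subspace_add subspace_dual_space)
  have sm: "a *\<^sub>R \<mu> \<in> Dual x" if "\<mu> \<in> Dual x" for a \<mu> x using that by (intro subspace_scale subspace_dual_space)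
  have Rm: "?R \<in> Dual (fst q)"
    by (intro mem(2) sm D_fib d \<alpha> \<beta> \<xi>_dual)
  show ?thesis
  proof (rule T.M.metric_eqI[of _ q])
    show "?L \<in> fib (dual_bundle (tilde_bundle (vbun A))) q"
      using T.cosections_dual[OF T.M.levi_civita_sec[OF pullback_cosec[OF \<alpha>] pullback_cosec[OF \<beta>]], of q] by simp
    show "exp (- snd q) *\<^sub>R ?R \<in> fib (dual_bundle (tilde_bundle (vbun A))) q" using sm[OF Rm] by simp
    fix Z assume "Z \<in> sections (tilde_atlas (base A)) (dual_bundle (tilde_bundle (vbun A)))"
    then have "Z q \<in> Dual (fst q)" using T.cosections_dual[of Z q] by simp
    \<comment> \<open>Only the value of the test section at \<open>q\<close> enters, so it may be
      replaced by a time-independent covector, for which the Koszul expression is known.\<close>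
    then obtain \<gamma> where \<gamma>: "\<gamma> \<in> Cos" "\<gamma> (fst q) = Z q" by (rule covector_through)
    have X0: "\<mu> (fst q) (X\<^sub>0 (fst q)) = \<phi>\<^sub>0 (fst q) (sharp A \<pi> (fst q) (\<mu> (fst q)))" if "\<mu> \<in> Cos" for \<mu>
      by (rule X0_apply[OF d[OF that]])
    have "tilde_metric g q ?L (\<gamma> (fst q)) = T.M.koszul (\<lambda>q. \<alpha> (fst q)) (\<lambda>q. \<beta> (fst q)) (\<lambda>q. \<gamma> (fst q)) q"
      by (rule T.M.levi_civita_koszul[OF T.M.is_levi_civita pullback_cosec[OF \<alpha>] pullback_cosec[OF \<beta>] pullback_cosec[OF \<gamma>(1)]])
    also have "\<dots> = exp (- snd q) * exp (- snd q) * g (fst q) ?R (\<gamma> (fst q))"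
    proof -
      have "g (fst q) ?R (\<gamma> (fst q)) = g (fst q) (D \<alpha> \<beta> (fst q)) (\<gamma> (fst q)) +
          ((- (1 / 2) * \<alpha> (fst q) (X\<^sub>0 (fst q))) * g (fst q) (\<beta> (fst q)) (\<gamma> (fst q)) +
          (((1 / 2) * \<beta> (fst q) (X\<^sub>0 (fst q))) * g (fst q) (\<alpha> (fst q)) (\<gamma> (fst q)) +
          (- (1 / 2) * g (fst q) (\<alpha> (fst q)) (\<beta> (fst q))) * g (fst q) (\<xi> (fst q)) (\<gamma> (fst q))))"
        using D_fib[OF \<alpha> \<beta>, of "fst q"] d[OF \<alpha>, of "fst q"] d[OF \<beta>, of "fst q"] d[OF \<gamma>(1), of "fst q"] \<xi>_dual[of "fst q"]
        by (simp only: M.metric_add M.metric_scale mem sm dual_bundle_simps)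
      moreover have "g (fst q) (\<xi> (fst q)) (\<gamma> (fst q)) = \<gamma> (fst q) (X\<^sub>0 (fst q))" by (rule \<xi>_apply[OF d[OF \<gamma>(1)]])
      moreover have "g (fst q) (D \<alpha> \<beta> (fst q)) (\<gamma> (fst q)) = M.koszul \<alpha> \<beta> \<gamma> (fst q)"
        by (rule M.levi_civita_koszul[OF M.is_levi_civita \<alpha> \<beta> \<gamma>(1)])
      ultimately show ?thesis
        unfolding koszul_tilde[OF \<alpha> \<beta> \<gamma>(1)] by (simp only: X0[OF \<alpha>] X0[OF \<beta>] X0[OF \<gamma>(1)]) (simp add: algebra_simps)
    qed
    also have "\<dots> = tilde_metric g q (exp (- snd q) *\<^sub>R ?R) (\<gamma> (fst q))"
      using M.metric_scale[of ?R "fst q" "\<gamma> (fst q)" "exp (- snd q)"] Rm d[OF \<gamma>(1)]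
      by (simp only: tilde_metric_apply dual_bundle_simps mult.assoc)
    finally show "tilde_metric g q ?L (Z q) = tilde_metric g q (exp (- snd q) *\<^sub>R ?R) (Z q)" by (simp only: \<gamma>(2))
  qed
qed

text \<open>The terms containing \<alpha>(\<open>X\<^sub>0\<close>) drop out: the derivative of the
  weight of \<pi> gives - \<alpha>(\<open>X\<^sub>0\<close>) \<pi>(\<beta>, \<gamma>), and each of
  the two connection terms returns half of it with the opposite sign. The remaining four corrections
  become the right-hand side of the compatibility condition after skew-symmetry has ordered the
  arguments of \<pi>.\<close>

lemma cov_tilde:
  assumes \<alpha>: "\<alpha> \<in> Cos" and \<beta>: "\<beta> \<in> Cos" and \<gamma>: "\<gamma> \<in> Cos"
  shows "cov_deriv_bivector (dual_algebroid_phi Tilde (\<lambda>q v. 0) (poissonization \<pi>))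
      (levi_civita (dual_algebroid_phi Tilde (\<lambda>q v. 0) (poissonization \<pi>)) (tilde_metric g)) (poissonization \<pi>)
      (\<lambda>q. \<alpha> (fst q)) (\<lambda>q. \<beta> (fst q)) (\<lambda>q. \<gamma> (fst q)) (x, t) =
    exp (- t) * exp (- t) * (cov \<alpha> \<beta> \<gamma> x + (1 / 2) *
      (\<beta> x (X\<^sub>0 x) * \<pi> x [\<gamma> x, \<alpha> x] + \<gamma> x (X\<^sub>0 x) * \<pi> x [\<alpha> x, \<beta> x] +
       g x (\<alpha> x) (\<beta> x) * \<pi> x [\<xi> x, \<gamma> x] - g x (\<alpha> x) (\<gamma> x) * \<pi> x [\<xi> x, \<beta> x]))"
proof -
  interpret T: bivector_metric Tilde "\<lambda>q v. 0" "poissonization \<pi>" "tilde_metric g"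
    rewrites "base Tilde = tilde_atlas (base A)" and "vbun Tilde = tilde_bundle (vbun A)"
    by (rule bivector_metric_tilde) simp_all
  have d: "\<mu> x \<in> Dual x" if "\<mu> \<in> Cos" for \<mu> x using that by (rule cosections_dual)
  have mem: "a *\<^sub>R \<mu> \<in> Dual x" "\<mu> + \<nu> \<in> Dual x" if "\<mu> \<in> Dual x" "\<nu> \<in> Dual x" for a \<mu> \<nu> x
    using that by (auto intro: subspace_scale subspace_add subspace_dual_space)
  have sm: "a *\<^sub>R \<mu> \<in> Dual x" if "\<mu> \<in> Dual x" for a \<mu> x using that by (intro subspace_scale subspace_dual_space)
  have s: "sharp_sec A \<pi> \<alpha> \<in> Sec" by (rule sharp_section(1)[OF \<alpha>])
  have f: "(\<lambda>x. \<pi> x [\<beta> x, \<gamma> x]) \<in> Fun" by (rule bivector_smooth[OF \<beta> \<gamma>])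
  have sh: "sharp Tilde (poissonization \<pi>) p (\<alpha> (fst p)) = exp (- snd p) *\<^sub>R sharp A \<pi> (fst p) (\<alpha> (fst p))" for p
    using d[OF \<alpha>] by (simp add: sharp_tilde)
  have ef: "(\<lambda>p. exp (- snd p) * \<pi> (fst p) [\<beta> (fst p), \<gamma> (fst p)]) \<in> Fun'"
    by (rule T.smooth_funs_mult[OF exp_Fun pullback_Fun[OF f]])
  have an: "anchor_fun Tilde (\<lambda>p. exp (- snd p) *\<^sub>R sharp A \<pi> (fst p) (\<alpha> (fst p)))
      (\<lambda>p. exp (- snd p) * \<pi> (fst p) [\<beta> (fst p), \<gamma> (fst p)]) (x, t) =
      exp (- t) * exp (- t) * (anchor_fun A (sharp_sec A \<pi> \<alpha>) (\<lambda>x. \<pi> x [\<beta> x, \<gamma> x]) x - \<alpha> x (X\<^sub>0 x) * \<pi> x [\<beta> x, \<gamma> x])"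
    using T.anchor_fun_sec_scale[OF pullback_sec[OF s] ef, of "\<lambda>q. exp (- snd q)" "(x, t)"] tilde_anchor_exp[OF s f, of "(x, t)"]
    by (simp add: X0_apply[OF d[OF \<alpha>]])
  have skew: "\<pi> x [\<mu>, \<nu>] = - \<pi> x [\<nu>, \<mu>]" if "\<mu> \<in> Dual x" "\<nu> \<in> Dual x" for \<mu> \<nu> using that by (rule bivector_skew)
  note mm = D_fib[OF \<alpha> \<beta>, of x] D_fib[OF \<alpha> \<gamma>, of x] d[OF \<alpha>, of x] d[OF \<beta>, of x] d[OF \<gamma>, of x] \<xi>_dual[of x]
  let ?Db = "D \<alpha> \<beta> x + ((- (1 / 2) * \<alpha> x (X\<^sub>0 x)) *\<^sub>R \<beta> x + (((1 / 2) * \<beta> x (X\<^sub>0 x)) *\<^sub>R \<alpha> x +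
      (- (1 / 2) * g x (\<alpha> x) (\<beta> x)) *\<^sub>R \<xi> x))"
  let ?Dc = "D \<alpha> \<gamma> x + ((- (1 / 2) * \<alpha> x (X\<^sub>0 x)) *\<^sub>R \<gamma> x + (((1 / 2) * \<gamma> x (X\<^sub>0 x)) *\<^sub>R \<alpha> x +
      (- (1 / 2) * g x (\<alpha> x) (\<gamma> x)) *\<^sub>R \<xi> x))"
  have p1: "\<pi> x [exp (- t) *\<^sub>R ?Db, \<gamma> x] = exp (- t) * (\<pi> x [D \<alpha> \<beta> x, \<gamma> x] + ((- (1 / 2) * \<alpha> x (X\<^sub>0 x)) * \<pi> x [\<beta> x, \<gamma> x] +
      (((1 / 2) * \<beta> x (X\<^sub>0 x)) * \<pi> x [\<alpha> x, \<gamma> x] + (- (1 / 2) * g x (\<alpha> x) (\<beta> x)) * \<pi> x [\<xi> x, \<gamma> x])))"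
    by (simp only: bivector_add_left bivector_scale_left mm mem sm)
  have p2: "\<pi> x [\<beta> x, exp (- t) *\<^sub>R ?Dc] = exp (- t) * (\<pi> x [\<beta> x, D \<alpha> \<gamma> x] + ((- (1 / 2) * \<alpha> x (X\<^sub>0 x)) * \<pi> x [\<beta> x, \<gamma> x] +
      (((1 / 2) * \<gamma> x (X\<^sub>0 x)) * \<pi> x [\<beta> x, \<alpha> x] + (- (1 / 2) * g x (\<alpha> x) (\<gamma> x)) * \<pi> x [\<beta> x, \<xi> x])))"
    by (simp only: bivector_add_right bivector_scale_right mm mem sm)
  have "T.cov (\<lambda>q. \<alpha> (fst q)) (\<lambda>q. \<beta> (fst q)) (\<lambda>q. \<gamma> (fst q)) (x, t) =
      exp (- t) * exp (- t) * (anchor_fun A (sharp_sec A \<pi> \<alpha>) (\<lambda>x. \<pi> x [\<beta> x, \<gamma> x]) x - \<alpha> x (X\<^sub>0 x) * \<pi> x [\<beta> x, \<gamma> x]) -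
      exp (- t) * \<pi> x [exp (- t) *\<^sub>R ?Db, \<gamma> x] - exp (- t) * \<pi> x [\<beta> x, exp (- t) *\<^sub>R ?Dc]"
    unfolding T.cov_apply sh poissonization_apply an levi_civita_tilde[OF \<alpha> \<beta>] levi_civita_tilde[OF \<alpha> \<gamma>]
      fst_conv snd_conv ..
  then show ?thesis
    unfolding p1 p2 cov_apply skew[OF mm(3) mm(5)] skew[OF mm(4) mm(3)] skew[OF mm(4) mm(6)]
    by (simp add: algebra_simps)
qed

lemma compatible_iff:
  "jacobi_compatible A \<phi>\<^sub>0 \<pi> g \<longleftrightarrow> compatible Tilde (poissonization \<pi>) (tilde_metric g)"
proof -
  interpret T: bivector_metric Tilde "\<lambda>q v. 0" "poissonization \<pi>" "tilde_metric g"
    rewrites "base Tilde = tilde_atlas (base A)" and "vbun Tilde = tilde_bundle (vbun A)"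
    by (rule bivector_metric_tilde) simp_all
  let ?S = "\<lambda>\<alpha> \<beta> \<gamma> x. \<beta> x (X\<^sub>0 x) * \<pi> x [\<gamma> x, \<alpha> x] + \<gamma> x (X\<^sub>0 x) * \<pi> x [\<alpha> x, \<beta> x] +
    g x (\<alpha> x) (\<beta> x) * \<pi> x [\<xi> x, \<gamma> x] - g x (\<alpha> x) (\<gamma> x) * \<pi> x [\<xi> x, \<beta> x]"
  have J: "jacobi_compatible A \<phi>\<^sub>0 \<pi> g \<longleftrightarrow>
      (\<forall>\<alpha>\<in>Cos. \<forall>\<beta>\<in>Cos. \<forall>\<gamma>\<in>Cos. \<forall>x. cov \<alpha> \<beta> \<gamma> x = - (1 / 2) * ?S \<alpha> \<beta> \<gamma> x)"
    unfolding jacobi_compatible_def Let_def ..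
  have P: "compatible Tilde (poissonization \<pi>) (tilde_metric g) \<longleftrightarrow>
      (\<forall>\<alpha>\<in>T.Cos. \<forall>\<beta>\<in>T.Cos. \<forall>\<gamma>\<in>T.Cos. \<forall>q. T.cov \<alpha> \<beta> \<gamma> q = 0)"
    unfolding compatible_def Let_def dual_algebroid_eq_dual_algebroid_phi tilde_minus_simps ..
  show ?thesis
    unfolding J P
  proof (intro iffI ballI allI)
    fix \<alpha> \<beta> \<gamma> and q :: "'m \<times> real"
    assume *: "\<forall>\<alpha>\<in>Cos. \<forall>\<beta>\<in>Cos. \<forall>\<gamma>\<in>Cos. \<forall>x. cov \<alpha> \<beta> \<gamma> x = - (1 / 2) * ?S \<alpha> \<beta> \<gamma> x"
      and m: "\<alpha> \<in> T.Cos" "\<beta> \<in> T.Cos" "\<gamma> \<in> T.Cos"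
    obtain x t where q: "q = (x, t)" by (cases q)
    have "\<alpha> q \<in> Dual x" "\<beta> q \<in> Dual x" "\<gamma> q \<in> Dual x" using T.cosections_dual[of _ q] m by (simp_all add: q)
    then obtain a b c where abc: "a \<in> Cos" "a x = \<alpha> q" "b \<in> Cos" "b x = \<beta> q" "c \<in> Cos" "c x = \<gamma> q"
      by (meson covector_through)
    \<comment> \<open>The covectors \<open>a\<close>, \<open>b\<close>, \<open>c\<close> on M are
      chosen for this one point \<open>q\<close>; they agree with the time-dependent ones there and
      nowhere else in general.\<close>
    have "T.cov \<alpha> \<beta> \<gamma> q = T.cov (\<lambda>q. a (fst q)) (\<lambda>q. b (fst q)) (\<lambda>q. c (fst q)) q"
      by (rule T.cov_tensorial) (use m abc pullback_cosec q in auto)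
    then show "T.cov \<alpha> \<beta> \<gamma> q = 0"
      using cov_tilde[OF abc(1,3,5), of x t] *[rule_format, OF abc(1,3,5), of x] by (simp add: q)
  next
    fix \<alpha> \<beta> \<gamma> x
    assume *: "\<forall>\<alpha>\<in>T.Cos. \<forall>\<beta>\<in>T.Cos. \<forall>\<gamma>\<in>T.Cos. \<forall>q. T.cov \<alpha> \<beta> \<gamma> q = 0"
      and m: "\<alpha> \<in> Cos" "\<beta> \<in> Cos" "\<gamma> \<in> Cos"
    \<comment> \<open>One time slice suffices, since the factor exp(-t)^2 never vanishes; at t = 0
      it is 1.\<close>
    have "T.cov (\<lambda>q. \<alpha> (fst q)) (\<lambda>q. \<beta> (fst q)) (\<lambda>q. \<gamma> (fst q)) (x, 0) = 0"
      using * pullback_cosec m by blast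
    then show "cov \<alpha> \<beta> \<gamma> x = - (1 / 2) * ?S \<alpha> \<beta> \<gamma> x"
      using cov_tilde[OF m, of x 0] by simp
  qed
qed

end

theorem theorem3p3:
  fixes A :: "('m::{t2_space,second_countable_topology}, 'e::{real_inner,heine_borel}, 'v::real_vector) algebroid"
    and \<phi>\<^sub>0 :: "'m \<Rightarrow> 'v \<Rightarrow> real"
    and \<pi> :: "'m \<Rightarrow> ('v \<Rightarrow> real) list \<Rightarrow> real"
    and g :: "'m \<Rightarrow> ('v \<Rightarrow> real) \<Rightarrow> ('v \<Rightarrow> real) \<Rightarrow> real"
  assumes "jacobi_algebroid A \<phi>\<^sub>0"
    and "jacobi_structure A \<phi>\<^sub>0 \<pi>"
    and "pseudo_riemannian_metric (base A) (dual_bundle (vbun A)) g"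
  shows "jacobi_compatible A \<phi>\<^sub>0 \<pi> g \<longleftrightarrow>
    compatible (tilde_minus A \<phi>\<^sub>0) (poissonization \<pi>) (tilde_metric g)"
proof -
  interpret bivector_metric A \<phi>\<^sub>0 \<pi> g
  proof unfold_locales
    show "skew_algebroid A" "\<phi>\<^sub>0 \<in> cosecs A"
      using assms(1) by (simp_all add: jacobi_algebroid_def lie_algebroid_def)
    show "\<pi> \<in> mvecs A 2" using assms(2) by (simp add: jacobi_structure_def)
  qed (rule assms(3))
  show ?thesis by (rule compatible_iff)
qed

end
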